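(* Consider a sequence of problem instances indexed by $n\to\infty$ (with $m,\mu_0,\mathsf f$ depending on $n$, and $\sigma\in(0,\infty)$ fixed). Let $\mathsf f$ be a closed convex function on $\mathbb{R}^n$, $\mu_0\in\mathbb{R}^n$, $K=K_{(\mathsf f,\mu_0)}=\{\mu\in\mathbb{R}^n:\mathsf f(\mu)\le\mathsf f(\mu_0)\}$, $Y=X\mu_0+\xi$ as in the context, and $\delta_0=\delta_{T_K(\mu_0)}$. Suppose $\liminf_n(m/\delta_0)>1$ and $m\gg\log\log n$. Then for any sequence of near minimizers $\hat\mu(\sigma)$, as $n\to\infty$ the normalized estimation error satisfies $$n^{-1}\|\hat\mu(\sigma)-\mu_0\|^2\;\overset{\mathrm p}{\simeq}\; r_n^2+\mathcal{O}_{\mathbf P}\big(\mathfrak{L}_n/m\big)\;\le\;\sigma^2\frac{\delta_0}{m-\delta_0}+\mathcal{O}_{\mathbf P}\Big(\frac{\log\log n}{m}\Big).$$ The inequality takes equality if $K_{(\mathsf f,\mu_0)}-\mu_0$ is a closed convex cone.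
   Context: Model: $X\in\mathbb{R}^{m\times n}$ has i.i.d. $\mathcal{N}(0,1/n)$ entries; $\xi\in\mathbb{R}^m$ is an error vector independent of $X$ with i.i.d. coordinates of mean $0$ and variance $\sigma^2\in(0,\infty)$. $\|\cdot\|$ is Euclidean. $a_n\overset{\mathrm p}{\simeq}b_n$ means $a_n/b_n\to1$ in probability; $a_n\gg b_n$ means $a_n/b_n\to\infty$. $\Pi_K$ is the metric projection onto $K$, $h\sim\mathcal{N}(0,I_n)$, $\mathrm{err}(\tau)=\|\Pi_K(\mu_0+\tau h)-\mu_0\|^2$, $\omega_\delta(r)=\sqrt{(r^2+\sigma^2)/\delta}$, and $r_n\in(0,\infty)$ is the unique solution of $n^{-1}\mathbb{E}\,\mathrm{err}(\omega_{m/n}(r))=r^2$ (which exists when $m>\delta_K=\lim_{\tau\uparrow\infty}\mathbb{E}\|\Pi_K(\tau h)\|^2/\tau^2$, hence eventually here since $\delta_K\le\delta_0$). $T_K(\mu_0)=\mathrm{cl}\{\alpha(\nu-\mu_0):\alpha\ge0,\nu\in K\}$; for a closed convex cone $T$, $\delta_T=\mathbb{E}\|\Pi_T(h)\|^2$. $\mathfrak{L}_n=\log(1+\delta_{T_K(\mu_0)})+\log\log(16n)$. Near minimizers: $\hat\mu(\sigma)\in K$ with $m^{-1}\|Y-X\hat\mu(\sigma)\|^2\le\min_{\mu\in K}m^{-1}\|Y-X\mu\|^2+\mathfrak{o}_{\mathbf P}(r_n^2)$. *)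

theory Defs
  imports "HOL-Probability.Probability"
begin

section \<open>Euclidean space of varying dimension\<close>

text \<open>
  The dimension varies along the sequence of problem instances, so \<open>\<real>\<^sup>n\<close> is the carrier
  \<^term>\<open>topspace (Euclidean_space n)\<close> of sequences \<open>x :: nat \<Rightarrow> real\<close> with
  \<open>x i = 0\<close> for \<open>i \<ge> n\<close>, with the topology of \<^term>\<open>Euclidean_space n\<close>.
  Vector operations are written out coordinatewise.
\<close>

abbreviation Rn :: "nat \<Rightarrow> (nat \<Rightarrow> real) set" where
  "Rn n \<equiv> topspace (Euclidean_space n)"

definition enorm :: "nat \<Rightarrow> (nat \<Rightarrow> real) \<Rightarrow> real" where
  "enorm n x = L2_set x {..<n}"

definition closed_convex_fun :: "nat \<Rightarrow> ((nat \<Rightarrow> real) \<Rightarrow> ereal) \<Rightarrow> bool" where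
  \<comment> \<open>values in \<open>(-\<infinity>, \<infinity>]\<close>; the epigraph is closed and convex\<close>
  "closed_convex_fun n f \<longleftrightarrow>
     (\<forall>x\<in>Rn n. f x \<noteq> - \<infinity>) \<and>
     closedin (prod_topology (Euclidean_space n) euclideanreal)
       {(x, t). x \<in> Rn n \<and> f x \<le> ereal t} \<and>
     (\<forall>x\<in>Rn n. \<forall>y\<in>Rn n. \<forall>s t u. f x \<le> ereal s \<and> f y \<le> ereal t \<and> 0 \<le> u \<and> u \<le> 1 \<longrightarrow>
        f (\<lambda>i. (1 - u) * x i + u * y i) \<le> ereal ((1 - u) * s + u * t))"

definition closed_convex_cone :: "nat \<Rightarrow> (nat \<Rightarrow> real) set \<Rightarrow> bool" where
  "closed_convex_cone n C \<longleftrightarrow>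
     C \<noteq> {} \<and> closedin (Euclidean_space n) C \<and>
     (\<forall>x\<in>C. \<forall>y\<in>C. \<forall>u. 0 \<le> u \<and> u \<le> 1 \<longrightarrow> (\<lambda>i. (1 - u) * x i + u * y i) \<in> C) \<and>
     (\<forall>x\<in>C. \<forall>\<alpha>\<ge>0. (\<lambda>i. \<alpha> * x i) \<in> C)"

definition level_set :: "nat \<Rightarrow> ((nat \<Rightarrow> real) \<Rightarrow> ereal) \<Rightarrow> (nat \<Rightarrow> real) \<Rightarrow> (nat \<Rightarrow> real) set" where
  "level_set n f \<mu>\<^sub>0 = {\<mu> \<in> Rn n. f \<mu> \<le> f \<mu>\<^sub>0}"

definition shift_set :: "(nat \<Rightarrow> real) set \<Rightarrow> (nat \<Rightarrow> real) \<Rightarrow> (nat \<Rightarrow> real) set" where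
  "shift_set K \<mu>\<^sub>0 = (\<lambda>\<nu> i. \<nu> i - \<mu>\<^sub>0 i) ` K"

definition tangent_cone :: "nat \<Rightarrow> (nat \<Rightarrow> real) set \<Rightarrow> (nat \<Rightarrow> real) \<Rightarrow> (nat \<Rightarrow> real) set" where
  "tangent_cone n K \<mu>\<^sub>0 =
     Euclidean_space n closure_of {(\<lambda>i. \<alpha> * (\<nu> i - \<mu>\<^sub>0 i)) | \<alpha> \<nu>. 0 \<le> \<alpha> \<and> \<nu> \<in> K}"

definition metric_proj :: "nat \<Rightarrow> (nat \<Rightarrow> real) set \<Rightarrow> (nat \<Rightarrow> real) \<Rightarrow> (nat \<Rightarrow> real)" where
  "metric_proj n K x = arg_min_on (\<lambda>y. enorm n (\<lambda>i. x i - y i)) K"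


section \<open>Gaussian quantities\<close>

text \<open>
  The law of \<open>h \<sim> N(0, I\<^sub>n)\<close>. Its points are undefined, rather than zero, beyond
  coordinate \<open>n\<close>; this is immaterial, as \<^const>\<open>enorm\<close> and \<^const>\<open>metric_proj\<close> only read
  coordinates below \<open>n\<close> of their argument.
\<close>

definition std_gaussian :: "nat \<Rightarrow> (nat \<Rightarrow> real) measure" where
  "std_gaussian n = (\<Pi>\<^sub>M i\<in>{..<n}. density lborel std_normal_density)"

definition err :: "nat \<Rightarrow> (nat \<Rightarrow> real) set \<Rightarrow> (nat \<Rightarrow> real) \<Rightarrow> real \<Rightarrow> (nat \<Rightarrow> real) \<Rightarrow> real" where
  "err n K \<mu>\<^sub>0 \<tau> h = (enorm n (\<lambda>i. metric_proj n K (\<lambda>j. \<mu>\<^sub>0 j + \<tau> * h j) i - \<mu>\<^sub>0 i))\<^sup>2"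

definition stat_dim :: "nat \<Rightarrow> (nat \<Rightarrow> real) set \<Rightarrow> real" where
  "stat_dim n T = (LINT h|std_gaussian n. (enorm n (metric_proj n T h))\<^sup>2)"

definition omega :: "real \<Rightarrow> real \<Rightarrow> real \<Rightarrow> real" where
  "omega \<sigma> \<delta> r = sqrt ((r\<^sup>2 + \<sigma>\<^sup>2) / \<delta>)"

text \<open>
  The fixed point \<open>r\<^sub>n\<close>. Zero solves the equation precisely when \<open>K = {\<mu>\<^sub>0}\<close>, so for
  \<open>K \<noteq> {\<mu>\<^sub>0}\<close> this is the unique solution in \<open>(0, \<infinity>)\<close>; admitting \<open>r = 0\<close> only gives the
  degenerate case \<open>K = {\<mu>\<^sub>0}\<close>, where there is no positive solution, its natural value.
\<close>

definition fixed_point_radius :: "nat \<Rightarrow> nat \<Rightarrow> real \<Rightarrow> (nat \<Rightarrow> real) set \<Rightarrow> (nat \<Rightarrow> real) \<Rightarrow> real" where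
  "fixed_point_radius n m \<sigma> K \<mu>\<^sub>0 =
     (THE r. 0 \<le> r \<and>
        (LINT h|std_gaussian n. err n K \<mu>\<^sub>0 (omega \<sigma> (real m / real n) r) h) / real n = r\<^sup>2)"

definition frakL :: "nat \<Rightarrow> real \<Rightarrow> real" where
  "frakL n \<delta> = ln (1 + \<delta>) + ln (ln (16 * real n))"


section \<open>Stochastic orders\<close>

text \<open>
  Instance \<open>n\<close> lives on its own probability space \<open>M n\<close>. The scales \<open>a n\<close> are deterministic.
\<close>

definition tendsto_in_prob :: "(nat \<Rightarrow> 'w measure) \<Rightarrow> (nat \<Rightarrow> 'w \<Rightarrow> real) \<Rightarrow> real \<Rightarrow> bool" where
  "tendsto_in_prob M Z c \<longleftrightarrow>
     (\<forall>\<epsilon>>0. (\<lambda>n. measure (M n) {\<omega> \<in> space (M n). \<bar>Z n \<omega> - c\<bar> > \<epsilon>}) \<longlonglongrightarrow> 0)"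

definition small_o_prob :: "(nat \<Rightarrow> 'w measure) \<Rightarrow> (nat \<Rightarrow> 'w \<Rightarrow> real) \<Rightarrow> (nat \<Rightarrow> real) \<Rightarrow> bool" where
  "small_o_prob M Z a \<longleftrightarrow>
     (\<forall>n. Z n \<in> borel_measurable (M n)) \<and>
     (\<forall>\<epsilon>>0. (\<lambda>n. measure (M n) {\<omega> \<in> space (M n). \<bar>Z n \<omega>\<bar> > \<epsilon> * \<bar>a n\<bar>}) \<longlonglongrightarrow> 0)"

definition big_O_prob :: "(nat \<Rightarrow> 'w measure) \<Rightarrow> (nat \<Rightarrow> 'w \<Rightarrow> real) \<Rightarrow> (nat \<Rightarrow> real) \<Rightarrow> bool" where
  "big_O_prob M Z a \<longleftrightarrow>
     (\<forall>n. Z n \<in> borel_measurable (M n)) \<and>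
     (\<forall>\<epsilon>>0. \<exists>C>0. \<forall>\<^sub>F n in sequentially.
        measure (M n) {\<omega> \<in> space (M n). \<bar>Z n \<omega>\<bar> > C * \<bar>a n\<bar>} < \<epsilon>)"

text \<open>
  \<open>A\<^sub>n / B\<^sub>n \<rightarrow> 1\<close> in probability, with \<open>0 / 0 = 1\<close>. The convention matters: the estimation
  error may vanish with probability bounded away from zero (for instance when \<open>K\<close> is a ray).
\<close>

definition equiv_in_prob ::
  "(nat \<Rightarrow> 'w measure) \<Rightarrow> (nat \<Rightarrow> 'w \<Rightarrow> real) \<Rightarrow> (nat \<Rightarrow> 'w \<Rightarrow> real) \<Rightarrow> bool" where
  "equiv_in_prob M A B \<longleftrightarrow>
     tendsto_in_prob M
       (\<lambda>n \<omega>. if A n \<omega> = 0 \<and> B n \<omega> = 0 then 1 else A n \<omega> / B n \<omega>) 1"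


section \<open>The linear model and its near minimizers\<close>

definition noise_law :: "real measure \<Rightarrow> real \<Rightarrow> bool" where
  "noise_law P \<sigma> \<longleftrightarrow>
     real_distribution P \<and> integrable P (\<lambda>x. x\<^sup>2) \<and>
     (LINT x|P. x) = 0 \<and> (LINT x|P. x\<^sup>2) = \<sigma>\<^sup>2"

definition linear_model ::
  "'w measure \<Rightarrow> nat \<Rightarrow> nat \<Rightarrow> ('w \<Rightarrow> nat \<Rightarrow> nat \<Rightarrow> real) \<Rightarrow> ('w \<Rightarrow> nat \<Rightarrow> real) \<Rightarrow> real measure \<Rightarrow> bool" where
  "linear_model M m n X \<xi> P \<longleftrightarrow>
     prob_space M \<and>
     (\<forall>i<m. \<forall>j<n. distributed M lborel (\<lambda>\<omega>. X \<omega> i j) (normal_density 0 (1 / sqrt (real n)))) \<and>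
     prob_space.indep_vars M (\<lambda>_. borel) (\<lambda>(i, j) \<omega>. X \<omega> i j) ({..<m} \<times> {..<n}) \<and>
     (\<forall>i<m. (\<lambda>\<omega>. \<xi> \<omega> i) \<in> borel_measurable M \<and> distr M borel (\<lambda>\<omega>. \<xi> \<omega> i) = P) \<and>
     prob_space.indep_vars M (\<lambda>_. borel) (\<lambda>i \<omega>. \<xi> \<omega> i) {..<m} \<and>
     prob_space.indep_set M
       (sets (vimage_algebra (space M) (\<lambda>\<omega>. \<lambda>(i, j)\<in>{..<m} \<times> {..<n}. X \<omega> i j)
                (\<Pi>\<^sub>M _\<in>{..<m} \<times> {..<n}. borel)))
       (sets (vimage_algebra (space M) (\<lambda>\<omega>. \<lambda>i\<in>{..<m}. \<xi> \<omega> i) (\<Pi>\<^sub>M _\<in>{..<m}. borel)))"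

definition mat_vec :: "nat \<Rightarrow> (nat \<Rightarrow> nat \<Rightarrow> real) \<Rightarrow> (nat \<Rightarrow> real) \<Rightarrow> nat \<Rightarrow> real" where
  "mat_vec n A \<mu> i = (\<Sum>j<n. A i j * \<mu> j)"

definition loss :: "nat \<Rightarrow> nat \<Rightarrow> (nat \<Rightarrow> nat \<Rightarrow> real) \<Rightarrow> (nat \<Rightarrow> real) \<Rightarrow> (nat \<Rightarrow> real) \<Rightarrow> real" where
  "loss m n A y \<mu> = (enorm m (\<lambda>i. y i - mat_vec n A \<mu> i))\<^sup>2 / real m"

definition near_minimizers ::
  "(nat \<Rightarrow> 'w measure) \<Rightarrow> (nat \<Rightarrow> nat) \<Rightarrow> (nat \<Rightarrow> 'w \<Rightarrow> nat \<Rightarrow> nat \<Rightarrow> real) \<Rightarrow>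
   (nat \<Rightarrow> 'w \<Rightarrow> nat \<Rightarrow> real) \<Rightarrow> (nat \<Rightarrow> (nat \<Rightarrow> real) set) \<Rightarrow> (nat \<Rightarrow> real) \<Rightarrow>
   (nat \<Rightarrow> 'w \<Rightarrow> nat \<Rightarrow> real) \<Rightarrow> bool" where
  "near_minimizers M m X Y K r \<mu>h \<longleftrightarrow>
     (\<forall>n. \<forall>j<n. (\<lambda>\<omega>. \<mu>h n \<omega> j) \<in> borel_measurable (M n)) \<and>
     (\<forall>n. AE \<omega> in M n. \<mu>h n \<omega> \<in> K n) \<and>
     (\<exists>R. small_o_prob M R (\<lambda>n. (r n)\<^sup>2) \<and>
       (\<forall>n. AE \<omega> in M n.
          loss (m n) n (X n \<omega>) (Y n \<omega>) (\<mu>h n \<omega>)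
            \<le> (INF \<mu>\<in>K n. loss (m n) n (X n \<omega>) (Y n \<omega>) \<mu>) + R n \<omega>))"

end

theory Submission
  imports Defs
begin

text \<open>
  Write \<open>C = K - \<mu>\<^sub>0\<close>. By Gordon's comparison inequality the norm of the residual \<open>\<xi> - X v\<close> over \<open>v \<in> C\<close>, written as
  a supremum of \<open>\<langle>u, \<xi> - X v\<rangle>\<close> over unit vectors \<open>u\<close>, is compared with \<open>\<parallel>\<xi> + \<alpha> g\<parallel> - \<langle>h, v\<rangle> / \<surd>n\<close>, where
  \<open>\<alpha> = \<parallel>v\<parallel> / \<surd>n\<close> and \<open>g\<close>, \<open>h\<close> are independent standard Gaussian vectors. With \<open>\<beta> = \<surd>(r\<^sup>2 + \<sigma>\<^sup>2)\<close> and \<open>w = \<surd>n \<beta> / \<surd>m\<close>,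
  strong convexity bounds \<open>\<langle>h, v\<rangle> - \<parallel>v\<parallel>\<^sup>2 / (2w)\<close> by its maximum, attained at the projection of \<open>w h\<close>, so
  that only the scalar \<open>\<alpha>\<close> matters. The fixed point equation makes \<open>\<alpha> = r\<close> critical for the scalar problem. By a
  dimension-free Gaussian variance bound the variance of the maximum is at most of order \<open>n r\<^sup>2\<close>, so leaving the range
  \<open>\<bar>\<alpha> - r\<bar> \<le> \<epsilon> r + C / \<surd>m\<close> costs a multiple of \<open>r\<^sup>2\<close> in the normalized loss, with probability close to one.
  Near minimizers therefore stay in that range, and \<open>\<bar>\<alpha>\<^sup>2 - r\<^sup>2\<bar>\<close> is at most
  \<open>\<epsilon> r\<^sup>2\<close> plus a multiple of \<open>1 / m\<close>.

  The error term \<open>E\<close> is \<open>\<alpha>\<^sup>2 - r\<^sup>2\<close> where this is at most \<open>ln (ln n) / m\<close>, and zero otherwise. In the latter case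
  \<open>1 / m\<close> is negligible compared to \<open>\<bar>\<alpha>\<^sup>2 - r\<^sup>2\<bar>\<close>, because \<open>ln (ln n)\<close> diverges, and \<open>\<alpha>\<^sup>2 / r\<^sup>2\<close> is close to one.
  Since the projection onto \<open>C\<close> is dominated by the projection onto the tangent cone, \<open>r\<^sup>2\<close> is at most
  \<open>\<sigma>\<^sup>2 \<delta>\<^sub>0 / (m - \<delta>\<^sub>0)\<close>, and \<open>E' = E\<close> works.
\<close>

section \<open>Standard Gaussian vectors\<close>

text \<open>The radius \<open>r\<close> may tend to zero at any rate, so every error must be a small
  multiple of \<open>r\<^sup>2\<close> or of order \<open>r * dl + dl\<^sup>2\<close> with
  \<open>dl = 1 / sqrt m\<close>. The noise obstructs this: its normalized squared norm obeys a mere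
  weak law and may fluctuate far more than \<open>r\<^sup>2\<close>. Therefore \<open>\<xi>\<close>
  is frozen, all thresholds depend on its norm through \<open>cstar\<close>, and the lower bound
  outside the range is compared with the upper bound at the projection for the same
  \<open>\<xi>\<close>; the fluctuation and the common error
  \<open>K1 * (r * dl + dl\<^sup>2)\<close> then cancel. Fubini's theorem reinstates the random
  noise afterwards. As convergence in probability is all that is claimed, concentration by second
  moments suffices; its constants grow as the failure probability shrinks, and the divergence of
  \<open>ln (ln n)\<close> absorbs them. The variance bound handles the maximum; the norm of its
  maximizer, a derivative of the maximum in the scale, is reached by comparing two nearby scales.
  Gordon's comparison speaks of probabilities, never of outcomes, so its conclusions are phrased as
  events on countable dense families.\<close>

abbreviation stdn :: "real measure" where
  "stdn \<equiv> density lborel std_normal_density"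

definition gauss :: "'i set \<Rightarrow> ('i \<Rightarrow> real) measure" where
  "gauss I = (\<Pi>\<^sub>M i\<in>I. stdn)"

lemma std_gaussian_eq: "std_gaussian n = gauss {..<n}"
  by (simp add: std_gaussian_def gauss_def)

lemma prob_space_stdn: "prob_space stdn"
  by (rule prob_space_normal_density) simp

lemma sets_stdn [measurable_cong]: "sets stdn = sets borel"
  by simp

interpretation stdn: prob_space stdn
  by (rule prob_space_stdn)

lemma stdn_prob_UNIV: "measure stdn UNIV = 1"
  using stdn.prob_space by simp

interpretation stdn_pair: pair_prob_space stdn stdn ..

lemma sets_gauss [measurable_cong]: "sets (gauss I) = sets (\<Pi>\<^sub>M i\<in>I. borel)"
  unfolding gauss_def by (intro sets_PiM_cong) simp_all

lemma space_gauss: "space (gauss I) = (\<Pi>\<^sub>E i\<in>I. UNIV)"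
  by (simp add: gauss_def space_PiM)

lemma prob_space_gauss: "prob_space (gauss I)"
  unfolding gauss_def by (intro prob_space_PiM prob_space_stdn)

section \<open>Rotation invariance of Gaussian vectors\<close>

lemma shear_x:
  fixes k :: "real \<times> real \<Rightarrow> ennreal"
  assumes [measurable]: "k \<in> borel_measurable (borel \<Otimes>\<^sub>M borel)"
  shows "(\<integral>\<^sup>+y. \<integral>\<^sup>+x. k (x + t * y, y) \<partial>lborel \<partial>lborel) = (\<integral>\<^sup>+y. \<integral>\<^sup>+x. k (x, y) \<partial>lborel \<partial>lborel)"
proof (rule nn_integral_cong)
  fix y :: real
  have "(\<integral>\<^sup>+x. k (x, y) \<partial>lborel) = (\<integral>\<^sup>+x. k (t * y + 1 * x, y) \<partial>lborel)"
    using nn_integral_real_affine[of "\<lambda>x. k (x, y)" 1 "t * y"] by simp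
  then show "(\<integral>\<^sup>+x. k (x + t * y, y) \<partial>lborel) = (\<integral>\<^sup>+x. k (x, y) \<partial>lborel)"
    by (simp add: add.commute)
qed

lemma shear_x':
  fixes k :: "real \<times> real \<Rightarrow> ennreal"
  assumes [measurable]: "k \<in> borel_measurable (borel \<Otimes>\<^sub>M borel)"
  shows "(\<integral>\<^sup>+z. k (fst z + t * snd z, snd z) \<partial>(lborel \<Otimes>\<^sub>M lborel)) = (\<integral>\<^sup>+z. k z \<partial>(lborel \<Otimes>\<^sub>M lborel))"
proof -
  have "(\<integral>\<^sup>+z. k (fst z + t * snd z, snd z) \<partial>(lborel \<Otimes>\<^sub>M lborel))
    = (\<integral>\<^sup>+y. \<integral>\<^sup>+x. k (x + t * y, y) \<partial>lborel \<partial>lborel)"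
    by (subst lborel_pair.nn_integral_snd[symmetric]) simp_all
  also have "\<dots> = (\<integral>\<^sup>+y. \<integral>\<^sup>+x. k (x, y) \<partial>lborel \<partial>lborel)"
    by (rule shear_x) fact
  also have "\<dots> = (\<integral>\<^sup>+z. k z \<partial>(lborel \<Otimes>\<^sub>M lborel))"
    by (subst lborel_pair.nn_integral_snd[symmetric]) simp_all
  finally show ?thesis .
qed

lemma shear_y':
  fixes k :: "real \<times> real \<Rightarrow> ennreal"
  assumes [measurable]: "k \<in> borel_measurable (borel \<Otimes>\<^sub>M borel)"
  shows "(\<integral>\<^sup>+z. k (fst z, snd z + t * fst z) \<partial>(lborel \<Otimes>\<^sub>M lborel)) = (\<integral>\<^sup>+z. k z \<partial>(lborel \<Otimes>\<^sub>M lborel))"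
proof -
  have "(\<integral>\<^sup>+z. k (fst z, snd z + t * fst z) \<partial>(lborel \<Otimes>\<^sub>M lborel))
    = (\<integral>\<^sup>+y. \<integral>\<^sup>+x. k (y, x + t * y) \<partial>lborel \<partial>lborel)"
    by (subst lborel.nn_integral_fst[symmetric]) simp_all
  also have "\<dots> = (\<integral>\<^sup>+y. \<integral>\<^sup>+x. k (y, x) \<partial>lborel \<partial>lborel)"
    using shear_x[of "\<lambda>z. k (snd z, fst z)" t] by simp
  also have "\<dots> = (\<integral>\<^sup>+z. k z \<partial>(lborel \<Otimes>\<^sub>M lborel))"
    by (subst lborel.nn_integral_fst[symmetric]) simp_all
  finally show ?thesis .
qed

text \<open>A rotation by \<theta> is a product of three shears with parameters \<open>t\<close>,
  \<open>- s\<close>, \<open>t\<close>, where \<open>t\<close> is the tangent of half the angle, and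
  each shear preserves Lebesgue measure by translation invariance in one variable. The assumption
  \<open>c \<ge> 0\<close> settles the case \<open>s = 0\<close>, where it forces
  \<open>c = 1\<close>.\<close>

lemma rotation_lborel:
  fixes k :: "real \<times> real \<Rightarrow> ennreal"
  assumes [measurable]: "k \<in> borel_measurable (borel \<Otimes>\<^sub>M borel)"
    and cs: "c\<^sup>2 + s\<^sup>2 = 1" "c \<ge> 0"
  shows "(\<integral>\<^sup>+z. k (c * fst z + s * snd z, - s * fst z + c * snd z) \<partial>(lborel \<Otimes>\<^sub>M lborel)) = (\<integral>\<^sup>+z. k z \<partial>(lborel \<Otimes>\<^sub>M lborel))"
proof (cases "s = 0")
  case True
  then have "c = 1" using cs by (simp add: power2_eq_1_iff)
  then show ?thesis using True by simp
next
  case False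
  define t where "t = (1 - c) / s"
  have ts: "t * s = 1 - c" using False by (simp add: t_def)
  have tc: "t * (1 + c) = s"
  proof -
    have "s * s = (1 - c) * (1 + c)" using cs(1) by (simp add: algebra_simps power2_eq_square)
    then show ?thesis using False by (simp add: t_def field_simps)
  qed
  define k1 where "k1 z = k (fst z + t * snd z, snd z)" for z
  define k2 where "k2 z = k1 (fst z, snd z + (- s) * fst z)" for z
  have [measurable]: "k1 \<in> borel_measurable (borel \<Otimes>\<^sub>M borel)" unfolding k1_def by measurable
  have [measurable]: "k2 \<in> borel_measurable (borel \<Otimes>\<^sub>M borel)" unfolding k2_def by measurable
  have eq: "k2 (fst z + t * snd z, snd z) = k (c * fst z + s * snd z, - s * fst z + c * snd z)" for z
  proof -
    have a: "c = 1 - t * s" using ts by simp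
    have "fst z + t * snd z + t * (snd z + - s * (fst z + t * snd z)) = (1 - t * s) * fst z + (t * (1 + (1 - t * s))) * snd z"
      by (simp add: algebra_simps)
    also have "\<dots> = c * fst z + s * snd z" using a tc by simp
    finally have 1: "fst z + t * snd z + t * (snd z + - s * (fst z + t * snd z)) = c * fst z + s * snd z" .
    have "snd z + - s * (fst z + t * snd z) = - s * fst z + (1 - t * s) * snd z"
      by (simp add: algebra_simps)
    then have 2: "snd z + - s * (fst z + t * snd z) = - s * fst z + c * snd z" using a by simp
    show ?thesis unfolding k2_def k1_def using 1 2 by simp
  qed
  have "(\<integral>\<^sup>+z. k (c * fst z + s * snd z, - s * fst z + c * snd z) \<partial>(lborel \<Otimes>\<^sub>M lborel))
    = (\<integral>\<^sup>+z. k2 z \<partial>(lborel \<Otimes>\<^sub>M lborel))"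
    unfolding eq[symmetric] by (rule shear_x') measurable
  also have "\<dots> = (\<integral>\<^sup>+z. k1 z \<partial>(lborel \<Otimes>\<^sub>M lborel))"
    unfolding k2_def by (rule shear_y') measurable
  also have "\<dots> = (\<integral>\<^sup>+z. k z \<partial>(lborel \<Otimes>\<^sub>M lborel))"
    unfolding k1_def by (rule shear_x') measurable
  finally show ?thesis .
qed

definition rot :: "real \<Rightarrow> real \<times> real \<Rightarrow> real \<times> real" where
  "rot \<theta> z = (cos \<theta> * fst z + sin \<theta> * snd z, - sin \<theta> * fst z + cos \<theta> * snd z)"

lemma measurable_rot [measurable]: "rot \<theta> \<in> borel \<Otimes>\<^sub>M borel \<rightarrow>\<^sub>M borel \<Otimes>\<^sub>M borel"
  unfolding rot_def[abs_def] by measurable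

lemma stdn_pair_density:
  "stdn \<Otimes>\<^sub>M stdn = density (lborel \<Otimes>\<^sub>M lborel) (\<lambda>z. ennreal (std_normal_density (fst z) * std_normal_density (snd z)))"
  by (subst pair_measure_density)
     (auto simp: stdn.sigma_finite_measure_axioms lborel.sigma_finite_measure_axioms ennreal_mult' split_beta
       intro!: density_cong)

text \<open>The joint density depends on the sum of the squares alone, and a rotation changes
  neither this sum nor Lebesgue measure.\<close>

lemma distr_rot:
  assumes "cos \<theta> \<ge> 0"
  shows "distr (stdn \<Otimes>\<^sub>M stdn) (stdn \<Otimes>\<^sub>M stdn) (rot \<theta>) = stdn \<Otimes>\<^sub>M stdn"
proof (rule measure_eqI)
  fix A assume "A \<in> sets (distr (stdn \<Otimes>\<^sub>M stdn) (stdn \<Otimes>\<^sub>M stdn) (rot \<theta>))"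
  then have A [measurable]: "A \<in> sets (borel \<Otimes>\<^sub>M borel)"
    by (simp cong: sets_pair_measure_cong)
  define d where "d z = std_normal_density (fst z) * std_normal_density (snd z)" for z
  have [measurable]: "d \<in> borel_measurable (borel \<Otimes>\<^sub>M borel)" unfolding d_def by measurable
  have inv: "d (rot \<theta> z) = d z" for z
  proof -
    have "(cos \<theta> * fst z + sin \<theta> * snd z)\<^sup>2 + (- sin \<theta> * fst z + cos \<theta> * snd z)\<^sup>2
      = ((cos \<theta>)\<^sup>2 + (sin \<theta>)\<^sup>2) * ((fst z)\<^sup>2 + (snd z)\<^sup>2)"
      by algebra
    then have *: "(cos \<theta> * fst z + sin \<theta> * snd z)\<^sup>2 + (- sin \<theta> * fst z + cos \<theta> * snd z)\<^sup>2 = (fst z)\<^sup>2 + (snd z)\<^sup>2"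
      by (simp only: sin_cos_squared_add2 mult_1)
    have "d z = (1 / sqrt (2 * pi)) * (1 / sqrt (2 * pi)) * exp (- ((fst z)\<^sup>2 + (snd z)\<^sup>2) / 2)" for z
      by (simp add: d_def std_normal_density_def mult_exp_exp field_simps)
    then show ?thesis using * by (simp add: rot_def)
  qed
  have "emeasure (distr (stdn \<Otimes>\<^sub>M stdn) (stdn \<Otimes>\<^sub>M stdn) (rot \<theta>)) A = (\<integral>\<^sup>+z. indicator A (rot \<theta> z) \<partial>(stdn \<Otimes>\<^sub>M stdn))"
    by (subst nn_integral_distr[symmetric, of "rot \<theta>" _ "stdn \<Otimes>\<^sub>M stdn"]) auto
  also have "\<dots> = (\<integral>\<^sup>+z. ennreal (d z) * indicator A (rot \<theta> z) \<partial>(lborel \<Otimes>\<^sub>M lborel))"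
    unfolding stdn_pair_density d_def by (subst nn_integral_density) auto
  also have "\<dots> = (\<integral>\<^sup>+z. ennreal (d (rot \<theta> z)) * indicator A (rot \<theta> z) \<partial>(lborel \<Otimes>\<^sub>M lborel))"
    by (simp add: inv)
  also have "\<dots> = (\<integral>\<^sup>+z. ennreal (d z) * indicator A z \<partial>(lborel \<Otimes>\<^sub>M lborel))"
    using rotation_lborel[of "\<lambda>z. ennreal (d z) * indicator A z" "cos \<theta>" "sin \<theta>"] assms
    by (simp add: rot_def)
  also have "\<dots> = (\<integral>\<^sup>+z. indicator A z \<partial>(stdn \<Otimes>\<^sub>M stdn))"
    unfolding stdn_pair_density d_def by (subst nn_integral_density) auto
  also have "\<dots> = emeasure (stdn \<Otimes>\<^sub>M stdn) A" by simp
  finally show "emeasure (distr (stdn \<Otimes>\<^sub>M stdn) (stdn \<Otimes>\<^sub>M stdn) (rot \<theta>)) A = emeasure (stdn \<Otimes>\<^sub>M stdn) A" .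
qed simp

lemma nn_integral_distr_rot:
  assumes [measurable]: "k \<in> borel_measurable (borel \<Otimes>\<^sub>M borel)" and "cos \<theta> \<ge> 0"
  shows "(\<integral>\<^sup>+x. \<integral>\<^sup>+y. k (rot \<theta> (x, y)) \<partial>stdn \<partial>stdn) = (\<integral>\<^sup>+x. \<integral>\<^sup>+y. k (x, y) \<partial>stdn \<partial>stdn)"
proof -
  have m: "k \<in> borel_measurable (stdn \<Otimes>\<^sub>M stdn)" by measurable
  have mr: "rot \<theta> \<in> (stdn \<Otimes>\<^sub>M stdn) \<rightarrow>\<^sub>M (stdn \<Otimes>\<^sub>M stdn)" by measurable
  have "(\<integral>\<^sup>+x. \<integral>\<^sup>+y. k (rot \<theta> (x, y)) \<partial>stdn \<partial>stdn) = (\<integral>\<^sup>+z. k (rot \<theta> z) \<partial>(stdn \<Otimes>\<^sub>M stdn))"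
    by (rule stdn.nn_integral_fst) measurable
  also have "\<dots> = (\<integral>\<^sup>+z. k z \<partial>(distr (stdn \<Otimes>\<^sub>M stdn) (stdn \<Otimes>\<^sub>M stdn) (rot \<theta>)))"
    using m mr by (subst nn_integral_distr) auto
  also have "\<dots> = (\<integral>\<^sup>+x. \<integral>\<^sup>+y. k (x, y) \<partial>stdn \<partial>stdn)"
    unfolding distr_rot[OF assms(2)] using m by (subst stdn.nn_integral_fst) auto
  finally show ?thesis .
qed

interpretation stdn_prod: product_prob_space "\<lambda>i. stdn" I for I ..

lemma nn_integral_gauss_insert:
  assumes "finite I" "i \<notin> I" "f \<in> borel_measurable (gauss (insert i I))"
  shows "(\<integral>\<^sup>+z. f z \<partial>gauss (insert i I)) = (\<integral>\<^sup>+z. \<integral>\<^sup>+x. f (z(i := x)) \<partial>stdn \<partial>gauss I)"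
  using stdn_prod.product_nn_integral_insert[OF assms(1,2)] assms(3)
  unfolding gauss_def by blast

lemma measurable_upd_gauss [measurable]:
  "(\<lambda>(z, x). z(i := x)) \<in> gauss I \<Otimes>\<^sub>M borel \<rightarrow>\<^sub>M gauss (insert i I)"
  using measurable_add_dim[of i I "\<lambda>_. stdn"]
  unfolding gauss_def by (simp cong: measurable_cong_sets)

text \<open>Separate angles for the planes of \<open>fst p i\<close> and \<open>snd p i\<close> are
  what \<open>gauss_stability\<close> calls for. With a common angle, the second component is the
  derivative of the first in the angle, which \<open>gauss_variance_bound\<close> exploits.\<close>

definition rots :: "'i set \<Rightarrow> ('i \<Rightarrow> real) \<Rightarrow> ('i \<Rightarrow> real) \<times> ('i \<Rightarrow> real) \<Rightarrow> ('i \<Rightarrow> real) \<times> ('i \<Rightarrow> real)" where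
  "rots J \<theta> p = ((\<lambda>i. if i \<in> J then cos (\<theta> i) * fst p i + sin (\<theta> i) * snd p i else fst p i),
                 (\<lambda>i. if i \<in> J then - sin (\<theta> i) * fst p i + cos (\<theta> i) * snd p i else snd p i))"

lemma measurable_rots [measurable]:
  assumes "J \<subseteq> I"
  shows "rots J \<theta> \<in> gauss I \<Otimes>\<^sub>M gauss I \<rightarrow>\<^sub>M gauss I \<Otimes>\<^sub>M gauss I"
proof -
  have "(\<lambda>p. (\<lambda>i. if i \<in> J then cos (\<theta> i) * fst p i + sin (\<theta> i) * snd p i else fst p i)) \<in> gauss I \<Otimes>\<^sub>M gauss I \<rightarrow>\<^sub>M (\<Pi>\<^sub>M i\<in>I. borel)"
    using assms by (intro measurable_PiM_single') (auto simp: space_pair_measure space_gauss PiE_iff extensional_def)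
  moreover have "(\<lambda>p. (\<lambda>i. if i \<in> J then - sin (\<theta> i) * fst p i + cos (\<theta> i) * snd p i else snd p i)) \<in> gauss I \<Otimes>\<^sub>M gauss I \<rightarrow>\<^sub>M (\<Pi>\<^sub>M i\<in>I. borel)"
    using assms by (intro measurable_PiM_single') (auto simp: space_pair_measure space_gauss PiE_iff extensional_def)
  ultimately show ?thesis unfolding rots_def[abs_def] by measurable
qed

text \<open>Prepares the rotation of a single coordinate plane: after Fubini the two integrals over
  coordinate \<open>i\<close> stand innermost and side by side, so that the planar statement applies
  to them.\<close>

lemma nn_integral_gauss_pair_insert:
  fixes I :: "'i set"
  assumes "finite I" "i \<notin> I"
    and f [measurable]: "f \<in> borel_measurable (gauss (insert i I) \<Otimes>\<^sub>M gauss (insert i I))"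
  shows "(\<integral>\<^sup>+z. \<integral>\<^sup>+w. f (z, w) \<partial>gauss (insert i I) \<partial>gauss (insert i I))
    = (\<integral>\<^sup>+z. \<integral>\<^sup>+w. \<integral>\<^sup>+x. \<integral>\<^sup>+y. f (z(i := x), w(i := y)) \<partial>stdn \<partial>stdn \<partial>gauss I \<partial>gauss I)"
proof -
  interpret G: prob_space "gauss L" for L :: "'i set" by (rule prob_space_gauss)
  interpret pair_prob_space stdn "gauss I" ..
  have 1: "(\<integral>\<^sup>+z. \<integral>\<^sup>+w. f (z, w) \<partial>gauss (insert i I) \<partial>gauss (insert i I))
    = (\<integral>\<^sup>+z. \<integral>\<^sup>+x. \<integral>\<^sup>+w. f (z(i := x), w) \<partial>gauss (insert i I) \<partial>stdn \<partial>gauss I)"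
    by (rule nn_integral_gauss_insert[OF assms(1,2), where f = "\<lambda>z. \<integral>\<^sup>+w. f (z, w) \<partial>gauss (insert i I)"]) measurable
  have 2: "(\<integral>\<^sup>+w. f (z(i := x), w) \<partial>gauss (insert i I)) = (\<integral>\<^sup>+w. \<integral>\<^sup>+y. f (z(i := x), w(i := y)) \<partial>stdn \<partial>gauss I)"
    if "z \<in> space (gauss I)" for z x
  proof (rule nn_integral_gauss_insert[OF assms(1,2)])
    have "z(i := x) \<in> space (gauss (insert i I))" using that by (auto simp: space_gauss PiE_iff extensional_def)
    then show "(\<lambda>w. f (z(i := x), w)) \<in> borel_measurable (gauss (insert i I))" by measurable
  qed
  have 3: "(\<integral>\<^sup>+x. \<integral>\<^sup>+w. \<integral>\<^sup>+y. f (z(i := x), w(i := y)) \<partial>stdn \<partial>gauss I \<partial>stdn)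
    = (\<integral>\<^sup>+w. \<integral>\<^sup>+x. \<integral>\<^sup>+y. f (z(i := x), w(i := y)) \<partial>stdn \<partial>stdn \<partial>gauss I)"
    if [measurable]: "z \<in> space (gauss I)" for z
  proof (rule Fubini'[symmetric])
    have [measurable]: "(\<lambda>x. z(i := x)) \<in> borel \<rightarrow>\<^sub>M gauss (insert i I)"
      using measurable_compose[OF _ measurable_upd_gauss[of i I], of "\<lambda>x. (z, x)" borel] by simp
    have [measurable]: "(\<lambda>q. (snd (fst q))(i := snd q)) \<in> (stdn \<Otimes>\<^sub>M gauss I) \<Otimes>\<^sub>M stdn \<rightarrow>\<^sub>M gauss (insert i I)"
      using measurable_compose[OF _ measurable_upd_gauss[of i I], of "\<lambda>q. (snd (fst q), snd q)" "(stdn \<Otimes>\<^sub>M gauss I) \<Otimes>\<^sub>M stdn"] by simp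
    show "(\<lambda>(x, w). \<integral>\<^sup>+y. f (z(i := x), w(i := y)) \<partial>stdn) \<in> borel_measurable (stdn \<Otimes>\<^sub>M gauss I)"
      unfolding split_beta
      by (intro stdn.borel_measurable_nn_integral) (simp add: split_beta')
  qed
  show ?thesis
    unfolding 1 using 2 3 by (simp cong: nn_integral_cong)
qed

lemma nn_integral_rots1:
  fixes I :: "'i set"
  assumes "finite I" "i \<in> I" "cos (\<theta> i) \<ge> 0"
    and f [measurable]: "f \<in> borel_measurable (gauss I \<Otimes>\<^sub>M gauss I)"
  shows "(\<integral>\<^sup>+p. f (rots {i} \<theta> p) \<partial>(gauss I \<Otimes>\<^sub>M gauss I)) = (\<integral>\<^sup>+p. f p \<partial>(gauss I \<Otimes>\<^sub>M gauss I))"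
proof -
  interpret G: prob_space "gauss L" for L :: "'i set" by (rule prob_space_gauss)
  define J where "J = I - {i}"
  have J: "finite J" "i \<notin> J" "I = insert i J" using assms by (auto simp: J_def)
  have mr [measurable]: "rots {i} \<theta> \<in> gauss I \<Otimes>\<^sub>M gauss I \<rightarrow>\<^sub>M gauss I \<Otimes>\<^sub>M gauss I"
    by (rule measurable_rots) (use assms(2) in simp)
  have fr: "(\<lambda>p. f (rots {i} \<theta> p)) \<in> borel_measurable (gauss I \<Otimes>\<^sub>M gauss I)"
    by measurable
  have eq: "rots {i} \<theta> (z(i := x), w(i := y)) = (z(i := fst (rot (\<theta> i) (x, y))), w(i := snd (rot (\<theta> i) (x, y))))" for z w x y
    by (auto simp: rots_def rot_def fun_eq_iff)
  have "(\<integral>\<^sup>+p. f (rots {i} \<theta> p) \<partial>(gauss I \<Otimes>\<^sub>M gauss I)) = (\<integral>\<^sup>+z. \<integral>\<^sup>+w. f (rots {i} \<theta> (z, w)) \<partial>gauss I \<partial>gauss I)"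
    by (rule G.nn_integral_fst[symmetric]) measurable
  also have "\<dots> = (\<integral>\<^sup>+z. \<integral>\<^sup>+w. \<integral>\<^sup>+x. \<integral>\<^sup>+y. f (rots {i} \<theta> (z(i := x), w(i := y))) \<partial>stdn \<partial>stdn \<partial>gauss J \<partial>gauss J)"
    by (rule nn_integral_gauss_pair_insert[OF J(1,2), folded J(3), OF fr])
  also have "\<dots> = (\<integral>\<^sup>+z. \<integral>\<^sup>+w. \<integral>\<^sup>+x. \<integral>\<^sup>+y. f (z(i := x), w(i := y)) \<partial>stdn \<partial>stdn \<partial>gauss J \<partial>gauss J)"
  proof (rule nn_integral_cong, rule nn_integral_cong)
    fix z w assume zw [measurable]: "z \<in> space (gauss J)" "w \<in> space (gauss J)"
    have [measurable]: "(\<lambda>x. z(i := x)) \<in> borel \<rightarrow>\<^sub>M gauss I" "(\<lambda>x. w(i := x)) \<in> borel \<rightarrow>\<^sub>M gauss I"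
      using measurable_compose[OF _ measurable_upd_gauss[of i J], of "\<lambda>x. (z, x)" borel]
        measurable_compose[OF _ measurable_upd_gauss[of i J], of "\<lambda>x. (w, x)" borel] J(3) by simp_all
    show "(\<integral>\<^sup>+x. \<integral>\<^sup>+y. f (rots {i} \<theta> (z(i := x), w(i := y))) \<partial>stdn \<partial>stdn) = (\<integral>\<^sup>+x. \<integral>\<^sup>+y. f (z(i := x), w(i := y)) \<partial>stdn \<partial>stdn)"
      unfolding eq using nn_integral_distr_rot[of "\<lambda>q. f (z(i := fst q), w(i := snd q))" "\<theta> i"] assms(3) by simp
  qed
  also have "\<dots> = (\<integral>\<^sup>+z. \<integral>\<^sup>+w. f (z, w) \<partial>gauss I \<partial>gauss I)"
    by (rule nn_integral_gauss_pair_insert[OF J(1,2), folded J(3), OF f, symmetric])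
  also have "\<dots> = (\<integral>\<^sup>+p. f p \<partial>(gauss I \<Otimes>\<^sub>M gauss I))"
    by (rule G.nn_integral_fst) measurable
  finally show ?thesis .
qed

lemma nn_integral_rots:
  assumes "finite I" "J \<subseteq> I" "\<And>i. i \<in> J \<Longrightarrow> cos (\<theta> i) \<ge> 0"
    and f [measurable]: "f \<in> borel_measurable (gauss I \<Otimes>\<^sub>M gauss I)"
  shows "(\<integral>\<^sup>+p. f (rots J \<theta> p) \<partial>(gauss I \<Otimes>\<^sub>M gauss I)) = (\<integral>\<^sup>+p. f p \<partial>(gauss I \<Otimes>\<^sub>M gauss I))"
  using finite_subset[OF assms(2,1)] assms(2,3) f
proof (induction J arbitrary: f)
  case empty
  then show ?case by (simp add: rots_def)
next
  case (insert i J)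
  have [measurable]: "rots {i} \<theta> \<in> gauss I \<Otimes>\<^sub>M gauss I \<rightarrow>\<^sub>M gauss I \<Otimes>\<^sub>M gauss I"
    by (rule measurable_rots) (use insert in auto)
  note insert.prems(3) [measurable]
  have "rots (insert i J) \<theta> p = rots {i} \<theta> (rots J \<theta> p)" for p
    using insert.hyps by (auto simp: rots_def fun_eq_iff)
  then have "(\<integral>\<^sup>+p. f (rots (insert i J) \<theta> p) \<partial>(gauss I \<Otimes>\<^sub>M gauss I)) = (\<integral>\<^sup>+p. f (rots {i} \<theta> (rots J \<theta> p)) \<partial>(gauss I \<Otimes>\<^sub>M gauss I))"
    by simp
  also have "\<dots> = (\<integral>\<^sup>+p. f (rots {i} \<theta> p) \<partial>(gauss I \<Otimes>\<^sub>M gauss I))"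
    by (rule insert.IH) (use insert in auto)
  also have "\<dots> = (\<integral>\<^sup>+p. f p \<partial>(gauss I \<Otimes>\<^sub>M gauss I))"
    by (rule nn_integral_rots1) (use insert assms(1) in auto)
  finally show ?case .
qed

lemma distr_rots:
  assumes "finite I" "\<And>i. i \<in> I \<Longrightarrow> cos (\<theta> i) \<ge> 0"
  shows "distr (gauss I \<Otimes>\<^sub>M gauss I) (gauss I \<Otimes>\<^sub>M gauss I) (rots I \<theta>) = gauss I \<Otimes>\<^sub>M gauss I"
proof (rule measure_eqI)
  fix A assume "A \<in> sets (distr (gauss I \<Otimes>\<^sub>M gauss I) (gauss I \<Otimes>\<^sub>M gauss I) (rots I \<theta>))"
  then have [measurable]: "A \<in> sets (gauss I \<Otimes>\<^sub>M gauss I)" by simp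
  have [measurable]: "rots I \<theta> \<in> gauss I \<Otimes>\<^sub>M gauss I \<rightarrow>\<^sub>M gauss I \<Otimes>\<^sub>M gauss I"
    by (rule measurable_rots) simp
  have "emeasure (distr (gauss I \<Otimes>\<^sub>M gauss I) (gauss I \<Otimes>\<^sub>M gauss I) (rots I \<theta>)) A
    = (\<integral>\<^sup>+p. indicator A (rots I \<theta> p) \<partial>(gauss I \<Otimes>\<^sub>M gauss I))"
    by (subst nn_integral_distr[symmetric, of "rots I \<theta>" _ "gauss I \<Otimes>\<^sub>M gauss I"]) auto
  also have "\<dots> = (\<integral>\<^sup>+p. indicator A p \<partial>(gauss I \<Otimes>\<^sub>M gauss I))"
    by (rule nn_integral_rots) (use assms in auto)
  finally show "emeasure (distr (gauss I \<Otimes>\<^sub>M gauss I) (gauss I \<Otimes>\<^sub>M gauss I) (rots I \<theta>)) A = emeasure (gauss I \<Otimes>\<^sub>M gauss I) A"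
    by simp
qed simp

lemma integral_rots:
  fixes f :: "('i \<Rightarrow> real) \<times> ('i \<Rightarrow> real) \<Rightarrow> real"
  assumes "finite I" "\<And>i. i \<in> I \<Longrightarrow> cos (\<theta> i) \<ge> 0"
    and f: "f \<in> borel_measurable (gauss I \<Otimes>\<^sub>M gauss I)"
  shows "(\<integral>p. f (rots I \<theta> p) \<partial>(gauss I \<Otimes>\<^sub>M gauss I)) = (\<integral>p. f p \<partial>(gauss I \<Otimes>\<^sub>M gauss I))"
proof -
  have "(\<integral>p. f (rots I \<theta> p) \<partial>(gauss I \<Otimes>\<^sub>M gauss I))
    = (\<integral>p. f p \<partial>(distr (gauss I \<Otimes>\<^sub>M gauss I) (gauss I \<Otimes>\<^sub>M gauss I) (rots I \<theta>)))"
    by (rule integral_distr[symmetric]) (use f measurable_rots in auto)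
  then show ?thesis by (simp add: distr_rots assms)
qed

lemma integrable_rots:
  fixes f :: "('i \<Rightarrow> real) \<times> ('i \<Rightarrow> real) \<Rightarrow> real"
  assumes "finite I" "\<And>i. i \<in> I \<Longrightarrow> cos (\<theta> i) \<ge> 0"
    and f: "integrable (gauss I \<Otimes>\<^sub>M gauss I) f"
  shows "integrable (gauss I \<Otimes>\<^sub>M gauss I) (\<lambda>p. f (rots I \<theta> p))"
proof (rule integrable_distr[of "rots I \<theta>" _ "gauss I \<Otimes>\<^sub>M gauss I"])
  show "rots I \<theta> \<in> gauss I \<Otimes>\<^sub>M gauss I \<rightarrow>\<^sub>M gauss I \<Otimes>\<^sub>M gauss I" by (rule measurable_rots) simp
  show "integrable (distr (gauss I \<Otimes>\<^sub>M gauss I) (gauss I \<Otimes>\<^sub>M gauss I) (rots I \<theta>)) f"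
    using f by (simp add: distr_rots assms)
qed

lemma integral_fst_gauss:
  fixes f :: "('i \<Rightarrow> real) \<Rightarrow> real"
  assumes [measurable]: "f \<in> borel_measurable (gauss I)"
  shows "(\<integral>p. f (fst p) \<partial>(gauss I \<Otimes>\<^sub>M gauss L)) = (\<integral>z. f z \<partial>gauss I)"
proof -
  interpret G: prob_space "gauss L" by (rule prob_space_gauss)
  have "(\<integral>p. f (fst p) \<partial>(gauss I \<Otimes>\<^sub>M gauss L)) = (\<integral>z. f z \<partial>distr (gauss I \<Otimes>\<^sub>M gauss L) (gauss I) fst)"
    by (rule integral_distr[symmetric]) auto
  also have "distr (gauss I \<Otimes>\<^sub>M gauss L) (gauss I) fst = gauss I"
    by (rule G.distr_pair_fst)
  finally show ?thesis .
qed

text \<open>Up to the factor \<open>sqrt ((p i)\<^sup>2 + (q i)\<^sup>2)\<close>, the combination is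
  the first component of a rotated pair, and the pair has a rotation invariant law. Read from right
  to left, this adds a small independent increment of variance, as the replacement argument
  requires.\<close>

lemma gauss_stability:
  fixes f :: "('i \<Rightarrow> real) \<Rightarrow> real"
  assumes I: "finite I"
    and pq: "\<And>i. i \<in> I \<Longrightarrow> p i \<ge> 0 \<and> q i \<ge> 0"
    and f [measurable]: "f \<in> borel_measurable (gauss I)"
  shows "(\<integral>x. f (\<lambda>i\<in>I. p i * fst x i + q i * snd x i) \<partial>(gauss I \<Otimes>\<^sub>M gauss I))
    = (\<integral>z. f (\<lambda>i\<in>I. sqrt ((p i)\<^sup>2 + (q i)\<^sup>2) * z i) \<partial>gauss I)"
proof -
  define \<rho> where "\<rho> i = sqrt ((p i)\<^sup>2 + (q i)\<^sup>2)" for i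
  have "\<exists>\<theta>. cos \<theta> \<ge> 0 \<and> \<rho> i * cos \<theta> = p i \<and> \<rho> i * sin \<theta> = q i" if "i \<in> I" for i
  proof (cases "\<rho> i = 0")
    case True
    then have "p i = 0" "q i = 0" by (auto simp: \<rho>_def sum_power2_eq_zero_iff)
    \<comment> \<open>Where \<rho> vanishes so do \<open>p i\<close> and \<open>q i\<close>, and any
      angle with nonnegative cosine will do.\<close>
    then show ?thesis using True by (intro exI[of _ 0]) auto
  next
    case False
    moreover have "\<rho> i \<ge> 0" by (simp add: \<rho>_def)
    ultimately have pos: "\<rho> i > 0" by linarith
    have "(p i / \<rho> i)\<^sup>2 + (q i / \<rho> i)\<^sup>2 = ((p i)\<^sup>2 + (q i)\<^sup>2) / (\<rho> i)\<^sup>2"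
      by (simp add: power_divide add_divide_distrib)
    also have "\<dots> = 1"
    proof -
      have "(\<rho> i)\<^sup>2 = (p i)\<^sup>2 + (q i)\<^sup>2" by (simp add: \<rho>_def)
      then show ?thesis using pos by (metis divide_self zero_less_power less_irrefl)
    qed
    finally have "(p i / \<rho> i)\<^sup>2 + (q i / \<rho> i)\<^sup>2 = 1" .
    from sincos_total_pi_half[OF _ _ this] pq[OF that] pos obtain t
      where "p i / \<rho> i = cos t" "q i / \<rho> i = sin t" by auto
    moreover have "p i / \<rho> i \<ge> 0" using pq[OF that] pos by simp
    ultimately show ?thesis using pos by (intro exI[of _ t]) (auto simp: field_simps)
  qed
  then obtain \<theta> where \<theta>: "\<And>i. i \<in> I \<Longrightarrow> cos (\<theta> i) \<ge> 0 \<and> \<rho> i * cos (\<theta> i) = p i \<and> \<rho> i * sin (\<theta> i) = q i"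
    by metis
  have [measurable]: "(\<lambda>z. (\<lambda>i\<in>I. \<rho> i * z i)) \<in> gauss I \<rightarrow>\<^sub>M gauss I"
    by (auto intro!: measurable_restrict simp: gauss_def)
  have eq: "(\<lambda>i\<in>I. p i * fst x i + q i * snd x i) = (\<lambda>i\<in>I. \<rho> i * fst (rots I \<theta> x) i)" for x
  proof (rule restrict_ext)
    fix i assume "i \<in> I"
    then have "p i = \<rho> i * cos (\<theta> i)" "q i = \<rho> i * sin (\<theta> i)" using \<theta> by simp_all
    then show "p i * fst x i + q i * snd x i = \<rho> i * fst (rots I \<theta> x) i"
      using \<open>i \<in> I\<close> by (simp add: rots_def algebra_simps)
  qed
  have "(\<integral>x. f (\<lambda>i\<in>I. p i * fst x i + q i * snd x i) \<partial>(gauss I \<Otimes>\<^sub>M gauss I))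
    = (\<integral>x. f (\<lambda>i\<in>I. \<rho> i * fst x i) \<partial>(gauss I \<Otimes>\<^sub>M gauss I))"
    unfolding eq by (rule integral_rots[OF I, where f = "\<lambda>x. f (\<lambda>i\<in>I. \<rho> i * fst x i)"]) (use \<theta> in auto)
  also have "\<dots> = (\<integral>z. f (\<lambda>i\<in>I. \<rho> i * z i) \<partial>gauss I)"
    by (rule integral_fst_gauss[where f = "\<lambda>z. f (\<lambda>i\<in>I. \<rho> i * z i)"]) measurable
  finally show ?thesis by (simp add: \<rho>_def)
qed

section \<open>Moments of Gaussian coordinates\<close>

lemma has_bochner_integral_stdn:
  "has_bochner_integral lborel (\<lambda>x. std_normal_density x * f x) c \<Longrightarrow> f \<in> borel_measurable borel
    \<Longrightarrow> has_bochner_integral stdn f c"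
  by (intro has_bochner_integral_density) (auto simp: normal_density_nonneg)

lemma stdn_moments:
  "has_bochner_integral stdn (\<lambda>x. x) 0"
  "has_bochner_integral stdn (\<lambda>x. x\<^sup>2) 1"
  "has_bochner_integral stdn (\<lambda>x. x ^ 4) 3"
proof -
  show "has_bochner_integral stdn (\<lambda>x. x) 0"
    by (rule has_bochner_integral_stdn) (use std_normal_moment_odd[of 0] in simp_all)
  show "has_bochner_integral stdn (\<lambda>x. x\<^sup>2) 1"
    by (rule has_bochner_integral_stdn) (use std_normal_moment_even[of 1] in \<open>simp_all add: fact_numeral\<close>)
  show "has_bochner_integral stdn (\<lambda>x. x ^ 4) 3"
    by (rule has_bochner_integral_stdn) (use std_normal_moment_even[of 2] in \<open>simp_all add: fact_numeral\<close>)
qed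

lemma integrable_stdn_abs_power: "integrable stdn (\<lambda>x. \<bar>x\<bar> ^ k)"
  by (subst integrable_density) (auto intro: integrable_std_normal_moment_abs)

lemma integral_gauss_component:
  fixes f :: "real \<Rightarrow> real"
  assumes "i \<in> I" "f \<in> borel_measurable borel"
  shows "(\<integral>z. f (z i) \<partial>gauss I) = (\<integral>x. f x \<partial>stdn)"
    and "integrable (gauss I) (\<lambda>z. f (z i)) \<longleftrightarrow> integrable stdn f"
proof -
  have d: "distr (gauss I) stdn (\<lambda>z. z i) = stdn"
    unfolding gauss_def by (rule stdn_prod.PiM_component) fact
  have m: "(\<lambda>z. z i) \<in> gauss I \<rightarrow>\<^sub>M stdn"
    using assms(1) by simp
  show "(\<integral>z. f (z i) \<partial>gauss I) = (\<integral>x. f x \<partial>stdn)"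
    using integral_distr[OF m, of f] assms(2) unfolding d by simp
  show "integrable (gauss I) (\<lambda>z. f (z i)) \<longleftrightarrow> integrable stdn f"
    using integrable_distr_eq[OF m, of f] assms(2) unfolding d by simp
qed

lemma integral_gauss_two_components:
  fixes f g :: "real \<Rightarrow> real"
  assumes I: "finite I" "i \<in> I" "j \<in> I" "i \<noteq> j" and int: "integrable stdn f" "integrable stdn g"
  shows "(\<integral>z. f (z i) * g (z j) \<partial>gauss I) = (\<integral>x. f x \<partial>stdn) * (\<integral>x. g x \<partial>stdn)"
    and "integrable (gauss I) (\<lambda>z. f (z i) * g (z j))"
proof -
  \<comment> \<open>The factor one at the remaining coordinates turns the product of two functions
    into a product over all of \<open>I\<close>.\<close>
  define F where "F k = (if k = i then f else if k = j then g else (\<lambda>x. 1))" for k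
  have intF: "integrable stdn (F k)" for k using int by (auto simp: F_def)
  have split: "(\<Prod>k\<in>I. h k) = h i * h j" if "\<And>k. k \<noteq> i \<Longrightarrow> k \<noteq> j \<Longrightarrow> h k = 1" for h :: "'a \<Rightarrow> real"
  proof -
    have "(\<Prod>k\<in>I. h k) = (\<Prod>k\<in>{i, j}. h k)"
      using I that by (intro prod.mono_neutral_right) auto
    then show ?thesis using I by simp
  qed
  have eq: "(\<Prod>k\<in>I. F k (z k)) = f (z i) * g (z j)" for z
    using I(4) by (subst split) (auto simp: F_def)
  have "(\<Prod>k\<in>I. integral\<^sup>L stdn (F k)) = (\<integral>x. f x \<partial>stdn) * (\<integral>x. g x \<partial>stdn)"
    using I(4) by (subst split) (auto simp: F_def stdn_prob_UNIV)
  then show "(\<integral>z. f (z i) * g (z j) \<partial>gauss I) = (\<integral>x. f x \<partial>stdn) * (\<integral>x. g x \<partial>stdn)"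
    using stdn_prod.product_integral_prod[OF I(1), of F] intF unfolding eq gauss_def by simp
  show "integrable (gauss I) (\<lambda>z. f (z i) * g (z j))"
    using stdn_prod.product_integrable_prod[OF I(1), of F] intF unfolding eq gauss_def by simp
qed

lemma gauss_second_moments:
  assumes "finite I" "i \<in> I" "j \<in> I"
  shows "(\<integral>z. z i * z j \<partial>gauss I) = (if i = j then 1 else 0)"
    and "integrable (gauss I) (\<lambda>z. z i * z j)"
    and "(\<integral>z. z i \<partial>gauss I) = 0"
    and "integrable (gauss I) (\<lambda>z. z i)"
proof -
  have m: "integrable stdn (\<lambda>x. x)" "(\<integral>x. x \<partial>stdn) = 0" "integrable stdn (\<lambda>x. x\<^sup>2)" "(\<integral>x. x\<^sup>2 \<partial>stdn) = 1"
    using stdn_moments(1,2) by (auto simp: has_bochner_integral_iff)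
  have idm: "(\<lambda>x::real. x) \<in> borel_measurable borel" by measurable
  note c1 = integral_gauss_component[OF assms(2), of "\<lambda>x. x", OF idm]
  have sq: "(\<lambda>x::real. x\<^sup>2) \<in> borel_measurable borel" by measurable
  note c2 = integral_gauss_component[OF assms(2), of "\<lambda>x. x\<^sup>2", OF sq]
  show "(\<integral>z. z i \<partial>gauss I) = 0" unfolding c1(1) by (rule m)
  show "integrable (gauss I) (\<lambda>z. z i)" unfolding c1(2) by (rule m)
  have "(\<integral>z. z i * z j \<partial>gauss I) = (if i = j then 1 else 0) \<and> integrable (gauss I) (\<lambda>z. z i * z j)"
  proof (cases "i = j")
    case True
    have "(\<integral>z. (z i)\<^sup>2 \<partial>gauss I) = 1" unfolding c2(1) by (rule m)
    moreover have "integrable (gauss I) (\<lambda>z. (z i)\<^sup>2)" unfolding c2(2) by (rule m)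
    ultimately show ?thesis using True by (simp only: power2_eq_square if_True simp_thms)
  next
    case False
    have "(\<integral>z. z i * z j \<partial>gauss I) = 0"
      unfolding integral_gauss_two_components(1)[OF assms False m(1) m(1)] m(2) by (rule mult_zero_left)
    moreover have "integrable (gauss I) (\<lambda>z. z i * z j)"
      by (rule integral_gauss_two_components(2)[OF assms False m(1) m(1)])
    ultimately show ?thesis using False by (simp only: if_False simp_thms)
  qed
  then show "(\<integral>z. z i * z j \<partial>gauss I) = (if i = j then 1 else 0)" "integrable (gauss I) (\<lambda>z. z i * z j)"
    by blast+
qed

lemma integrable_gauss_abs_power:
  assumes "i \<in> I"
  shows "integrable (gauss I) (\<lambda>z. \<bar>z i\<bar> ^ k)"
proof -
  have m: "(\<lambda>x::real. \<bar>x\<bar> ^ k) \<in> borel_measurable borel" by measurable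
  show ?thesis
    unfolding integral_gauss_component(2)[OF assms m] by (rule integrable_stdn_abs_power)
qed

section \<open>Metric projections onto closed convex sets\<close>

definition ip :: "nat \<Rightarrow> (nat \<Rightarrow> real) \<Rightarrow> (nat \<Rightarrow> real) \<Rightarrow> real" where
  "ip n x y = (\<Sum>i<n. x i * y i)"

lemma ip_commute: "ip n x y = ip n y x"
  unfolding ip_def by (rule sum.cong) (auto simp: mult.commute)

lemma ip_add_left: "ip n (\<lambda>i. x i + y i) z = ip n x z + ip n y z"
  by (simp add: ip_def distrib_right sum.distrib)

lemma ip_diff_left: "ip n (\<lambda>i. x i - y i) z = ip n x z - ip n y z"
  by (simp add: ip_def left_diff_distrib sum_subtractf)

lemma ip_scale_left: "ip n (\<lambda>i. c * x i) z = c * ip n x z"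
  by (simp add: ip_def sum_distrib_left mult.assoc)

lemma ip_add_right: "ip n z (\<lambda>i. x i + y i) = ip n z x + ip n z y"
  by (simp add: ip_def distrib_left sum.distrib)

lemma ip_diff_right: "ip n z (\<lambda>i. x i - y i) = ip n z x - ip n z y"
  by (simp add: ip_def right_diff_distrib sum_subtractf)

lemma ip_scale_right: "ip n z (\<lambda>i. c * x i) = c * ip n z x"
  by (simp add: ip_def sum_distrib_left mult.left_commute)

lemmas ip_simps = ip_add_left ip_diff_left ip_scale_left ip_add_right ip_diff_right ip_scale_right

lemma ip_zero [simp]: "ip n (\<lambda>i. 0) x = 0" "ip n x (\<lambda>i. 0) = 0"
  by (simp_all add: ip_def)

lemma ip_self_nonneg: "0 \<le> ip n x x"
  by (simp add: ip_def sum_nonneg)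

lemma enorm_sq: "(enorm n x)\<^sup>2 = ip n x x"
  by (simp add: enorm_def L2_set_def ip_def power2_eq_square[symmetric] sum_nonneg)

lemma enorm_eq_sqrt: "enorm n x = sqrt (ip n x x)"
  by (simp add: enorm_def L2_set_def ip_def power2_eq_square)

lemma enorm_nonneg [simp]: "0 \<le> enorm n x"
  by (simp add: enorm_def)

lemma ip_le_enorm: "ip n x y \<le> enorm n x * enorm n y"
  unfolding ip_def enorm_def
  by (rule order_trans[OF _ L2_set_mult_ineq]) (auto intro!: sum_mono simp: abs_mult[symmetric])

lemma abs_ip_le_enorm: "\<bar>ip n x y\<bar> \<le> enorm n x * enorm n y"
proof -
  have "- ip n x y = ip n (\<lambda>i. (-1) * x i) y" unfolding ip_scale_left by simp
  moreover have "enorm n (\<lambda>i. (-1) * x i) = enorm n x"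
    by (simp add: enorm_eq_sqrt ip_def)
  ultimately have "- ip n x y \<le> enorm n x * enorm n y"
    using ip_le_enorm[of n "\<lambda>i. (-1) * x i" y] by metis
  then show ?thesis using ip_le_enorm[of n x y] by linarith
qed

lemma enorm_triangle: "enorm n (\<lambda>i. x i + y i) \<le> enorm n x + enorm n y"
  unfolding enorm_def by (rule L2_set_triangle_ineq)

lemma enorm_scale: "enorm n (\<lambda>i. c * x i) = \<bar>c\<bar> * enorm n x"
  by (simp add: enorm_eq_sqrt ip_simps real_sqrt_mult[symmetric] mult.assoc[symmetric] power2_eq_square[symmetric])
     (simp add: real_sqrt_mult)

lemma enorm_zero_iff: "enorm n x = 0 \<longleftrightarrow> (\<forall>i<n. x i = 0)"
  by (auto simp: enorm_def L2_set_eq_0_iff)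

lemma enorm_cong: "(\<And>i. i < n \<Longrightarrow> x i = y i) \<Longrightarrow> enorm n x = enorm n y"
  by (simp add: enorm_def L2_set_def)

lemma ip_cong: "(\<And>i. i < n \<Longrightarrow> x i = x' i) \<Longrightarrow> (\<And>i. i < n \<Longrightarrow> y i = y' i) \<Longrightarrow> ip n x y = ip n x' y'"
  by (simp add: ip_def)

lemma continuous_on_coord: "continuous_on S (\<lambda>x. x (i::'i) :: real)"
  by (rule continuous_on_subset[OF continuous_on_product_coordinates]) simp

lemma continuous_on_ip:
  assumes "continuous_on S f" "continuous_on S g"
  shows "continuous_on S (\<lambda>x. ip n (f x) (g x))"
  unfolding ip_def
  by (rule continuous_on_sum, rule continuous_on_mult; rule continuous_on_product_then_coordinatewise; rule assms)

lemma continuous_on_enorm: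
  assumes "continuous_on S f"
  shows "continuous_on S (\<lambda>x. enorm n (f x))"
  unfolding enorm_eq_sqrt by (rule continuous_on_real_sqrt, rule continuous_on_ip; rule assms)

lemma continuous_on_enorm_diff: "continuous_on S (\<lambda>y. enorm n (\<lambda>i. x i - y i))"
  unfolding enorm_eq_sqrt ip_def
  by (intro continuous_on_real_sqrt continuous_on_sum continuous_on_mult continuous_on_diff continuous_on_const continuous_on_coord)

lemma enorm_minus_commute: "enorm n (\<lambda>i. x i - y i) = enorm n (\<lambda>i. y i - x i)"
  by (simp add: enorm_def L2_set_def power2_commute)

section \<open>Closed and bounded subsets of Euclidean space inside the product topology\<close>

lemma Rn_eq: "Rn n = {x. \<forall>i\<ge>n. x i = 0}"
  by (rule topspace_Euclidean_space)

lemma closed_Rn: "closed (Rn n)"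
  using closedin_Euclidean_space[of n] by (simp add: euclidean_product_topology)

lemma closedin_Euclidean_iff: "closedin (Euclidean_space n) C \<longleftrightarrow> closed C \<and> C \<subseteq> Rn n"
  using closed_Rn[of n] unfolding Rn_eq Euclidean_space_def euclidean_product_topology
  by (subst closedin_closed_subtopology) auto

lemma compact_box:
  fixes a b :: "nat \<Rightarrow> real"
  shows "compact {x. \<forall>i. a i \<le> x i \<and> x i \<le> b i}"
proof -
  have "compactin (product_topology (\<lambda>i. euclideanreal) UNIV) (PiE UNIV (\<lambda>i. {a i..b i}))"
    by (subst compactin_PiE) auto
  moreover have "PiE UNIV (\<lambda>i. {a i..b i}) = {x. \<forall>i. a i \<le> x i \<and> x i \<le> b i}"
    by (auto simp: PiE_iff)
  ultimately show ?thesis by (simp add: euclidean_product_topology)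
qed

lemma abs_coord_le_enorm: "i < n \<Longrightarrow> \<bar>x i\<bar> \<le> enorm n x"
  using member_le_L2_set[of "{..<n}" i "\<lambda>i. \<bar>x i\<bar>"] by (simp add: enorm_def L2_set_def)

definition bounded_part :: "nat \<Rightarrow> (nat \<Rightarrow> real) set \<Rightarrow> real \<Rightarrow> (nat \<Rightarrow> real) set" where
  "bounded_part n C B = {x \<in> C. enorm n x \<le> B}"

text \<open>A closed subset of a box is compact by Tychonoff's theorem. The norm bound confines the
  coordinates below \<open>n\<close>, and membership in \<open>Rn n\<close> those from
  \<open>n\<close> on to zero.\<close>

lemma compact_bounded_part:
  assumes "closed C" "C \<subseteq> Rn n"
  shows "compact (bounded_part n C B)"
proof -
  define a where "a i = (if i < n then B else 0)" for i
  have "bounded_part n C B = {x. \<forall>i. - a i \<le> x i \<and> x i \<le> a i} \<inter> (C \<inter> {x. enorm n x \<le> B})"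
  proof -
    have "- a i \<le> x i \<and> x i \<le> a i" if "x \<in> C" "enorm n x \<le> B" for x i
    proof (cases "i < n")
      case True
      then show ?thesis using abs_coord_le_enorm[of i n x] that by (auto simp: a_def)
    next
      case False
      then show ?thesis using that assms by (auto simp: a_def Rn_eq)
    qed
    then show ?thesis unfolding bounded_part_def by blast
  qed
  moreover have "closed {x. enorm n x \<le> B}"
    by (rule closed_Collect_le) (simp_all add: continuous_on_enorm)
  ultimately show ?thesis
    using assms by (simp add: compact_Int_closed closed_Int compact_box)
qed

definition cvx :: "(nat \<Rightarrow> real) set \<Rightarrow> bool" where
  "cvx C \<longleftrightarrow> (\<forall>x\<in>C. \<forall>y\<in>C. \<forall>u. 0 \<le> u \<and> u \<le> 1 \<longrightarrow> (\<lambda>i. (1 - u) * x i + u * y i) \<in> C)"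

definition cc_set :: "nat \<Rightarrow> (nat \<Rightarrow> real) set \<Rightarrow> bool" where
  "cc_set n C \<longleftrightarrow> C \<noteq> {} \<and> closed C \<and> C \<subseteq> Rn n \<and> cvx C"

lemma argmin_exists:
  assumes "closed C" "C \<subseteq> Rn n" "C \<noteq> {}"
  shows "\<exists>p\<in>C. \<forall>y\<in>C. enorm n (\<lambda>i. x i - p i) \<le> enorm n (\<lambda>i. x i - y i)"
proof -
  obtain c where c: "c \<in> C" using assms by auto
  \<comment> \<open>Points at least as close to \<open>x\<close> as \<open>c\<close> have norm at
    most \<open>B\<close>, so the search takes place in a compact set.\<close>
  define B where "B = enorm n (\<lambda>i. x i - c i) + enorm n x"
  have *: "enorm n y \<le> B" if "enorm n (\<lambda>i. x i - y i) \<le> enorm n (\<lambda>i. x i - c i)" for y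
  proof -
    have "enorm n y = enorm n (\<lambda>i. x i + (-1) * (x i - y i))" by simp
    also have "\<dots> \<le> enorm n x + enorm n (\<lambda>i. (-1) * (x i - y i))" by (rule enorm_triangle)
    also have "\<dots> = enorm n x + enorm n (\<lambda>i. x i - y i)" unfolding enorm_scale by simp
    finally show ?thesis using that by (simp add: B_def)
  qed
  have "bounded_part n C B \<noteq> {}" using *[of c] c by (auto simp: bounded_part_def)
  moreover have "continuous_on (bounded_part n C B) (\<lambda>y. enorm n (\<lambda>i. x i - y i))"
    by (rule continuous_on_enorm_diff)
  ultimately have "\<exists>p\<in>bounded_part n C B. \<forall>y\<in>bounded_part n C B. enorm n (\<lambda>i. x i - p i) \<le> enorm n (\<lambda>i. x i - y i)"
    by (rule continuous_attains_inf[OF compact_bounded_part[OF assms(1,2)]])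
  then obtain p where p: "p \<in> bounded_part n C B"
    and min: "\<And>y. y \<in> bounded_part n C B \<Longrightarrow> enorm n (\<lambda>i. x i - p i) \<le> enorm n (\<lambda>i. x i - y i)"
    by blast
  have "enorm n (\<lambda>i. x i - p i) \<le> enorm n (\<lambda>i. x i - y i)" if "y \<in> C" for y
  proof (cases "enorm n (\<lambda>i. x i - y i) \<le> enorm n (\<lambda>i. x i - c i)")
    case True
    then show ?thesis using min[of y] *[of y] that by (auto simp: bounded_part_def)
  next
    case False
    then show ?thesis using min[of c] *[of c] c by (auto simp: bounded_part_def)
  qed
  then show ?thesis using p by (auto simp: bounded_part_def)
qed

section \<open>Variational inequality and Lipschitz continuity of the projection\<close>

lemma metric_proj_min:
  assumes "cc_set n C"
  shows "metric_proj n C x \<in> C"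
    and "y \<in> C \<Longrightarrow> enorm n (\<lambda>i. x i - metric_proj n C x i) \<le> enorm n (\<lambda>i. x i - y i)"
proof -
  obtain p where p: "p \<in> C" "\<forall>y\<in>C. enorm n (\<lambda>i. x i - p i) \<le> enorm n (\<lambda>i. x i - y i)"
    using argmin_exists[of C n x] assms by (auto simp: cc_set_def)
  have "is_arg_min (\<lambda>y. enorm n (\<lambda>i. x i - y i)) (\<lambda>y. y \<in> C) (metric_proj n C x)"
    unfolding metric_proj_def arg_min_on_def arg_min_def
    by (rule someI[of _ p]) (use p in \<open>auto simp: is_arg_min_def not_less\<close>)
  then show "metric_proj n C x \<in> C"
    and "y \<in> C \<Longrightarrow> enorm n (\<lambda>i. x i - metric_proj n C x i) \<le> enorm n (\<lambda>i. x i - y i)"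
    by (auto simp: is_arg_min_def not_less)
qed

lemma quadratic_nonneg_imp:
  fixes b c :: real
  assumes "\<And>u. 0 < u \<Longrightarrow> u \<le> 1 \<Longrightarrow> 0 \<le> u * u * c - 2 * u * b"
  shows "b \<le> 0"
proof (rule ccontr)
  assume "\<not> b \<le> 0"
  then have b: "b > 0" by simp
  \<comment> \<open>Small enough for the linear term to win:
    \<open>u * c \<le> u * (\<bar>c\<bar> + 1) \<le> b < 2 * b\<close>.\<close>
  define u where "u = min 1 (b / (\<bar>c\<bar> + 1))"
  have u: "0 < u" "u \<le> 1" using b by (auto simp: u_def)
  have "u * (\<bar>c\<bar> + 1) \<le> b"
  proof -
    have "u \<le> b / (\<bar>c\<bar> + 1)" by (simp add: u_def)
    then show ?thesis by (simp add: pos_le_divide_eq)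
  qed
  moreover have "u * c \<le> u * (\<bar>c\<bar> + 1)" using u by (intro mult_left_mono) auto
  ultimately have "u * c < 2 * b" using b by linarith
  then have "u * (u * c) < u * (2 * b)" using u by (intro mult_strict_left_mono)
  then show False using assms[OF u] by (simp add: algebra_simps)
qed

text \<open>Moving from \<open>p\<close> a fraction \<open>u\<close> towards \<open>y\<close> cannot
  decrease the distance to \<open>x\<close>; the behaviour as \<open>u\<close> tends to zero gives
  the inequality. It is stated for any minimizer over a convex set, rather than for
  \<open>metric_proj\<close>, because it is applied once more to the set of residuals in
  \<open>min_residual_le\<close>.\<close>

lemma projection_ip:
  assumes C: "cvx C" and p: "p \<in> C" and y: "y \<in> C"
    and min: "\<And>z. z \<in> C \<Longrightarrow> enorm n (\<lambda>i. x i - p i) \<le> enorm n (\<lambda>i. x i - z i)"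
  shows "ip n (\<lambda>i. x i - p i) (\<lambda>i. y i - p i) \<le> 0"
proof (rule quadratic_nonneg_imp)
  fix u :: real assume u: "0 < u" "u \<le> 1"
  have "(\<lambda>i. (1 - u) * p i + u * y i) \<in> C" using C p y u by (auto simp: cvx_def)
  from power_mono[OF min[OF this], of 2] show "0 \<le> u * u * ip n (\<lambda>i. y i - p i) (\<lambda>i. y i - p i) - 2 * u * ip n (\<lambda>i. x i - p i) (\<lambda>i. y i - p i)"
    by (simp add: enorm_sq ip_simps ip_commute algebra_simps)
qed

lemma metric_proj_ip:
  assumes "cc_set n C" "y \<in> C"
  shows "ip n (\<lambda>i. x i - metric_proj n C x i) (\<lambda>i. y i - metric_proj n C x i) \<le> 0"
proof (rule projection_ip)
  show "cvx C" "y \<in> C" using assms by (auto simp: cc_set_def)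
qed (use metric_proj_min[OF assms(1)] in auto)

text \<open>The variational inequalities of \<open>p\<close> and of the projection, each tested at
  the other point, add up to a nonpositive squared distance. Membership in \<open>Rn n\<close> then
  upgrades equality below \<open>n\<close> to equality of functions.\<close>

lemma metric_proj_unique:
  assumes C: "cc_set n C" and p: "p \<in> C"
    and var: "\<And>y. y \<in> C \<Longrightarrow> ip n (\<lambda>i. x i - p i) (\<lambda>i. y i - p i) \<le> 0"
  shows "metric_proj n C x = p"
proof -
  let ?q = "metric_proj n C x"
  have q: "?q \<in> C" by (rule metric_proj_min[OF C])
  have "ip n (\<lambda>i. ?q i - p i) (\<lambda>i. ?q i - p i) \<le> 0"
    using var[OF q] metric_proj_ip[OF C p, of x] by (simp add: ip_simps ip_commute)
  then have "enorm n (\<lambda>i. ?q i - p i) = 0"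
    using ip_self_nonneg[of n "\<lambda>i. ?q i - p i"] by (simp add: enorm_eq_sqrt)
  moreover have "?q \<in> Rn n" "p \<in> Rn n" using q p C by (auto simp: cc_set_def)
  ultimately show ?thesis by (auto simp: enorm_zero_iff Rn_eq fun_eq_iff) (metis not_less)
qed

lemma metric_proj_cong:
  assumes "\<And>i. i < n \<Longrightarrow> x i = y i"
  shows "metric_proj n C x = metric_proj n C y"
proof -
  have "enorm n (\<lambda>i. x i - z i) = enorm n (\<lambda>i. y i - z i)" for z
    by (rule enorm_cong) (simp add: assms)
  then show ?thesis by (simp add: metric_proj_def)
qed

text \<open>Adding the variational inequalities of both projections, each tested at the other,
  bounds their squared distance by its inner product with \<open>x - y\<close>; Cauchy-Schwarz
  finishes.\<close>

lemma metric_proj_nonexpansive: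
  assumes C: "cc_set n C"
  shows "enorm n (\<lambda>i. metric_proj n C x i - metric_proj n C y i) \<le> enorm n (\<lambda>i. x i - y i)"
proof -
  let ?p = "metric_proj n C x" and ?q = "metric_proj n C y"
  let ?d = "\<lambda>i. ?p i - ?q i"
  have "ip n ?d ?d \<le> ip n (\<lambda>i. x i - y i) ?d"
    using metric_proj_ip[OF C metric_proj_min(1)[OF C], of x y] metric_proj_ip[OF C metric_proj_min(1)[OF C], of y x]
    by (simp add: ip_simps ip_commute)
  also have "\<dots> \<le> enorm n (\<lambda>i. x i - y i) * enorm n ?d" by (rule ip_le_enorm)
  finally have "enorm n ?d * enorm n ?d \<le> enorm n (\<lambda>i. x i - y i) * enorm n ?d"
    by (simp add: enorm_sq[symmetric] power2_eq_square)
  then show ?thesis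
    by (cases "enorm n ?d = 0") (auto simp: mult_le_cancel_right order_less_le)
qed

lemma metric_proj_shift:
  assumes C: "cc_set n (shift_set K \<mu>)" and \<mu>: "\<mu> \<in> Rn n"
    and K: "cc_set n K"
  shows "metric_proj n K (\<lambda>i. \<mu> i + x i) i - \<mu> i = metric_proj n (shift_set K \<mu>) x i"
proof -
  let ?p = "metric_proj n K (\<lambda>i. \<mu> i + x i)"
  have "metric_proj n (shift_set K \<mu>) x = (\<lambda>i. ?p i - \<mu> i)"
  proof (rule metric_proj_unique[OF C])
    show "(\<lambda>i. ?p i - \<mu> i) \<in> shift_set K \<mu>"
      using metric_proj_min(1)[OF K] by (auto simp: shift_set_def)
    fix y assume "y \<in> shift_set K \<mu>"
    then obtain v where v: "v \<in> K" "y = (\<lambda>i. v i - \<mu> i)" by (auto simp: shift_set_def)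
    have "(\<lambda>i. x i - (?p i - \<mu> i)) = (\<lambda>i. (\<mu> i + x i) - ?p i)" "(\<lambda>i. v i - \<mu> i - (?p i - \<mu> i)) = (\<lambda>i. v i - ?p i)"
      by auto
    then show "ip n (\<lambda>i. x i - (?p i - \<mu> i)) (\<lambda>i. y i - (?p i - \<mu> i)) \<le> 0"
      using metric_proj_ip[OF K v(1), of "\<lambda>i. \<mu> i + x i"] unfolding v(2) by metis
  qed
  then show ?thesis by simp
qed

lemma cc_set_shift:
  assumes K: "cc_set n K" and \<mu>: "\<mu> \<in> Rn n"
  shows "cc_set n (shift_set K \<mu>)"
proof -
  have "shift_set K \<mu> = {x. (\<lambda>i. x i + \<mu> i) \<in> K}"
  proof (intro equalityI subsetI)
    fix x assume "x \<in> {x. (\<lambda>i. x i + \<mu> i) \<in> K}"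
    then have "(\<lambda>i. x i + \<mu> i) \<in> K" by simp
    then have "(\<lambda>i. (x i + \<mu> i) - \<mu> i) \<in> shift_set K \<mu>" unfolding shift_set_def by (rule imageI)
    then show "x \<in> shift_set K \<mu>" by simp
  qed (auto simp: shift_set_def)
  moreover have "closed ((\<lambda>x. (\<lambda>i. x i + \<mu> i)) -` K)"
    by (rule closed_vimage) (use K in \<open>auto simp: cc_set_def intro!: continuous_on_coordinatewise_then_product continuous_on_add continuous_on_coord\<close>)
  ultimately have "closed (shift_set K \<mu>)" by (simp add: vimage_def)
  moreover have "cvx (shift_set K \<mu>)"
    unfolding cvx_def
  proof (intro ballI allI impI)
    fix x y u assume xy: "x \<in> shift_set K \<mu>" "y \<in> shift_set K \<mu>" and u: "0 \<le> u \<and> u \<le> (1::real)"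
    then obtain a b where ab: "a \<in> K" "b \<in> K" "x = (\<lambda>i. a i - \<mu> i)" "y = (\<lambda>i. b i - \<mu> i)"
      by (auto simp: shift_set_def)
    have "(\<lambda>i. (1 - u) * a i + u * b i) \<in> K" using K ab u by (auto simp: cc_set_def cvx_def)
    moreover have "(\<lambda>i. (1 - u) * x i + u * y i) = (\<lambda>i. ((1 - u) * a i + u * b i) - \<mu> i)"
      by (auto simp: ab algebra_simps)
    ultimately show "(\<lambda>i. (1 - u) * x i + u * y i) \<in> shift_set K \<mu>"
      by (auto simp: shift_set_def)
  qed
  ultimately show ?thesis
    using K \<mu> unfolding cc_set_def by (auto simp: shift_set_def Rn_eq subset_iff)
qed

section \<open>The regularized maximum and its maximizer\<close>

definition pj :: "nat \<Rightarrow> (nat \<Rightarrow> real) set \<Rightarrow> real \<Rightarrow> (nat \<Rightarrow> real) \<Rightarrow> nat \<Rightarrow> real" where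
  "pj n C w h = metric_proj n C (\<lambda>i. w * h i)"

text \<open>The maximum over \<open>v\<close> in \<open>C\<close> of
  \<open>ip n h v - ip n v v / (2 * w)\<close>, written with its maximizer: completing the square
  turns the objective into a constant minus the squared distance of \<open>v\<close> from
  \<open>w h\<close>, divided by \<open>2 * w\<close>. Up to a quadratic in \<open>h\<close> this is
  a Moreau envelope.\<close>

definition Jf :: "nat \<Rightarrow> (nat \<Rightarrow> real) set \<Rightarrow> real \<Rightarrow> (nat \<Rightarrow> real) \<Rightarrow> real" where
  "Jf n C w h = ip n h (pj n C w h) - ip n (pj n C w h) (pj n C w h) / (2 * w)"

definition cc_set0 :: "nat \<Rightarrow> (nat \<Rightarrow> real) set \<Rightarrow> bool" where
  "cc_set0 n C \<longleftrightarrow> cc_set n C \<and> (\<lambda>i. 0) \<in> C"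

lemma cc_set0D: "cc_set0 n C \<Longrightarrow> cc_set n C" "cc_set0 n C \<Longrightarrow> (\<lambda>i. 0) \<in> C"
  by (simp_all add: cc_set0_def)

lemma pj_mem: "cc_set n C \<Longrightarrow> pj n C w h \<in> C"
  by (simp add: pj_def metric_proj_min)

lemma pj_linear_bound:
  assumes "cc_set n C" "v \<in> C"
  shows "w * ip n h v \<le> w * ip n h (pj n C w h) + ip n (pj n C w h) v - ip n (pj n C w h) (pj n C w h)"
  using metric_proj_ip[OF assms, of "\<lambda>i. w * h i"]
  by (simp add: pj_def[symmetric] ip_simps algebra_simps)

text \<open>The objective is strongly concave with modulus \<open>1 / w\<close>. The deficit in the
  distance to the maximizer later supplies the term \<open>(a - a0)\<^sup>2\<close> of the scalar
  problem.\<close>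

lemma Jf_strong:
  assumes C: "cc_set n C" and v: "v \<in> C" and w: "w > 0"
  shows "ip n h v - ip n v v / (2 * w)
    \<le> Jf n C w h - ip n (\<lambda>i. v i - pj n C w h i) (\<lambda>i. v i - pj n C w h i) / (2 * w)"
proof -
  let ?p = "pj n C w h"
  have "2 * (w * ip n h v) - ip n v v \<le> 2 * (w * ip n h ?p) - ip n ?p ?p - ip n (\<lambda>i. v i - ?p i) (\<lambda>i. v i - ?p i)"
    using pj_linear_bound[OF C v, of w h] by (simp add: ip_simps ip_commute algebra_simps)
  then have "(2 * (w * ip n h v) - ip n v v) / (2 * w)
    \<le> (2 * (w * ip n h ?p) - ip n ?p ?p - ip n (\<lambda>i. v i - ?p i) (\<lambda>i. v i - ?p i)) / (2 * w)"
    using w by (intro divide_right_mono) auto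
  then show ?thesis using w by (simp add: Jf_def diff_divide_distrib)
qed

lemma Jf_upper:
  assumes C: "cc_set n C" and v: "v \<in> C" and w: "w > 0"
  shows "ip n h v - ip n v v / (2 * w) \<le> Jf n C w h"
proof -
  have "0 \<le> ip n (\<lambda>i. v i - pj n C w h i) (\<lambda>i. v i - pj n C w h i) / (2 * w)"
    using w ip_self_nonneg by (intro divide_nonneg_pos) auto
  then show ?thesis using Jf_strong[OF assms, of h] by linarith
qed

lemma pj_nonexpansive:
  assumes C: "cc_set n C" and w: "w > 0"
  shows "enorm n (\<lambda>i. pj n C w h i - pj n C w g i) \<le> w * enorm n (\<lambda>i. h i - g i)"
proof -
  have "enorm n (\<lambda>i. pj n C w h i - pj n C w g i) \<le> enorm n (\<lambda>i. w * h i - w * g i)"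
    unfolding pj_def by (rule metric_proj_nonexpansive[OF C])
  also have "\<dots> = enorm n (\<lambda>i. w * (h i - g i))" by (simp add: algebra_simps)
  also have "\<dots> = w * enorm n (\<lambda>i. h i - g i)" using w by (simp add: enorm_scale)
  finally show ?thesis .
qed

text \<open>\<open>pj\<close> is the gradient of \<open>Jf\<close> in \<open>h\<close>. Using each
  maximizer as a competitor in the other problem traps the increment between
  \<open>ip n y ?p\<close> and \<open>ip n y ?q\<close>, and these are close because the projection
  is Lipschitz.\<close>

lemma Jf_first_order:
  assumes C: "cc_set n C" and w: "w > 0"
  shows "\<bar>Jf n C w (\<lambda>i. h i + y i) - Jf n C w h - ip n (pj n C w h) y\<bar> \<le> w * (enorm n y)\<^sup>2"
proof -
  let ?p = "pj n C w h" and ?q = "pj n C w (\<lambda>i. h i + y i)"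
  have 1: "Jf n C w h + ip n y ?p \<le> Jf n C w (\<lambda>i. h i + y i)"
    using Jf_upper[OF C pj_mem[OF C, of w h] w, of "\<lambda>i. h i + y i"] by (simp add: Jf_def[of n C w h] ip_simps)
  have 2: "Jf n C w (\<lambda>i. h i + y i) - ip n y ?q \<le> Jf n C w h"
    using Jf_upper[OF C pj_mem[OF C, of w "\<lambda>i. h i + y i"] w, of h] by (simp add: Jf_def[of n C w "\<lambda>i. h i + y i"] ip_simps)
  have "ip n y (\<lambda>i. ?q i - ?p i) \<le> enorm n y * enorm n (\<lambda>i. ?q i - ?p i)" by (rule ip_le_enorm)
  also have "\<dots> \<le> enorm n y * (w * enorm n y)"
    using pj_nonexpansive[OF C w, of "\<lambda>i. h i + y i" h] by (intro mult_left_mono) auto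
  finally have "ip n y ?q \<le> ip n y ?p + w * (enorm n y)\<^sup>2"
    by (simp add: ip_simps power2_eq_square algebra_simps)
  then show ?thesis using 1 2 by (simp add: ip_commute)
qed

lemma pj_zero: "cc_set0 n C \<Longrightarrow> pj n C w (\<lambda>i. 0) = (\<lambda>i. 0)"
  unfolding pj_def by (rule metric_proj_unique) (auto simp: cc_set0_def)

lemma pj_le_enorm:
  assumes "cc_set0 n C" and w: "w > 0"
  shows "enorm n (pj n C w h) \<le> w * enorm n h"
  using pj_nonexpansive[of n C w h "\<lambda>i. 0"] assms by (simp add: pj_zero cc_set0_def)

text \<open>Linearizes the largest value of \<open>ip n h v\<close> as a function of the norm of
  \<open>v\<close>: at the norm of the projection the slope is this norm over \<open>w\<close>.
  Applied at two scales, each to the projection of the other, it yields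
  \<open>pj_mono\<close>.\<close>

lemma pj_bound2:
  assumes C: "cc_set n C" and v: "v \<in> C" and w: "w > 0"
  shows "ip n h v \<le> ip n h (pj n C w h) + (enorm n (pj n C w h) / w) * (enorm n v - enorm n (pj n C w h))"
proof -
  let ?p = "pj n C w h"
  have "w * ip n h v \<le> w * ip n h ?p + enorm n ?p * enorm n v - enorm n ?p * enorm n ?p"
    using pj_linear_bound[OF C v, of w h] ip_le_enorm[of n ?p v]
    by (simp add: enorm_sq[symmetric] power2_eq_square)
  also have "\<dots> = w * (ip n h ?p + (enorm n ?p / w) * (enorm n v - enorm n ?p))"
    using w by (simp add: field_simps)
  finally show ?thesis using w by (simp add: mult_le_cancel_left_pos)
qed

text \<open>The two linear bounds add up to \<open>0 \<le> (?a / w - ?b / w') * (?b - ?a)\<close>,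
  and \<open>w \<le> w'\<close> leaves a single sign pattern.\<close>

lemma pj_mono:
  assumes C: "cc_set n C" and w: "0 < w" "w \<le> w'"
  shows "enorm n (pj n C w h) \<le> enorm n (pj n C w' h)"
    and "enorm n (pj n C w' h) / w' \<le> enorm n (pj n C w h) / w"
proof -
  let ?a = "enorm n (pj n C w h)" and ?b = "enorm n (pj n C w' h)"
  have w': "w' > 0" using w by simp
  have *: "0 \<le> (?a / w - ?b / w') * (?b - ?a)"
    using pj_bound2[OF C pj_mem[OF C, of w' h] w(1), of h] pj_bound2[OF C pj_mem[OF C, of w h] w', of h]
    by (simp add: algebra_simps)
  have "?a \<le> ?b"
  proof (rule ccontr)
    assume "\<not> ?a \<le> ?b"
    then have ab: "?b < ?a" by simp
    have "?b / w' \<le> ?b / w" using w by (intro divide_left_mono) auto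
    also have "\<dots> < ?a / w" using ab w by (intro divide_strict_right_mono)
    finally have "0 < ?a / w - ?b / w'" by simp
    then have "(?a / w - ?b / w') * (?b - ?a) < 0" using ab by (intro mult_pos_neg) auto
    then show False using * by simp
  qed
  then show "?a \<le> ?b" .
  show "?b / w' \<le> ?a / w"
  proof (cases "?a = ?b")
    case True
    then show ?thesis using w by (simp, intro divide_left_mono) auto
  next
    case False
    then have "0 < ?b - ?a" using \<open>?a \<le> ?b\<close> by simp
    then have "0 \<le> ?a / w - ?b / w'" using * by (simp add: zero_le_mult_iff)
    then show ?thesis by simp
  qed
qed

text \<open>As a maximum of affine functions of \<open>- 1 / (2 * w)\<close>, \<open>Jf\<close> is
  convex in this parameter, with derivative the squared norm of the projection. A difference
  quotient between two scales brackets this norm, which is how concentration passes from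
  \<open>Jf\<close> to it.\<close>

lemma Jf_sandwich:
  assumes C: "cc_set n C" and w: "0 < w" "w \<le> w'"
  shows "(enorm n (pj n C w h))\<^sup>2 * (1 / (2 * w) - 1 / (2 * w')) \<le> Jf n C w' h - Jf n C w h"
    and "Jf n C w' h - Jf n C w h \<le> (enorm n (pj n C w' h))\<^sup>2 * (1 / (2 * w) - 1 / (2 * w'))"
proof -
  have w': "w' > 0" using w by simp
  show "(enorm n (pj n C w h))\<^sup>2 * (1 / (2 * w) - 1 / (2 * w')) \<le> Jf n C w' h - Jf n C w h"
    using Jf_upper[OF C pj_mem[OF C, of w h] w', of h]
    by (simp add: Jf_def[of n C w h] enorm_sq algebra_simps)
  show "Jf n C w' h - Jf n C w h \<le> (enorm n (pj n C w' h))\<^sup>2 * (1 / (2 * w) - 1 / (2 * w'))"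
    using Jf_upper[OF C pj_mem[OF C, of w' h] w(1), of h]
    by (simp add: Jf_def[of n C w' h] enorm_sq algebra_simps)
qed

lemma pj_sq_le_ip:
  assumes C: "cc_set0 n C"
  shows "ip n (pj n C w h) (pj n C w h) \<le> w * ip n h (pj n C w h)"
  using pj_linear_bound[OF cc_set0D(1)[OF C] cc_set0D(2)[OF C], of w h] by simp

section \<open>Projections onto cones\<close>

definition coneset :: "(nat \<Rightarrow> real) set \<Rightarrow> bool" where
  "coneset T \<longleftrightarrow> (\<forall>x\<in>T. \<forall>\<alpha>\<ge>0. (\<lambda>i. \<alpha> * x i) \<in> T)"

text \<open>A convex cone is closed under addition, so the variational inequality may be tested at
  \<open>?p + v\<close>; this gives \<open>ip n x v \<le> ip n ?p v\<close>.\<close>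

lemma cone_proj_ip:
  assumes T: "cc_set n T" "coneset T" and v: "v \<in> T"
  shows "ip n x v \<le> enorm n (metric_proj n T x) * enorm n v"
proof -
  let ?p = "metric_proj n T x"
  have p: "?p \<in> T" by (rule metric_proj_min[OF T(1)])
  have "(\<lambda>i. (1 - 1/2) * ?p i + (1/2) * v i) \<in> T"
    using T(1) p v unfolding cc_set_def cvx_def 
    by (elim conjE) (drule bspec, assumption, drule bspec, assumption, drule spec[of _ "1/2"], simp)
  then have "(\<lambda>i. (1/2) * ?p i + (1/2) * v i) \<in> T" by simp
  then have "(\<lambda>i. 2 * ((1/2) * ?p i + (1/2) * v i)) \<in> T" using T(2) unfolding coneset_def by (metis zero_le_numeral)
  then have "(\<lambda>i. ?p i + v i) \<in> T" by (simp add: algebra_simps)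
  from metric_proj_ip[OF T(1) this, of x] have "ip n x v \<le> ip n ?p v"
    by (simp add: ip_simps)
  also have "\<dots> \<le> enorm n ?p * enorm n v" by (rule ip_le_enorm)
  finally show ?thesis .
qed

lemma cone_proj_scale:
  assumes T: "cc_set n T" "coneset T" and w: "w > 0"
  shows "pj n T w h = (\<lambda>i. w * metric_proj n T h i)"
  unfolding pj_def
proof (rule metric_proj_unique[OF T(1)])
  let ?p = "metric_proj n T h"
  have p: "?p \<in> T" by (rule metric_proj_min[OF T(1)])
  show "(\<lambda>i. w * ?p i) \<in> T" using T(2) p w by (auto simp: coneset_def)
  fix y assume "y \<in> T"
  then have "(\<lambda>i. (1/w) * y i) \<in> T" using T(2) w unfolding coneset_def by (metis divide_nonneg_pos zero_le_one)
  from metric_proj_ip[OF T(1) this, of h]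
  have "w * w * ip n (\<lambda>i. h i - ?p i) (\<lambda>i. (1/w) * y i - ?p i) \<le> 0"
    using w by (intro mult_nonneg_nonpos) auto
  also have "w * w * ip n (\<lambda>i. h i - ?p i) (\<lambda>i. (1/w) * y i - ?p i) = ip n (\<lambda>i. w * h i - w * ?p i) (\<lambda>i. y i - w * ?p i)"
    unfolding ip_simps using w by (simp add: field_simps)
  finally show "ip n (\<lambda>i. w * h i - w * ?p i) (\<lambda>i. y i - w * ?p i) \<le> 0" .
qed

text \<open>Testing with the origin bounds the squared norm by \<open>w * ip n h ?p\<close>, and the
  cone inequality bounds that by a product of norms, one of which cancels.\<close>

lemma pj_le_cone:
  assumes C: "cc_set0 n C" and T: "cc_set n T" "coneset T" "C \<subseteq> T" and w: "w > 0"
  shows "enorm n (pj n C w h) \<le> w * enorm n (metric_proj n T h)"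
proof -
  let ?p = "pj n C w h"
  have "?p \<in> T" using pj_mem[OF cc_set0D(1)[OF C]] T(3) by auto
  then have "ip n h ?p \<le> enorm n (metric_proj n T h) * enorm n ?p" by (rule cone_proj_ip[OF T(1,2)])
  then have "enorm n ?p * enorm n ?p \<le> (w * enorm n (metric_proj n T h)) * enorm n ?p"
    using pj_sq_le_ip[OF C, of w h] w
    by (simp add: enorm_sq[symmetric] power2_eq_square mult.assoc)
       (meson mult_left_mono order_trans less_imp_le)
  then show ?thesis
    using w by (cases "enorm n ?p = 0") (auto simp: mult_le_cancel_right order_less_le)
qed

lemma Jf_le_cone:
  assumes C: "cc_set0 n C" and T: "cc_set n T" "coneset T" "C \<subseteq> T" and w: "w > 0"
  shows "Jf n C w h \<le> w * (enorm n (metric_proj n T h))\<^sup>2 / 2"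
proof -
  let ?p = "pj n C w h"
  define a b where "a = enorm n (metric_proj n T h)" and "b = enorm n ?p"
  have "?p \<in> T" using pj_mem[OF cc_set0D(1)[OF C]] T(3) by auto
  then have "ip n h ?p \<le> a * b" unfolding a_def b_def by (rule cone_proj_ip[OF T(1,2)])
  then have "Jf n C w h \<le> a * b - b\<^sup>2 / (2 * w)" by (simp add: Jf_def enorm_sq[symmetric] b_def)
  also have "\<dots> \<le> w * a\<^sup>2 / 2"
  proof -
    have "0 \<le> (w * a - b)\<^sup>2" by simp
    then have "2 * w * a * b - b\<^sup>2 \<le> w\<^sup>2 * a\<^sup>2" by (simp add: power2_eq_square algebra_simps)
    then have "(2 * w * a * b - b\<^sup>2) / (2 * w) \<le> (w\<^sup>2 * a\<^sup>2) / (2 * w)" using w by (intro divide_right_mono) auto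
    then show ?thesis using w by (simp add: diff_divide_distrib power2_eq_square)
  qed
  finally show ?thesis by (simp add: a_def)
qed

lemma pj_Lipschitz_scale:
  assumes C: "cc_set n C"
  shows "enorm n (\<lambda>i. pj n C w h i - pj n C w' h i) \<le> \<bar>w - w'\<bar> * enorm n h"
  using metric_proj_nonexpansive[OF C, of "\<lambda>i. w * h i" "\<lambda>i. w' * h i"] enorm_scale[of n "w - w'" h]
  by (simp add: pj_def left_diff_distrib)

lemma continuous_metric_proj:
  assumes C: "cc_set n C"
  shows "continuous_on UNIV (metric_proj n C)"
proof (rule continuous_on_coordinatewise_then_product)
  fix i
  show "continuous_on UNIV (\<lambda>x. metric_proj n C x i)"
  proof (cases "i < n")
    case False
    then have "metric_proj n C x i = 0" for x
      using metric_proj_min(1)[OF C, of x] C by (auto simp: cc_set_def Rn_eq)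
    then show ?thesis by simp
  next
    case True
    show ?thesis unfolding continuous_on_eq_continuous_at[OF open_UNIV] isCont_def
    proof
      fix x :: "nat \<Rightarrow> real"
      have "continuous_on UNIV (\<lambda>y. enorm n (\<lambda>i. y i - x i))"
        by (subst enorm_minus_commute) (rule continuous_on_enorm_diff)
      then have "((\<lambda>y. enorm n (\<lambda>i. y i - x i)) \<longlongrightarrow> enorm n (\<lambda>i. x i - x i)) (at x)"
        unfolding continuous_on_eq_continuous_at[OF open_UNIV] isCont_def by (rule bspec) simp
      then have lim: "((\<lambda>y. enorm n (\<lambda>i. y i - x i)) \<longlongrightarrow> 0) (at x)" by (simp add: enorm_def L2_set_def)
      show "((\<lambda>y. metric_proj n C y i) \<longlongrightarrow> metric_proj n C x i) (at x)"
      proof (rule LIM_zero_cancel, rule Lim_null_comparison[OF always_eventually lim], rule allI)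
        fix y :: "nat \<Rightarrow> real"
        show "norm (metric_proj n C y i - metric_proj n C x i) \<le> enorm n (\<lambda>i. y i - x i)"
          using abs_coord_le_enorm[OF True, of "\<lambda>i. metric_proj n C y i - metric_proj n C x i"]
            metric_proj_nonexpansive[OF C, of y x] by simp
      qed
    qed
  qed
qed

lemma continuous_pj: "cc_set n C \<Longrightarrow> continuous_on UNIV (pj n C w)"
  unfolding pj_def[abs_def]
proof (rule continuous_on_compose2[OF continuous_metric_proj])
  show "continuous_on UNIV (\<lambda>(h::nat \<Rightarrow> real) i. w * h i)"
    by (rule continuous_on_coordinatewise_then_product) (rule continuous_on_mult_left[OF continuous_on_coord])
qed auto

lemma continuous_Jf: "cc_set n C \<Longrightarrow> continuous_on UNIV (Jf n C w)"
  unfolding Jf_def[abs_def] divide_inverse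
  by (intro continuous_on_diff continuous_on_mult continuous_on_const; rule continuous_on_ip)
     (auto intro: continuous_pj continuous_on_id)

section \<open>Gordon's comparison inequality\<close>

text \<open>The coefficients \<open>g\<close> and \<open>H\<close> are carried along explicitly,
  together with a global cubic remainder, instead of being defined as derivatives. Products then
  reduce to algebra, and the signs of the entries can be followed through the construction.\<close>

definition taylor :: "'a set \<Rightarrow> (('a \<Rightarrow> real) \<Rightarrow> real) \<Rightarrow> (('a \<Rightarrow> real) \<Rightarrow> 'a \<Rightarrow> real) \<Rightarrow> (('a \<Rightarrow> real) \<Rightarrow> 'a \<Rightarrow> 'a \<Rightarrow> real) \<Rightarrow> bool" where
  "taylor D F g H \<longleftrightarrow> (\<exists>B\<ge>0. \<forall>w. \<bar>F w\<bar> \<le> B \<and> (\<forall>a\<in>D. \<bar>g w a\<bar> \<le> B) \<and> (\<forall>a\<in>D. \<forall>b\<in>D. \<bar>H w a b\<bar> \<le> B) \<and>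
     (\<forall>x. \<bar>F (\<lambda>a. w a + x a) - (F w + (\<Sum>a\<in>D. g w a * x a) + (\<Sum>a\<in>D. \<Sum>b\<in>D. H w a b * x a * x b) / 2)\<bar>
       \<le> B * (\<Sum>a\<in>D. \<bar>x a\<bar>) ^ 3))"

lemma seven_term_bound:
  fixes K :: real
  assumes "\<bar>a\<bar> \<le> K" "\<bar>b\<bar> \<le> K" "\<bar>c\<bar> \<le> K" "\<bar>d\<bar> \<le> K" "\<bar>e\<bar> \<le> K" "\<bar>f\<bar> \<le> K" "\<bar>g\<bar> \<le> K"
  shows "\<bar>a - (b + (c + d) + (e + f + 2 * g) / 2)\<bar> \<le> 8 * K"
proof -
  have "(e + f + 2 * g) / 2 = e / 2 + f / 2 + g" by (simp add: field_simps)
  moreover have "\<bar>c + d\<bar> \<le> 2 * K" "\<bar>e / 2 + f / 2\<bar> \<le> K" "\<bar>a - b\<bar> \<le> 2 * K" using assms by linarith+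
  ultimately show ?thesis using assms(7) by linarith
qed

lemma taylor_mult_bound:
  fixes S B :: real
  assumes S: "S \<ge> 0" and B: "B \<ge> 0"
    and f: "\<bar>f1\<bar> \<le> B" "\<bar>f2\<bar> \<le> B" "\<bar>F1\<bar> \<le> B" "\<bar>F2\<bar> \<le> B"
    and l: "\<bar>l1\<bar> \<le> B * S" "\<bar>l2\<bar> \<le> B * S" and h: "\<bar>h1\<bar> \<le> B * S ^ 2" "\<bar>h2\<bar> \<le> B * S ^ 2"
    and R: "\<bar>F1 - (f1 + l1 + h1 / 2)\<bar> \<le> B * S ^ 3" "\<bar>F2 - (f2 + l2 + h2 / 2)\<bar> \<le> B * S ^ 3"
  shows "\<bar>F1 * F2 - (f1 * f2 + (f1 * l2 + f2 * l1) + (f1 * h2 + f2 * h1 + 2 * l1 * l2) / 2)\<bar> \<le> 8 * B\<^sup>2 * S ^ 3"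
proof -
  have m: "\<bar>u * v\<bar> \<le> (B * s) * (B * t)" if "\<bar>u\<bar> \<le> B * s" "\<bar>v\<bar> \<le> B * t" for u v s t
    unfolding abs_mult using that by (intro mult_mono) (auto intro: order_trans[OF abs_ge_zero])
  show ?thesis
  \<comment> \<open>For small \<open>S\<close> the surplus terms in the product of the expansions
    have order at least three; for large \<open>S\<close> the cubic bound dominates every term
    separately.\<close>
  proof (cases "S \<le> 1")
    case True
    have p: "S ^ 4 \<le> S ^ 3" "S ^ 5 \<le> S ^ 3"
      using S True by (auto intro!: power_decreasing)
    define A2 where "A2 = f2 + l2 + h2 / 2"
    have 1: "F1 * F2 - (f1 * f2 + (f1 * l2 + f2 * l1) + (f1 * h2 + f2 * h1 + 2 * l1 * l2) / 2)
      = F1 * (F2 - A2) + (F1 - (f1 + l1 + h1 / 2)) * A2 + (l1 * h2 / 2 + h1 * l2 / 2 + h1 * h2 / 4)"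
      by (simp add: A2_def field_simps)
    have S2: "S ^ 2 \<le> 1" using S True by (simp add: power_le_one)
    have A2: "\<bar>A2\<bar> \<le> B * 3"
      using f(2) l(2) h(2) mult_left_mono[OF True B] mult_left_mono[OF S2 B] unfolding A2_def by linarith
    have "\<bar>F1 * (F2 - A2)\<bar> \<le> (B * 1) * (B * S ^ 3)" using f R by (intro m) (auto simp: A2_def)
    moreover have "\<bar>(F1 - (f1 + l1 + h1 / 2)) * A2\<bar> \<le> (B * S ^ 3) * (B * 3)" using R A2 by (intro m) auto
    moreover have "\<bar>l1 * h2\<bar> \<le> (B * S) * (B * S ^ 2)" using l h by (intro m) auto
    moreover have "\<bar>h1 * l2\<bar> \<le> (B * S ^ 2) * (B * S)" using l h by (intro m) auto
    moreover have "\<bar>h1 * h2\<bar> \<le> (B * S ^ 2) * (B * S ^ 2)" using l h by (intro m) auto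
    moreover have "B * B * S ^ 4 \<le> B * B * S ^ 3" using p B by (intro mult_left_mono) auto
    ultimately show ?thesis unfolding 1
      by (simp add: power2_eq_square power3_eq_cube power4_eq_xxxx mult_ac)
  next
    case False
    then have S1: "1 \<le> S" by simp
    have p: "1 \<le> S ^ 3" "S \<le> S ^ 3" "S ^ 2 \<le> S ^ 3"
      using S1 by (auto intro!: power_increasing[of 1 3 S, simplified] power_increasing one_le_power)
    define K where "K = B * B * S ^ 3"
    have K: "B * B * 1 \<le> K" "B * B * S \<le> K" "B * B * S ^ 2 \<le> K"
      unfolding K_def using p B by (auto simp del: mult_1_right intro!: mult_left_mono)
    have f': "\<bar>f1\<bar> \<le> B * 1" "\<bar>f2\<bar> \<le> B * 1" "\<bar>F1\<bar> \<le> B * 1" "\<bar>F2\<bar> \<le> B * 1" using f by auto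
    have e: "B * 1 * (B * 1) = B * B * 1" "B * 1 * (B * S) = B * B * S" "B * 1 * (B * S ^ 2) = B * B * S ^ 2"
      "B * S * (B * S) = B * B * S ^ 2"
      by (simp_all only: power2_eq_square mult_1_right mult.assoc mult.commute mult.left_commute)
    have "\<bar>F1 * F2\<bar> \<le> K" "\<bar>f1 * f2\<bar> \<le> K" "\<bar>f1 * l2\<bar> \<le> K" "\<bar>f2 * l1\<bar> \<le> K"
      "\<bar>f1 * h2\<bar> \<le> K" "\<bar>f2 * h1\<bar> \<le> K" "\<bar>l1 * l2\<bar> \<le> K"
      using m[OF f'(3,4)] m[OF f'(1,2)] m[OF f'(1) l(2)] m[OF f'(2) l(1)] m[OF f'(1) h(2)] m[OF f'(2) h(1)] m[OF l] K
      unfolding e by (blast intro: order_trans)+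
    note this
    from seven_term_bound[OF this] have "\<bar>F1 * F2 - (f1 * f2 + (f1 * l2 + f2 * l1) + (f1 * h2 + f2 * h1 + 2 * (l1 * l2)) / 2)\<bar> \<le> 8 * K" .
    then show ?thesis by (simp add: K_def power2_eq_square mult.assoc)
  qed
qed

lemma taylor_mult:
  assumes D: "finite D" and 1: "taylor D F1 g1 H1" and 2: "taylor D F2 g2 H2"
  shows "taylor D (\<lambda>w. F1 w * F2 w) (\<lambda>w a. F1 w * g2 w a + F2 w * g1 w a)
    (\<lambda>w a b. F1 w * H2 w a b + F2 w * H1 w a b + g1 w a * g2 w b + g2 w a * g1 w b)"
proof -
  obtain B1 where B1: "B1 \<ge> 0" "\<And>w. \<bar>F1 w\<bar> \<le> B1" "\<And>w a. a \<in> D \<Longrightarrow> \<bar>g1 w a\<bar> \<le> B1"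
    "\<And>w a b. a \<in> D \<Longrightarrow> b \<in> D \<Longrightarrow> \<bar>H1 w a b\<bar> \<le> B1"
    "\<And>w x. \<bar>F1 (\<lambda>a. w a + x a) - (F1 w + (\<Sum>a\<in>D. g1 w a * x a) + (\<Sum>a\<in>D. \<Sum>b\<in>D. H1 w a b * x a * x b) / 2)\<bar>
       \<le> B1 * (\<Sum>a\<in>D. \<bar>x a\<bar>) ^ 3"
    using 1 unfolding taylor_def by blast
  obtain B2 where B2: "B2 \<ge> 0" "\<And>w. \<bar>F2 w\<bar> \<le> B2" "\<And>w a. a \<in> D \<Longrightarrow> \<bar>g2 w a\<bar> \<le> B2"
    "\<And>w a b. a \<in> D \<Longrightarrow> b \<in> D \<Longrightarrow> \<bar>H2 w a b\<bar> \<le> B2"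
    "\<And>w x. \<bar>F2 (\<lambda>a. w a + x a) - (F2 w + (\<Sum>a\<in>D. g2 w a * x a) + (\<Sum>a\<in>D. \<Sum>b\<in>D. H2 w a b * x a * x b) / 2)\<bar>
       \<le> B2 * (\<Sum>a\<in>D. \<bar>x a\<bar>) ^ 3"
    using 2 unfolding taylor_def by blast
  define B where "B = max B1 B2"
  have B: "B \<ge> 0" "B1 \<le> B" "B2 \<le> B" using B1 by (auto simp: B_def)
  have b1: "\<bar>F1 w\<bar> \<le> B" "\<bar>F2 w\<bar> \<le> B" for w using B1(2) B2(2) B by (meson order_trans)+
  have b2: "\<bar>g1 w a\<bar> \<le> B" "\<bar>g2 w a\<bar> \<le> B" if "a \<in> D" for w a using B1(3) B2(3) B that by (meson order_trans)+
  have b3: "\<bar>H1 w a b\<bar> \<le> B" "\<bar>H2 w a b\<bar> \<le> B" if "a \<in> D" "b \<in> D" for w a b using B1(4) B2(4) B that by (meson order_trans)+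
  have pr: "\<bar>u * v\<bar> \<le> B\<^sup>2" if "\<bar>u\<bar> \<le> B" "\<bar>v\<bar> \<le> B" for u v :: real
    unfolding abs_mult power2_eq_square using that B by (intro mult_mono) auto
  show ?thesis unfolding taylor_def
  proof (intro exI[of _ "8 * B\<^sup>2"] conjI allI ballI)
    fix w
    show "\<bar>F1 w * F2 w\<bar> \<le> 8 * B\<^sup>2" using pr[OF b1(1) b1(2), of w w] by linarith
    fix a assume a: "a \<in> D"
    show "\<bar>F1 w * g2 w a + F2 w * g1 w a\<bar> \<le> 8 * B\<^sup>2"
      using pr[OF b1(1) b2(2)[OF a], of w w] pr[OF b1(2) b2(1)[OF a], of w w] by linarith
    fix b assume b: "b \<in> D"
    show "\<bar>F1 w * H2 w a b + F2 w * H1 w a b + g1 w a * g2 w b + g2 w a * g1 w b\<bar> \<le> 8 * B\<^sup>2"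
      using pr[OF b1(1) b3(2)[OF a b], of w w] pr[OF b1(2) b3(1)[OF a b], of w w]
        pr[OF b2(1)[OF a] b2(2)[OF b], of w w] pr[OF b2(2)[OF a] b2(1)[OF b], of w w] by linarith
  next
    fix w x :: "'a \<Rightarrow> real"
    define S where "S = (\<Sum>a\<in>D. \<bar>x a\<bar>)"
    have S: "S \<ge> 0" by (simp add: S_def sum_nonneg)
    have lb: "\<bar>\<Sum>a\<in>D. g a * x a\<bar> \<le> B * S" if "\<And>a. a \<in> D \<Longrightarrow> \<bar>g a\<bar> \<le> B" for g
    proof -
      have "\<bar>\<Sum>a\<in>D. g a * x a\<bar> \<le> (\<Sum>a\<in>D. B * \<bar>x a\<bar>)"
        using that by (intro order_trans[OF sum_abs] sum_mono) (auto simp: abs_mult intro!: mult_right_mono)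
      then show ?thesis by (simp add: S_def sum_distrib_left)
    qed
    have hb: "\<bar>\<Sum>a\<in>D. \<Sum>b\<in>D. h a b * x a * x b\<bar> \<le> B * S ^ 2" if "\<And>a b. a \<in> D \<Longrightarrow> b \<in> D \<Longrightarrow> \<bar>h a b\<bar> \<le> B" for h
    proof -
      have "\<bar>\<Sum>a\<in>D. \<Sum>b\<in>D. h a b * x a * x b\<bar> \<le> (\<Sum>a\<in>D. \<Sum>b\<in>D. B * (\<bar>x a\<bar> * \<bar>x b\<bar>))"
        using that by (intro order_trans[OF sum_abs] sum_mono) (auto simp: abs_mult mult.assoc intro!: mult_right_mono)
      also have "\<dots> = B * S ^ 2" unfolding S_def power2_eq_square sum_product by (simp add: sum_distrib_left)
      finally show ?thesis .
    qed
    define l1 l2 h1 h2 where "l1 = (\<Sum>a\<in>D. g1 w a * x a)" and "l2 = (\<Sum>a\<in>D. g2 w a * x a)"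
      and "h1 = (\<Sum>a\<in>D. \<Sum>b\<in>D. H1 w a b * x a * x b)" and "h2 = (\<Sum>a\<in>D. \<Sum>b\<in>D. H2 w a b * x a * x b)"
    have e1: "(\<Sum>a\<in>D. (F1 w * g2 w a + F2 w * g1 w a) * x a) = F1 w * l2 + F2 w * l1"
      by (simp add: l1_def l2_def sum_distrib_left sum.distrib[symmetric] algebra_simps)
    have ll: "l1 * l2 = (\<Sum>a\<in>D. \<Sum>b\<in>D. (g1 w a * x a) * (g2 w b * x b))" "l2 * l1 = (\<Sum>a\<in>D. \<Sum>b\<in>D. (g2 w a * x a) * (g1 w b * x b))"
      by (simp_all add: l1_def l2_def sum_product)
    have e2: "(\<Sum>a\<in>D. \<Sum>b\<in>D. (F1 w * H2 w a b + F2 w * H1 w a b + g1 w a * g2 w b + g2 w a * g1 w b) * x a * x b)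
      = F1 w * h2 + F2 w * h1 + l1 * l2 + l2 * l1"
      unfolding ll by (simp add: h1_def h2_def sum_distrib_left sum.distrib[symmetric] algebra_simps)
    have R: "B1 * S ^ 3 \<le> B * S ^ 3" "B2 * S ^ 3 \<le> B * S ^ 3" using B S by (auto intro!: mult_right_mono)
    show "\<bar>F1 (\<lambda>a. w a + x a) * F2 (\<lambda>a. w a + x a) -
          (F1 w * F2 w + (\<Sum>a\<in>D. (F1 w * g2 w a + F2 w * g1 w a) * x a) +
           (\<Sum>a\<in>D. \<Sum>b\<in>D. (F1 w * H2 w a b + F2 w * H1 w a b + g1 w a * g2 w b + g2 w a * g1 w b) * x a * x b) / 2)\<bar>
         \<le> 8 * B\<^sup>2 * (\<Sum>a\<in>D. \<bar>x a\<bar>) ^ 3"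
      using taylor_mult_bound[OF S B(1) b1(1)[of w] b1(2)[of w] b1(1)[of "\<lambda>a. w a + x a"] b1(2)[of "\<lambda>a. w a + x a"]
          lb[of "g1 w", OF b2(1)] lb[of "g2 w", OF b2(2)] hb[of "H1 w", OF b3(1)] hb[of "H2 w", OF b3(2)]]
        order_trans[OF B1(5)[of w x, folded S_def l1_def h1_def] R(1)]
        order_trans[OF B2(5)[of w x, folded S_def l2_def h2_def] R(2)]
      unfolding e1 e2 S_def[symmetric] l1_def[symmetric] l2_def[symmetric] h1_def[symmetric] h2_def[symmetric]
      by (simp add: algebra_simps)
  qed simp
qed

lemma taylor_complement:
  assumes "taylor D F g H"
  shows "taylor D (\<lambda>w. 1 - F w) (\<lambda>w a. - g w a) (\<lambda>w a b. - H w a b)"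
proof -
  obtain B where B: "B \<ge> 0" "\<And>w. \<bar>F w\<bar> \<le> B" "\<And>w a. a \<in> D \<Longrightarrow> \<bar>g w a\<bar> \<le> B"
    "\<And>w a b. a \<in> D \<Longrightarrow> b \<in> D \<Longrightarrow> \<bar>H w a b\<bar> \<le> B"
    "\<And>w x. \<bar>F (\<lambda>a. w a + x a) - (F w + (\<Sum>a\<in>D. g w a * x a) + (\<Sum>a\<in>D. \<Sum>b\<in>D. H w a b * x a * x b) / 2)\<bar>
       \<le> B * (\<Sum>a\<in>D. \<bar>x a\<bar>) ^ 3"
    using assms unfolding taylor_def by blast
  show ?thesis unfolding taylor_def
  proof (intro exI[of _ "B + 1"] conjI allI ballI)
    fix w show "\<bar>1 - F w\<bar> \<le> B + 1" using B(2)[of w] by linarith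
    fix a assume a: "a \<in> D" show "\<bar>- g w a\<bar> \<le> B + 1" using B(3)[OF a, of w] by linarith
    fix b assume b: "b \<in> D" show "\<bar>- H w a b\<bar> \<le> B + 1" using B(4)[OF a b, of w] by linarith
  next
    fix w x :: "'a \<Rightarrow> real"
    have "B * (\<Sum>a\<in>D. \<bar>x a\<bar>) ^ 3 \<le> (B + 1) * (\<Sum>a\<in>D. \<bar>x a\<bar>) ^ 3"
      by (intro mult_right_mono) (auto intro: sum_nonneg)
    then show "\<bar>1 - F (\<lambda>a. w a + x a) - (1 - F w + (\<Sum>a\<in>D. - g w a * x a) + (\<Sum>a\<in>D. \<Sum>b\<in>D. - H w a b * x a * x b) / 2)\<bar>
         \<le> (B + 1) * (\<Sum>a\<in>D. \<bar>x a\<bar>) ^ 3"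
      using B(5)[of w x] by (simp add: sum_negf)
  qed (use B in auto)
qed

lemma taylor_one: "taylor D (\<lambda>w. 1) (\<lambda>w a. 0) (\<lambda>w a b. 0)"
  unfolding taylor_def by (intro exI[of _ 1]) (auto intro: sum_nonneg)

lemma taylor_coordinate:
  assumes D: "finite D" "a0 \<in> D"
    and b: "\<And>t. \<bar>\<phi> t\<bar> \<le> B" "\<And>t. \<bar>\<phi>' t\<bar> \<le> B" "\<And>t. \<bar>\<phi>'' t\<bar> \<le> B"
    and R: "\<And>t x. \<bar>\<phi> (t + x) - (\<phi> t + \<phi>' t * x + \<phi>'' t * x\<^sup>2 / 2)\<bar> \<le> B * \<bar>x\<bar> ^ 3"
  shows "taylor D (\<lambda>w. \<phi> (w a0 - c)) (\<lambda>w a. if a = a0 then \<phi>' (w a0 - c) else 0)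
    (\<lambda>w a b. if a = a0 \<and> b = a0 then \<phi>'' (w a0 - c) else 0)"
proof -
  have B: "B \<ge> 0" using b(1)[of 0] by linarith
  show ?thesis unfolding taylor_def
  proof (intro exI[of _ B] conjI allI ballI)
    fix w x :: "'a \<Rightarrow> real"
    have s1: "(\<Sum>a\<in>D. (if a = a0 then \<phi>' (w a0 - c) else 0) * x a) = \<phi>' (w a0 - c) * x a0"
      using D by (subst sum.remove[OF D]) auto
    have s2: "(\<Sum>a\<in>D. \<Sum>b\<in>D. (if a = a0 \<and> b = a0 then \<phi>'' (w a0 - c) else 0) * x a * x b) = \<phi>'' (w a0 - c) * (x a0)\<^sup>2"
      using D by (subst sum.remove[OF D], simp, subst sum.remove[OF D]) (auto simp: power2_eq_square)
    have "\<bar>x a0\<bar> \<le> (\<Sum>a\<in>D. \<bar>x a\<bar>)" using D by (intro member_le_sum) auto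
    then have "B * \<bar>x a0\<bar> ^ 3 \<le> B * (\<Sum>a\<in>D. \<bar>x a\<bar>) ^ 3" using B by (intro mult_left_mono power_mono) auto
    then show "\<bar>\<phi> (w a0 + x a0 - c) - (\<phi> (w a0 - c) + (\<Sum>a\<in>D. (if a = a0 then \<phi>' (w a0 - c) else 0) * x a) +
         (\<Sum>a\<in>D. \<Sum>b\<in>D. (if a = a0 \<and> b = a0 then \<phi>'' (w a0 - c) else 0) * x a * x b) / 2)\<bar> \<le> B * (\<Sum>a\<in>D. \<bar>x a\<bar>) ^ 3"
      using R[of "w a0 - c" "x a0"] unfolding s1 s2 by (simp add: algebra_simps)
  qed (use b B in auto)
qed

section \<open>Replacement of one Gaussian family by another\<close>

definition lin_on :: "'i set \<Rightarrow> ('a \<Rightarrow> 'i \<Rightarrow> real) \<Rightarrow> ('i \<Rightarrow> real) \<Rightarrow> 'a \<Rightarrow> real" where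
  "lin_on L M z a = (\<Sum>k\<in>L. M a k * z k)"

lemma measurable_lin_on [measurable]:
  assumes "L \<subseteq> I"
  shows "(\<lambda>z. lin_on L M z a) \<in> borel_measurable (gauss I)"
  unfolding lin_on_def using assms by (intro borel_measurable_sum borel_measurable_times) auto

lemma lin_on_moments:
  assumes I: "finite I" "L \<subseteq> I"
  shows "(\<integral>z. lin_on L M z a \<partial>gauss I) = 0" "integrable (gauss I) (\<lambda>z. lin_on L M z a)"
    and "(\<integral>z. lin_on L M z a * lin_on L M z b \<partial>gauss I) = (\<Sum>k\<in>L. M a k * M b k)"
    and "integrable (gauss I) (\<lambda>z. lin_on L M z a * lin_on L M z b)"
proof -
  have m: "k \<in> L \<Longrightarrow> k \<in> I" for k using I by auto
  note g = gauss_second_moments[OF I(1) m m]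
  have fL: "finite L" using I finite_subset by auto
  show "integrable (gauss I) (\<lambda>z. lin_on L M z a)"
    unfolding lin_on_def by (intro Bochner_Integration.integrable_sum integrable_mult_right) (use g(4) in auto)
  show "(\<integral>z. lin_on L M z a \<partial>gauss I) = 0"
    unfolding lin_on_def using g(3,4) by (subst Bochner_Integration.integral_sum) auto
  have e: "lin_on L M z a * lin_on L M z b = (\<Sum>k\<in>L. \<Sum>l\<in>L. M a k * M b l * (z k * z l))" for z
    by (simp add: lin_on_def sum_product algebra_simps)
  show "integrable (gauss I) (\<lambda>z. lin_on L M z a * lin_on L M z b)"
    unfolding e by (intro Bochner_Integration.integrable_sum integrable_mult_right g(2))
  have "(\<integral>z. lin_on L M z a * lin_on L M z b \<partial>gauss I) = (\<Sum>k\<in>L. \<Sum>l\<in>L. M a k * M b l * (\<integral>z. z k * z l \<partial>gauss I))"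
    unfolding e
    by (subst Bochner_Integration.integral_sum, intro Bochner_Integration.integrable_sum integrable_mult_right g(2), assumption+,
        rule sum.cong[OF refl], subst Bochner_Integration.integral_sum, intro integrable_mult_right g(2), assumption+,
        rule sum.cong[OF refl], rule integral_mult_right_zero)
  also have "\<dots> = (\<Sum>k\<in>L. \<Sum>l\<in>L. if k = l then M a k * M b l else 0)"
    using g(1) by (intro sum.cong) auto
  also have "\<dots> = (\<Sum>k\<in>L. M a k * M b k)" using fL by simp
  finally show "(\<integral>z. lin_on L M z a * lin_on L M z b \<partial>gauss I) = (\<Sum>k\<in>L. M a k * M b k)" .
qed

lemma sum_cube_le:
  fixes y :: "'i \<Rightarrow> real"
  assumes "finite I" "\<And>k. k \<in> I \<Longrightarrow> y k \<ge> 0"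
  shows "(\<Sum>k\<in>I. y k) ^ 3 \<le> real (card I) ^ 3 * (\<Sum>k\<in>I. y k ^ 3)"
proof (cases "I = {}")
  case False
  define m where "m = Max (y ` I)"
  have "m \<in> y ` I" unfolding m_def using assms False by (intro Max_in) auto
  then obtain k where k: "k \<in> I" "m = y k" by auto
  have le: "y j \<le> m" if "j \<in> I" for j unfolding m_def using assms that by auto
  have "(\<Sum>k\<in>I. y k) \<le> real (card I) * m" using sum_bounded_above[of I y m] le by simp
  then have "(\<Sum>k\<in>I. y k) ^ 3 \<le> (real (card I) * m) ^ 3" using assms by (intro power_mono sum_nonneg) auto
  also have "\<dots> = real (card I) ^ 3 * y k ^ 3" by (simp add: power_mult_distrib k)
  also have "\<dots> \<le> real (card I) ^ 3 * (\<Sum>k\<in>I. y k ^ 3)"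
    using assms k by (intro mult_left_mono member_le_sum) auto
  finally show ?thesis .
qed simp

lemma lin_on_cube_integrable:
  assumes I: "finite I" "L \<subseteq> I" and D: "finite D"
  shows "integrable (gauss I) (\<lambda>z. (\<Sum>a\<in>D. \<bar>lin_on L M z a\<bar>) ^ 3)"
proof -
  define C where "C = (\<Sum>a\<in>D. \<Sum>k\<in>L. \<bar>M a k\<bar>)"
  have fL: "finite L" using I finite_subset by auto
  have C0: "C \<ge> 0" unfolding C_def by (intro sum_nonneg) auto
  have b: "(\<Sum>a\<in>D. \<bar>lin_on L M z a\<bar>) \<le> C * (\<Sum>k\<in>L. \<bar>z k\<bar>)" for z
  proof -
    have "(\<Sum>a\<in>D. \<bar>lin_on L M z a\<bar>) \<le> (\<Sum>a\<in>D. \<Sum>k\<in>L. \<bar>M a k\<bar> * \<bar>z k\<bar>)"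
      unfolding lin_on_def by (intro sum_mono order_trans[OF sum_abs]) (simp add: abs_mult)
    also have "\<dots> \<le> (\<Sum>a\<in>D. \<Sum>k\<in>L. \<bar>M a k\<bar> * (\<Sum>k\<in>L. \<bar>z k\<bar>))"
      using fL by (intro sum_mono mult_left_mono member_le_sum) auto
    also have "\<dots> = C * (\<Sum>k\<in>L. \<bar>z k\<bar>)" by (simp add: C_def sum_distrib_right)
    finally show ?thesis .
  qed
  have b3: "(\<Sum>a\<in>D. \<bar>lin_on L M z a\<bar>) ^ 3 \<le> C ^ 3 * (real (card L) ^ 3 * (\<Sum>k\<in>L. \<bar>z k\<bar> ^ 3))" for z
  proof -
    have "(\<Sum>a\<in>D. \<bar>lin_on L M z a\<bar>) ^ 3 \<le> (C * (\<Sum>k\<in>L. \<bar>z k\<bar>)) ^ 3"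
      by (intro power_mono b sum_nonneg) auto
    also have "\<dots> = C ^ 3 * (\<Sum>k\<in>L. \<bar>z k\<bar>) ^ 3" by (rule power_mult_distrib)
    also have "\<dots> \<le> C ^ 3 * (real (card L) ^ 3 * (\<Sum>k\<in>L. \<bar>z k\<bar> ^ 3))"
      using C0 fL by (intro mult_left_mono sum_cube_le) auto
    finally show ?thesis .
  qed
  show ?thesis
  proof (rule Bochner_Integration.integrable_bound)
    show "integrable (gauss I) (\<lambda>z. C ^ 3 * (real (card L) ^ 3 * (\<Sum>k\<in>L. \<bar>z k\<bar> ^ 3)))"
      by (intro integrable_mult_right Bochner_Integration.integrable_sum integrable_gauss_abs_power) (use I in auto)
    show "(\<lambda>z. (\<Sum>a\<in>D. \<bar>lin_on L M z a\<bar>) ^ 3) \<in> borel_measurable (gauss I)"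
      by (intro borel_measurable_power borel_measurable_sum borel_measurable_abs measurable_lin_on I)
    have "0 \<le> (\<Sum>a\<in>D. \<bar>lin_on L M z a\<bar>) ^ 3" for z by (intro zero_le_power sum_nonneg) auto
    then show "AE z in gauss I. norm ((\<Sum>a\<in>D. \<bar>lin_on L M z a\<bar>) ^ 3) \<le> norm (C ^ 3 * (real (card L) ^ 3 * (\<Sum>k\<in>L. \<bar>z k\<bar> ^ 3)))"
      using b3 by (intro always_eventually allI) (smt (verit) real_norm_def)
  qed
qed

text \<open>Arguments such as \<open>lin_on L M z\<close> are given at all indices, whereas the
  product space over \<open>D\<close> consists of functions undefined outside \<open>D\<close>.
  Invariance under restriction bridges the two.\<close>

definition loc_meas :: "'a set \<Rightarrow> (('a \<Rightarrow> real) \<Rightarrow> real) \<Rightarrow> bool" where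
  "loc_meas D F \<longleftrightarrow> F \<in> borel_measurable (\<Pi>\<^sub>M a\<in>D. borel) \<and> (\<forall>w. F (restrict w D) = F w)"

lemma loc_meas_compose:
  assumes "loc_meas D F" "\<And>a. a \<in> D \<Longrightarrow> (\<lambda>x. f x a) \<in> borel_measurable N"
  shows "(\<lambda>x. F (f x)) \<in> borel_measurable N"
proof -
  have "(\<lambda>x. F (restrict (f x) D)) \<in> borel_measurable N"
    using assms unfolding loc_meas_def
    by (intro measurable_compose[of "\<lambda>x. restrict (f x) D" N "\<Pi>\<^sub>M a\<in>D. borel" F] measurable_restrict) auto
  then show ?thesis using assms(1) by (simp add: loc_meas_def)
qed

text \<open>Averaging the expansion over a centred Gaussian increment kills the linear term, turns
  the quadratic one into a contraction of \<open>H\<close> with the covariance, and leaves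
  \<open>e ^ 3\<close> times a third absolute moment.\<close>

lemma one_step:
  assumes I: "finite I" "L \<subseteq> I" and D: "finite D" and F: "loc_meas D F"
    and B: "\<And>w. \<bar>F w\<bar> \<le> B"
    and T: "\<And>w x. \<bar>F (\<lambda>a. w a + x a) - (F w + (\<Sum>a\<in>D. g w a * x a) + (\<Sum>a\<in>D. \<Sum>b\<in>D. H w a b * x a * x b) / 2)\<bar>
       \<le> B * (\<Sum>a\<in>D. \<bar>x a\<bar>) ^ 3" and e: "e \<ge> 0"
  shows "\<bar>(\<integral>z. F (\<lambda>a. w a + e * lin_on L M z a) \<partial>gauss I) - (F w + e\<^sup>2 * (\<Sum>a\<in>D. \<Sum>b\<in>D. H w a b * (\<Sum>k\<in>L. M a k * M b k)) / 2)\<bar>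
    \<le> B * e ^ 3 * (\<integral>z. (\<Sum>a\<in>D. \<bar>lin_on L M z a\<bar>) ^ 3 \<partial>gauss I)"
proof -
  interpret G: prob_space "gauss I" by (rule prob_space_gauss)
  note mom = lin_on_moments[OF I, of M]
  define Q where "Q z = F w + (\<Sum>a\<in>D. g w a * (e * lin_on L M z a)) + (\<Sum>a\<in>D. \<Sum>b\<in>D. (e\<^sup>2 * H w a b) * (lin_on L M z a * lin_on L M z b)) / 2" for z
  have iQ: "integrable (gauss I) Q"
    unfolding Q_def
    by (intro Bochner_Integration.integrable_add Bochner_Integration.integrable_sum integrable_mult_right integrable_divide_zero mom) auto
  have mF [measurable]: "(\<lambda>z. F (\<lambda>a. w a + e * lin_on L M z a)) \<in> borel_measurable (gauss I)"
    using measurable_lin_on[OF I(2)] by (intro loc_meas_compose[OF F] borel_measurable_add borel_measurable_times) auto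
  have iF: "integrable (gauss I) (\<lambda>z. F (\<lambda>a. w a + e * lin_on L M z a))"
    by (rule G.integrable_const_bound[of _ B]) (use B mF in auto)
  have "(\<integral>z. Q z \<partial>gauss I) = F w + e\<^sup>2 * (\<Sum>a\<in>D. \<Sum>b\<in>D. H w a b * (\<Sum>k\<in>L. M a k * M b k)) / 2"
  proof -
    have 1: "(\<integral>z. (\<Sum>a\<in>D. g w a * (e * lin_on L M z a)) \<partial>gauss I) = 0"
      by (subst Bochner_Integration.integral_sum) (use mom in auto)
    have 2: "(\<integral>z. (\<Sum>a\<in>D. \<Sum>b\<in>D. (e\<^sup>2 * H w a b) * (lin_on L M z a * lin_on L M z b)) \<partial>gauss I)
      = (\<Sum>a\<in>D. \<Sum>b\<in>D. (e\<^sup>2 * H w a b) * (\<Sum>k\<in>L. M a k * M b k))"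
      by (subst Bochner_Integration.integral_sum, intro Bochner_Integration.integrable_sum integrable_mult_right mom,
          rule sum.cong[OF refl], subst Bochner_Integration.integral_sum, intro integrable_mult_right mom,
          rule sum.cong[OF refl], subst integral_mult_right_zero, simp only: mom)
    have "(\<integral>z. Q z \<partial>gauss I) = (\<integral>z. F w \<partial>gauss I) + (\<integral>z. (\<Sum>a\<in>D. g w a * (e * lin_on L M z a)) \<partial>gauss I)
      + (\<integral>z. (\<Sum>a\<in>D. \<Sum>b\<in>D. (e\<^sup>2 * H w a b) * (lin_on L M z a * lin_on L M z b)) \<partial>gauss I) / 2"
      unfolding Q_def
      by (subst Bochner_Integration.integral_add,
          intro Bochner_Integration.integrable_add Bochner_Integration.integrable_sum integrable_mult_right mom G.integrable_const,
          intro integrable_divide_zero Bochner_Integration.integrable_sum integrable_mult_right mom impI,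
          subst Bochner_Integration.integral_add, rule G.integrable_const,
          intro Bochner_Integration.integrable_sum integrable_mult_right mom, simp only: integral_divide_zero)
    then show ?thesis unfolding 1 2 by (simp add: G.prob_space sum_distrib_left mult.assoc)
  qed
  then have "(\<integral>z. F (\<lambda>a. w a + e * lin_on L M z a) \<partial>gauss I) - (F w + e\<^sup>2 * (\<Sum>a\<in>D. \<Sum>b\<in>D. H w a b * (\<Sum>k\<in>L. M a k * M b k)) / 2)
    = (\<integral>z. F (\<lambda>a. w a + e * lin_on L M z a) - Q z \<partial>gauss I)"
    using iF iQ by simp
  also have "\<bar>\<dots>\<bar> \<le> (\<integral>z. \<bar>F (\<lambda>a. w a + e * lin_on L M z a) - Q z\<bar> \<partial>gauss I)"
    by (rule integral_abs_bound)
  also have "\<dots> \<le> (\<integral>z. B * e ^ 3 * (\<Sum>a\<in>D. \<bar>lin_on L M z a\<bar>) ^ 3 \<partial>gauss I)"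
  proof (rule integral_mono)
    show "integrable (gauss I) (\<lambda>z. \<bar>F (\<lambda>a. w a + e * lin_on L M z a) - Q z\<bar>)" using iF iQ by auto
    show "integrable (gauss I) (\<lambda>z. B * e ^ 3 * (\<Sum>a\<in>D. \<bar>lin_on L M z a\<bar>) ^ 3)"
      using lin_on_cube_integrable[OF I D] by auto
    fix z
    have "(\<Sum>a\<in>D. \<Sum>b\<in>D. H w a b * (e * lin_on L M z a) * (e * lin_on L M z b)) = (\<Sum>a\<in>D. \<Sum>b\<in>D. (e\<^sup>2 * H w a b) * (lin_on L M z a * lin_on L M z b))"
      by (simp add: power2_eq_square algebra_simps)
    moreover have "(\<Sum>a\<in>D. \<bar>e * lin_on L M z a\<bar>) = e * (\<Sum>a\<in>D. \<bar>lin_on L M z a\<bar>)"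
      using e by (simp add: abs_mult sum_distrib_left)
    ultimately show "\<bar>F (\<lambda>a. w a + e * lin_on L M z a) - Q z\<bar> \<le> B * e ^ 3 * (\<Sum>a\<in>D. \<bar>lin_on L M z a\<bar>) ^ 3"
      using T[of w "\<lambda>a. e * lin_on L M z a"] by (simp add: Q_def power_mult_distrib)
  qed
  also have "\<dots> = B * e ^ 3 * (\<integral>z. (\<Sum>a\<in>D. \<bar>lin_on L M z a\<bar>) ^ 3 \<partial>gauss I)" by simp
  finally show ?thesis .
qed

text \<open>By \<open>gauss_stability\<close>, raising the variances on \<open>L\<close> by
  \<open>e\<^sup>2\<close> amounts to adding \<open>e\<close> times an independent copy, over which
  \<open>one_step\<close> can average while the rest is held fixed.\<close>

lemma lindeberg_step:
  fixes M :: "'a \<Rightarrow> 'i \<Rightarrow> real" and p :: "'i \<Rightarrow> real"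
  assumes I: "finite I" "L \<subseteq> I" and D: "finite D" and F: "loc_meas D F" and B: "\<And>w. \<bar>F w\<bar> \<le> B"
    and p: "\<And>i. i \<in> I \<Longrightarrow> p i \<ge> 0" and e: "e \<ge> 0"
  shows "(\<integral>z. F (lin_on I M (\<lambda>i. sqrt ((p i)\<^sup>2 + (if i \<in> L then e else 0)\<^sup>2) * z i)) \<partial>gauss I)
    = (\<integral>z. (\<integral>z'. F (\<lambda>a. lin_on I M (\<lambda>i. p i * z i) a + e * lin_on L M z' a) \<partial>gauss I) \<partial>gauss I)"
    and "integrable (gauss I) (\<lambda>z. \<integral>z'. F (\<lambda>a. lin_on I M (\<lambda>i. p i * z i) a + e * lin_on L M z' a) \<partial>gauss I)"
proof -
  interpret G: prob_space "gauss I" by (rule prob_space_gauss)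
  interpret GG: pair_prob_space "gauss I" "gauss I" ..
  define q where "q i = (if i \<in> L then e else 0)" for i
  have cong: "lin_on I M (restrict f I) = lin_on I M f" for f
    by (auto simp: lin_on_def fun_eq_iff intro!: sum.cong)
  have mF: "(\<lambda>z. F (lin_on I M z)) \<in> borel_measurable (gauss I)"
    using measurable_lin_on[of I I M] by (intro loc_meas_compose[OF F]) auto
  have split: "lin_on I M (\<lambda>i. p i * z i + q i * z' i) = (\<lambda>a. lin_on I M (\<lambda>i. p i * z i) a + e * lin_on L M z' a)" for z z'
  proof
    fix a
    have "(\<Sum>k\<in>I. M a k * (q k * z' k)) = (\<Sum>k\<in>L. M a k * (q k * z' k))"
      using I by (intro sum.mono_neutral_right) (auto simp: q_def)
    also have "\<dots> = e * (\<Sum>k\<in>L. M a k * z' k)"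
      by (simp add: q_def sum_distrib_left algebra_simps)
    finally show "lin_on I M (\<lambda>i. p i * z i + q i * z' i) a = lin_on I M (\<lambda>i. p i * z i) a + e * lin_on L M z' a"
      by (simp add: lin_on_def distrib_left sum.distrib)
  qed
  have mm: "(\<lambda>x. F (\<lambda>a. lin_on I M (\<lambda>i. p i * fst x i) a + e * lin_on L M (snd x) a)) \<in> borel_measurable (gauss I \<Otimes>\<^sub>M gauss I)"
  proof (intro loc_meas_compose[OF F] borel_measurable_add borel_measurable_times)
    fix a
    have "(\<lambda>z. lin_on I M (\<lambda>i. p i * z i) a) \<in> borel_measurable (gauss I)"
      unfolding lin_on_def by measurable
    then show "(\<lambda>x. lin_on I M (\<lambda>i. p i * fst x i) a) \<in> borel_measurable (gauss I \<Otimes>\<^sub>M gauss I)"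
      by (rule measurable_compose[OF measurable_fst])
    show "(\<lambda>x. lin_on L M (snd x) a) \<in> borel_measurable (gauss I \<Otimes>\<^sub>M gauss I)"
      by (rule measurable_compose[OF measurable_snd measurable_lin_on[OF I(2)]])
  qed simp
  have int: "integrable (gauss I \<Otimes>\<^sub>M gauss I) (\<lambda>x. F (\<lambda>a. lin_on I M (\<lambda>i. p i * fst x i) a + e * lin_on L M (snd x) a))"
    by (rule GG.integrable_const_bound[of _ B]) (use B mm in auto)
  have "(\<integral>z. F (lin_on I M (\<lambda>i. sqrt ((p i)\<^sup>2 + (q i)\<^sup>2) * z i)) \<partial>gauss I)
    = (\<integral>x. F (lin_on I M (\<lambda>i. p i * fst x i + q i * snd x i)) \<partial>(gauss I \<Otimes>\<^sub>M gauss I))"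
    using gauss_stability[OF I(1) _ mF, of p q] p e by (simp add: cong q_def)
  also have "\<dots> = (\<integral>x. F (\<lambda>a. lin_on I M (\<lambda>i. p i * fst x i) a + e * lin_on L M (snd x) a) \<partial>(gauss I \<Otimes>\<^sub>M gauss I))"
    by (simp add: split)
  also have "\<dots> = (\<integral>z. (\<integral>z'. F (\<lambda>a. lin_on I M (\<lambda>i. p i * z i) a + e * lin_on L M z' a) \<partial>gauss I) \<partial>gauss I)"
    using GG.integral_fst'[OF int] by simp
  finally show "(\<integral>z. F (lin_on I M (\<lambda>i. sqrt ((p i)\<^sup>2 + (if i \<in> L then e else 0)\<^sup>2) * z i)) \<partial>gauss I)
    = (\<integral>z. (\<integral>z'. F (\<lambda>a. lin_on I M (\<lambda>i. p i * z i) a + e * lin_on L M z' a) \<partial>gauss I) \<partial>gauss I)"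
    by (simp add: q_def)
  show "integrable (gauss I) (\<lambda>z. \<integral>z'. F (\<lambda>a. lin_on I M (\<lambda>i. p i * z i) a + e * lin_on L M z' a) \<partial>gauss I)"
    using GG.integrable_fst'[OF int] by simp
qed

text \<open>Lindeberg replacement: the Gaussian vectors on the coordinates \<open>L\<close> and \<open>I - L\<close> are exchanged in
  \<open>N\<close> steps of variance \<open>1 / N\<close>, each of which changes the expectation in the right direction up to \<open>N powr (-3/2)\<close>.\<close>

theorem gaussian_comparison:
  fixes M :: "'a \<Rightarrow> 'i \<Rightarrow> real"
  assumes I: "finite I" "L \<subseteq> I" and D: "finite D" and F: "loc_meas D F" and T: "taylor D F g H"
    and cov: "\<And>w. 0 \<le> (\<Sum>a\<in>D. \<Sum>b\<in>D. H w a b * ((\<Sum>k\<in>L. M a k * M b k) - (\<Sum>k\<in>I - L. M a k * M b k)))"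
  shows "(\<integral>z. F (lin_on (I - L) M z) \<partial>gauss I) \<le> (\<integral>z. F (lin_on L M z) \<partial>gauss I)"
proof -
  interpret G: prob_space "gauss I" by (rule prob_space_gauss)
  obtain B where B: "B \<ge> 0" "\<And>w. \<bar>F w\<bar> \<le> B"
    "\<And>w x. \<bar>F (\<lambda>a. w a + x a) - (F w + (\<Sum>a\<in>D. g w a * x a) + (\<Sum>a\<in>D. \<Sum>b\<in>D. H w a b * x a * x b) / 2)\<bar>
       \<le> B * (\<Sum>a\<in>D. \<bar>x a\<bar>) ^ 3"
    using T unfolding taylor_def by blast
  define K where "K J = (\<integral>z. (\<Sum>a\<in>D. \<bar>lin_on J M z a\<bar>) ^ 3 \<partial>gauss I)" for J
  define C where "C = B * (K L + K (I - L))"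
  have IL: "I - L \<subseteq> I" by auto
  have main: "(\<integral>z. F (lin_on (I - L) M z) \<partial>gauss I) - (\<integral>z. F (lin_on L M z) \<partial>gauss I) \<le> C / sqrt (real N)" if N: "N > 0" for N :: nat
  proof -
    define e where "e = 1 / sqrt (real N)"
    have e: "e \<ge> 0" by (simp add: e_def)
    have e2: "e\<^sup>2 = 1 / real N" by (simp add: e_def power_divide)
    \<comment> \<open>After \<open>k\<close> steps the coordinates in \<open>L\<close> have variance
      \<open>k / N\<close> and the others \<open>(N - k) / N\<close>, so that \<open>S 0\<close> and
      \<open>S N\<close> are the expectations to be compared.\<close>
    define c where "c k i = (if i \<in> L then sqrt (real k / real N) else sqrt (real (N - k) / real N))" for k :: nat and i
    define S where "S k = (\<integral>z. F (lin_on I M (\<lambda>i. c k i * z i)) \<partial>gauss I)" for k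
    have step: "S k - S (Suc k) \<le> C * e ^ 3" if k: "k < N" for k
    proof -
      \<comment> \<open>The part common to the stages \<open>k\<close> and \<open>Suc k\<close>: the
        former adds the increment on \<open>I - L\<close> to it, the latter the one on
        \<open>L\<close>.\<close>
      define p where "p i = (if i \<in> L then sqrt (real k / real N) else sqrt (real (N - Suc k) / real N))" for i
      have p: "p i \<ge> 0" for i by (simp add: p_def)
      have c1: "c (Suc k) i = sqrt ((p i)\<^sup>2 + (if i \<in> L then e else 0)\<^sup>2)" for i
        by (simp add: c_def p_def e2 add_divide_distrib add.commute)
      have "real (N - k) = real (N - Suc k) + 1" using k by (simp add: of_nat_diff)
      then have eq: "real (N - k) / real N = real (N - Suc k) / real N + 1 / real N"
        by (simp only: add_divide_distrib)
      have c2: "c k i = sqrt ((p i)\<^sup>2 + (if i \<in> I - L then e else 0)\<^sup>2)" if "i \<in> I" for i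
        using that by (simp add: c_def p_def e2 eq del: of_nat_diff of_nat_Suc)
      have lin_c: "lin_on I M (\<lambda>i. c k i * z i) = lin_on I M (\<lambda>i. sqrt ((p i)\<^sup>2 + (if i \<in> I - L then e else 0)\<^sup>2) * z i)" for z
        using c2 unfolding lin_on_def fun_eq_iff by (intro allI sum.cong) (simp_all only: )
      define W where "W z = lin_on I M (\<lambda>i. p i * z i)" for z
      have s1: "S (Suc k) = (\<integral>z. (\<integral>z'. F (\<lambda>a. W z a + e * lin_on L M z' a) \<partial>gauss I) \<partial>gauss I)"
        unfolding S_def W_def c1 by (rule lindeberg_step(1)[OF I D F B(2) p e])
      have s2: "S k = (\<integral>z. (\<integral>z'. F (\<lambda>a. W z a + e * lin_on (I - L) M z' a) \<partial>gauss I) \<partial>gauss I)"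
        unfolding S_def W_def lin_c by (rule lindeberg_step(1)[OF I(1) IL D F B(2) p e])
      have i1: "integrable (gauss I) (\<lambda>z. \<integral>z'. F (\<lambda>a. W z a + e * lin_on L M z' a) \<partial>gauss I)"
        unfolding W_def by (rule lindeberg_step(2)[OF I D F B(2) p e])
      have i2: "integrable (gauss I) (\<lambda>z. \<integral>z'. F (\<lambda>a. W z a + e * lin_on (I - L) M z' a) \<partial>gauss I)"
        unfolding W_def by (rule lindeberg_step(2)[OF I(1) IL D F B(2) p e])
      have pt: "(\<integral>z'. F (\<lambda>a. w a + e * lin_on (I - L) M z' a) \<partial>gauss I) - (\<integral>z'. F (\<lambda>a. w a + e * lin_on L M z' a) \<partial>gauss I) \<le> C * e ^ 3" for w
      proof -
        note o1 = one_step[OF I D F B(2,3) e, of w M, folded K_def]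
        note o2 = one_step[OF I(1) IL D F B(2,3) e, of w M, folded K_def]
        have "(\<Sum>a\<in>D. \<Sum>b\<in>D. H w a b * (\<Sum>k\<in>I - L. M a k * M b k)) \<le> (\<Sum>a\<in>D. \<Sum>b\<in>D. H w a b * (\<Sum>k\<in>L. M a k * M b k))"
          using cov[of w] by (simp add: right_diff_distrib sum_subtractf)
        then have "e\<^sup>2 * (\<Sum>a\<in>D. \<Sum>b\<in>D. H w a b * (\<Sum>k\<in>I - L. M a k * M b k)) / 2 \<le> e\<^sup>2 * (\<Sum>a\<in>D. \<Sum>b\<in>D. H w a b * (\<Sum>k\<in>L. M a k * M b k)) / 2"
          by (intro divide_right_mono mult_left_mono) auto
        moreover have "C * e ^ 3 = B * e ^ 3 * K L + B * e ^ 3 * K (I - L)" by (simp add: C_def algebra_simps)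
        ultimately show ?thesis using o1 o2 by linarith
      qed
      have "S k - S (Suc k) = (\<integral>z. (\<integral>z'. F (\<lambda>a. W z a + e * lin_on (I - L) M z' a) \<partial>gauss I) - (\<integral>z'. F (\<lambda>a. W z a + e * lin_on L M z' a) \<partial>gauss I) \<partial>gauss I)"
        unfolding s1 s2 by (rule Bochner_Integration.integral_diff[symmetric, OF i2 i1])
      also have "\<dots> \<le> (\<integral>z. C * e ^ 3 \<partial>gauss I)"
        by (rule integral_mono[OF Bochner_Integration.integrable_diff[OF i2 i1] G.integrable_const pt])
      also have "\<dots> = C * e ^ 3" by (simp add: G.prob_space)
      finally show ?thesis .
    qed
    have "S 0 - S N = (\<Sum>k<N. S k - S (Suc k))" by (induction N) auto
    also have "\<dots> \<le> (\<Sum>k<N. C * e ^ 3)" by (intro sum_mono step) simp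
    \<comment> \<open>Since \<open>N * e\<^sup>2 = 1\<close>, the sum of \<open>N\<close> errors of
      order \<open>e ^ 3\<close> has order \<open>e\<close>.\<close>
    also have "\<dots> = C * e * (real N * e\<^sup>2)" by (simp add: power2_eq_square power3_eq_cube)
    also have "\<dots> = C / sqrt (real N)" using N by (simp add: e2) (simp add: e_def)
    finally have "S 0 - S N \<le> C / sqrt (real N)" .
    moreover have "lin_on I M (\<lambda>i. c 0 i * z i) = lin_on (I - L) M z" for z
      unfolding lin_on_def fun_eq_iff using I N by (intro allI sum.mono_neutral_cong_right) (auto simp: c_def)
    moreover have "lin_on I M (\<lambda>i. c N i * z i) = lin_on L M z" for z
      unfolding lin_on_def fun_eq_iff using I N by (intro allI sum.mono_neutral_cong_right) (auto simp: c_def)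
    ultimately show ?thesis by (simp add: S_def)
  qed
  have "(\<lambda>N. C / sqrt (real N)) \<longlonglongrightarrow> 0"
    by (rule tendsto_divide_0[OF tendsto_const filterlim_at_top_imp_at_infinity])
       (rule filterlim_compose[OF sqrt_at_top filterlim_real_sequentially])
  then have "(\<integral>z. F (lin_on (I - L) M z) \<partial>gauss I) - (\<integral>z. F (lin_on L M z) \<partial>gauss I) \<le> 0"
    by (rule tendsto_lowerbound[of _ _ sequentially]) (use main in \<open>auto intro!: eventually_sequentiallyI[of 1]\<close>)
  then show ?thesis by simp
qed

section \<open>Smooth approximation of indicator functions\<close>

definition lgs :: "real \<Rightarrow> real" where "lgs x = 1 / (1 + exp (- x))"

lemma lgs_bounds: "0 \<le> lgs x" "lgs x \<le> 1"
  by (auto simp: lgs_def divide_le_eq add_pos_pos less_imp_le)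

lemma lgs_deriv: "(lgs has_real_derivative lgs x * (1 - lgs x)) (at x)"
proof -
  have p: "1 + exp (- x) \<noteq> 0" using exp_gt_zero[of "- x"] by linarith
  have "(lgs has_real_derivative exp (- x) / (1 + exp (- x))\<^sup>2) (at x)"
    unfolding lgs_def[abs_def] by (auto intro!: derivative_eq_intros simp: p power2_eq_square)
  also have "exp (- x) / (1 + exp (- x))\<^sup>2 = lgs x * (1 - lgs x)"
    using p by (simp add: lgs_def field_simps power2_eq_square)
  finally show ?thesis .
qed

text \<open>The derivatives of the logistic function are polynomials in the function itself. The
  third is at most 6 in absolute value, which cancels the factorial in the remainder.\<close>

lemma lgs_taylor:
  "\<bar>lgs (t + x) - (lgs t + lgs t * (1 - lgs t) * x + lgs t * (1 - lgs t) * (1 - 2 * lgs t) * x\<^sup>2 / 2)\<bar> \<le> \<bar>x\<bar> ^ 3"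
proof (cases "x = 0")
  case False
  define df where "df m = (if m = 0 then lgs else if m = 1 then (\<lambda>x. lgs x * (1 - lgs x))
    else if m = 2 then (\<lambda>x. lgs x * (1 - lgs x) * (1 - 2 * lgs x))
    else (\<lambda>x. lgs x * (1 - lgs x) * (1 - 6 * lgs x + 6 * (lgs x)\<^sup>2)))" for m :: nat
  have der: "DERIV (df m) s :> df (Suc m) s" if "m < 3" for m s
  proof -
    have "m = 0 \<or> m = 1 \<or> m = 2" using that by auto
    then show ?thesis
      by (auto simp: df_def power2_eq_square intro!: derivative_eq_intros lgs_deriv) (auto simp: algebra_simps)
  qed
  obtain s where s: "lgs (t + x) = (\<Sum>m<3. df m t / fact m * (t + x - t) ^ m) + df 3 s / fact 3 * (t + x - t) ^ 3"
    using Taylor[of 3 df lgs "min t (t + x)" "max t (t + x)" t "t + x"] der False by (auto simp: df_def)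
  have eq: "lgs (t + x) - (lgs t + lgs t * (1 - lgs t) * x + lgs t * (1 - lgs t) * (1 - 2 * lgs t) * x\<^sup>2 / 2) = df 3 s / 6 * x ^ 3"
    using s by (simp add: eval_nat_numeral lessThan_Suc df_def)
  have "\<bar>df 3 s\<bar> \<le> 6"
  proof -
    let ?l = "lgs s"
    have l: "0 \<le> ?l" "?l \<le> 1" by (rule lgs_bounds)+
    then have l2: "0 \<le> ?l\<^sup>2" "?l\<^sup>2 \<le> 1" by (auto simp: power_le_one)
    have "\<bar>?l * (1 - ?l)\<bar> \<le> 1" using l by (auto simp: abs_mult intro!: mult_le_one)
    moreover have "\<bar>1 - 6 * ?l + 6 * ?l\<^sup>2\<bar> \<le> 6"
    proof -
      have "?l\<^sup>2 \<le> ?l" using l by (simp add: power2_eq_square mult_left_le)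
      then show ?thesis using l l2 by linarith
    qed
    ultimately have "\<bar>?l * (1 - ?l)\<bar> * \<bar>1 - 6 * ?l + 6 * ?l\<^sup>2\<bar> \<le> 1 * 6" by (intro mult_mono) auto
    then show ?thesis by (simp add: df_def abs_mult)
  qed
  then have "\<bar>df 3 s / 6\<bar> * \<bar>x\<bar> ^ 3 \<le> 1 * \<bar>x\<bar> ^ 3" by (intro mult_right_mono) auto
  then show ?thesis unfolding eq by (simp add: abs_mult power_abs)
qed simp

text \<open>The factor \<open>n\<^sup>2\<close> outgrows the shift \<open>n\<close> wherever
  \<open>x > 0\<close>, while the shift drives the value at \<open>x = 0\<close> to zero; the limit
  is thus the indicator of a strict inequality.\<close>

definition step :: "nat \<Rightarrow> real \<Rightarrow> real" where
  "step n x = lgs ((real n)\<^sup>2 * x - real n)"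

lemma step_bounds: "0 \<le> step n x" "step n x \<le> 1"
  by (simp_all add: step_def lgs_bounds)

lemma measurable_step [measurable]: "step n \<in> borel_measurable borel"
  unfolding step_def[abs_def] lgs_def by measurable

lemma step_tendsto: "(\<lambda>n. step n x) \<longlonglongrightarrow> (if x > 0 then 1 else 0)"
proof (rule LIM_zero_cancel, rule Lim_null_comparison)
  show "(\<lambda>n. exp (- real n)) \<longlonglongrightarrow> 0"
    by (rule filterlim_compose[OF exp_at_bot filterlim_compose[OF filterlim_uminus_at_bot_at_top filterlim_real_sequentially]])
  show "\<forall>\<^sub>F n in sequentially. norm (step n x - (if x > 0 then 1 else 0)) \<le> exp (- real n)"
  proof (cases "x > 0")
    case True
    have "\<forall>\<^sub>F n in sequentially. real n \<ge> 2 / x"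
      using filterlim_real_sequentially by (auto simp: filterlim_at_top)
    then show ?thesis
    proof eventually_elim
      case (elim n)
      have "real n * 2 \<le> real n * (real n * x)" using elim True by (intro mult_left_mono) (auto simp: field_simps)
      then have "real n \<le> (real n)\<^sup>2 * x - real n" by (simp add: power2_eq_square)
      then have a: "exp (- ((real n)\<^sup>2 * x - real n)) \<le> exp (- real n)" by (subst exp_le_cancel_iff) linarith
      have "1 - step n x = exp (- ((real n)\<^sup>2 * x - real n)) / (1 + exp (- ((real n)\<^sup>2 * x - real n)))"
        using exp_gt_zero[of "- ((real n)\<^sup>2 * x - real n)"] unfolding step_def lgs_def
        by (simp add: field_simps add_eq_0_iff del: exp_gt_zero)
      also have "\<dots> \<le> exp (- ((real n)\<^sup>2 * x - real n)) / 1"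
        using exp_gt_zero[of "- ((real n)\<^sup>2 * x - real n)"] by (intro divide_left_mono) (auto simp: add_pos_pos)
      finally have "1 - step n x \<le> exp (- ((real n)\<^sup>2 * x - real n))" unfolding div_by_1 .
      from order_trans[OF this a] show ?case using step_bounds[of n x] True by (simp add: abs_le_iff)
    qed
  next
    case False
    have "step n x \<le> exp (- real n)" for n
    proof -
      define y where "y = (real n)\<^sup>2 * x - real n"
      have "(real n)\<^sup>2 * x \<le> 0" using False by (intro mult_nonneg_nonpos) auto
      then have y: "y \<le> - real n" by (simp add: y_def)
      have "lgs y = exp y / (exp y + 1)"
        unfolding lgs_def exp_minus using exp_gt_zero[of y] by (simp add: field_simps)
      also have "\<dots> \<le> exp y / 1" using exp_gt_zero[of y] by (intro divide_left_mono) (auto simp: add_pos_pos)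
      also have "\<dots> \<le> exp (- real n)" using y by simp
      finally show ?thesis by (simp add: step_def y_def)
    qed
    then show ?thesis using False step_bounds[of _ x] by auto
  qed
qed

text \<open>Compressing the logistic function by \<open>N = n\<^sup>2\<close> multiplies its
  derivatives by powers of \<open>N\<close>, all at most \<open>(1 + N) ^ 3\<close>. Signs and
  supports of the coefficients are the only information carried on.\<close>

lemma taylor_step:
  assumes D: "finite D" "a0 \<in> D"
  shows "\<exists>g H. taylor D (\<lambda>w. 1 - step n (w a0 - c)) g H \<and> (\<forall>w a. g w a \<le> 0) \<and>
    (\<forall>w a. a \<noteq> a0 \<longrightarrow> g w a = 0) \<and> (\<forall>w a b. a \<noteq> a0 \<or> b \<noteq> a0 \<longrightarrow> H w a b = 0)"
proof -
  define N where "N = (real n)\<^sup>2"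
  have N: "N \<ge> 0" by (simp add: N_def)
  define L where "L t = lgs (N * t - real n)" for t
  have L: "0 \<le> L t" "L t \<le> 1" for t by (simp_all add: L_def lgs_bounds)
  have L1: "0 \<le> L t * (1 - L t)" "L t * (1 - L t) \<le> 1" for t using L[of t] by (auto intro!: mult_le_one)
  have L2: "\<bar>L t * (1 - L t) * (1 - 2 * L t)\<bar> \<le> 1" for t
    using L[of t] L1[of t] by (simp only: abs_mult[of "L t * (1 - L t)"]) (rule mult_le_one; auto)
  have "N \<le> (1 + N) ^ 3" "N\<^sup>2 \<le> (1 + N) ^ 3" "1 \<le> (1 + N) ^ 3" "N ^ 3 \<le> (1 + N) ^ 3"
    using N by (auto simp: power2_eq_square power3_eq_cube algebra_simps intro!: power_mono one_le_power add_nonneg_nonneg mult_nonneg_nonneg)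
  note NN = this
  have "taylor D (\<lambda>w. L (w a0 - c)) (\<lambda>w a. if a = a0 then N * (L (w a0 - c) * (1 - L (w a0 - c))) else 0)
    (\<lambda>w a b. if a = a0 \<and> b = a0 then N\<^sup>2 * (L (w a0 - c) * (1 - L (w a0 - c)) * (1 - 2 * L (w a0 - c))) else 0)"
  proof (rule taylor_coordinate[OF D, where B = "(1 + N) ^ 3"])
    fix t x
    show "\<bar>L t\<bar> \<le> (1 + N) ^ 3" using L[of t] NN(3) by linarith
    have "N * (L t * (1 - L t)) \<le> N * 1" using L1[of t] N by (intro mult_left_mono) auto
    moreover have "0 \<le> N * (L t * (1 - L t))" using N L1(1)[of t] by (rule mult_nonneg_nonneg)
    ultimately show "\<bar>N * (L t * (1 - L t))\<bar> \<le> (1 + N) ^ 3" using NN(1) by linarith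
    have "N\<^sup>2 * \<bar>L t * (1 - L t) * (1 - 2 * L t)\<bar> \<le> N\<^sup>2 * 1" using L2[of t] by (intro mult_left_mono) auto
    then show "\<bar>N\<^sup>2 * (L t * (1 - L t) * (1 - 2 * L t))\<bar> \<le> (1 + N) ^ 3" using NN(2) by (simp add: abs_mult)
    have "\<bar>N * x\<bar> ^ 3 \<le> (1 + N) ^ 3 * \<bar>x\<bar> ^ 3"
      using N NN(4) by (simp add: abs_mult power_mult_distrib mult_right_mono)
    moreover have "N * (t + x) - real n = (N * t - real n) + N * x" by (simp add: algebra_simps)
    ultimately show "\<bar>L (t + x) - (L t + N * (L t * (1 - L t)) * x + N\<^sup>2 * (L t * (1 - L t) * (1 - 2 * L t)) * x\<^sup>2 / 2)\<bar> \<le> (1 + N) ^ 3 * \<bar>x\<bar> ^ 3"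
      using lgs_taylor[of "N * t - real n" "N * x"] by (simp add: L_def power_mult_distrib algebra_simps)
  qed
  note T = taylor_complement[OF this]
  have g: "0 \<le> N * (L t * (1 - L t))" for t using N L1(1)[of t] by (rule mult_nonneg_nonneg)
  show ?thesis
    unfolding step_def N_def[symmetric] L_def[symmetric]
    by (rule exI, rule exI, rule conjI[OF T]) (use g in auto)
qed

text \<open>All factors are nonnegative with nonpositive gradient, so the product has nonpositive
  gradient as well. Second derivatives within the row have no definite sign, and only their support
  is recorded.\<close>

lemma taylor_row:
  assumes D: "finite D" and U: "finite U" "\<And>j. j \<in> U \<Longrightarrow> (i, j) \<in> D"
  shows "\<exists>g H. taylor D (\<lambda>w. \<Prod>j\<in>U. 1 - step n (w (i, j) - c j)) g H \<and> (\<forall>w a. g w a \<le> 0) \<and>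
    (\<forall>w a. fst a \<noteq> i \<longrightarrow> g w a = 0) \<and> (\<forall>w a b. fst a \<noteq> i \<or> fst b \<noteq> i \<longrightarrow> H w a b = 0)"
  using U
proof (induction U)
  case empty
  show ?case using taylor_one[of D] by (intro exI[of _ "\<lambda>w a. 0"] exI[of _ "\<lambda>w a b. 0"]) auto
next
  case (insert j U)
  then obtain g H where gH: "taylor D (\<lambda>w. \<Prod>j\<in>U. 1 - step n (w (i, j) - c j)) g H" "\<And>w a. g w a \<le> 0"
    "\<And>w a. fst a \<noteq> i \<Longrightarrow> g w a = 0" "\<And>w a b. fst a \<noteq> i \<or> fst b \<noteq> i \<Longrightarrow> H w a b = 0"
    by auto
  obtain g' H' where gH': "taylor D (\<lambda>w. 1 - step n (w (i, j) - c j)) g' H'" "\<And>w a. g' w a \<le> 0"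
    "\<And>w a. a \<noteq> (i, j) \<Longrightarrow> g' w a = 0" "\<And>w a b. a \<noteq> (i, j) \<or> b \<noteq> (i, j) \<Longrightarrow> H' w a b = 0"
    using taylor_step[OF D, of "(i, j)" n "c j"] insert.prems by auto
  have pos: "0 \<le> (\<Prod>j\<in>U. 1 - step n (w (i, j) - c j))" "0 \<le> 1 - step n (w (i, j) - c j)" for w
    using step_bounds by (auto intro!: prod_nonneg)
  have z: "fst a \<noteq> i \<Longrightarrow> a \<noteq> (i, j)" for a by auto
  have eq: "(\<lambda>w. \<Prod>j\<in>insert j U. 1 - step n (w (i, j) - c j)) = (\<lambda>w. (1 - step n (w (i, j) - c j)) * (\<Prod>j\<in>U. 1 - step n (w (i, j) - c j)))"
    using insert.hyps by auto
  show ?case unfolding eq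
    using taylor_mult[OF D gH'(1) gH(1)]
    by (intro exI conjI allI impI, assumption)
       (use gH gH' pos z in \<open>auto intro!: add_nonpos_nonpos mult_nonneg_nonpos\<close>)
qed

text \<open>The smoothed indicator of the event that every row \<open>i\<close> has an entry above
  its threshold. Distinct rows enter through distinct factors, hence a mixed second derivative is
  built from products of nonnegative first derivatives. Entries within one row are left open, since
  the covariances to be compared agree there.\<close>

lemma taylor_table:
  assumes D: "finite D" and U: "finite U" and V: "finite V" and UV: "V \<times> U \<subseteq> D"
  shows "\<exists>g H. taylor D (\<lambda>w. \<Prod>i\<in>V. 1 - (\<Prod>j\<in>U. 1 - step n (w (i, j) - c i j))) g H \<and> (\<forall>w a. g w a \<ge> 0) \<and>
    (\<forall>w a b. fst a \<noteq> fst b \<longrightarrow> H w a b \<ge> 0)"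
  using V UV
proof (induction V)
  case empty
  show ?case using taylor_one[of D] by (intro exI[of _ "\<lambda>w a. 0"] exI[of _ "\<lambda>w a b. 0"]) auto
next
  case (insert i V)
  have sub: "V \<times> U \<subseteq> D" "\<And>j. j \<in> U \<Longrightarrow> (i, j) \<in> D" using insert.prems by auto
  from insert.IH[OF sub(1)] obtain g H where gH: "taylor D (\<lambda>w. \<Prod>i\<in>V. 1 - (\<Prod>j\<in>U. 1 - step n (w (i, j) - c i j))) g H" "\<And>w a. g w a \<ge> 0"
    "\<And>w a b. fst a \<noteq> fst b \<Longrightarrow> H w a b \<ge> 0"
    by blast
  from taylor_row[OF D U sub(2), of n "c i"]
  obtain g' H' where gH': "taylor D (\<lambda>w. \<Prod>j\<in>U. 1 - step n (w (i, j) - c i j)) g' H'" "\<And>w a. g' w a \<le> 0"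
    "\<And>w a. fst a \<noteq> i \<Longrightarrow> g' w a = 0" "\<And>w a b. fst a \<noteq> i \<or> fst b \<noteq> i \<Longrightarrow> H' w a b = 0"
    by blast
  have p1: "0 \<le> (\<Prod>j\<in>U. 1 - step n (w (i, j) - c i j))" "(\<Prod>j\<in>U. 1 - step n (w (i, j) - c i j)) \<le> 1" for i w
    using step_bounds by (auto intro!: prod_nonneg prod_le_1)
  have pos: "0 \<le> (\<Prod>i\<in>V. 1 - (\<Prod>j\<in>U. 1 - step n (w (i, j) - c i j)))" for w
    using p1 by (auto intro!: prod_nonneg)
  have eq: "(\<lambda>w. \<Prod>i\<in>insert i V. 1 - (\<Prod>j\<in>U. 1 - step n (w (i, j) - c i j))) = (\<lambda>w. (1 - (\<Prod>j\<in>U. 1 - step n (w (i, j) - c i j))) * (\<Prod>i\<in>V. 1 - (\<Prod>j\<in>U. 1 - step n (w (i, j) - c i j))))"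
    using insert.hyps by auto
  have q: "0 \<le> - g' w a" for w a using gH'(2)[of w a] by simp
  show ?case unfolding eq
  proof (intro exI conjI allI impI)
    show "taylor D (\<lambda>w. (1 - (\<Prod>j\<in>U. 1 - step n (w (i, j) - c i j))) * (\<Prod>i\<in>V. 1 - (\<Prod>j\<in>U. 1 - step n (w (i, j) - c i j))))
      (\<lambda>w a. (1 - (\<Prod>j\<in>U. 1 - step n (w (i, j) - c i j))) * g w a + (\<Prod>i\<in>V. 1 - (\<Prod>j\<in>U. 1 - step n (w (i, j) - c i j))) * (- g' w a))
      (\<lambda>w a b. (1 - (\<Prod>j\<in>U. 1 - step n (w (i, j) - c i j))) * H w a b + (\<Prod>i\<in>V. 1 - (\<Prod>j\<in>U. 1 - step n (w (i, j) - c i j))) * (- H' w a b)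
         + (- g' w a) * g w b + g w a * (- g' w b))"
      by (rule taylor_mult[OF D taylor_complement[OF gH'(1)] gH(1)])
  next
    fix w a
    show "0 \<le> (1 - (\<Prod>j\<in>U. 1 - step n (w (i, j) - c i j))) * g w a + (\<Prod>i\<in>V. 1 - (\<Prod>j\<in>U. 1 - step n (w (i, j) - c i j))) * (- g' w a)"
      using p1[of w i] pos[of w] q gH(2) by (intro add_nonneg_nonneg mult_nonneg_nonneg) auto
  next
    fix w and a b :: "'a \<times> 'b" assume ab: "fst a \<noteq> fst b"
    have "H' w a b = 0" using ab gH'(4)[of a b w] by auto
    moreover have "0 \<le> (1 - (\<Prod>j\<in>U. 1 - step n (w (i, j) - c i j))) * H w a b"
      using p1(2)[of w i] gH(3)[OF ab, of w] by (intro mult_nonneg_nonneg) auto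
    moreover have "0 \<le> (- g' w a) * g w b" "0 \<le> g w a * (- g' w b)"
      by (rule mult_nonneg_nonneg[OF q gH(2)], rule mult_nonneg_nonneg[OF gH(2) q])
    ultimately show "0 \<le> (1 - (\<Prod>j\<in>U. 1 - step n (w (i, j) - c i j))) * H w a b + (\<Prod>i\<in>V. 1 - (\<Prod>j\<in>U. 1 - step n (w (i, j) - c i j))) * (- H' w a b)
         + (- g' w a) * g w b + g w a * (- g' w b)"
      by simp
  qed
qed

lemma loc_meas_table:
  fixes c :: "'v \<Rightarrow> 'u \<Rightarrow> real"
  assumes U: "finite U" and V: "finite V"
  shows "loc_meas (V \<times> U) (\<lambda>w. \<Prod>i\<in>V. 1 - (\<Prod>j\<in>U. 1 - step n (w (i, j) - c i j)))"
  unfolding loc_meas_def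
proof
  show "(\<lambda>w. \<Prod>i\<in>V. 1 - (\<Prod>j\<in>U. 1 - step n (w (i, j) - c i j))) \<in> borel_measurable (\<Pi>\<^sub>M a\<in>V \<times> U. borel)"
    by (intro borel_measurable_prod borel_measurable_diff borel_measurable_const measurable_compose[OF _ measurable_step] measurable_component_singleton) auto
  show "\<forall>w. (\<Prod>i\<in>V. 1 - (\<Prod>j\<in>U. 1 - step n (restrict w (V \<times> U) (i, j) - c i j))) = (\<Prod>i\<in>V. 1 - (\<Prod>j\<in>U. 1 - step n (w (i, j) - c i j)))"
    by (intro allI prod.cong refl arg_cong2[of _ _ _ _ "(-)"]) auto
qed

section \<open>Comparison of probabilities for finite and countable tables\<close>

definition gcov :: "'i set \<Rightarrow> ('a \<Rightarrow> 'i \<Rightarrow> real) \<Rightarrow> 'a \<Rightarrow> 'a \<Rightarrow> real" where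
  "gcov L M a b = (\<Sum>k\<in>L. M a k * M b k)"

text \<open>Within a row the covariances coincide, so the second derivatives of unknown sign drop
  out; across rows both factors of each summand are nonnegative.\<close>

lemma gordon_smooth:
  fixes M :: "'v \<times> 'u \<Rightarrow> 'i \<Rightarrow> real"
  assumes I: "finite I" "L \<subseteq> I" and U: "finite U" and V: "finite V"
    and eq: "\<And>i j j'. gcov L M (i, j) (i, j') = gcov (I - L) M (i, j) (i, j')"
    and le: "\<And>i i' j j'. gcov (I - L) M (i, j) (i', j') \<le> gcov L M (i, j) (i', j')"
  shows "(\<integral>z. (\<Prod>i\<in>V. 1 - (\<Prod>j\<in>U. 1 - step n (lin_on (I - L) M z (i, j) - c i j))) \<partial>gauss I)
    \<le> (\<integral>z. (\<Prod>i\<in>V. 1 - (\<Prod>j\<in>U. 1 - step n (lin_on L M z (i, j) - c i j))) \<partial>gauss I)"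
proof -
  have D: "finite (V \<times> U)" using U V by simp
  obtain g H where gH: "taylor (V \<times> U) (\<lambda>w. \<Prod>i\<in>V. 1 - (\<Prod>j\<in>U. 1 - step n (w (i, j) - c i j))) g H"
    "\<And>w a b. fst a \<noteq> fst b \<Longrightarrow> H w a b \<ge> 0"
    using taylor_table[OF D U V subset_refl, of n c] by blast
  show ?thesis
  proof (rule gaussian_comparison[OF I D loc_meas_table[OF U V] gH(1)])
    fix w
    have "0 \<le> H w a b * (gcov L M a b - gcov (I - L) M a b)" for a b
    proof (cases "fst a = fst b")
      case True
      then have "gcov L M a b = gcov (I - L) M a b" using eq[of "fst a" "snd a" "snd b"] by (metis prod.collapse)
      then show ?thesis by simp
    next
      case False
      have "gcov (I - L) M a b \<le> gcov L M a b" using le[of "fst a" "snd a" "fst b" "snd b"] by simp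
      then show ?thesis using gH(2)[OF False, of w] by simp
    qed
    then show "0 \<le> (\<Sum>a\<in>V \<times> U. \<Sum>b\<in>V \<times> U. H w a b * ((\<Sum>k\<in>L. M a k * M b k) - (\<Sum>k\<in>I - L. M a k * M b k)))"
      unfolding gcov_def by (intro sum_nonneg)
  qed
qed

lemma table_tendsto:
  fixes M :: "'v \<times> 'u \<Rightarrow> 'i \<Rightarrow> real"
  assumes I: "finite I" "L \<subseteq> I" and U: "finite U" and V: "finite V"
  shows "(\<lambda>n. \<integral>z. (\<Prod>i\<in>V. 1 - (\<Prod>j\<in>U. 1 - step n (lin_on L M z (i, j) - c i j))) \<partial>gauss I)
    \<longlonglongrightarrow> measure (gauss I) {z \<in> space (gauss I). \<forall>i\<in>V. \<exists>j\<in>U. c i j < lin_on L M z (i, j)}"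
proof -
  interpret G: prob_space "gauss I" by (rule prob_space_gauss)
  let ?A = "{z \<in> space (gauss I). \<forall>i\<in>V. \<exists>j\<in>U. c i j < lin_on L M z (i, j)}"
  note [measurable] = measurable_lin_on[OF I(2)]
  have A: "?A \<in> sets (gauss I)" using U V by measurable
  have ind: "(\<Prod>i\<in>V. 1 - (\<Prod>j\<in>U. 1 - (if x i j > 0 then 1 else 0))) = (if \<forall>i\<in>V. \<exists>j\<in>U. x i j > 0 then 1 else (0::real))" for x :: "'v \<Rightarrow> 'u \<Rightarrow> real"
  proof -
    have 1: "(\<Prod>j\<in>U. 1 - (if x i j > 0 then 1 else 0)) = (if \<exists>j\<in>U. x i j > 0 then 0 else (1::real))" for i
      using U by (auto intro!: prod.neutral prod_zero)
    show ?thesis unfolding 1 using V by (auto intro!: prod.neutral prod_zero)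
  qed
  have "(\<lambda>n. \<integral>z. (\<Prod>i\<in>V. 1 - (\<Prod>j\<in>U. 1 - step n (lin_on L M z (i, j) - c i j))) \<partial>gauss I)
    \<longlonglongrightarrow> (\<integral>z. indicator ?A z \<partial>gauss I)"
  proof (rule integral_dominated_convergence[where w = "\<lambda>_. 1"])
    fix n
    show "(\<lambda>z. \<Prod>i\<in>V. 1 - (\<Prod>j\<in>U. 1 - step n (lin_on L M z (i, j) - c i j))) \<in> borel_measurable (gauss I)"
      by measurable
    have p1: "0 \<le> (\<Prod>j\<in>U. 1 - step n (w j))" "(\<Prod>j\<in>U. 1 - step n (w j)) \<le> 1" for w
      using step_bounds by (auto intro!: prod_nonneg prod_le_1)
    have "0 \<le> (\<Prod>i\<in>V. 1 - (\<Prod>j\<in>U. 1 - step n (w i j)))" "(\<Prod>i\<in>V. 1 - (\<Prod>j\<in>U. 1 - step n (w i j))) \<le> 1" for w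
      using p1 by (auto intro!: prod_nonneg prod_le_1)
    then show "AE z in gauss I. norm (\<Prod>i\<in>V. 1 - (\<Prod>j\<in>U. 1 - step n (lin_on L M z (i, j) - c i j))) \<le> 1"
      by (intro always_eventually allI) (simp only: real_norm_def abs_of_nonneg)
  next
    show "AE z in gauss I. (\<lambda>n. \<Prod>i\<in>V. 1 - (\<Prod>j\<in>U. 1 - step n (lin_on L M z (i, j) - c i j))) \<longlonglongrightarrow> indicator ?A z"
    proof (rule AE_I2)
      fix z assume z: "z \<in> space (gauss I)"
      have "(\<lambda>n. \<Prod>i\<in>V. 1 - (\<Prod>j\<in>U. 1 - step n (lin_on L M z (i, j) - c i j)))
        \<longlonglongrightarrow> (\<Prod>i\<in>V. 1 - (\<Prod>j\<in>U. 1 - (if lin_on L M z (i, j) - c i j > 0 then 1 else 0)))"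
        by (intro tendsto_prod tendsto_diff tendsto_const step_tendsto)
      also have "(\<Prod>i\<in>V. 1 - (\<Prod>j\<in>U. 1 - (if lin_on L M z (i, j) - c i j > 0 then 1 else 0))) = indicat_real ?A z"
        unfolding ind[of "\<lambda>i j. lin_on L M z (i, j) - c i j"] using z by (simp add: indicator_def)
      finally show "(\<lambda>n. \<Prod>i\<in>V. 1 - (\<Prod>j\<in>U. 1 - step n (lin_on L M z (i, j) - c i j))) \<longlonglongrightarrow> indicator ?A z" .
    qed
  qed (use A in auto)
  then show ?thesis using A by simp
qed

lemma gordon_finite:
  fixes M :: "'v \<times> 'u \<Rightarrow> 'i \<Rightarrow> real"
  assumes I: "finite I" "L \<subseteq> I" and U: "finite U" and V: "finite V"
    and eq: "\<And>i j j'. gcov L M (i, j) (i, j') = gcov (I - L) M (i, j) (i, j')"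
    and le: "\<And>i i' j j'. gcov (I - L) M (i, j) (i', j') \<le> gcov L M (i, j) (i', j')"
  shows "measure (gauss I) {z \<in> space (gauss I). \<forall>i\<in>V. \<exists>j\<in>U. c i j < lin_on (I - L) M z (i, j)}
    \<le> measure (gauss I) {z \<in> space (gauss I). \<forall>i\<in>V. \<exists>j\<in>U. c i j < lin_on L M z (i, j)}"
  by (rule LIMSEQ_le[OF table_tendsto[OF I(1) _ U V] table_tendsto[OF I U V]])
     (use gordon_smooth[OF I U V eq le] in auto)

text \<open>The event increases in the number \<open>q\<close> of columns and decreases in the
  number \<open>p\<close> of rows. The limits are therefore taken one after the other, first in
  \<open>q\<close> for fixed \<open>p\<close>.\<close>

lemma measure_Ball_Bex_tendsto:
  assumes "prob_space N" and Q: "\<And>i j. {z \<in> space N. Q i j z} \<in> sets N"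
  shows "(\<lambda>q. measure N {z \<in> space N. \<forall>i\<in>{..<p::nat}. \<exists>j\<in>{..<q::nat}. Q i j z})
      \<longlonglongrightarrow> measure N {z \<in> space N. \<forall>i\<in>{..<p}. \<exists>j. Q i j z}"
    and "(\<lambda>p. measure N {z \<in> space N. \<forall>i\<in>{..<p::nat}. \<exists>j. Q i j z})
      \<longlonglongrightarrow> measure N {z \<in> space N. \<forall>i::nat. \<exists>j::nat. Q i j z}"
proof -
  interpret prob_space N by fact
  note [measurable] = Q
  have "{z \<in> space N. \<forall>i\<in>{..<p}. \<exists>j. Q i j z} = (\<Union>q. {z \<in> space N. \<forall>i\<in>{..<p}. \<exists>j\<in>{..<q}. Q i j z})"
  proof (intro equalityI subsetI)
    fix z assume z: "z \<in> {z \<in> space N. \<forall>i\<in>{..<p}. \<exists>j. Q i j z}"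
    then obtain j where j: "\<And>i. i < p \<Longrightarrow> Q i (j i) z" by (auto simp: Ball_def) metis
    \<comment> \<open>The sum of the finitely many witnesses bounds each of them.\<close>
    have "\<forall>i\<in>{..<p}. \<exists>k\<in>{..<Suc (\<Sum>i<p. j i)}. Q i k z"
    proof
      fix i assume "i \<in> {..<p}"
      then show "\<exists>k\<in>{..<Suc (\<Sum>i<p. j i)}. Q i k z"
        using j[of i] member_le_sum[of i "{..<p}" j] by (intro bexI[of _ "j i"]) (auto simp: less_Suc_eq_le)
    qed
    then show "z \<in> (\<Union>q. {z \<in> space N. \<forall>i\<in>{..<p}. \<exists>j\<in>{..<q}. Q i j z})" using z by auto
  qed auto
  moreover have "(\<lambda>q. measure N {z \<in> space N. \<forall>i\<in>{..<p}. \<exists>j\<in>{..<q}. Q i j z})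
      \<longlonglongrightarrow> measure N (\<Union>q. {z \<in> space N. \<forall>i\<in>{..<p}. \<exists>j\<in>{..<q}. Q i j z})"
  proof (rule finite_Lim_measure_incseq)
    show "range (\<lambda>q. {z \<in> space N. \<forall>i\<in>{..<p}. \<exists>j\<in>{..<q}. Q i j z}) \<subseteq> sets N"
      by (intro image_subsetI) measurable
    show "incseq (\<lambda>q. {z \<in> space N. \<forall>i\<in>{..<p}. \<exists>j\<in>{..<q}. Q i j z})"
      unfolding incseq_def by (auto, meson less_le_trans lessThan_iff)
  qed
  ultimately show "(\<lambda>q. measure N {z \<in> space N. \<forall>i\<in>{..<p::nat}. \<exists>j\<in>{..<q::nat}. Q i j z})
      \<longlonglongrightarrow> measure N {z \<in> space N. \<forall>i\<in>{..<p}. \<exists>j. Q i j z}" by simp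
  have "{z \<in> space N. \<forall>i::nat. \<exists>j::nat. Q i j z} = (\<Inter>p. {z \<in> space N. \<forall>i\<in>{..<p}. \<exists>j. Q i j z})"
    by auto
  moreover have "(\<lambda>p. measure N {z \<in> space N. \<forall>i\<in>{..<p}. \<exists>j. Q i j z})
      \<longlonglongrightarrow> measure N (\<Inter>p. {z \<in> space N. \<forall>i\<in>{..<p}. \<exists>j. Q i j z})"
  proof (rule finite_Lim_measure_decseq)
    show "range (\<lambda>p. {z \<in> space N. \<forall>i\<in>{..<p}. \<exists>j. Q i j z}) \<subseteq> sets N"
      by (intro image_subsetI) measurable
    show "decseq (\<lambda>p. {z \<in> space N. \<forall>i\<in>{..<p}. \<exists>j. Q i j z})"
      unfolding decseq_def by auto
  qed
  ultimately show "(\<lambda>p. measure N {z \<in> space N. \<forall>i\<in>{..<p::nat}. \<exists>j. Q i j z})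
      \<longlonglongrightarrow> measure N {z \<in> space N. \<forall>i::nat. \<exists>j::nat. Q i j z}" by simp
qed

theorem gordon_comparison:
  fixes M :: "nat \<times> nat \<Rightarrow> 'i \<Rightarrow> real"
  assumes I: "finite I" "L \<subseteq> I"
    and eq: "\<And>i j j'. gcov L M (i, j) (i, j') = gcov (I - L) M (i, j) (i, j')"
    and le: "\<And>i i' j j'. gcov (I - L) M (i, j) (i', j') \<le> gcov L M (i, j) (i', j')"
  shows "measure (gauss I) {z \<in> space (gauss I). \<forall>i. \<exists>j. c i j < lin_on (I - L) M z (i, j)}
    \<le> measure (gauss I) {z \<in> space (gauss I). \<forall>i. \<exists>j. c i j < lin_on L M z (i, j)}"
proof -
  have m: "{z \<in> space (gauss I). c i j < lin_on J M z (i, j)} \<in> sets (gauss I)" if "J \<subseteq> I" for J i j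
    using measurable_lin_on[OF that] by measurable
  note t1 = measure_Ball_Bex_tendsto[OF prob_space_gauss, where Q = "\<lambda>i j z. c i j < lin_on (I - L) M z (i, j)", OF m[OF Diff_subset]]
  note t2 = measure_Ball_Bex_tendsto[OF prob_space_gauss, where Q = "\<lambda>i j z. c i j < lin_on L M z (i, j)", OF m[OF I(2)]]
  have "measure (gauss I) {z \<in> space (gauss I). \<forall>i\<in>{..<p}. \<exists>j. c i j < lin_on (I - L) M z (i, j)}
    \<le> measure (gauss I) {z \<in> space (gauss I). \<forall>i\<in>{..<p}. \<exists>j. c i j < lin_on L M z (i, j)}" for p
    by (rule LIMSEQ_le[OF t1(1) t2(1)]) (use gordon_finite[OF I _ _ eq le] in auto)
  then show ?thesis
    by (intro LIMSEQ_le[OF t1(2) t2(2)]) auto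
qed

text \<open>One Gaussian array carries both processes: the entries \<open>(a, b)\<close> with \<open>a < m\<close>, \<open>b < n\<close> form the design and \<open>(m, n)\<close> is
  an extra scalar, as needed to equalize the variances of \<open>po\<close> (primary) and \<open>ao\<close> (auxiliary); the column \<open>(a, n)\<close> is \<open>g\<close>
  and the row \<open>(m, b)\<close> is \<open>h\<close>.\<close>

definition gidx :: "nat \<Rightarrow> nat \<Rightarrow> (nat \<times> nat) set" where
  "gidx m n = {..m} \<times> {..n}"

definition pidx :: "nat \<Rightarrow> nat \<Rightarrow> (nat \<times> nat) set" where
  "pidx m n = insert (m, n) ({..<m} \<times> {..<n})"

text \<open>Coefficients of both processes on the common array: the block \<open>pidx\<close> yields
  \<open>po\<close>, its complement \<open>ao\<close>. The minus sign at the design makes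
  \<open>po\<close> plus \<open>ip m u \<xi>\<close> the pairing of \<open>u\<close> with the
  residual, up to the scalar term.\<close>

definition bil :: "nat \<Rightarrow> nat \<Rightarrow> (nat \<Rightarrow> real) \<Rightarrow> (nat \<Rightarrow> real) \<Rightarrow> nat \<times> nat \<Rightarrow> real" where
  "bil m n x u k = (if fst k < m then (if snd k < n then - (u (fst k) * x (snd k)) else enorm n x * u (fst k))
     else (if snd k < n then - x (snd k) else enorm n x))"

definition po :: "nat \<Rightarrow> nat \<Rightarrow> (nat \<times> nat \<Rightarrow> real) \<Rightarrow> (nat \<Rightarrow> real) \<Rightarrow> (nat \<Rightarrow> real) \<Rightarrow> real" where
  "po m n z x u = enorm n x * z (m, n) - ip m u (\<lambda>a. ip n (\<lambda>b. z (a, b)) x)"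

definition ao :: "nat \<Rightarrow> nat \<Rightarrow> (nat \<times> nat \<Rightarrow> real) \<Rightarrow> (nat \<Rightarrow> real) \<Rightarrow> (nat \<Rightarrow> real) \<Rightarrow> real" where
  "ao m n z x u = enorm n x * ip m u (\<lambda>a. z (a, n)) - ip n (\<lambda>b. z (m, b)) x"

lemma gidx_diff: "gidx m n - pidx m n = {..<m} \<times> {n} \<union> {m} \<times> {..<n}"
  by (auto simp: gidx_def pidx_def)

lemma sum_pidx: "(\<Sum>k\<in>pidx m n. f k) = f (m, n) + (\<Sum>a<m. \<Sum>b<n. f (a, b))"
  unfolding pidx_def by (subst sum.insert) (auto simp: sum.cartesian_product)

lemma sum_gidx_diff: "(\<Sum>k\<in>gidx m n - pidx m n. f k) = (\<Sum>a<m. f (a, n)) + (\<Sum>b<n. f (m, b))"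
proof -
  have "(\<Sum>k\<in>{..<m} \<times> {n}. f k) = (\<Sum>a<m. f (a, n))" "(\<Sum>k\<in>{m} \<times> {..<n}. f k) = (\<Sum>b<n. f (m, b))"
  proof -
    have "{..<m} \<times> {n} = (\<lambda>a. (a, n)) ` {..<m}" "{m} \<times> {..<n} = (\<lambda>b. (m, b)) ` {..<n}" by auto
    then show "(\<Sum>k\<in>{..<m} \<times> {n}. f k) = (\<Sum>a<m. f (a, n))" "(\<Sum>k\<in>{m} \<times> {..<n}. f k) = (\<Sum>b<n. f (m, b))"
      by (simp_all add: sum.reindex inj_on_def)
  qed
  then show ?thesis unfolding gidx_diff by (subst sum.union_disjoint) auto
qed

lemma lin_on_po: "lin_on (pidx m n) (\<lambda>k. bil m n (x k) (u k)) z k = po m n z (x k) (u k)"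
  unfolding lin_on_def sum_pidx
  by (simp add: bil_def po_def ip_def sum_distrib_left sum_negf algebra_simps)

lemma lin_on_ao: "lin_on (gidx m n - pidx m n) (\<lambda>k. bil m n (x k) (u k)) z k = ao m n z (x k) (u k)"
  unfolding lin_on_def sum_gidx_diff
  by (simp add: bil_def ao_def ip_def sum_distrib_left sum_negf algebra_simps)

lemma gcov_po:
  "gcov (pidx m n) (\<lambda>k. bil m n (x k) (u k)) k l = enorm n (x k) * enorm n (x l) + ip m (u k) (u l) * ip n (x k) (x l)"
  unfolding gcov_def sum_pidx
  by (simp add: bil_def ip_def sum_product algebra_simps)

lemma gcov_ao:
  "gcov (gidx m n - pidx m n) (\<lambda>k. bil m n (x k) (u k)) k l = enorm n (x k) * enorm n (x l) * ip m (u k) (u l) + ip n (x k) (x l)"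
  unfolding gcov_def sum_gidx_diff
  by (simp add: bil_def ip_def sum_distrib_left algebra_simps)

text \<open>The difference factors as
  \<open>enorm n (x k) * enorm n (x l) - ip n (x k) (x l)\<close> times
  \<open>1 - ip m (u k) (u l)\<close>, both nonnegative by Cauchy-Schwarz. The first factor vanishes
  for equal \<open>x\<close>, the second for equal \<open>u\<close>, so either of them may serve as
  the row index.\<close>

lemma gcov_diff:
  assumes "enorm m (u k) = 1" "enorm m (u l) = 1"
  shows "gcov (gidx m n - pidx m n) (\<lambda>k. bil m n (x k) (u k)) k l \<le> gcov (pidx m n) (\<lambda>k. bil m n (x k) (u k)) k l"
proof -
  have "0 \<le> (enorm n (x k) * enorm n (x l) - ip n (x k) (x l)) * (1 - ip m (u k) (u l))"
    using ip_le_enorm[of n "x k" "x l"] ip_le_enorm[of m "u k" "u l"] assms by (intro mult_nonneg_nonneg) auto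
  then show ?thesis unfolding gcov_po gcov_ao by (simp add: algebra_simps)
qed

lemma finite_gidx: "finite (gidx m n)" "pidx m n \<subseteq> gidx m n"
  by (auto simp: gidx_def pidx_def)

text \<open>Rows are indexed by \<open>x\<close>. That some \<open>u\<close> exceeds the threshold
  for every \<open>x\<close> is a lower bound on all residual norms at once.\<close>

lemma gordon_lower:
  assumes u: "\<And>j. enorm m (u j) = 1"
  shows "measure (gauss (gidx m n)) {z \<in> space (gauss (gidx m n)). \<forall>i::nat. \<exists>j::nat. c i j < ao m n z (x i) (u j)}
    \<le> measure (gauss (gidx m n)) {z \<in> space (gauss (gidx m n)). \<forall>i. \<exists>j. c i j < po m n z (x i) (u j)}"
proof -
  define M where "M = (\<lambda>k. bil m n (x (fst k)) (u (snd k)))"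
  note [simp] = lin_on_po[of m n "\<lambda>k. x (fst k)" "\<lambda>k. u (snd k)", folded M_def]
    lin_on_ao[of m n "\<lambda>k. x (fst k)" "\<lambda>k. u (snd k)", folded M_def]
  note p = gcov_po[of m n "\<lambda>k. x (fst k)" "\<lambda>k. u (snd k)", folded M_def]
  note a = gcov_ao[of m n "\<lambda>k. x (fst k)" "\<lambda>k. u (snd k)", folded M_def]
  note d = gcov_diff[of m "\<lambda>k. u (snd k)" _ _ n "\<lambda>k. x (fst k)", folded M_def]
  have e: "gcov (pidx m n) M (i, j) (i, j') = gcov (gidx m n - pidx m n) M (i, j) (i, j')" for i j j'
    unfolding p a by (simp add: enorm_sq[symmetric] power2_eq_square)
  have le: "gcov (gidx m n - pidx m n) M (i, j) (i', j') \<le> gcov (pidx m n) M (i, j) (i', j')" for i i' j j'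
    by (rule d) (use u in auto)
  show ?thesis using gordon_comparison[OF finite_gidx e le, of c] by simp
qed

text \<open>Rows are indexed by \<open>u\<close>. The conclusion offers an \<open>x\<close> for each
  \<open>u\<close> separately; merging them into one \<open>x\<close> for all \<open>u\<close> is
  left to convexity in \<open>min_residual_le\<close>.\<close>

lemma gordon_upper:
  assumes u: "\<And>j. enorm m (u j) = 1"
  shows "measure (gauss (gidx m n)) {z \<in> space (gauss (gidx m n)). \<forall>j::nat. \<exists>i::nat. c i j < ao m n z (x i) (u j)}
    \<le> measure (gauss (gidx m n)) {z \<in> space (gauss (gidx m n)). \<forall>j. \<exists>i. c i j < po m n z (x i) (u j)}"
proof -
  define M where "M = (\<lambda>k. bil m n (x (snd k)) (u (fst k)))"
  note [simp] = lin_on_po[of m n "\<lambda>k. x (snd k)" "\<lambda>k. u (fst k)", folded M_def]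
    lin_on_ao[of m n "\<lambda>k. x (snd k)" "\<lambda>k. u (fst k)", folded M_def]
  note p = gcov_po[of m n "\<lambda>k. x (snd k)" "\<lambda>k. u (fst k)", folded M_def]
  note a = gcov_ao[of m n "\<lambda>k. x (snd k)" "\<lambda>k. u (fst k)", folded M_def]
  note d = gcov_diff[of m "\<lambda>k. u (fst k)" _ _ n "\<lambda>k. x (snd k)", folded M_def]
  have "ip m (u j) (u j) = 1" for j using u[of j] by (simp add: enorm_sq[symmetric])
  then have e: "gcov (pidx m n) M (i, j) (i, j') = gcov (gidx m n - pidx m n) M (i, j) (i, j')" for i j j'
    unfolding p a by simp
  have le: "gcov (gidx m n - pidx m n) M (i, j) (i', j') \<le> gcov (pidx m n) M (i, j) (i', j')" for i i' j j'
    by (rule d) (use u in auto)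
  show ?thesis using gordon_comparison[OF finite_gidx e le, of "\<lambda>j i. c i j"] by simp
qed

section \<open>Concentration of Gaussian functionals\<close>

lemma integrable_fst_gauss:
  fixes f :: "('i \<Rightarrow> real) \<Rightarrow> real"
  assumes "integrable (gauss I) f"
  shows "integrable (gauss I \<Otimes>\<^sub>M gauss L) (\<lambda>p. f (fst p))"
proof -
  interpret G: prob_space "gauss L" by (rule prob_space_gauss)
  show ?thesis
    by (rule integrable_distr[of fst _ "gauss I"]) (use assms in \<open>auto simp: G.distr_pair_fst\<close>)
qed

lemma integrable_snd_gauss:
  fixes f :: "('i \<Rightarrow> real) \<Rightarrow> real"
  assumes "integrable (gauss I) f"
  shows "integrable (gauss L \<Otimes>\<^sub>M gauss I) (\<lambda>p. f (snd p))"
proof -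
  interpret G: prob_space "gauss K" for K :: "'i set" by (rule prob_space_gauss)
  interpret H: prob_space "gauss L" by (rule prob_space_gauss)
  interpret P: pair_prob_space "gauss L" "gauss I" ..
  show ?thesis
    using P.integrable_product_swap_iff[of "\<lambda>p. f (snd p)"] integrable_fst_gauss[OF assms, of L]
    by (simp add: case_prod_unfold)
qed

lemma measurable_enorm_gauss [measurable]: "enorm n \<in> borel_measurable (gauss {..<n})"
  unfolding enorm_eq_sqrt[abs_def] ip_def by measurable

lemma integrable_enorm_pow4: "integrable (gauss {..<n}) (\<lambda>h. enorm n h ^ 4)"
proof (rule Bochner_Integration.integrable_bound)
  show "integrable (gauss {..<n}) (\<lambda>h. real n * (\<Sum>i<n. \<bar>h i\<bar> ^ 4))"
    by (intro integrable_mult_right Bochner_Integration.integrable_sum integrable_gauss_abs_power) auto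
  have "enorm n h ^ 4 \<le> real n * (\<Sum>i<n. \<bar>h i\<bar> ^ 4)" for h
  proof -
    have "enorm n h ^ 4 = (\<Sum>i<n. 1 * (h i)\<^sup>2)\<^sup>2"
      using enorm_sq[of n h] by (simp add: ip_def power2_eq_square power4_eq_xxxx mult.assoc)
    also have "\<dots> \<le> (\<Sum>i<n. 1\<^sup>2) * (\<Sum>i<n. ((h i)\<^sup>2)\<^sup>2)" by (rule Cauchy_Schwarz_ineq_sum)
    also have "\<dots> = real n * (\<Sum>i<n. \<bar>h i\<bar> ^ 4)" by (simp add: power_even_abs)
    finally show ?thesis .
  qed
  then show "AE h in gauss {..<n}. norm (enorm n h ^ 4) \<le> norm (real n * (\<Sum>i<n. \<bar>h i\<bar> ^ 4))"
    by (intro always_eventually allI) (smt (verit) real_norm_def zero_le_power enorm_nonneg)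
qed measurable

lemma integrable_enorm_sq: "integrable (gauss {..<n}) (\<lambda>h. (enorm n h)\<^sup>2)"
  unfolding enorm_sq ip_def
  by (intro Bochner_Integration.integrable_sum gauss_second_moments(2)) auto

lemma one_minus_cos_le: "1 - cos x \<le> x\<^sup>2 / 2" for x :: real
proof -
  have "cos x = 1 - 2 * (sin (x / 2))\<^sup>2" using cos_double_sin[of "x / 2"] by simp
  moreover have "(sin (x / 2))\<^sup>2 \<le> (x / 2)\<^sup>2"
    using abs_sin_x_le_abs_x[of "x / 2"] by (simp only: abs_le_square_iff)
  ultimately show ?thesis by (simp add: power2_eq_square)
qed

text \<open>For independent copies \<open>x\<close> and \<open>y\<close>, the mean square of
  \<open>J y - J x\<close> is twice the variance. The copies are joined by the quarter circle
  \<open>cos t * x + sin t * y\<close>, cut into \<open>N\<close> arcs. By rotation invariance all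
  arcs contribute alike, and the leading part \<open>ip n (v x) y\<close> of an arc has the second
  moment of \<open>enorm n (v x)\<close>, because \<open>y\<close> is independent of
  \<open>x\<close>. The constant is free of the dimension, which enters only the remainder that
  vanishes as \<open>N\<close> grows.\<close>

lemma gauss_variance_bound:
  fixes J :: "(nat \<Rightarrow> real) \<Rightarrow> real" and v :: "(nat \<Rightarrow> real) \<Rightarrow> nat \<Rightarrow> real"
  assumes mJ [measurable]: "J \<in> borel_measurable (gauss {..<n})"
    and mv [measurable]: "\<And>i. i < n \<Longrightarrow> (\<lambda>h. v h i) \<in> borel_measurable (gauss {..<n})"
    and cong: "\<And>x y. (\<And>i. i < n \<Longrightarrow> x i = y i) \<Longrightarrow> J x = J y"
    and w: "w \<ge> 0"
    and J0: "\<And>h. \<bar>J h\<bar> \<le> w * (enorm n h)\<^sup>2" and v0: "\<And>h. enorm n (v h) \<le> w * enorm n h"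
    and first: "\<And>h y. \<bar>J (\<lambda>i. h i + y i) - J h - ip n (v h) y\<bar> \<le> w * (enorm n y)\<^sup>2"
  shows "integrable (gauss {..<n}) J" and "integrable (gauss {..<n}) (\<lambda>h. (J h)\<^sup>2)"
    and "integrable (gauss {..<n}) (\<lambda>h. (enorm n (v h))\<^sup>2)"
    and "(\<integral>h. (J h - (\<integral>h. J h \<partial>gauss {..<n}))\<^sup>2 \<partial>gauss {..<n}) \<le> 4 * (\<integral>h. (enorm n (v h))\<^sup>2 \<partial>gauss {..<n})"
proof -
  let ?G = "gauss {..<n}" and ?P = "gauss {..<n} \<Otimes>\<^sub>M gauss {..<n}"
  interpret G: prob_space ?G by (rule prob_space_gauss)
  interpret P: pair_prob_space ?G ?G ..
  show iJ2: "integrable ?G (\<lambda>h. (J h)\<^sup>2)"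
  proof (rule Bochner_Integration.integrable_bound)
    show "integrable ?G (\<lambda>h. w\<^sup>2 * enorm n h ^ 4)" using integrable_enorm_pow4 by auto
    have "(J h)\<^sup>2 \<le> w\<^sup>2 * enorm n h ^ 4" for h
      using power_mono[OF J0[of h] abs_ge_zero, of 2] by (simp add: power_mult_distrib power_mult[symmetric])
    then show "AE h in ?G. norm ((J h)\<^sup>2) \<le> norm (w\<^sup>2 * enorm n h ^ 4)" by auto
  qed measurable
  show iJ: "integrable ?G J"
    by (rule G.square_integrable_imp_integrable) (use iJ2 in auto)
  have mve [measurable]: "(\<lambda>h. enorm n (v h)) \<in> borel_measurable ?G"
    unfolding enorm_eq_sqrt ip_def by measurable
  show iv: "integrable ?G (\<lambda>h. (enorm n (v h))\<^sup>2)"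
  proof (rule Bochner_Integration.integrable_bound)
    show "integrable ?G (\<lambda>h. w\<^sup>2 * (enorm n h)\<^sup>2)" using integrable_enorm_sq by auto
    have "(enorm n (v h))\<^sup>2 \<le> w\<^sup>2 * (enorm n h)\<^sup>2" for h
      using power_mono[OF v0[of h], of 2] by (simp add: power_mult_distrib)
    then show "AE h in ?G. norm ((enorm n (v h))\<^sup>2) \<le> norm (w\<^sup>2 * (enorm n h)\<^sup>2)" by auto
  qed measurable
  define Q where "Q p = enorm n (fst p) ^ 4 + enorm n (snd p) ^ 4" for p :: "(nat \<Rightarrow> real) \<times> (nat \<Rightarrow> real)"
  have iQ: "integrable ?P Q"
    unfolding Q_def using integrable_fst_gauss[OF integrable_enorm_pow4] integrable_snd_gauss[OF integrable_enorm_pow4]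
    by (rule Bochner_Integration.integrable_add)
  define C where "C = 36 * w\<^sup>2 * (\<integral>p. Q p \<partial>?P)"
  define V where "V = (\<integral>h. (enorm n (v h))\<^sup>2 \<partial>?G)"
  define R where "R e = rots {..<n} (\<lambda>_. e)" for e
  define Dd where "Dd e p = J (fst (R e p)) - J (fst p)" for e and p :: "(nat \<Rightarrow> real) \<times> (nat \<Rightarrow> real)"
  have mR [measurable]: "R e \<in> ?P \<rightarrow>\<^sub>M ?P" for e unfolding R_def by (rule measurable_rots) simp
  have mD [measurable]: "Dd e \<in> borel_measurable ?P" for e unfolding Dd_def by measurable
  have mip [measurable]: "(\<lambda>p. ip n (v (fst p)) (snd p)) \<in> borel_measurable ?P"
    unfolding ip_def
  proof (intro borel_measurable_sum borel_measurable_times)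
    fix i assume "i \<in> {..<n}"
    then show "(\<lambda>p. v (fst p) i) \<in> borel_measurable ?P" "(\<lambda>p. snd p i) \<in> borel_measurable ?P"
      using measurable_compose[OF measurable_fst mv[of i]] by auto
  qed
  have ip_bd: "(ip n (v (fst p)) (snd p))\<^sup>2 \<le> w\<^sup>2 * Q p" for p
  proof -
    let ?a = "enorm n (fst p)" and ?b = "enorm n (snd p)"
    have "\<bar>ip n (v (fst p)) (snd p)\<bar> \<le> (w * ?a) * ?b"
      by (rule order_trans[OF abs_ip_le_enorm]) (intro mult_right_mono v0 enorm_nonneg)
    then have "(ip n (v (fst p)) (snd p))\<^sup>2 \<le> (w * (?a * ?b))\<^sup>2"
      using power_mono[of "\<bar>ip n (v (fst p)) (snd p)\<bar>" "w * ?a * ?b" 2] by (simp add: mult.assoc)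
    also have "\<dots> = w\<^sup>2 * (?a\<^sup>2 * ?b\<^sup>2)" by (simp add: power_mult_distrib)
    also have "\<dots> \<le> w\<^sup>2 * (?a ^ 4 + ?b ^ 4)"
    proof (intro mult_left_mono)
      have "0 \<le> (?a\<^sup>2 - ?b\<^sup>2)\<^sup>2 + ?a ^ 4 + ?b ^ 4" by simp
      then show "?a\<^sup>2 * ?b\<^sup>2 \<le> ?a ^ 4 + ?b ^ 4" by (simp add: power2_diff power_mult[symmetric])
    qed simp
    finally show ?thesis by (simp add: Q_def)
  qed
  have iip: "integrable ?P (\<lambda>p. (ip n (v (fst p)) (snd p))\<^sup>2)"
    by (rule Bochner_Integration.integrable_bound[OF integrable_mult_right[OF iQ, of "w\<^sup>2"]])
       (use ip_bd in \<open>auto simp: Q_def\<close>)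
  \<comment> \<open>With the first copy frozen, the inner product is a centred Gaussian whose
    variance is the squared norm of \<open>v\<close>.\<close>
  have Eip: "(\<integral>p. (ip n (v (fst p)) (snd p))\<^sup>2 \<partial>?P) = V"
  proof -
    have in1: "(\<integral>z. (ip n (v h) z)\<^sup>2 \<partial>?G) = (enorm n (v h))\<^sup>2" for h
      using lin_on_moments(3)[of "{..<n}" "{..<n}" "\<lambda>(_::nat). v h" 0 0]
      unfolding enorm_sq by (simp add: lin_on_def ip_def power2_eq_square)
    have "(\<integral>p. (ip n (v (fst p)) (snd p))\<^sup>2 \<partial>?P) = (\<integral>h. (\<integral>z. (ip n (v h) z)\<^sup>2 \<partial>?G) \<partial>?G)"
      using P.integral_fst'[OF iip] by simp
    also have "\<dots> = (\<integral>h. (enorm n (v h))\<^sup>2 \<partial>?G)" unfolding in1 ..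
    finally show ?thesis by (simp add: V_def)
  qed
  \<comment> \<open>A turn by \<open>e\<close> displaces the first copy by
    \<open>sin e * y - (1 - cos e) * x\<close>. Only the sine term is of first order in
    \<open>e\<close>; everything else is gathered in \<open>b\<close>, which is of order
    \<open>e\<^sup>2\<close>.\<close>
  have D_bd: "(Dd e p)\<^sup>2 \<le> 2 * e\<^sup>2 * (ip n (v (fst p)) (snd p))\<^sup>2 + 36 * w\<^sup>2 * e ^ 4 * Q p" if e: "0 \<le> e" "e \<le> 2" for e p
  proof -
    define x y where "x = fst p" and "y = snd p"
    define c where "c = 1 - cos e"
    have c: "0 \<le> c" "c \<le> e\<^sup>2 / 2" using one_minus_cos_le[of e] by (auto simp: c_def)
    have e2: "e\<^sup>2 \<le> 4" using power_mono[OF e(2,1), of 2] by simp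
    have c2: "c\<^sup>2 \<le> e\<^sup>2"
    proof -
      have "c\<^sup>2 \<le> (e\<^sup>2 / 2)\<^sup>2" using c by (intro power_mono)
      also have "\<dots> = e\<^sup>2 * (e\<^sup>2 / 4)" by (simp add: power2_eq_square)
      also have "\<dots> \<le> e\<^sup>2 * 1" using e2 by (intro mult_left_mono) auto
      finally show ?thesis by simp
    qed
    have s2: "(sin e)\<^sup>2 \<le> e\<^sup>2" using abs_sin_x_le_abs_x[of e] by (simp only: abs_le_square_iff)
    define d where "d i = (- c) * x i + sin e * y i" for i
    have J: "J (fst (R e p)) = J (\<lambda>i. x i + d i)"
      by (rule cong) (simp add: R_def rots_def d_def c_def x_def y_def algebra_simps)
    have d1: "(enorm n d)\<^sup>2 \<le> 2 * (c\<^sup>2 * (enorm n x)\<^sup>2 + (sin e)\<^sup>2 * (enorm n y)\<^sup>2)"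
    proof -
      have "enorm n d \<le> c * enorm n x + \<bar>sin e\<bar> * enorm n y"
        unfolding d_def using enorm_triangle[of n "\<lambda>i. (- c) * x i" "\<lambda>i. sin e * y i"] c unfolding enorm_scale by simp
      then have "(enorm n d)\<^sup>2 \<le> (c * enorm n x + \<bar>sin e\<bar> * enorm n y)\<^sup>2" by (intro power_mono) auto
      also have "\<dots> \<le> 2 * ((c * enorm n x)\<^sup>2 + (\<bar>sin e\<bar> * enorm n y)\<^sup>2)"
        using sum_squares_bound[of "c * enorm n x" "\<bar>sin e\<bar> * enorm n y"] by (simp add: power2_sum)
      finally show ?thesis by (simp add: power_mult_distrib)
    qed
    define X Y where "X = (enorm n x)\<^sup>2" and "Y = (enorm n y)\<^sup>2"
    have XY: "0 \<le> X" "0 \<le> Y" by (auto simp: X_def Y_def)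
    have d2: "(enorm n d)\<^sup>2 \<le> e\<^sup>2 * (2 * X + 2 * Y)"
      using d1 mult_right_mono[OF c2 XY(1)] mult_right_mono[OF s2 XY(2)] by (simp add: X_def Y_def algebra_simps)
    have vx: "\<bar>ip n (v x) x\<bar> \<le> w * X"
      using abs_ip_le_enorm[of n "v x" x] mult_right_mono[OF v0[of x] enorm_nonneg[of n x]]
      by (simp add: X_def power2_eq_square mult.assoc)
    have "ip n (v x) (\<lambda>i. (- c) * x i + sin e * y i) = (- c) * ip n (v x) x + sin e * ip n (v x) y"
      unfolding ip_add_right ip_scale_right ..
    then have ipd: "ip n (v x) d = (- c) * ip n (v x) x + sin e * ip n (v x) y"
      unfolding d_def[abs_def] .
    have dd: "Dd e p = J (\<lambda>i. x i + d i) - J x"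
      unfolding Dd_def x_def[symmetric] using J by simp
    define b where "b = Dd e p - sin e * ip n (v x) y"
    have b_eq: "Dd e p - sin e * ip n (v x) y = (J (\<lambda>i. x i + d i) - J x - ip n (v x) d) - c * ip n (v x) x"
      using ipd dd by linarith
    have "\<bar>b\<bar> \<le> w * (enorm n d)\<^sup>2 + c * (w * X)"
    proof -
      have "\<bar>c * ip n (v x) x\<bar> \<le> c * (w * X)" using mult_left_mono[OF vx c(1)] c(1) by (simp add: abs_mult)
      then show ?thesis using first[of x d] b_eq unfolding b_def by linarith
    qed
    also have "\<dots> \<le> w * (e\<^sup>2 * (2 * X + 2 * Y)) + e\<^sup>2 / 2 * (w * X)"
      using w d2 c XY by (intro add_mono mult_left_mono mult_right_mono mult_nonneg_nonneg) auto
    also have "\<dots> \<le> 3 * w * e\<^sup>2 * (X + Y)"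
    proof -
      have "0 \<le> w * e\<^sup>2 * X" "0 \<le> w * e\<^sup>2 * Y" using w XY by simp_all
      then show ?thesis by (simp add: algebra_simps)
    qed
    finally have "b\<^sup>2 \<le> (3 * w * e\<^sup>2 * (X + Y))\<^sup>2"
      using power_mono[of "\<bar>b\<bar>" _ 2] by auto
    also have "\<dots> = 9 * w\<^sup>2 * e ^ 4 * (X + Y)\<^sup>2" by (simp add: power_mult_distrib power_mult[symmetric])
    also have "\<dots> \<le> 9 * w\<^sup>2 * e ^ 4 * (2 * (X\<^sup>2 + Y\<^sup>2))"
      using sum_squares_bound[of X Y] by (intro mult_left_mono) (auto simp: power2_sum)
    also have "X\<^sup>2 + Y\<^sup>2 = Q p" by (simp add: X_def Y_def Q_def x_def y_def power_mult[symmetric])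
    finally have b2: "b\<^sup>2 \<le> 18 * w\<^sup>2 * e ^ 4 * Q p" by simp
    have "(Dd e p)\<^sup>2 = (sin e * ip n (v x) y + b)\<^sup>2" by (simp add: b_def)
    also have "\<dots> \<le> 2 * ((sin e * ip n (v x) y)\<^sup>2 + b\<^sup>2)"
      using sum_squares_bound[of "sin e * ip n (v x) y" b] by (simp add: power2_sum)
    also have "(sin e * ip n (v x) y)\<^sup>2 \<le> e\<^sup>2 * (ip n (v x) y)\<^sup>2"
      using s2 by (simp add: power_mult_distrib mult_right_mono)
    finally show ?thesis using b2 by (simp add: x_def y_def algebra_simps)
  qed
  have ED: "integrable ?P (\<lambda>p. (Dd e p)\<^sup>2)" "(\<integral>p. (Dd e p)\<^sup>2 \<partial>?P) \<le> 2 * e\<^sup>2 * V + C * e ^ 4" if e: "0 \<le> e" "e \<le> 2" for e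
  proof -
    have i: "integrable ?P (\<lambda>p. 2 * e\<^sup>2 * (ip n (v (fst p)) (snd p))\<^sup>2 + 36 * w\<^sup>2 * e ^ 4 * Q p)"
      by (intro Bochner_Integration.integrable_add integrable_mult_right iip iQ)
    show iD: "integrable ?P (\<lambda>p. (Dd e p)\<^sup>2)"
      by (rule Bochner_Integration.integrable_bound[OF i]) (use D_bd[OF e] in \<open>auto intro!: always_eventually order_trans[OF D_bd[OF e]]\<close>)
    have "(\<integral>p. (Dd e p)\<^sup>2 \<partial>?P) \<le> (\<integral>p. 2 * e\<^sup>2 * (ip n (v (fst p)) (snd p))\<^sup>2 + 36 * w\<^sup>2 * e ^ 4 * Q p \<partial>?P)"
      by (rule integral_mono[OF iD i D_bd[OF e]])
    also have "\<dots> = 2 * e\<^sup>2 * V + C * e ^ 4"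
      using iip iQ by (simp add: Eip C_def)
    finally show "(\<integral>p. (Dd e p)\<^sup>2 \<partial>?P) \<le> 2 * e\<^sup>2 * V + C * e ^ 4" .
  qed
  have main: "integrable ?P (\<lambda>p. (J (snd p) - J (fst p))\<^sup>2) \<and> (\<integral>p. (J (snd p) - J (fst p))\<^sup>2 \<partial>?P) \<le> 2 * (pi / 2)\<^sup>2 * V + C * (pi / 2) ^ 4 / (real N)\<^sup>2"
    if N: "N > 0" for N :: nat
  proof -
    define e where "e = pi / 2 / real N"
    have e: "0 \<le> e" "e \<le> 2"
    proof -
      show "0 \<le> e" by (simp add: e_def)
      have "pi / 2 / real N \<le> pi / 2 / 1" using N by (intro divide_left_mono) auto
      then show "e \<le> 2" using pi_less_4 by (simp add: e_def)
    qed
    have Ne: "real N * e = pi / 2" using N by (simp add: e_def)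
    have ang: "cos (real k * e) \<ge> 0" if "k \<le> N" for k
    proof (rule cos_ge_zero)
      have "real k * e \<le> real N * e" using that e by (intro mult_right_mono) auto
      then show "real k * e \<le> pi / 2" using Ne by simp
      have "0 \<le> real k * e" using e by simp
      then show "- (pi / 2) \<le> real k * e" using pi_ge_zero by linarith
    qed
    \<comment> \<open>The arc number \<open>k\<close> is the first arc evaluated at a rotated pair,
      and this pair has the original law.\<close>
    define Dk where "Dk k p = Dd e (R (real k * e) p)" for k p
    have Dk: "Dk k p = J (fst (R (real (Suc k) * e) p)) - J (fst (R (real k * e) p))" for k p
    proof -
      have "J (fst (R e (R (real k * e) p))) = J (fst (R (real (Suc k) * e) p))"
      proof (rule cong)
        fix i assume "i < n"
        have "real (Suc k) * e = e + real k * e" by (simp add: algebra_simps)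
        then show "fst (R e (R (real k * e) p)) i = fst (R (real (Suc k) * e) p) i"
          using \<open>i < n\<close> by (simp add: R_def rots_def cos_add sin_add algebra_simps)
      qed
      then show ?thesis by (simp add: Dk_def Dd_def)
    qed
    have tel: "J (snd p) - J (fst p) = (\<Sum>k<N. Dk k p)" for p
    proof -
      have "(\<Sum>k<N. Dk k p) = J (fst (R (real N * e) p)) - J (fst (R (real 0 * e) p))"
        unfolding Dk by (rule sum_lessThan_telescope)
      also have "J (fst (R (real N * e) p)) = J (snd p)" unfolding Ne by (rule cong) (simp add: R_def rots_def)
      also have "J (fst (R (real 0 * e) p)) = J (fst p)" by (rule cong) (simp add: R_def rots_def)
      finally show ?thesis by simp
    qed
    have bd: "(J (snd p) - J (fst p))\<^sup>2 \<le> real N * (\<Sum>k<N. (Dk k p)\<^sup>2)" for p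
      using Cauchy_Schwarz_ineq_sum[of "\<lambda>_. 1" "\<lambda>k. Dk k p" "{..<N}"] unfolding tel by simp
    have iDk: "integrable ?P (\<lambda>p. (Dk k p)\<^sup>2)" if "k < N" for k
      unfolding Dk_def R_def using ang[of k] that
      by (intro integrable_rots[where f = "\<lambda>p. (Dd e p)\<^sup>2"] ED(1)[OF e]) auto
    have eDk: "(\<integral>p. (Dk k p)\<^sup>2 \<partial>?P) = (\<integral>p. (Dd e p)\<^sup>2 \<partial>?P)" if "k < N" for k
      unfolding Dk_def R_def using ang[of k] that
      by (intro integral_rots[where f = "\<lambda>p. (Dd e p)\<^sup>2"]) auto
    have iS: "integrable ?P (\<lambda>p. real N * (\<Sum>k<N. (Dk k p)\<^sup>2))"
      by (intro integrable_mult_right Bochner_Integration.integrable_sum iDk) simp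
    have iJJ: "integrable ?P (\<lambda>p. (J (snd p) - J (fst p))\<^sup>2)"
      by (rule Bochner_Integration.integrable_bound[OF iS]) (auto intro!: always_eventually order_trans[OF bd])
    have "(\<integral>p. (J (snd p) - J (fst p))\<^sup>2 \<partial>?P) \<le> (\<integral>p. real N * (\<Sum>k<N. (Dk k p)\<^sup>2) \<partial>?P)"
      by (rule integral_mono[OF iJJ iS bd])
    also have "\<dots> = real N * (\<Sum>k<N. (\<integral>p. (Dk k p)\<^sup>2 \<partial>?P))"
      using iDk by simp
    also have "\<dots> = real N * (real N * (\<integral>p. (Dd e p)\<^sup>2 \<partial>?P))"
      using eDk by simp
    also have "\<dots> \<le> real N * (real N * (2 * e\<^sup>2 * V + C * e ^ 4))"
      using ED(2)[OF e] by (intro mult_left_mono) auto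
    also have "\<dots> = 2 * (pi / 2)\<^sup>2 * V + C * (pi / 2) ^ 4 / (real N)\<^sup>2"
      using N by (simp add: e_def field_simps power2_eq_square power4_eq_xxxx)
    finally show ?thesis using iJJ by simp
  qed
  have iJJ: "integrable ?P (\<lambda>p. (J (snd p) - J (fst p))\<^sup>2)" using main[of 1] by simp
  \<comment> \<open>The remainders vanish in the limit, and \<open>(pi / 2)\<^sup>2 \<le> 4\<close>
    rounds the constant up to 8.\<close>
  have "(\<lambda>N. 2 * (pi / 2)\<^sup>2 * V + C * (pi / 2) ^ 4 / (real N)\<^sup>2) \<longlonglongrightarrow> 2 * (pi / 2)\<^sup>2 * V + 0"
    by (intro tendsto_add tendsto_const tendsto_divide_0[OF tendsto_const] filterlim_at_top_imp_at_infinity filterlim_pow_at_top filterlim_real_sequentially) simp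
  then have "(\<integral>p. (J (snd p) - J (fst p))\<^sup>2 \<partial>?P) \<le> 2 * (pi / 2)\<^sup>2 * V + 0"
    by (rule tendsto_lowerbound) (use main in \<open>auto intro!: eventually_sequentiallyI[of 1]\<close>)
  moreover have "(pi / 2)\<^sup>2 \<le> 2\<^sup>2" using pi_less_4 by (intro power_mono) auto
  moreover have "V \<ge> 0" by (auto simp: V_def)
  ultimately have le8: "(\<integral>p. (J (snd p) - J (fst p))\<^sup>2 \<partial>?P) \<le> 8 * V"
    using mult_right_mono[of "(pi / 2)\<^sup>2" 4 V] by simp
  define \<mu> E2 where "\<mu> = (\<integral>h. J h \<partial>?G)" and "E2 = (\<integral>h. (J h)\<^sup>2 \<partial>?G)"
  have quad: "(\<integral>h. a + b * J h + (J h)\<^sup>2 \<partial>?G) = a + b * \<mu> + E2" for a b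
    using iJ iJ2 by (simp add: G.prob_space \<mu>_def E2_def)
  have sq: "(J z - c)\<^sup>2 = c\<^sup>2 + (- 2 * c) * J z + (J z)\<^sup>2" for z c by (simp add: power2_diff)
  have inner: "(\<integral>z. (J z - c)\<^sup>2 \<partial>?G) = c\<^sup>2 + (- 2 * c) * \<mu> + E2" for c
    unfolding sq by (rule quad)
  \<comment> \<open>This is twice the variance, written with the first two moments of
    \<open>J\<close>.\<close>
  have outer: "(\<integral>h. (\<integral>z. (J z - J h)\<^sup>2 \<partial>?G) \<partial>?G) = E2 + (- 2 * \<mu>) * \<mu> + E2"
  proof -
    have "(\<integral>z. (J z - J h)\<^sup>2 \<partial>?G) = E2 + (- 2 * \<mu>) * J h + (J h)\<^sup>2" for h
      unfolding inner[of "J h"] by simp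
    then have "(\<integral>h. (\<integral>z. (J z - J h)\<^sup>2 \<partial>?G) \<partial>?G) = (\<integral>h. E2 + (- 2 * \<mu>) * J h + (J h)\<^sup>2 \<partial>?G)"
      by (intro Bochner_Integration.integral_cong refl)
    then show ?thesis unfolding quad .
  qed
  have "(\<integral>p. (J (snd p) - J (fst p))\<^sup>2 \<partial>?P) = (\<integral>h. (\<integral>z. (J z - J h)\<^sup>2 \<partial>?G) \<partial>?G)"
    using P.integral_fst'[OF iJJ, symmetric] unfolding fst_conv snd_conv .
  then have "E2 - \<mu>\<^sup>2 \<le> 4 * V" using le8 unfolding outer by (simp add: power2_eq_square)
  moreover have "(\<integral>h. (J h - \<mu>)\<^sup>2 \<partial>?G) = E2 - \<mu>\<^sup>2"
    unfolding inner[of \<mu>] by (simp add: power2_eq_square)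
  ultimately show "(\<integral>h. (J h - (\<integral>h. J h \<partial>?G))\<^sup>2 \<partial>?G) \<le> 4 * (\<integral>h. (enorm n (v h))\<^sup>2 \<partial>?G)"
    by (simp add: \<mu>_def V_def)
qed

text \<open>Continuity refers to all real sequences, while points of the Gaussian space are
  undefined from \<open>n\<close> on. Padding with zeros connects the two and does not affect a
  function of the first \<open>n\<close> coordinates.\<close>

lemma measurable_gauss_continuous:
  fixes f :: "(nat \<Rightarrow> real) \<Rightarrow> real"
  assumes f: "continuous_on UNIV f" and cong: "\<And>x y. (\<And>i. i < n \<Longrightarrow> x i = y i) \<Longrightarrow> f x = f y"
  shows "f \<in> borel_measurable (gauss {..<n})"
proof -
  define t where "t h i = (if i < n then h i else 0)" for h :: "nat \<Rightarrow> real" and i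
  have "t \<in> gauss {..<n} \<rightarrow>\<^sub>M (\<Pi>\<^sub>M i\<in>UNIV. borel)"
  proof (rule measurable_PiM_single')
    fix i show "(\<lambda>h. t h i) \<in> borel_measurable (gauss {..<n})" unfolding t_def by (cases "i < n") auto
  qed (auto simp: t_def)
  moreover have "f \<in> borel_measurable (\<Pi>\<^sub>M i\<in>UNIV. borel)"
    using borel_measurable_continuous_onI[OF f] by (simp cong: measurable_cong_sets add: sets_PiM_equal_borel)
  ultimately have "(\<lambda>h. f (t h)) \<in> borel_measurable (gauss {..<n})" by (rule measurable_compose)
  moreover have "f (t h) = f h" for h by (rule cong) (simp add: t_def)
  ultimately show ?thesis by simp
qed

lemma pj_cong: "(\<And>i. i < n \<Longrightarrow> x i = y i) \<Longrightarrow> pj n C w x = pj n C w y"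
  unfolding pj_def by (rule metric_proj_cong) simp

lemma Jf_cong: "(\<And>i. i < n \<Longrightarrow> x i = y i) \<Longrightarrow> Jf n C w x = Jf n C w y"
  unfolding Jf_def using pj_cong[of n x y C w] ip_cong[of n x y "pj n C w y" "pj n C w y"] by simp

lemma measurable_pj:
  assumes "cc_set n C"
  shows "(\<lambda>h. pj n C w h i) \<in> borel_measurable (gauss {..<n})"
proof (rule measurable_gauss_continuous)
  show "continuous_on UNIV (\<lambda>h. pj n C w h i)"
    by (rule continuous_on_product_then_coordinatewise[OF continuous_pj[OF assms]])
  show "pj n C w x i = pj n C w y i" if "\<And>i. i < n \<Longrightarrow> x i = y i" for x y
    using pj_cong[OF that] by simp
qed

lemma measurable_enorm_pj:
  assumes "cc_set n C"
  shows "(\<lambda>h. enorm n (pj n C w h)) \<in> borel_measurable (gauss {..<n})"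
  using measurable_pj[OF assms, of w] unfolding enorm_eq_sqrt ip_def by measurable

lemma measurable_Jf:
  assumes "cc_set n C"
  shows "Jf n C w \<in> borel_measurable (gauss {..<n})"
  by (rule measurable_gauss_continuous[OF continuous_Jf[OF assms]]) (rule Jf_cong)

text \<open>As \<open>pj\<close> is the gradient of \<open>Jf\<close>, the variance of the maximum
  is controlled by the mean squared norm of the projection, which equals
  \<open>n * r\<^sup>2\<close> at the fixed point.\<close>

lemma Jf_variance:
  assumes C: "cc_set0 n C" and w: "w > 0"
  shows "integrable (gauss {..<n}) (Jf n C w)" and "integrable (gauss {..<n}) (\<lambda>h. (Jf n C w h)\<^sup>2)"
    and "integrable (gauss {..<n}) (\<lambda>h. (enorm n (pj n C w h))\<^sup>2)"
    and "(\<integral>h. (Jf n C w h - (\<integral>h. Jf n C w h \<partial>gauss {..<n}))\<^sup>2 \<partial>gauss {..<n}) \<le> 4 * (\<integral>h. (enorm n (pj n C w h))\<^sup>2 \<partial>gauss {..<n})"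
proof -
  note C1 = cc_set0D(1)[OF C]
  have J0: "\<bar>Jf n C w h\<bar> \<le> w * (enorm n h)\<^sup>2" for h
    using Jf_first_order[OF C1 w, of "\<lambda>i. 0" h] by (simp add: Jf_def[of n C w "\<lambda>i. 0"] pj_zero[OF C])
  note v = gauss_variance_bound[OF measurable_Jf[OF C1] measurable_pj[OF C1] Jf_cong less_imp_le[OF w] J0 pj_le_enorm[OF C w] Jf_first_order[OF C1 w]]
  show "integrable (gauss {..<n}) (Jf n C w)" "integrable (gauss {..<n}) (\<lambda>h. (Jf n C w h)\<^sup>2)"
    "integrable (gauss {..<n}) (\<lambda>h. (enorm n (pj n C w h))\<^sup>2)"
    "(\<integral>h. (Jf n C w h - (\<integral>h. Jf n C w h \<partial>gauss {..<n}))\<^sup>2 \<partial>gauss {..<n}) \<le> 4 * (\<integral>h. (enorm n (pj n C w h))\<^sup>2 \<partial>gauss {..<n})"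
    by (rule v(1), assumption) (rule v(2), assumption, rule v(3), assumption, rule v(4), assumption)
qed

lemma (in prob_space) markov_sq:
  assumes "integrable M (\<lambda>x. (X x)\<^sup>2)" "X \<in> borel_measurable M" "expectation (\<lambda>x. (X x)\<^sup>2) \<le> c" "t > 0"
  shows "prob {x \<in> space M. \<bar>X x\<bar> > t} \<le> c / t\<^sup>2"
proof -
  have "prob {x \<in> space M. \<bar>X x\<bar> > t} \<le> prob {x \<in> space M. (X x)\<^sup>2 \<ge> t\<^sup>2}"
  proof (rule finite_measure_mono)
    show "{x \<in> space M. (X x)\<^sup>2 \<ge> t\<^sup>2} \<in> events" using assms(2) by measurable
    show "{x \<in> space M. \<bar>X x\<bar> > t} \<subseteq> {x \<in> space M. (X x)\<^sup>2 \<ge> t\<^sup>2}"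
    proof safe
      fix x assume "\<bar>X x\<bar> > t"
      then show "t\<^sup>2 \<le> (X x)\<^sup>2" using assms(4) power_mono[of t "\<bar>X x\<bar>" 2] by simp
    qed
  qed
  also have "\<dots> \<le> expectation (\<lambda>x. (X x)\<^sup>2) / t\<^sup>2"
    using assms by (intro integral_Markov_inequality_measure[where A = "space M"]) auto
  also have "\<dots> \<le> c / t\<^sup>2" using assms by (intro divide_right_mono) auto
  finally show ?thesis .
qed

lemma pj_sq_mono:
  assumes C: "cc_set0 n C" and w: "0 < w" and e: "0 \<le> e"
  shows "(\<integral>h. (enorm n (pj n C w h))\<^sup>2 \<partial>gauss {..<n}) \<le> (\<integral>h. (enorm n (pj n C ((1 + e) * w) h))\<^sup>2 \<partial>gauss {..<n})"
    and "(\<integral>h. (enorm n (pj n C ((1 + e) * w) h))\<^sup>2 \<partial>gauss {..<n}) \<le> (1 + e)\<^sup>2 * (\<integral>h. (enorm n (pj n C w h))\<^sup>2 \<partial>gauss {..<n})"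
    and "enorm n (pj n C ((1 + e) * w) h) \<le> (1 + e) * enorm n (pj n C w h)"
proof -
  have w': "0 < (1 + e) * w" "w \<le> (1 + e) * w" using w e by (auto simp: algebra_simps intro: add_pos_nonneg)
  note m = pj_mono[OF cc_set0D(1)[OF C] w w'(2)]
  show u: "enorm n (pj n C ((1 + e) * w) h) \<le> (1 + e) * enorm n (pj n C w h)" for h
  proof -
    have "enorm n (pj n C ((1 + e) * w) h) \<le> enorm n (pj n C w h) / w * ((1 + e) * w)"
      using m(2)[of h] w'(1) by (simp only: pos_divide_le_eq)
    also have "\<dots> = (1 + e) * enorm n (pj n C w h)" using w by simp
    finally show ?thesis .
  qed
  show "(\<integral>h. (enorm n (pj n C w h))\<^sup>2 \<partial>gauss {..<n}) \<le> (\<integral>h. (enorm n (pj n C ((1 + e) * w) h))\<^sup>2 \<partial>gauss {..<n})"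
    by (intro integral_mono Jf_variance(3)[OF C] w w' power_mono m(1) enorm_nonneg)
  have "(\<integral>h. (enorm n (pj n C ((1 + e) * w) h))\<^sup>2 \<partial>gauss {..<n}) \<le> (\<integral>h. (1 + e)\<^sup>2 * (enorm n (pj n C w h))\<^sup>2 \<partial>gauss {..<n})"
    using power_mono[OF u enorm_nonneg, of _ 2]
    by (intro integral_mono integrable_mult_right Jf_variance(3)[OF C] w w') (simp_all add: power_mult_distrib)
  then show "(\<integral>h. (enorm n (pj n C ((1 + e) * w) h))\<^sup>2 \<partial>gauss {..<n}) \<le> (1 + e)\<^sup>2 * (\<integral>h. (enorm n (pj n C w h))\<^sup>2 \<partial>gauss {..<n})"
    by simp
qed

text \<open>The increment of \<open>J\<close> from scale \<open>w\<close> to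
  \<open>(1 + e) * w\<close>, divided by \<open>th\<close>, equals \<open>A\<close> up to the factor
  \<open>(1 + e)\<^sup>2\<close>. Deviations \<open>t\<close> of both values cost
  \<open>2 * t / th\<close>, which is of order \<open>w * t / e\<close>: a smaller relative error
  \<open>e\<close> is bought with a larger additive one.\<close>

lemma proj_concentration_algebra:
  fixes S t e w A A' J J' j j' :: real
  assumes e: "0 < e" "e \<le> 1" and w: "w > 0" and S: "S \<ge> 0" and t: "t \<ge> 0"
    and th: "th = 1 / (2 * w) - 1 / (2 * ((1 + e) * w))"
    and sand: "A * th \<le> J' - J" "J' - J \<le> A' * th" "A' \<le> (1 + e)\<^sup>2 * A"
    and Esand: "S * th \<le> j' - j" "j' - j \<le> S' * th" "S' \<le> (1 + e)\<^sup>2 * S"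
    and dev: "\<bar>J - j\<bar> \<le> t" "\<bar>J' - j'\<bar> \<le> t" and A: "A \<ge> 0"
  shows "\<bar>A - S\<bar> \<le> 3 * e * S + 8 * w * t / e"
proof -
  have th_eq: "th = e / (2 * w * (1 + e))" 
  proof -
    define u where "u = 1 + e"
    have u: "u > 0" "e = u - 1" using e by (auto simp: u_def)
    show ?thesis unfolding th u_def[symmetric] using u w by (simp add: field_simps)
  qed
  have thp: "th > 0" using e w by (simp add: th_eq)
  have tth: "2 * t / th \<le> 8 * w * t / e"
  proof -
    have "2 * t / th = 4 * w * t / e * (1 + e)" using e w by (simp add: th_eq field_simps)
    also have "\<dots> \<le> 4 * w * t / e * 2" using e w t by (intro mult_left_mono) auto
    finally show ?thesis by simp
  qed
  have e2: "(1 + e)\<^sup>2 \<le> 1 + 3 * e" using e by (simp add: power2_eq_square algebra_simps mult_left_le)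
  have "A * th \<le> (1 + e)\<^sup>2 * S * th + 2 * t"
    using sand(1) Esand(2) mult_right_mono[OF Esand(3) less_imp_le[OF thp]] dev by linarith
  then have "A \<le> (1 + e)\<^sup>2 * S + 2 * t / th" using thp by (simp add: field_simps)
  moreover have "(1 + e)\<^sup>2 * S \<le> (1 + 3 * e) * S" using e2 S by (intro mult_right_mono)
  ultimately have up: "A - S \<le> 3 * e * S + 8 * w * t / e" using tth by (simp add: algebra_simps)
  have "S * th \<le> (1 + e)\<^sup>2 * A * th + 2 * t"
    using sand(2) Esand(1) mult_right_mono[OF sand(3) less_imp_le[OF thp]] dev by linarith
  then have 1: "S \<le> (1 + e)\<^sup>2 * A + 2 * t / th" using thp by (simp add: field_simps)
  have "S - A \<le> 3 * e * S + 8 * w * t / e"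
  proof (cases "A \<le> S")
    case True
    have "(1 + e)\<^sup>2 * A \<le> (1 + 3 * e) * A" using e2 A by (intro mult_right_mono)
    moreover have "3 * e * A \<le> 3 * e * S" using True e by (intro mult_left_mono) auto
    ultimately show ?thesis using 1 tth by (simp add: algebra_simps)
  next
    case False
    have "0 \<le> 3 * e * S + 8 * w * t / e" using e w t S by (intro add_nonneg_nonneg mult_nonneg_nonneg divide_nonneg_pos) auto
    then show ?thesis using False by linarith
  qed
  then show ?thesis using up by (simp add: abs_le_iff)
qed

lemma proj_concentration:
  assumes C: "cc_set0 n C" and w: "w > 0" and e: "0 < e" "e \<le> 1" and p: "p > 0"
    and S: "S = (\<integral>h. (enorm n (pj n C w h))\<^sup>2 \<partial>gauss {..<n})" "S > 0"
    and j: "j = (\<integral>h. Jf n C w h \<partial>gauss {..<n})"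
  defines "Bad \<equiv> {h \<in> space (gauss {..<n}). \<not> (\<bar>Jf n C w h - j\<bar> \<le> 4 * sqrt S / sqrt p \<and>
      \<bar>(enorm n (pj n C w h))\<^sup>2 - S\<bar> \<le> 3 * e * S + 32 * w * sqrt S / (e * sqrt p))}"
  shows "Bad \<in> sets (gauss {..<n})" and "measure (gauss {..<n}) Bad \<le> 2 * p"
proof -
  let ?G = "gauss {..<n}"
  interpret G: prob_space ?G by (rule prob_space_gauss)
  note C1 = cc_set0D(1)[OF C]
  note [measurable] = measurable_Jf[OF C1] measurable_enorm_pj[OF C1]
  show mB: "Bad \<in> sets ?G" unfolding Bad_def by measurable
  define w' where "w' = (1 + e) * w"
  have w': "w' > 0" "w \<le> w'" using w e by (auto simp: w'_def algebra_simps intro: add_pos_pos)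
  define j' where "j' = (\<integral>h. Jf n C w' h \<partial>?G)"
  \<comment> \<open>At both scales the variance is at most \<open>4 * (4 * S)\<close>, and with this
    \<open>t\<close> Chebyshev's bound becomes exactly \<open>p\<close>.\<close>
  define t where "t = 4 * sqrt S / sqrt p"
  have t: "t > 0" using S p by (simp add: t_def)
  have t2: "t\<^sup>2 = 16 * S / p" using S p by (simp add: t_def power_divide power_mult_distrib)
  define S' where "S' = (\<integral>h. (enorm n (pj n C w' h))\<^sup>2 \<partial>?G)"
  have S': "S \<le> S'" "S' \<le> (1 + e)\<^sup>2 * S" using pj_sq_mono[OF C w, of e] e unfolding S'_def S(1) w'_def by auto
  have "(1 + e)\<^sup>2 \<le> 2\<^sup>2" using e by (intro power_mono) auto
  then have "(1 + e)\<^sup>2 * S \<le> 2\<^sup>2 * S" using S(2) by (intro mult_right_mono) auto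
  then have S'4: "S' \<le> 4 * S" using S'(2) by simp
  have dev: "G.prob {h \<in> space ?G. \<bar>Jf n C u h - (\<integral>h. Jf n C u h \<partial>?G)\<bar> > t} \<le> p"
    if u: "u > 0" and Su: "(\<integral>h. (enorm n (pj n C u h))\<^sup>2 \<partial>?G) \<le> 4 * S" for u
  proof -
    note v = Jf_variance[OF C u]
    have "G.prob {h \<in> space ?G. \<bar>Jf n C u h - (\<integral>h. Jf n C u h \<partial>?G)\<bar> > t} \<le> 16 * S / t\<^sup>2"
    proof (rule G.markov_sq[OF _ _ _ t])
      show "integrable ?G (\<lambda>h. (Jf n C u h - (\<integral>h. Jf n C u h \<partial>?G))\<^sup>2)"
        unfolding power2_diff using v(1,2) by simp
      show "(\<integral>h. (Jf n C u h - (\<integral>h. Jf n C u h \<partial>?G))\<^sup>2 \<partial>?G) \<le> 16 * S" using v(4) Su by linarith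
    qed measurable
    also have "\<dots> = p" using S p by (simp add: t2)
    finally show ?thesis .
  qed
  define B1 B2 where "B1 = {h \<in> space ?G. \<bar>Jf n C w h - j\<bar> > t}" and "B2 = {h \<in> space ?G. \<bar>Jf n C w' h - j'\<bar> > t}"
  have P: "G.prob B1 \<le> p" "G.prob B2 \<le> p"
    using dev[OF w] dev[OF w'(1)] S S'4 unfolding B1_def B2_def j j'_def S'_def by auto
  have mB12: "B1 \<in> sets ?G" "B2 \<in> sets ?G" unfolding B1_def B2_def by measurable
  have Esand: "S * (1 / (2 * w) - 1 / (2 * w')) \<le> j' - j" "j' - j \<le> S' * (1 / (2 * w) - 1 / (2 * w'))"
  proof -
    note s = Jf_sandwich[OF C1 w w'(2)]
    note i = Jf_variance(1,3)[OF C w] Jf_variance(1,3)[OF C w'(1)]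
    have "j' - j = (\<integral>h. Jf n C w' h - Jf n C w h \<partial>?G)" unfolding j j'_def using i by simp
    then show "S * (1 / (2 * w) - 1 / (2 * w')) \<le> j' - j" "j' - j \<le> S' * (1 / (2 * w) - 1 / (2 * w'))"
      using integral_mono[OF integrable_mult_left[OF i(2)] Bochner_Integration.integrable_diff[OF i(3,1)] s(1)]
        integral_mono[OF Bochner_Integration.integrable_diff[OF i(3,1)] integrable_mult_left[OF i(4)] s(2)]
      by (simp_all only: integral_mult_left_zero S(1) S'_def)
  qed
  have "Bad \<subseteq> B1 \<union> B2"
  proof
    fix h assume h: "h \<in> Bad"
    show "h \<in> B1 \<union> B2"
    proof (rule ccontr)
      assume "h \<notin> B1 \<union> B2"
      then have d: "\<bar>Jf n C w h - j\<bar> \<le> t" "\<bar>Jf n C w' h - j'\<bar> \<le> t" using h by (auto simp: B1_def B2_def Bad_def)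
      have a: "(enorm n (pj n C w' h))\<^sup>2 \<le> (1 + e)\<^sup>2 * (enorm n (pj n C w h))\<^sup>2"
        using power_mono[OF pj_sq_mono(3)[OF C w, of e h] enorm_nonneg, of 2] e by (simp add: w'_def power_mult_distrib)
      have "\<bar>(enorm n (pj n C w h))\<^sup>2 - S\<bar> \<le> 3 * e * S + 8 * w * t / e"
        by (rule proj_concentration_algebra[OF e w _ _ refl _ _ a, of S t "Jf n C w' h" "Jf n C w h" j' j S'])
           (use S t Esand S' d Jf_sandwich[OF C1 w w'(2), of h] in \<open>auto simp: w'_def\<close>)
      moreover have "8 * w * t / e = 32 * w * sqrt S / (e * sqrt p)" by (simp add: t_def field_simps)
      ultimately show False using h d(1) by (auto simp: Bad_def t_def)
    qed
  qed
  then have "G.prob Bad \<le> G.prob (B1 \<union> B2)" using mB12 by (intro G.finite_measure_mono) auto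
  also have "\<dots> \<le> G.prob B1 + G.prob B2" using mB12 by (intro measure_Un_le)
  finally show "G.prob Bad \<le> 2 * p" using P by simp
qed

section \<open>Subvectors, and deviations of linear and quadratic forms\<close>

lemma gauss_reindex:
  assumes inj: "inj_on f L" and sub: "f ` L \<subseteq> I"
  shows "distr (gauss I) (gauss L) (\<lambda>z. \<lambda>i\<in>L. z (f i)) = gauss L"
  unfolding gauss_def using assms by (intro distr_PiM_reindex) (auto intro: prob_space_stdn)

lemma gauss_reindex_prob:
  assumes inj: "inj_on f L" and sub: "f ` L \<subseteq> I" and A: "A \<in> sets (gauss L)"
  shows "measure (gauss I) {z \<in> space (gauss I). (\<lambda>i\<in>L. z (f i)) \<in> A} = measure (gauss L) A"
    and "{z \<in> space (gauss I). (\<lambda>i\<in>L. z (f i)) \<in> A} \<in> sets (gauss I)"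
proof -
  have m [measurable]: "(\<lambda>z. \<lambda>i\<in>L. z (f i)) \<in> gauss I \<rightarrow>\<^sub>M gauss L"
    unfolding gauss_def using sub by (intro measurable_restrict) (auto simp: measurable_component_singleton)
  show "{z \<in> space (gauss I). (\<lambda>i\<in>L. z (f i)) \<in> A} \<in> sets (gauss I)"
    using A by measurable
  have "measure (gauss L) A = measure (distr (gauss I) (gauss L) (\<lambda>z. \<lambda>i\<in>L. z (f i))) A"
    by (simp add: gauss_reindex[OF inj sub])
  also have "\<dots> = measure (gauss I) {z \<in> space (gauss I). (\<lambda>i\<in>L. z (f i)) \<in> A}"
    using A by (subst measure_distr[OF m]) (auto simp: vimage_def Int_def conj_commute)
  finally show "measure (gauss I) {z \<in> space (gauss I). (\<lambda>i\<in>L. z (f i)) \<in> A} = measure (gauss L) A" ..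
qed

lemma gauss_linear_deviation:
  assumes I: "finite I" "L \<subseteq> I" and M: "M > 0"
  shows "measure (gauss I) {z \<in> space (gauss I). \<bar>\<Sum>k\<in>L. c k * z k\<bar> > M * sqrt (\<Sum>k\<in>L. (c k)\<^sup>2)} \<le> 1 / M\<^sup>2"
proof -
  interpret G: prob_space "gauss I" by (rule prob_space_gauss)
  define s where "s = (\<Sum>k\<in>L. (c k)\<^sup>2)"
  have fL: "finite L" using I finite_subset by auto
  have s0: "s \<ge> 0" by (simp add: s_def sum_nonneg)
  show ?thesis
  proof (cases "s = 0")
    case True
    then have "\<forall>k\<in>L. c k = 0" using fL by (simp add: s_def sum_nonneg_eq_0_iff)
    then show ?thesis using M by simp
  next
    case False
    then have s: "s > 0" using s0 by simp
    note l = lin_on_moments[OF I, of "\<lambda>(_::nat). c" 0]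
    have "G.prob {z \<in> space (gauss I). \<bar>lin_on L (\<lambda>(_::nat). c) z 0\<bar> > M * sqrt s} \<le> s / (M * sqrt s)\<^sup>2"
    proof (rule G.markov_sq)
      show "integrable (gauss I) (\<lambda>z. (lin_on L (\<lambda>_::nat. c) z 0)\<^sup>2)" using l(4)[of 0] by (simp add: power2_eq_square)
      show "(\<integral>z. (lin_on L (\<lambda>_::nat. c) z 0)\<^sup>2 \<partial>gauss I) \<le> s" using l(3)[of 0] by (simp add: power2_eq_square s_def)
      show "M * sqrt s > 0" using M s by simp
    qed (rule measurable_lin_on[OF I(2)])
    also have "\<dots> = 1 / M\<^sup>2" using s M by (simp add: power_mult_distrib)
    finally show ?thesis by (simp add: lin_on_def s_def)
  qed
qed

lemma gauss_norm_deviation: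
  assumes I: "finite I" "L \<subseteq> I" and M: "M > 0"
  shows "measure (gauss I) {z \<in> space (gauss I). \<bar>(\<Sum>k\<in>L. (z k)\<^sup>2) - real (card L)\<bar> > M * sqrt (real (card L))} \<le> 2 / M\<^sup>2"
proof -
  interpret G: prob_space "gauss I" by (rule prob_space_gauss)
  have fL: "finite L" using I finite_subset by auto
  show ?thesis
  proof (cases "L = {}")
    case True
    then show ?thesis using M by simp
  next
    case False
    then have c: "real (card L) > 0" using fL by (simp add: card_gt_0_iff)
    \<comment> \<open>Centred squares of distinct coordinates are uncorrelated, and each has second
      moment \<open>3 - 2 + 1 = 2\<close>.\<close>
    define f where "f x = x\<^sup>2 - 1" for x :: real
    have mom: "integrable stdn (\<lambda>x. x\<^sup>2)" "(\<integral>x. x\<^sup>2 \<partial>stdn) = 1" "integrable stdn (\<lambda>x. x ^ 4)" "(\<integral>x. x ^ 4 \<partial>stdn) = 3"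
      using stdn_moments(2,3) by (auto simp: has_bochner_integral_iff)
    have f1: "integrable stdn f" "(\<integral>x. f x \<partial>stdn) = 0"
      unfolding f_def using mom stdn.integrable_const[of "1::real"]
      by (simp_all only: Bochner_Integration.integrable_diff Bochner_Integration.integral_diff) (simp_all add: stdn_prob_UNIV)
    have feq: "f x * f x = x ^ 4 - 2 * x\<^sup>2 + 1" for x by (simp add: f_def power2_eq_square power4_eq_xxxx algebra_simps)
    have f2: "integrable stdn (\<lambda>x. f x * f x)" "(\<integral>x. f x * f x \<partial>stdn) = 2"
    proof -
      note i2 = integrable_mult_right[OF mom(1), of 2]
      note i3 = Bochner_Integration.integrable_diff[OF mom(3) i2]
      show "integrable stdn (\<lambda>x. f x * f x)" unfolding feq by (rule Bochner_Integration.integrable_add[OF i3 stdn.integrable_const])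
      show "(\<integral>x. f x * f x \<partial>stdn) = 2"
        unfolding feq Bochner_Integration.integral_add[OF i3 stdn.integrable_const] Bochner_Integration.integral_diff[OF mom(3) i2] integral_mult_right_zero mom(2,4)
        by (simp add: stdn_prob_UNIV)
    qed
    have mf: "f \<in> borel_measurable borel" unfolding f_def by measurable
    have mff: "(\<lambda>x. f x * f x) \<in> borel_measurable borel" using mf by measurable
    have kl: "integrable (gauss I) (\<lambda>z. f (z k) * f (z l)) \<and> (\<integral>z. f (z k) * f (z l) \<partial>gauss I) = (if k = l then 2 else 0)"
      if "k \<in> L" "l \<in> L" for k l
    proof (cases "k = l")
      case True
      have "k \<in> I" using that I by auto
      note c = integral_gauss_component[OF this mff]
      show ?thesis using True c f2 by simp
    next
      case False
      have "k \<in> I" "l \<in> I" using that I by auto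
      note c = integral_gauss_two_components[OF I(1) this False f1(1) f1(1)]
      show ?thesis using False c f1(2) by simp
    qed
    define X where "X z = (\<Sum>k\<in>L. f (z k))" for z
    have X2: "(X z)\<^sup>2 = (\<Sum>k\<in>L. \<Sum>l\<in>L. f (z k) * f (z l))" for z by (simp add: X_def power2_eq_square sum_product)
    have iX: "integrable (gauss I) (\<lambda>z. (X z)\<^sup>2)" unfolding X2 using kl by (intro Bochner_Integration.integrable_sum) auto
    have "(\<integral>z. (X z)\<^sup>2 \<partial>gauss I) = (\<Sum>k\<in>L. \<Sum>l\<in>L. (\<integral>z. f (z k) * f (z l) \<partial>gauss I))"
      unfolding X2 using kl
      by (subst Bochner_Integration.integral_sum, intro Bochner_Integration.integrable_sum, simp,
          intro sum.cong refl Bochner_Integration.integral_sum, simp)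
    also have "\<dots> = (\<Sum>k\<in>L. \<Sum>l\<in>L. if k = l then 2 else 0)" using kl by (intro sum.cong refl) simp
    also have "\<dots> = 2 * real (card L)" using fL by simp
    finally have E: "(\<integral>z. (X z)\<^sup>2 \<partial>gauss I) \<le> 2 * real (card L)" by simp
    have mX: "X \<in> borel_measurable (gauss I)"
      unfolding X_def f_def using I(2) by (intro borel_measurable_sum borel_measurable_diff borel_measurable_power) auto
    have "G.prob {z \<in> space (gauss I). \<bar>X z\<bar> > M * sqrt (real (card L))} \<le> 2 * real (card L) / (M * sqrt (real (card L)))\<^sup>2"
      by (rule G.markov_sq[OF iX mX E]) (use M c in simp)
    also have "\<dots> = 2 / M\<^sup>2" using c by (simp add: power_mult_distrib)
    finally show ?thesis by (simp add: X_def f_def sum_subtractf)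
  qed
qed

section \<open>The fixed point radius\<close>

text \<open>The mean of \<open>err\<close> at noise level \<open>w\<close>, once the true parameter
  is translated to the origin.\<close>

definition Esq :: "nat \<Rightarrow> (nat \<Rightarrow> real) set \<Rightarrow> real \<Rightarrow> real" where
  "Esq n C w = (\<integral>h. (enorm n (pj n C w h))\<^sup>2 \<partial>gauss {..<n})"

lemma Esq_nonneg: "0 \<le> Esq n C w"
  by (simp add: Esq_def)

lemma integrable_cone_proj:
  assumes T: "cc_set0 n T"
  shows "integrable (gauss {..<n}) (\<lambda>h. (enorm n (metric_proj n T h))\<^sup>2)"
  using Jf_variance(3)[OF T, of 1] by (simp add: pj_def)

lemma Esq_le_cone:
  assumes C: "cc_set0 n C" and T: "cc_set n T" "coneset T" "C \<subseteq> T" and w: "w > 0"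
  shows "Esq n C w \<le> w\<^sup>2 * (\<integral>h. (enorm n (metric_proj n T h))\<^sup>2 \<partial>gauss {..<n})"
proof -
  have T0: "cc_set0 n T" using C T by (auto simp: cc_set0_def)
  have "(enorm n (pj n C w h))\<^sup>2 \<le> w\<^sup>2 * (enorm n (metric_proj n T h))\<^sup>2" for h
    using power_mono[OF pj_le_cone[OF C T w, of h] enorm_nonneg, of 2] by (simp add: power_mult_distrib)
  then have "Esq n C w \<le> (\<integral>h. w\<^sup>2 * (enorm n (metric_proj n T h))\<^sup>2 \<partial>gauss {..<n})"
    unfolding Esq_def by (intro integral_mono integrable_mult_right integrable_cone_proj[OF T0] Jf_variance(3)[OF C w])
  then show ?thesis by simp
qed

lemma Esq_cone:
  assumes T: "cc_set n T" "coneset T" and w: "w > 0"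
  shows "Esq n T w = w\<^sup>2 * (\<integral>h. (enorm n (metric_proj n T h))\<^sup>2 \<partial>gauss {..<n})"
  unfolding Esq_def cone_proj_scale[OF T w] enorm_scale by (simp add: power_mult_distrib)

lemma EJf_bounds:
  assumes C: "cc_set0 n C" and T: "cc_set n T" "coneset T" "C \<subseteq> T" and w: "w > 0"
  shows "(\<integral>h. Jf n C w h \<partial>gauss {..<n}) \<le> w * (\<integral>h. (enorm n (metric_proj n T h))\<^sup>2 \<partial>gauss {..<n}) / 2"
proof -
  have T0: "cc_set0 n T" using C T by (auto simp: cc_set0_def)
  have "(\<integral>h. Jf n C w h \<partial>gauss {..<n}) \<le> (\<integral>h. w * (enorm n (metric_proj n T h))\<^sup>2 / 2 \<partial>gauss {..<n})"
    by (intro integral_mono integrable_divide_zero integrable_mult_right impI integrable_cone_proj[OF T0] Jf_variance(1)[OF C w] Jf_le_cone[OF C T w])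
  then show ?thesis by simp
qed

text \<open>Both the norm of the projection and its dependence on the scale are Lipschitz with
  constant \<open>enorm n h\<close>. Serves the continuity in the existence proof for the fixed
  point.\<close>

lemma Esq_diff:
  assumes C: "cc_set0 n C" and w: "w > 0" "w' > 0"
  shows "\<bar>Esq n C w - Esq n C w'\<bar> \<le> \<bar>w\<^sup>2 - w'\<^sup>2\<bar> * (\<integral>h. (enorm n h)\<^sup>2 \<partial>gauss {..<n})"
proof -
  have pt: "\<bar>(enorm n (pj n C w h))\<^sup>2 - (enorm n (pj n C w' h))\<^sup>2\<bar> \<le> \<bar>w\<^sup>2 - w'\<^sup>2\<bar> * (enorm n h)\<^sup>2" for h
  proof -
    let ?a = "enorm n (pj n C w h)" and ?b = "enorm n (pj n C w' h)"
    have tri: "enorm n x \<le> enorm n y + enorm n (\<lambda>i. x i - y i)" for x y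
      using enorm_triangle[of n y "\<lambda>i. x i - y i"] by simp
    have "\<bar>?a - ?b\<bar> \<le> enorm n (\<lambda>i. pj n C w h i - pj n C w' h i)"
      using tri[of "pj n C w h" "pj n C w' h"] tri[of "pj n C w' h" "pj n C w h"]
        enorm_minus_commute[of n "pj n C w h" "pj n C w' h"] by linarith
    also have "\<dots> \<le> \<bar>w - w'\<bar> * enorm n h" by (rule pj_Lipschitz_scale[OF cc_set0D(1)[OF C]])
    finally have 1: "\<bar>?a - ?b\<bar> \<le> \<bar>w - w'\<bar> * enorm n h" .
    have 2: "\<bar>?a + ?b\<bar> \<le> (w + w') * enorm n h"
      using pj_le_enorm[OF C w(1), of h] pj_le_enorm[OF C w(2), of h] by (simp add: algebra_simps)
    have "\<bar>?a\<^sup>2 - ?b\<^sup>2\<bar> = \<bar>?a - ?b\<bar> * \<bar>?a + ?b\<bar>"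
      unfolding abs_mult[symmetric] by (rule arg_cong[of _ _ abs]) algebra
    also have "\<dots> \<le> (\<bar>w - w'\<bar> * enorm n h) * ((w + w') * enorm n h)"
      by (intro mult_mono 1 2) auto
    also have "\<dots> = \<bar>w\<^sup>2 - w'\<^sup>2\<bar> * (enorm n h)\<^sup>2"
    proof -
      have "\<bar>w\<^sup>2 - w'\<^sup>2\<bar> = \<bar>w - w'\<bar> * \<bar>w + w'\<bar>"
        unfolding abs_mult[symmetric] by (rule arg_cong[of _ _ abs]) algebra
      then show ?thesis using w by (simp add: power2_eq_square)
    qed
    finally show ?thesis .
  qed
  have "Esq n C w - Esq n C w' = (\<integral>h. (enorm n (pj n C w h))\<^sup>2 - (enorm n (pj n C w' h))\<^sup>2 \<partial>gauss {..<n})"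
    unfolding Esq_def using Jf_variance(3)[OF C w(1)] Jf_variance(3)[OF C w(2)] by simp
  also have "\<bar>\<dots>\<bar> \<le> (\<integral>h. \<bar>(enorm n (pj n C w h))\<^sup>2 - (enorm n (pj n C w' h))\<^sup>2\<bar> \<partial>gauss {..<n})"
    by (rule integral_abs_bound)
  also have "\<dots> \<le> (\<integral>h. \<bar>w\<^sup>2 - w'\<^sup>2\<bar> * (enorm n h)\<^sup>2 \<partial>gauss {..<n})"
    by (intro integral_mono integrable_abs Bochner_Integration.integrable_diff integrable_mult_right integrable_enorm_sq Jf_variance(3)[OF C] w pt)
  finally show ?thesis by simp
qed

lemma Esq_ratio_mono:
  assumes C: "cc_set0 n C" and w: "0 < w" "w \<le> w'"
  shows "Esq n C w' / w'\<^sup>2 \<le> Esq n C w / w\<^sup>2"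
proof -
  define e where "e = w' / w - 1"
  have e: "e \<ge> 0" "(1 + e) * w = w'" using w by (auto simp: e_def)
  have "Esq n C w' \<le> (1 + e)\<^sup>2 * Esq n C w"
    using pj_sq_mono(2)[OF C w(1) e(1)] unfolding Esq_def e(2) .
  also have "(1 + e)\<^sup>2 = w'\<^sup>2 / w\<^sup>2" by (simp add: e_def power_divide)
  finally show ?thesis using w by (simp add: field_simps)
qed

text \<open>If the projection vanishes almost surely, then \<open>ip n h v \<le> 0\<close> almost
  surely. This variable is centred, hence almost surely zero, and its variance is the squared norm
  of \<open>v\<close>.\<close>

lemma Esq_zero_imp_trivial:
  assumes C: "cc_set0 n C" and w: "w > 0" and z: "Esq n C w = 0" and v: "v \<in> C"
  shows "v = (\<lambda>i. 0)"
proof -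
  let ?G = "gauss {..<n}"
  interpret G: prob_space ?G by (rule prob_space_gauss)
  note C1 = cc_set0D(1)[OF C]
  have "AE h in ?G. (enorm n (pj n C w h))\<^sup>2 = 0"
    using integral_nonneg_eq_0_iff_AE[OF Jf_variance(3)[OF C w]] z by (simp add: Esq_def)
  then have "AE h in ?G. 0 \<le> - ip n h v"
  proof eventually_elim
    case (elim h)
    let ?p = "pj n C w h"
    have p0: "\<forall>i<n. ?p i = 0" using elim by (simp add: enorm_zero_iff)
    then have "ip n h ?p = 0" "ip n ?p ?p = 0" "ip n ?p v = 0" by (simp_all add: ip_def)
    then have "w * ip n h v \<le> 0" using pj_linear_bound[OF C1 v, of w h] by simp
    then show ?case using w by (simp add: mult_le_0_iff)
  qed
  note l = lin_on_moments[of "{..<n}" "{..<n}" "\<lambda>(_::nat). v" 0]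
  have lin: "lin_on {..<n} (\<lambda>(_::nat). v) h 0 = ip n h v" for h by (simp add: lin_on_def ip_def mult.commute)
  have i: "integrable ?G (\<lambda>h. - ip n h v)" "(\<integral>h. - ip n h v \<partial>?G) = 0"
    using l(1,2) unfolding lin by simp_all
  have "AE h in ?G. - ip n h v = 0"
    using integral_nonneg_eq_0_iff_AE[OF i(1) \<open>AE h in ?G. 0 \<le> - ip n h v\<close>] i(2) by simp
  then have "(\<integral>h. ip n h v * ip n h v \<partial>?G) = (\<integral>h. 0 \<partial>?G)"
    using i(1) by (intro integral_cong_AE) auto
  moreover have "(\<integral>h. ip n h v * ip n h v \<partial>?G) = ip n v v"
    using l(3)[of 0] unfolding lin by (simp add: ip_def)
  ultimately have "enorm n v = 0" by (simp add: enorm_eq_sqrt)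
  moreover have "v \<in> Rn n" using v C1 by (auto simp: cc_set_def)
  ultimately show ?thesis by (auto simp: enorm_zero_iff Rn_eq fun_eq_iff) (metis not_less)
qed

text \<open>At a solution, \<open>Esq n C w / w\<^sup>2\<close> equals
  \<open>m * r\<^sup>2 / (r\<^sup>2 + \<sigma>\<^sup>2)\<close>. The former is nonincreasing in
  \<open>r\<close> and the latter strictly increasing, whence uniqueness. The former is also at most
  \<open>d\<close>, its constant value for the tangent cone, which gives the bound and the equality
  case.\<close>

lemma fixed_point_exists_unique:
  assumes C: "cc_set0 n C" and T: "cc_set n T" "coneset T" "C \<subseteq> T"
    and d: "d = (\<integral>h. (enorm n (metric_proj n T h))\<^sup>2 \<partial>gauss {..<n})"
    and m: "d < real m" and n: "n > 0" and \<sigma>: "\<sigma> > 0"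
  shows "\<exists>!r. 0 \<le> r \<and> Esq n C (omega \<sigma> (real m / real n) r) / real n = r\<^sup>2"
    and "0 \<le> r \<and> Esq n C (omega \<sigma> (real m / real n) r) / real n = r\<^sup>2 \<Longrightarrow>
      r\<^sup>2 \<le> \<sigma>\<^sup>2 * (d / (real m - d))"
    and "T = C \<Longrightarrow> 0 \<le> r \<and> Esq n C (omega \<sigma> (real m / real n) r) / real n = r\<^sup>2 \<Longrightarrow>
      r\<^sup>2 = \<sigma>\<^sup>2 * (d / (real m - d))"
proof -
  define w where "w r = omega \<sigma> (real m / real n) r" for r
  have d0: "d \<ge> 0" by (simp add: d)
  have mp: "real m > 0" using d0 m by linarith
  have w2: "(w r)\<^sup>2 = (r\<^sup>2 + \<sigma>\<^sup>2) * (real n / real m)" for r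
    unfolding w_def omega_def using mp n by (simp add: field_simps)
  have wp: "w r > 0" for r
    unfolding w_def omega_def using mp n \<sigma> by (simp add: add_nonneg_pos)
  have key: "r\<^sup>2 * (real m - d) \<le> \<sigma>\<^sup>2 * d" "T = C \<Longrightarrow> r\<^sup>2 * (real m - d) = \<sigma>\<^sup>2 * d"
    if r: "0 \<le> r \<and> Esq n C (w r) / real n = r\<^sup>2" for r
  proof -
    have S: "Esq n C (w r) = real n * r\<^sup>2" using r n by (simp add: field_simps)
    have "real n * r\<^sup>2 \<le> (r\<^sup>2 + \<sigma>\<^sup>2) * (real n / real m) * d"
      using Esq_le_cone[OF C T wp, of r] unfolding S w2 d .
    then have "real n * (r\<^sup>2 * real m) \<le> real n * ((r\<^sup>2 + \<sigma>\<^sup>2) * d)"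
      using mp by (simp add: field_simps)
    then have "r\<^sup>2 * real m \<le> (r\<^sup>2 + \<sigma>\<^sup>2) * d" using n by (simp only: mult_le_cancel_left_pos of_nat_0_less_iff)
    then show "r\<^sup>2 * (real m - d) \<le> \<sigma>\<^sup>2 * d" by (simp add: algebra_simps)
    assume TC: "T = C"
    have "real n * r\<^sup>2 = (r\<^sup>2 + \<sigma>\<^sup>2) * (real n / real m) * d"
      using Esq_cone[OF T(1,2) wp, of r] unfolding TC S w2 d .
    then have "real n * (r\<^sup>2 * real m) = real n * ((r\<^sup>2 + \<sigma>\<^sup>2) * d)"
      using mp by (simp add: field_simps)
    then have "r\<^sup>2 * real m = (r\<^sup>2 + \<sigma>\<^sup>2) * d" using n by simp
    then show "r\<^sup>2 * (real m - d) = \<sigma>\<^sup>2 * d" by (simp add: algebra_simps)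
  qed
  show "r\<^sup>2 \<le> \<sigma>\<^sup>2 * (d / (real m - d))"
    if "0 \<le> r \<and> Esq n C (omega \<sigma> (real m / real n) r) / real n = r\<^sup>2"
    using key(1)[OF that[folded w_def]] m by (simp add: pos_le_divide_eq)
  show "r\<^sup>2 = \<sigma>\<^sup>2 * (d / (real m - d))"
    if "T = C" "0 \<le> r \<and> Esq n C (omega \<sigma> (real m / real n) r) / real n = r\<^sup>2"
    using key(2)[OF that(2)[folded w_def] that(1)] m by (simp add: eq_divide_eq)
  have uniq: False if r: "0 \<le> r \<and> Esq n C (w r) / real n = r\<^sup>2" and r': "0 \<le> r' \<and> Esq n C (w r') / real n = r'\<^sup>2" and lt: "r < r'" for r r'
  proof -
    have lt2: "r\<^sup>2 < r'\<^sup>2" using r lt by (intro power_strict_mono) auto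
    have "(w r)\<^sup>2 \<le> (w r')\<^sup>2" unfolding w2 using lt2 mp by (intro mult_right_mono) auto
    then have "w r \<le> w r'" using wp[of r] wp[of r'] by (simp add: power2_le_iff_abs_le)
    note rat = Esq_ratio_mono[OF C wp this]
    define X Y k where "X = r\<^sup>2 + \<sigma>\<^sup>2" and "Y = r'\<^sup>2 + \<sigma>\<^sup>2" and "k = real n / real m"
    have pos: "0 < X" "0 < Y" "0 < k" using \<sigma> n mp by (auto simp: X_def Y_def k_def intro: add_nonneg_pos)
    have S: "Esq n C (w r) = real n * r\<^sup>2" "Esq n C (w r') = real n * r'\<^sup>2" using r r' n by (auto simp: field_simps)
    have "real n * r'\<^sup>2 / (Y * k) \<le> real n * r\<^sup>2 / (X * k)"
      using rat unfolding S w2 X_def Y_def k_def .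
    then have "real n * r'\<^sup>2 \<le> real n * r\<^sup>2 / (X * k) * (Y * k)" using pos by (simp only: pos_divide_le_eq mult_pos_pos)
    also have "\<dots> = real n * (r\<^sup>2 * Y / X)" using pos by simp
    finally have "r'\<^sup>2 \<le> r\<^sup>2 * Y / X" using n by (simp only: mult_le_cancel_left_pos of_nat_0_less_iff)
    then have "r'\<^sup>2 * (r\<^sup>2 + \<sigma>\<^sup>2) \<le> r\<^sup>2 * (r'\<^sup>2 + \<sigma>\<^sup>2)"
      using pos by (simp only: pos_le_divide_eq X_def[symmetric] Y_def[symmetric])
    then have "r'\<^sup>2 * \<sigma>\<^sup>2 \<le> r\<^sup>2 * \<sigma>\<^sup>2" by (simp add: algebra_simps)
    then show False using lt2 \<sigma> by simp
  qed
  \<comment> \<open>The solution for the tangent cone in place of \<open>C\<close>. There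
    \<open>ph\<close> is nonpositive, and at zero it is nonnegative, so a root lies in
    between.\<close>
  define R where "R = sqrt (\<sigma>\<^sup>2 * d / (real m - d))"
  have R0: "0 \<le> R" using d0 m by (simp add: R_def)
  have R2: "R\<^sup>2 = \<sigma>\<^sup>2 * d / (real m - d)" using d0 m by (simp add: R_def)
  define ph where "ph r = Esq n C (w r) - real n * r\<^sup>2" for r
  have contE: "continuous_on UNIV (\<lambda>r. Esq n C (w r))"
    unfolding continuous_on_eq_continuous_at[OF open_UNIV] isCont_def
  proof
    fix r :: real
    define k where "k = (real n / real m) * (\<integral>h. (enorm n h)\<^sup>2 \<partial>gauss {..<n})"
    show "((\<lambda>x. Esq n C (w x)) \<longlongrightarrow> Esq n C (w r)) (at r)"
    proof (rule LIM_zero_cancel, rule Lim_null_comparison[OF always_eventually, rule_format])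
      show "norm (Esq n C (w x) - Esq n C (w r)) \<le> \<bar>x\<^sup>2 - r\<^sup>2\<bar> * k" for x
      proof -
        have "(w x)\<^sup>2 - (w r)\<^sup>2 = (x\<^sup>2 - r\<^sup>2) * (real n / real m)" unfolding w2 by (simp add: algebra_simps)
        then have "\<bar>(w x)\<^sup>2 - (w r)\<^sup>2\<bar> = \<bar>x\<^sup>2 - r\<^sup>2\<bar> * (real n / real m)" by (simp add: abs_mult)
        then show ?thesis using Esq_diff[OF C wp wp, of x r] by (simp add: k_def mult.assoc)
      qed
      have "((\<lambda>x. \<bar>x\<^sup>2 - r\<^sup>2\<bar> * k) \<longlongrightarrow> \<bar>r\<^sup>2 - r\<^sup>2\<bar> * k) (at r)" by (intro tendsto_intros)
      then show "((\<lambda>x. \<bar>x\<^sup>2 - r\<^sup>2\<bar> * k) \<longlongrightarrow> 0) (at r)" by simp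
    qed
  qed
  have "\<exists>r. 0 \<le> r \<and> r \<le> R \<and> ph r = 0"
  proof (rule IVT2')
    show "0 \<le> ph 0" by (simp add: ph_def Esq_nonneg)
    have "Esq n C (w R) \<le> (w R)\<^sup>2 * d" unfolding d by (rule Esq_le_cone[OF C T wp])
    also have "\<dots> = real n * R\<^sup>2"
    proof -
      define q where "q = real m - d"
      have q: "q > 0" "d = real m - q" using m by (auto simp: q_def)
      show ?thesis unfolding w2 R2 q_def[symmetric] using mp q(1) by (simp add: q(2) field_simps)
    qed
    finally show "ph R \<le> 0" by (simp add: ph_def)
    show "continuous_on {0..R} ph"
      unfolding ph_def by (intro continuous_on_diff continuous_on_subset[OF contE] continuous_intros) auto
  qed (rule R0)
  then obtain r where "0 \<le> r" "ph r = 0" by auto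
  then have r: "0 \<le> r \<and> Esq n C (w r) / real n = r\<^sup>2" using n by (simp add: ph_def field_simps)
  show "\<exists>!r. 0 \<le> r \<and> Esq n C (omega \<sigma> (real m / real n) r) / real n = r\<^sup>2"
    unfolding w_def[symmetric]
  proof (rule ex1I[where a = r])
    show "0 \<le> r \<and> Esq n C (w r) / real n = r\<^sup>2" by (rule r)
    fix r' assume r': "0 \<le> r' \<and> Esq n C (w r') / real n = r'\<^sup>2"
    show "r' = r" using uniq[OF r r'] uniq[OF r' r] by (cases r r' rule: linorder_cases) auto
  qed
qed

section \<open>Level sets and tangent cones\<close>

lemma level_set_cc:
  assumes f: "closed_convex_fun n f" and \<mu>: "\<mu> \<in> Rn n"
  shows "cc_set n (level_set n f \<mu>)" and "\<mu> \<in> level_set n f \<mu>"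
proof -
  show mem: "\<mu> \<in> level_set n f \<mu>" using \<mu> by (simp add: level_set_def)
  have RnC: "(\<lambda>i. (1 - u) * x i + u * y i) \<in> Rn n" if "x \<in> Rn n" "y \<in> Rn n" for x y u
    using that by (auto simp: Rn_eq)
  show "cc_set n (level_set n f \<mu>)"
  \<comment> \<open>An infinite value puts no constraint on the points, and the epigraph has slices
    at finite heights only.\<close>
  proof (cases "f \<mu> = \<infinity>")
    case True
    then have "level_set n f \<mu> = Rn n" by (auto simp: level_set_def)
    then show ?thesis using closed_Rn[of n] \<mu> RnC by (auto simp: cc_set_def cvx_def)
  next
    case False
    have "f \<mu> \<noteq> - \<infinity>" using f \<mu> by (auto simp: closed_convex_fun_def)
    then obtain t where t: "f \<mu> = ereal t" using False by (cases "f \<mu>") auto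
    \<comment> \<open>The level set is the slice of the closed epigraph at height
      \<open>t\<close>.\<close>
    have "continuous_map (Euclidean_space n) (prod_topology (Euclidean_space n) euclideanreal) (\<lambda>x. (x, t))"
      by (intro continuous_map_pairedI) auto
    then have "closedin (Euclidean_space n) {x \<in> topspace (Euclidean_space n). (x, t) \<in> {(x, t). x \<in> Rn n \<and> f x \<le> ereal t}}"
      by (rule closedin_continuous_map_preimage) (use f in \<open>simp add: closed_convex_fun_def\<close>)
    moreover have "{x \<in> topspace (Euclidean_space n). (x, t) \<in> {(x, t). x \<in> Rn n \<and> f x \<le> ereal t}} = level_set n f \<mu>"
      by (auto simp: level_set_def t)
    ultimately have "closed (level_set n f \<mu>)" by (simp add: closedin_Euclidean_iff)
    moreover have "cvx (level_set n f \<mu>)"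
      unfolding cvx_def
    proof (intro ballI allI impI)
      fix x y and u :: real assume xy: "x \<in> level_set n f \<mu>" "y \<in> level_set n f \<mu>" and u: "0 \<le> u \<and> u \<le> 1"
      then have "f (\<lambda>i. (1 - u) * x i + u * y i) \<le> ereal ((1 - u) * t + u * t)"
        using f unfolding closed_convex_fun_def by (auto simp: level_set_def t)
      then show "(\<lambda>i. (1 - u) * x i + u * y i) \<in> level_set n f \<mu>"
        using xy RnC by (auto simp: level_set_def t algebra_simps)
    qed
    ultimately show ?thesis using mem by (auto simp: cc_set_def level_set_def)
  qed
qed

lemma tangent_cone_props:
  assumes K: "cc_set n K" and \<mu>: "\<mu> \<in> K"
  defines "T \<equiv> tangent_cone n K \<mu>" and "C \<equiv> shift_set K \<mu>"
  shows "cc_set0 n C" and "cc_set n T" and "coneset T" and "C \<subseteq> T"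
    and "closed_convex_cone n C \<Longrightarrow> T = C"
proof -
  have \<mu>R: "\<mu> \<in> Rn n" using K \<mu> by (auto simp: cc_set_def)
  have C: "cc_set n C" unfolding C_def by (rule cc_set_shift[OF K \<mu>R])
  have "(\<lambda>i. \<mu> i - \<mu> i) \<in> C" unfolding C_def shift_set_def using \<mu> by (rule imageI)
  then have C0: "(\<lambda>i. 0) \<in> C" by simp
  show "cc_set0 n C" using C C0 by (simp add: cc_set0_def)
  define S where "S = {(\<lambda>i. \<alpha> * (\<nu> i - \<mu> i)) | \<alpha> \<nu>. 0 \<le> \<alpha> \<and> \<nu> \<in> K}"
  have SI: "(\<lambda>i. \<alpha> * v i) \<in> S" if "0 \<le> \<alpha>" "v \<in> C" for \<alpha> v
    using that unfolding S_def C_def shift_set_def by auto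
  have SE: "\<exists>\<alpha> v. 0 \<le> \<alpha> \<and> v \<in> C \<and> x = (\<lambda>i. \<alpha> * v i)" if "x \<in> S" for x
    using that unfolding S_def C_def shift_set_def by auto
  have SR: "S \<subseteq> Rn n"
  proof
    fix x assume "x \<in> S"
    then obtain \<alpha> v where "v \<in> C" "x = (\<lambda>i. \<alpha> * v i)" using SE by blast
    then show "x \<in> Rn n" using C by (auto simp: cc_set_def Rn_eq)
  qed
  \<comment> \<open>Closure in the subspace is ordinary closure because \<open>Rn n\<close> is
    closed.\<close>
  have "T = closure S"
  proof -
    have "closure S \<subseteq> Rn n" using SR closed_Rn by (rule closure_minimal)
    moreover have "Euclidean_space n closure_of S = Rn n \<inter> closure (Rn n \<inter> S)"
      unfolding Euclidean_space_def euclidean_product_topology closure_of_subtopology Rn_eq by (simp add: euclidean_closure_of)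
    ultimately show ?thesis using SR by (simp add: T_def tangent_cone_def S_def[symmetric] Int_absorb1)
  qed
  note T = this
  have cv: "(\<lambda>i. (1 - u) * x i + u * y i) \<in> S" if x: "x \<in> S" and y: "y \<in> S" and u: "0 \<le> u" "u \<le> 1" for x y u
  proof -
    obtain \<alpha> a where a: "0 \<le> \<alpha>" "a \<in> C" "x = (\<lambda>i. \<alpha> * a i)" using SE[OF x] by blast
    obtain \<beta> b where b: "0 \<le> \<beta>" "b \<in> C" "y = (\<lambda>i. \<beta> * b i)" using SE[OF y] by blast
    \<comment> \<open>A convex combination of \<open>\<alpha> * a\<close> and
      \<open>\<beta> * b\<close> is \<open>g\<close> times the convex combination of
      \<open>a\<close> and \<open>b\<close> with weight \<open>u * \<beta> / g\<close>, so it lies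
      again on a ray through \<open>C\<close>.\<close>
    define g where "g = (1 - u) * \<alpha> + u * \<beta>"
    have nn: "0 \<le> (1 - u) * \<alpha>" "0 \<le> u * \<beta>" using a b u by auto
    show ?thesis
    proof (cases "g = 0")
      case True
      then have "(1 - u) * \<alpha> = 0" "u * \<beta> = 0" using nn unfolding g_def by linarith+
      then have "(\<lambda>i. (1 - u) * x i + u * y i) = (\<lambda>i. 0 * 0)" by (auto simp: a b mult.assoc[symmetric])
      then show ?thesis using SI[of 0 "\<lambda>i. 0"] C0 by simp
    next
      case False
      then have g: "g > 0" using nn by (simp add: g_def)
      define s where "s = u * \<beta> / g"
      have s: "0 \<le> s" "s \<le> 1" using nn g by (auto simp: s_def g_def divide_le_eq)
      have s1: "(1 - s) * g = (1 - u) * \<alpha>" "s * g = u * \<beta>" using g by (auto simp: s_def g_def field_simps)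
      have "(\<lambda>i. (1 - s) * a i + s * b i) \<in> C" using C a b s by (auto simp: cc_set_def cvx_def)
      from SI[OF less_imp_le[OF g] this] have "(\<lambda>i. g * ((1 - s) * a i + s * b i)) \<in> S" .
      moreover have "g * ((1 - s) * a i + s * b i) = (1 - u) * x i + u * y i" for i
      proof -
        have "g * ((1 - s) * a i + s * b i) = ((1 - s) * g) * a i + (s * g) * b i" by (simp add: algebra_simps)
        then show ?thesis unfolding s1 by (simp add: a b)
      qed
      ultimately show ?thesis by simp
    qed
  qed
  have SC: "(\<lambda>i. c * x i) \<in> S" if xS: "x \<in> S" and c0: "0 \<le> c" for x c
  proof -
    obtain \<alpha> a where a: "0 \<le> \<alpha>" "a \<in> C" "x = (\<lambda>i. \<alpha> * a i)" using SE[OF xS] by blast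
    show ?thesis using SI[of "c * \<alpha>" a] a c0 by (simp add: mult.assoc)
  qed
  have cont2: "continuous_on A (\<lambda>p. (\<lambda>i. c * fst p i + d * snd p i) :: nat \<Rightarrow> real)" for A and c d :: real
  proof (rule continuous_on_coordinatewise_then_product)
    fix i
    show "continuous_on A (\<lambda>p. c * fst p i + d * snd p i :: real)"
      by (intro continuous_on_add continuous_on_mult_left continuous_on_product_then_coordinatewise[of A fst i]
          continuous_on_product_then_coordinatewise[of A snd i] continuous_on_fst continuous_on_snd continuous_on_id)
  qed
  have CS: "C \<subseteq> S" using SI[of 1] by auto
  show "C \<subseteq> T" unfolding T using CS closure_subset by auto
  show "cc_set n T"
    unfolding cc_set_def
  proof (intro conjI)
    show "T \<noteq> {}" using C0 \<open>C \<subseteq> T\<close> by auto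
    show "closed T" by (simp add: T)
    show "T \<subseteq> Rn n" unfolding T using SR closed_Rn by (rule closure_minimal)
    show "cvx T" unfolding cvx_def
    proof (intro ballI allI impI)
      fix x y and u :: real assume xy: "x \<in> T" "y \<in> T" and u: "0 \<le> u \<and> u \<le> 1"
      have sub: "(\<lambda>p. (\<lambda>i. (1 - u) * fst p i + u * snd p i)) ` closure (S \<times> S) \<subseteq> closure S"
      proof (rule image_closure_subset[OF cont2 closed_closure], rule image_subsetI)
        fix p assume "p \<in> S \<times> S"
        then have "(\<lambda>i. (1 - u) * fst p i + u * snd p i) \<in> S" by (intro cv) (use u in auto)
        then show "(\<lambda>i. (1 - u) * fst p i + u * snd p i) \<in> closure S" by (rule subsetD[OF closure_subset])
      qed
      have "(x, y) \<in> closure (S \<times> S)" using xy by (simp add: T closure_Times)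
      from subsetD[OF sub imageI[OF this]] show "(\<lambda>i. (1 - u) * x i + u * y i) \<in> T" by (simp add: T)
    qed
  qed
  show "coneset T" unfolding coneset_def
  proof (intro ballI allI impI)
    fix x and c :: real assume x: "x \<in> T" and c: "0 \<le> c"
    have sub: "(\<lambda>x. (\<lambda>i. c * x i)) ` closure S \<subseteq> closure S"
    proof (rule image_closure_subset[OF _ closed_closure])
      show "continuous_on (closure S) (\<lambda>(x::nat \<Rightarrow> real) i. c * x i)"
        by (rule continuous_on_coordinatewise_then_product) (rule continuous_on_mult_left[OF continuous_on_coord])
      show "(\<lambda>x. (\<lambda>i. c * x i)) ` S \<subseteq> closure S"
        by (rule image_subsetI, rule subsetD[OF closure_subset], rule SC) (use c in auto)
    qed
    show "(\<lambda>i. c * x i) \<in> T" using subsetD[OF sub imageI[OF x[unfolded T]]] by (simp add: T)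
  qed
  assume cone: "closed_convex_cone n C"
  have "S \<subseteq> C"
  proof
    fix x assume "x \<in> S"
    then obtain \<alpha> v where "0 \<le> \<alpha>" "v \<in> C" "x = (\<lambda>i. \<alpha> * v i)" using SE by blast
    then show "x \<in> C" using cone by (auto simp: closed_convex_cone_def)
  qed
  then have "T \<subseteq> C" unfolding T using C by (intro closure_minimal) (auto simp: cc_set_def)
  then show "T = C" using \<open>C \<subseteq> T\<close> by auto
qed

section \<open>Curvature of the scalar problem\<close>

text \<open>The bound \<open>3 * \<sigma>\<^sup>2 / 4\<close> is the largest one that keeps
  \<open>s\<^sup>2\<close> above \<open>(\<sigma> / 2)\<^sup>2\<close>. The last claim divides a
  difference of squares by the sum of the roots, which is at least \<sigma>.\<close>

lemma sqrt_diff_bound: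
  fixes r s \<sigma> \<eta> :: real
  assumes \<sigma>: "\<sigma> > 0" and s: "s > 0" and sb: "\<bar>s\<^sup>2 - \<sigma>\<^sup>2\<bar> \<le> \<eta>" "\<eta> \<le> 3 * \<sigma>\<^sup>2 / 4"
  shows "\<sigma> / 2 \<le> s" "s \<le> 2 * \<sigma>" "\<bar>sqrt (r\<^sup>2 + \<sigma>\<^sup>2) - sqrt (r\<^sup>2 + s\<^sup>2)\<bar> \<le> \<eta> / \<sigma>"
proof -
  have "(\<sigma> / 2)\<^sup>2 \<le> s\<^sup>2" using sb by (simp add: power_divide)
  then show "\<sigma> / 2 \<le> s" by (rule power2_le_imp_le) (use s in simp)
  have "s\<^sup>2 \<le> (2 * \<sigma>)\<^sup>2" using sb by (simp add: power_mult_distrib)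
  then show "s \<le> 2 * \<sigma>" by (rule power2_le_imp_le) (use \<sigma> in simp)
  define b q where "b = sqrt (r\<^sup>2 + \<sigma>\<^sup>2)" and "q = sqrt (r\<^sup>2 + s\<^sup>2)"
  have b: "b \<ge> \<sigma>" unfolding b_def by (rule real_le_rsqrt) simp
  have q: "q \<ge> 0" by (simp add: q_def)
  have "(b - q) * (b + q) = \<sigma>\<^sup>2 - s\<^sup>2"
  proof -
    have "b\<^sup>2 = r\<^sup>2 + \<sigma>\<^sup>2" "q\<^sup>2 = r\<^sup>2 + s\<^sup>2" by (simp_all add: b_def q_def)
    then show ?thesis by (simp add: power2_eq_square algebra_simps)
  qed
  then have "\<bar>b - q\<bar> * (b + q) = \<bar>\<sigma>\<^sup>2 - s\<^sup>2\<bar>" using b q \<sigma> by (metis abs_mult abs_of_nonneg add_nonneg_nonneg less_imp_le order_trans)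
  then have "\<bar>b - q\<bar> * (b + q) \<le> \<eta>" using sb by linarith
  moreover have "\<bar>b - q\<bar> * \<sigma> \<le> \<bar>b - q\<bar> * (b + q)" using b q by (intro mult_left_mono) auto
  ultimately have "\<bar>b - q\<bar> * \<sigma> \<le> \<eta>" by linarith
  then show "\<bar>sqrt (r\<^sup>2 + \<sigma>\<^sup>2) - sqrt (r\<^sup>2 + s\<^sup>2)\<bar> \<le> \<eta> / \<sigma>"
    using \<sigma> by (simp add: b_def q_def pos_le_divide_eq)
qed

text \<open>With \<open>p = sqrt (a\<^sup>2 + s\<^sup>2)\<close> and \<open>q = sqrt (r\<^sup>2 + s\<^sup>2)\<close> the left hand side of the conclusion times \<open>2\<beta>\<close> equals
  \<open>(a - a\<^sub>0)\<^sup>2 - (p - q)\<^sup>2 + 2 (p - q) (\<beta> - q)\<close>, and \<open>(p - q)\<^sup>2\<close> is smaller than \<open>(a - r)\<^sup>2\<close> because \<open>s\<close> is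
  bounded away from zero.\<close>

lemma curvature_core:
  fixes a a0 r s \<beta> \<epsilon> d D c0 e L \<eta>2 p q :: real
  assumes nn: "a \<ge> 0" "r \<ge> 0" "s > 0" "\<beta> > 0"
    and p: "p = sqrt (a\<^sup>2 + s\<^sup>2)" and q: "q = sqrt (r\<^sup>2 + s\<^sup>2)" and d: "d = \<bar>a - r\<bar>"
    and c0: "c0 \<le> q - r" "c0 \<ge> 0" and D: "2 * r + 2 * s \<le> D"
    and e: "\<bar>a0 - r\<bar> \<le> e" and eta: "\<bar>\<beta> - q\<bar> \<le> \<eta>2" and rd: "d + 2 * r \<le> L * d"
  shows "d\<^sup>2 * c0 - 2 * d * e * (d + D) - 2 * d\<^sup>2 * L * \<eta>2
    \<le> (p + q) * (2 * \<beta> * (p - q - (a\<^sup>2 - r\<^sup>2) / (2 * \<beta>) + (a - a0)\<^sup>2 / (2 * \<beta>)))"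
    and "p + q \<le> d + D" and "0 < p + q"
proof -
  have p2: "p\<^sup>2 = a\<^sup>2 + s\<^sup>2" and q2: "q\<^sup>2 = r\<^sup>2 + s\<^sup>2" using p q by simp_all
  have pa: "a \<le> p" unfolding p by (rule real_le_rsqrt) simp
  have qr: "r \<le> q" unfolding q by (rule real_le_rsqrt) simp
  have pas: "p \<le> a + s" unfolding p using nn by (intro real_le_lsqrt) (auto simp: power2_sum)
  have qrs: "q \<le> r + s" unfolding q using nn by (intro real_le_lsqrt) (auto simp: power2_sum)
  have qs: "q \<ge> s" unfolding q by (rule real_le_rsqrt) simp
  define P where "P = p + q"
  show P0: "0 < p + q" using pa qs nn by linarith
  have ad: "a \<le> r + d" "a + r \<le> d + 2 * r" using d by linarith+
  show PD: "p + q \<le> d + D" using pas qrs ad D by linarith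
  have d0: "d \<ge> 0" by (simp add: d)
  have e0: "e \<ge> 0" using e by linarith
  have pq: "(p - q) * P = a\<^sup>2 - r\<^sup>2" unfolding P_def using p2 q2 by (simp add: power2_eq_square algebra_simps)
  have pqd: "\<bar>p - q\<bar> * P = d * (a + r)"
  proof -
    have "\<bar>(p - q) * P\<bar> = \<bar>p - q\<bar> * P" using P0 by (simp add: abs_mult P_def)
    moreover have "a\<^sup>2 - r\<^sup>2 = (a - r) * (a + r)" by (simp add: power2_eq_square algebra_simps)
    ultimately show ?thesis using pq nn by (simp add: d abs_mult)
  qed
  have "2 * \<beta> * (p - q - (a\<^sup>2 - r\<^sup>2) / (2 * \<beta>) + (a - a0)\<^sup>2 / (2 * \<beta>)) = 2 * \<beta> * (p - q) - (a\<^sup>2 - r\<^sup>2) + (a - a0)\<^sup>2"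
    using nn by (simp add: field_simps)
  also have "\<dots> = (a - a0)\<^sup>2 - (p - q)\<^sup>2 + 2 * (p - q) * (\<beta> - q)"
    unfolding pq[symmetric] P_def by (simp add: power2_eq_square algebra_simps)
  finally have eq: "2 * \<beta> * (p - q - (a\<^sup>2 - r\<^sup>2) / (2 * \<beta>) + (a - a0)\<^sup>2 / (2 * \<beta>)) = (a - a0)\<^sup>2 - (p - q)\<^sup>2 + 2 * (p - q) * (\<beta> - q)" .
  have sq1: "d\<^sup>2 - 2 * d * e \<le> (a - a0)\<^sup>2"
  proof -
    have "(a - a0)\<^sup>2 = (a - r)\<^sup>2 - 2 * ((a - r) * (a0 - r)) + (a0 - r)\<^sup>2" by (simp add: power2_eq_square algebra_simps)
    moreover have "(a - r) * (a0 - r) \<le> d * e"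
    proof -
      have "(a - r) * (a0 - r) \<le> \<bar>a - r\<bar> * \<bar>a0 - r\<bar>" by (metis abs_ge_self abs_mult)
      also have "\<dots> \<le> d * e" using e by (simp add: d mult_left_mono)
      finally show ?thesis .
    qed
    moreover have "d\<^sup>2 = (a - r)\<^sup>2" by (simp add: d)
    moreover have "2 * d * e = 2 * (d * e)" by simp
    ultimately show ?thesis using zero_le_power2[of "a0 - r"] by linarith
  qed
  \<comment> \<open>One factor of \<open>(p - q)\<^sup>2\<close> is bounded by \<open>d\<close>, the
    other is kept exactly as \<open>d * (a + r) / P\<close>. The slack
    \<open>P - (a + r) \<ge> q - r \<ge> c0\<close> is the curvature.\<close>
  have "\<bar>p - q\<bar> \<le> d"
  proof -
    have "\<bar>p - q\<bar> * P \<le> d * P" unfolding pqd using pa qr d0 by (intro mult_left_mono) (auto simp: P_def)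
    then show ?thesis using P0 by (simp add: P_def)
  qed
  then have "\<bar>p - q\<bar> * (\<bar>p - q\<bar> * P) \<le> d * (\<bar>p - q\<bar> * P)" using P0 by (intro mult_right_mono) (auto simp: P_def)
  then have "(p - q)\<^sup>2 * P \<le> d * (d * (a + r))" unfolding pqd by (simp add: power2_eq_square mult.assoc[symmetric] pqd[symmetric])
  moreover have "d\<^sup>2 * P - d\<^sup>2 * (a + r) \<ge> d\<^sup>2 * c0"
  proof -
    have "d\<^sup>2 * c0 \<le> d\<^sup>2 * (P - (a + r))" using c0 pa by (intro mult_left_mono) (auto simp: P_def)
    then show ?thesis by (simp add: algebra_simps)
  qed
  ultimately have t1: "d\<^sup>2 * c0 \<le> (d\<^sup>2 - (p - q)\<^sup>2) * P" by (simp add: power2_eq_square algebra_simps)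
  have t2: "- (2 * d\<^sup>2 * L * \<eta>2) \<le> 2 * (p - q) * (\<beta> - q) * P"
  proof -
    have "\<bar>(p - q) * (\<beta> - q) * P\<bar> = (\<bar>p - q\<bar> * P) * \<bar>\<beta> - q\<bar>" using P0 by (simp add: abs_mult P_def)
    also have "\<dots> = d * (a + r) * \<bar>\<beta> - q\<bar>" unfolding pqd ..
    also have "\<dots> \<le> d * (L * d) * \<eta>2"
      using ad rd d0 nn eta by (intro mult_mono mult_left_mono) auto
    finally show ?thesis by (simp add: power2_eq_square algebra_simps abs_le_iff)
  qed
  have "P * ((a - a0)\<^sup>2 - (p - q)\<^sup>2 + 2 * (p - q) * (\<beta> - q)) \<ge> P * (d\<^sup>2 - 2 * d * e - (p - q)\<^sup>2 + 2 * (p - q) * (\<beta> - q))"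
    using sq1 P0 by (intro mult_left_mono) (auto simp: P_def)
  moreover have "P * (d\<^sup>2 - 2 * d * e - (p - q)\<^sup>2 + 2 * (p - q) * (\<beta> - q)) = (d\<^sup>2 - (p - q)\<^sup>2) * P - 2 * d * e * P + 2 * (p - q) * (\<beta> - q) * P"
    by (simp add: algebra_simps)
  moreover have "2 * d * e * P \<le> 2 * d * e * (d + D)" using PD d0 e0 by (intro mult_left_mono) (auto simp: P_def)
  ultimately show "d\<^sup>2 * c0 - 2 * d * e * (d + D) - 2 * d\<^sup>2 * L * \<eta>2
    \<le> (p + q) * (2 * \<beta> * (p - q - (a\<^sup>2 - r\<^sup>2) / (2 * \<beta>) + (a - a0)\<^sup>2 / (2 * \<beta>)))"
    using t1 t2 unfolding eq P_def by linarith
qed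

text \<open>The order of the quantifiers is dictated by the application: the relative accuracy
  \<open>\<epsilon>1\<close> of \<open>a0\<close> is fixed before \<open>K\<close>, because the
  additive error in the norm of the projection is part of \<open>K\<close> and grows as
  \<open>\<epsilon>1\<close> shrinks. The remaining constants may then depend on \<open>K\<close>.
  The left hand side of the final inequality collects the errors of the probabilistic comparison,
  with \<delta> in the role of \<open>1 / sqrt m\<close>.\<close>

lemma curvature_gap:
  fixes \<sigma> rb \<epsilon> :: real
  assumes \<sigma>: "\<sigma> > 0" and rb: "rb \<ge> 0" and \<epsilon>: "0 < \<epsilon>" "\<epsilon> \<le> 1"
  shows "\<exists>\<epsilon>1>0. \<epsilon>1 \<le> 1 \<and> (\<forall>K\<ge>1. \<forall>\<eta>0>0. \<exists>C \<rho> \<eta> \<delta>0. 0 < C \<and> 0 < \<rho> \<and> \<rho> \<le> 1 \<and> 0 < \<eta> \<and> \<eta> \<le> \<eta>0 \<and> 0 < \<delta>0 \<and>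
    (\<forall>r s \<delta>. 0 \<le> r \<and> r \<le> rb \<and> s > 0 \<and> \<bar>s\<^sup>2 - \<sigma>\<^sup>2\<bar> \<le> \<eta> \<and> 0 < \<delta> \<and> \<delta> \<le> \<delta>0 \<longrightarrow>
      \<bar>sqrt (r\<^sup>2 + \<sigma>\<^sup>2) - sqrt (r\<^sup>2 + s\<^sup>2)\<bar> \<le> \<eta> / \<sigma> \<and>
      \<bar>1 / sqrt (r\<^sup>2 + s\<^sup>2) - 1 / sqrt (r\<^sup>2 + \<sigma>\<^sup>2)\<bar> \<le> 2 * \<rho> \<and>
      (\<forall>a a0. a \<ge> 0 \<and> \<bar>a0 - r\<bar> \<le> \<epsilon>1 * r + K * \<delta> \<and> \<bar>a - r\<bar> > \<epsilon> * r + C * \<delta> \<longrightarrow>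
        2 * \<rho> * r\<^sup>2 + K * ((a + r) * \<delta> + \<delta>\<^sup>2)
        < sqrt (a\<^sup>2 + s\<^sup>2) - sqrt (r\<^sup>2 + s\<^sup>2) - (a\<^sup>2 - r\<^sup>2) / (2 * sqrt (r\<^sup>2 + \<sigma>\<^sup>2)) + (a - a0)\<^sup>2 / (2 * sqrt (r\<^sup>2 + \<sigma>\<^sup>2)))))"
proof -
  \<comment> \<open>\<open>D\<close> bounds \<open>2 * r + 2 * s\<close>, \<open>B\<close> bounds
    \<beta>, and \<open>L * d\<close> bounds \<open>d + 2 * r\<close> as soon as
    \<open>r \<le> d / \<epsilon>\<close>. The curvature \<open>c0\<close> is a lower bound for
    \<open>q - r = s\<^sup>2 / (q + r)\<close>.\<close>
  define D where "D = 2 * rb + 4 * \<sigma>"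
  define B where "B = rb + \<sigma>"
  define L where "L = 2 + 2 / \<epsilon>"
  define c0 where "c0 = \<sigma>\<^sup>2 / (4 * D)"
  have pos: "D > 0" "B > 0" "L > 2" "c0 > 0" using \<sigma> rb \<epsilon> by (auto simp: D_def B_def L_def c0_def)
  define \<epsilon>1 where "\<epsilon>1 = min 1 (min (c0 / (20 * (rb + 1))) (c0 * \<epsilon> / (20 * D)))"
  have e1: "0 < \<epsilon>1" "\<epsilon>1 \<le> 1" using pos rb \<epsilon> by (auto simp: \<epsilon>1_def)
  have e1a: "2 * \<epsilon>1 * rb \<le> c0 / 10"
  proof -
    have "\<epsilon>1 \<le> c0 / (20 * (rb + 1))" by (simp add: \<epsilon>1_def)
    then have "\<epsilon>1 * (20 * (rb + 1)) \<le> c0" using rb by (simp add: pos_le_divide_eq)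
    then show ?thesis using e1 by (simp add: algebra_simps)
  qed
  have e1b: "2 * D * (\<epsilon>1 / \<epsilon>) \<le> c0 / 10"
  proof -
    have "\<epsilon>1 \<le> c0 * \<epsilon> / (20 * D)" by (simp add: \<epsilon>1_def)
    then have "\<epsilon>1 * (20 * D) \<le> c0 * \<epsilon>" using pos by (simp add: pos_le_divide_eq)
    then show ?thesis using \<epsilon> by (simp add: field_simps)
  qed
  show ?thesis
  proof (rule exI[of _ \<epsilon>1], intro conjI allI impI e1)
    fix K \<eta>0 :: real assume K: "1 \<le> K" and \<eta>0: "0 < \<eta>0"
    \<comment> \<open>Together with \<open>\<epsilon>1\<close>, these choices hold each error term
      of the final sum below \<open>c0 / 10\<close>. There are nine of them, namely
      \<open>e1a\<close>, \<open>e1b\<close>, \<open>t2\<close> and \<open>t4\<close> to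
      \<open>t9\<close>, so a tenth of the curvature survives.\<close>
    define C where "C = max 1 (20 * K * D * (1 + B * L) / c0)"
    define \<delta>0 where "\<delta>0 = c0 / (20 * K * (1 + B * L))"
    define \<rho> where "\<rho> = min 1 (c0 * \<epsilon>\<^sup>2 / (40 * B * (rb + D)))"
    define \<eta> where "\<eta> = min \<eta>0 (min (3 * \<sigma>\<^sup>2 / 4) (min (\<sigma> * c0 / (20 * L)) (\<rho> * \<sigma> ^ 3)))"
    have BL: "B * L > 0" using pos by simp
    have C: "C \<ge> 1" by (simp add: C_def)
    have \<rho>: "0 < \<rho>" "\<rho> \<le> 1" using pos rb \<epsilon> by (auto simp: \<rho>_def intro!: divide_pos_pos mult_pos_pos)
    have \<delta>0: "0 < \<delta>0" using pos K BL by (auto simp: \<delta>0_def intro!: divide_pos_pos mult_pos_pos add_pos_pos)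
    have \<eta>: "0 < \<eta>" using \<eta>0 \<sigma> pos \<rho> by (auto simp: \<eta>_def intro!: divide_pos_pos mult_pos_pos)
    have CK: "20 * K * D * (1 + B * L) \<le> c0 * C"
    proof -
      have "20 * K * D * (1 + B * L) / c0 \<le> C" by (simp add: C_def)
      then show ?thesis using pos by (simp add: pos_divide_le_eq mult.commute)
    qed
    have t4: "2 * D * (K / C) \<le> c0 / 10" and t9: "2 * B * D * (K * L / C) \<le> c0 / 10"
    proof -
      have n: "0 \<le> 20 * K * D * (B * L)" "0 \<le> 20 * K * D" using K pos BL by auto
      have "20 * K * D \<le> c0 * C" "20 * K * D * (B * L) \<le> c0 * C" using CK n by (simp_all add: algebra_simps)
      then show "2 * D * (K / C) \<le> c0 / 10" "2 * B * D * (K * L / C) \<le> c0 / 10"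
        using C by (simp_all add: field_simps)
    qed
    have t2: "2 * (K * \<delta>0) \<le> c0 / 10" and t7: "2 * B * (K * L * \<delta>0) \<le> c0 / 10"
    proof -
      have x: "\<delta>0 * (20 * K * (1 + B * L)) = c0" using K BL by (simp add: \<delta>0_def)
      have n: "0 \<le> 20 * K * \<delta>0 * (B * L)" "0 \<le> 20 * K * \<delta>0" using K BL \<delta>0 by auto
      show "2 * (K * \<delta>0) \<le> c0 / 10" "2 * B * (K * L * \<delta>0) \<le> c0 / 10"
        using x n by (simp_all add: algebra_simps)
    qed
    have \<rho>x: "\<rho> * (40 * B * (rb + D)) \<le> c0 * \<epsilon>\<^sup>2"
    proof -
      have "\<rho> \<le> c0 * \<epsilon>\<^sup>2 / (40 * B * (rb + D))" by (simp add: \<rho>_def)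
      then show ?thesis using pos rb by (simp add: pos_le_divide_eq)
    qed
    have t8: "2 * B * D * (2 * \<rho> / \<epsilon>\<^sup>2) \<le> c0 / 10" and t6: "2 * B * (2 * \<rho> * rb / \<epsilon>) \<le> c0 / 10"
    proof -
      have n: "0 \<le> \<rho> * (40 * B * rb)" "0 \<le> \<rho> * (40 * B * D)" using \<rho> pos rb by auto
      have "\<rho> * (40 * B * D) \<le> c0 * \<epsilon>\<^sup>2" using \<rho>x n by (simp add: algebra_simps)
      then show "2 * B * D * (2 * \<rho> / \<epsilon>\<^sup>2) \<le> c0 / 10" using \<epsilon> by (simp add: field_simps)
      have "\<rho> * (40 * B * rb) \<le> c0 * \<epsilon>\<^sup>2" using \<rho>x n by (simp add: algebra_simps)
      also have "\<dots> \<le> c0 * \<epsilon>" using \<epsilon> pos by (simp add: power2_eq_square mult_left_le)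
      finally show "2 * B * (2 * \<rho> * rb / \<epsilon>) \<le> c0 / 10" using \<epsilon> by (simp add: field_simps)
    qed
    have t5: "2 * L * (\<eta> / \<sigma>) \<le> c0 / 10"
    proof -
      have "\<eta> \<le> \<sigma> * c0 / (20 * L)" by (simp add: \<eta>_def)
      then have "\<eta> * (20 * L) \<le> \<sigma> * c0" using pos by (simp add: pos_le_divide_eq)
      then show ?thesis using \<sigma> by (simp add: field_simps)
    qed
    have main: "(\<forall>r s \<delta>. 0 \<le> r \<and> r \<le> rb \<and> s > 0 \<and> \<bar>s\<^sup>2 - \<sigma>\<^sup>2\<bar> \<le> \<eta> \<and> 0 < \<delta> \<and> \<delta> \<le> \<delta>0 \<longrightarrow>
      \<bar>sqrt (r\<^sup>2 + \<sigma>\<^sup>2) - sqrt (r\<^sup>2 + s\<^sup>2)\<bar> \<le> \<eta> / \<sigma> \<and>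
      \<bar>1 / sqrt (r\<^sup>2 + s\<^sup>2) - 1 / sqrt (r\<^sup>2 + \<sigma>\<^sup>2)\<bar> \<le> 2 * \<rho> \<and>
      (\<forall>a a0. a \<ge> 0 \<and> \<bar>a0 - r\<bar> \<le> \<epsilon>1 * r + K * \<delta> \<and> \<bar>a - r\<bar> > \<epsilon> * r + C * \<delta> \<longrightarrow>
        2 * \<rho> * r\<^sup>2 + K * ((a + r) * \<delta> + \<delta>\<^sup>2)
        < sqrt (a\<^sup>2 + s\<^sup>2) - sqrt (r\<^sup>2 + s\<^sup>2) - (a\<^sup>2 - r\<^sup>2) / (2 * sqrt (r\<^sup>2 + \<sigma>\<^sup>2)) + (a - a0)\<^sup>2 / (2 * sqrt (r\<^sup>2 + \<sigma>\<^sup>2))))"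
    proof (intro allI impI, elim conjE)
      fix r s \<delta> :: real
      assume r: "0 \<le> r" "r \<le> rb" and s: "s > 0" "\<bar>s\<^sup>2 - \<sigma>\<^sup>2\<bar> \<le> \<eta>" and \<delta>: "0 < \<delta>" "\<delta> \<le> \<delta>0"
      define \<beta> q where "\<beta> = sqrt (r\<^sup>2 + \<sigma>\<^sup>2)" and "q = sqrt (r\<^sup>2 + s\<^sup>2)"
      note sb = sqrt_diff_bound[OF \<sigma> s]
      have \<eta>3: "\<eta> \<le> 3 * \<sigma>\<^sup>2 / 4" by (simp add: \<eta>_def)
      have s2: "\<sigma> / 2 \<le> s" "s \<le> 2 * \<sigma>" by (rule sb(1)[OF \<eta>3], rule sb(2)[OF \<eta>3])
      have bq: "\<bar>\<beta> - q\<bar> \<le> \<eta> / \<sigma>" unfolding \<beta>_def q_def by (rule sb(3)[OF \<eta>3])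
      have \<beta>\<sigma>: "\<sigma> \<le> \<beta>" unfolding \<beta>_def by (rule real_le_rsqrt) simp
      have \<beta>B: "\<beta> \<le> B" unfolding \<beta>_def B_def using r \<sigma> rb
        by (intro real_le_lsqrt) (auto simp: power2_sum intro!: add_mono power_mono add_nonneg_nonneg order_trans[OF power_mono[OF r(2) r(1), of 2]])
      have qs: "s \<le> q" unfolding q_def by (rule real_le_rsqrt) simp
      have qrs: "q \<le> r + s" unfolding q_def using r s by (intro real_le_lsqrt) (auto simp: power2_sum)
      have q2: "q\<^sup>2 = r\<^sup>2 + s\<^sup>2" by (simp add: q_def)
      have qr: "r \<le> q" unfolding q_def by (rule real_le_rsqrt) simp
      have inv: "\<bar>1 / q - 1 / \<beta>\<bar> \<le> 2 * \<rho>"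
      proof -
        have p0: "q > 0" "\<beta> > 0" using qs s \<beta>\<sigma> \<sigma> by linarith+
        have "1 / q - 1 / \<beta> = (\<beta> - q) / (q * \<beta>)" using p0 by (simp add: field_simps)
        then have "\<bar>1 / q - 1 / \<beta>\<bar> = \<bar>\<beta> - q\<bar> / (q * \<beta>)" using p0 by (simp add: abs_mult)
        also have "\<dots> \<le> (\<eta> / \<sigma>) / (\<sigma> / 2 * \<sigma>)"
          using bq p0 \<sigma> s2 qs \<beta>\<sigma> \<eta> by (intro frac_le mult_mono) auto
        also have "\<dots> = 2 * \<eta> / \<sigma> ^ 3" using \<sigma> by (simp add: field_simps power3_eq_cube)
        also have "\<dots> \<le> 2 * \<rho>"
        proof -
          have "\<eta> \<le> \<rho> * \<sigma> ^ 3" by (simp add: \<eta>_def)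
          then show ?thesis using \<sigma> by (simp add: pos_divide_le_eq)
        qed
        finally show ?thesis .
      qed
      have c0q: "c0 \<le> q - r"
      proof -
        have "(q - r) * (q + r) = s\<^sup>2" using q2 by (simp add: power2_eq_square algebra_simps)
        moreover have "(q - r) * (q + r) \<le> (q - r) * D" using qr qrs r s2 by (intro mult_left_mono) (auto simp: D_def)
        moreover have "(\<sigma> / 2)\<^sup>2 \<le> s\<^sup>2" using s2 \<sigma> by (intro power_mono) auto
        ultimately have "\<sigma>\<^sup>2 / 4 \<le> (q - r) * D" by (simp add: power_divide)
        then show ?thesis using pos by (simp add: c0_def field_simps)
      qed
      have "2 * \<rho> * r\<^sup>2 + K * ((a + r) * \<delta> + \<delta>\<^sup>2)
        < sqrt (a\<^sup>2 + s\<^sup>2) - q - (a\<^sup>2 - r\<^sup>2) / (2 * \<beta>) + (a - a0)\<^sup>2 / (2 * \<beta>)"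
        if a: "a \<ge> 0" and a0: "\<bar>a0 - r\<bar> \<le> \<epsilon>1 * r + K * \<delta>" and bad: "\<bar>a - r\<bar> > \<epsilon> * r + C * \<delta>" for a a0
      proof -
        define d p where "d = \<bar>a - r\<bar>" and "p = sqrt (a\<^sup>2 + s\<^sup>2)"
        define e where "e = \<epsilon>1 * r + K * \<delta>"
        \<comment> \<open>Outside the range both \<open>r\<close> and \<delta> are controlled by
          \<open>d\<close>, as \<open>r \<le> d / \<epsilon>\<close> and
          \<open>\<delta> \<le> d / C\<close>; all errors are then measured against
          \<open>d\<^sup>2\<close>.\<close>
        have er: "0 \<le> \<epsilon> * r" "0 < C * \<delta>" using \<epsilon> r C \<delta> by auto
        have d: "d > 0" "\<epsilon> * r \<le> d" "C * \<delta> \<le> d" using bad er by (auto simp: d_def)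
        have rd: "r \<le> d / \<epsilon>" using d \<epsilon> by (simp add: field_simps)
        have \<delta>d: "\<delta> \<le> d / C" using d C by (simp add: field_simps)
        have \<delta>d1: "d / C \<le> d" using d C by (simp add: divide_le_eq mult_le_cancel_left1)
        have rL: "d + 2 * r \<le> (L - 1) * d"
        proof -
          have "(L - 1) * d = d + 2 * (d / \<epsilon>)" by (simp add: L_def algebra_simps)
          then show ?thesis using rd by linarith
        qed
        have Ld: "0 \<le> L * d" using pos d by simp
        have rL': "d + 2 * r \<le> L * d" using rL d by (simp add: algebra_simps)
        have ar: "a + r \<le> (L - 1) * d" using rL by (simp add: d_def)
        note cc = curvature_core[OF a r(1) s(1) _ p_def q_def d_def c0q less_imp_le[OF pos(4)] _ a0[folded e_def] bq rL', of D]
        have \<beta>0: "\<beta> > 0" using \<beta>\<sigma> \<sigma> by linarith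
        have Dr: "2 * r + 2 * s \<le> D" using r s2 by (simp add: D_def)
        note core = cc[OF \<beta>0 Dr]
        define F where "F = p - q - (a\<^sup>2 - r\<^sup>2) / (2 * \<beta>) + (a - a0)\<^sup>2 / (2 * \<beta>)"
        define R where "R = 2 * \<rho> * r\<^sup>2 + K * ((a + r) * \<delta> + \<delta>\<^sup>2)"
        have R0: "0 \<le> R" using \<rho> K a r \<delta> by (simp add: R_def)
        have dd: "(a + r) * \<delta> + \<delta>\<^sup>2 \<le> L * d * \<delta>"
        proof -
          have "\<delta> \<le> d" using \<delta>d \<delta>d1 by linarith
          then have "(a + r + \<delta>) * \<delta> \<le> (L * d) * \<delta>" using ar \<delta> by (intro mult_right_mono) (auto simp: algebra_simps)
          then show ?thesis by (simp add: power2_eq_square algebra_simps)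
        qed
        \<comment> \<open>Two bounds on \<open>R\<close>, quadratic and linear in \<open>d\<close>,
          because the factor \<open>p + q \<le> d + D\<close> has a bounded part, which goes with
          the quadratic bound, and a part \<open>d\<close>, which goes with the linear one.
          \<open>E1\<close> and \<open>E2\<close> do the same for \<open>e\<close>, one order
          lower.\<close>
        have R1: "R \<le> d\<^sup>2 * (2 * \<rho> / \<epsilon>\<^sup>2 + K * L / C)"
        proof -
          have "r\<^sup>2 \<le> (d / \<epsilon>)\<^sup>2" using rd r by (intro power_mono)
          then have "2 * \<rho> * r\<^sup>2 \<le> 2 * \<rho> * (d / \<epsilon>)\<^sup>2" using \<rho> by (intro mult_left_mono) auto
          moreover have "K * ((a + r) * \<delta> + \<delta>\<^sup>2) \<le> K * (L * d * (d / C))"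
            using order_trans[OF dd mult_left_mono[OF \<delta>d Ld]] K by (intro mult_left_mono) auto
          ultimately show ?thesis by (simp add: R_def power2_eq_square field_simps)
        qed
        have R2: "R \<le> d * (2 * \<rho> * rb / \<epsilon> + K * L * \<delta>0)"
        proof -
          have "r * r \<le> (d / \<epsilon>) * rb" using rd r d \<epsilon> by (intro mult_mono) auto
          then have "2 * \<rho> * r\<^sup>2 \<le> 2 * \<rho> * ((d / \<epsilon>) * rb)" using \<rho> by (intro mult_left_mono) (auto simp: power2_eq_square)
          moreover have "K * ((a + r) * \<delta> + \<delta>\<^sup>2) \<le> K * (L * d * \<delta>0)"
            using order_trans[OF dd mult_left_mono[OF \<delta>(2) Ld]] K by (intro mult_left_mono) auto
          ultimately show ?thesis by (simp add: R_def algebra_simps)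
        qed
        have E1: "e \<le> d * (\<epsilon>1 / \<epsilon> + K / C)"
        proof -
          have "\<epsilon>1 * r \<le> \<epsilon>1 * (d / \<epsilon>)" "K * \<delta> \<le> K * (d / C)" 
            using mult_left_mono[OF rd, of \<epsilon>1] mult_left_mono[OF \<delta>d, of K] e1 K by simp_all
          then show ?thesis by (simp add: e_def algebra_simps)
        qed
        have E2: "e \<le> \<epsilon>1 * rb + K * \<delta>0"
          unfolding e_def using r \<delta> e1 K by (intro add_mono mult_left_mono) auto
        have "(p + q) * (2 * \<beta> * R) \<le> (d + D) * (2 * B * R)"
          using core(2,3) \<beta>0 \<beta>B R0 by (intro mult_mono) auto
        also have "\<dots> = d * (2 * B) * R + D * (2 * B) * R" by (simp add: algebra_simps)
        also have "\<dots> \<le> d * (2 * B) * (d * (2 * \<rho> * rb / \<epsilon> + K * L * \<delta>0)) + D * (2 * B) * (d\<^sup>2 * (2 * \<rho> / \<epsilon>\<^sup>2 + K * L / C))"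
          using d pos by (intro add_mono mult_left_mono R1 R2) auto
        also have "\<dots> = d\<^sup>2 * (2 * B * (2 * \<rho> * rb / \<epsilon>) + 2 * B * (K * L * \<delta>0) + 2 * B * D * (2 * \<rho> / \<epsilon>\<^sup>2) + 2 * B * D * (K * L / C))"
          by (simp add: power2_eq_square algebra_simps)
        also have "\<dots> \<le> d\<^sup>2 * (4 * (c0 / 10))" using t6 t7 t8 t9 by (intro mult_left_mono) auto
        finally have up: "(p + q) * (2 * \<beta> * R) \<le> d\<^sup>2 * (4 * (c0 / 10))" .
        have "2 * d * e * (d + D) = 2 * d * d * e + 2 * d * D * e" by (simp add: algebra_simps)
        also have "\<dots> \<le> 2 * d * d * (\<epsilon>1 * rb + K * \<delta>0) + 2 * d * D * (d * (\<epsilon>1 / \<epsilon> + K / C))"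
          using d pos by (intro add_mono mult_left_mono E1 E2) auto
        also have "\<dots> = d\<^sup>2 * (2 * \<epsilon>1 * rb + 2 * (K * \<delta>0) + 2 * D * (\<epsilon>1 / \<epsilon>) + 2 * D * (K / C))"
          by (simp add: power2_eq_square algebra_simps)
        also have "\<dots> \<le> d\<^sup>2 * (4 * (c0 / 10))" using e1a e1b t2 t4 by (intro mult_left_mono) auto
        finally have eD: "2 * d * e * (d + D) \<le> d\<^sup>2 * (4 * (c0 / 10))" .
        have "2 * d\<^sup>2 * L * (\<eta> / \<sigma>) = d\<^sup>2 * (2 * L * (\<eta> / \<sigma>))" by (simp add: algebra_simps)
        also have "\<dots> \<le> d\<^sup>2 * (c0 / 10)" using t5 by (intro mult_left_mono) auto
        finally have eL: "2 * d\<^sup>2 * L * (\<eta> / \<sigma>) \<le> d\<^sup>2 * (c0 / 10)" .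
        have "0 < d\<^sup>2 * c0" using d pos by simp
        then have "d\<^sup>2 * (4 * (c0 / 10)) < d\<^sup>2 * c0 - d\<^sup>2 * (4 * (c0 / 10)) - d\<^sup>2 * (c0 / 10)" by (simp add: algebra_simps)
        then have "(p + q) * (2 * \<beta> * R) < (p + q) * (2 * \<beta> * F)"
          using up eD eL core(1) unfolding F_def by linarith
        then have "R < F" using core(3) \<beta>0 by (simp add: mult_less_cancel_left_pos)
        then show ?thesis by (simp add: R_def F_def p_def)
      qed
      then show "\<bar>sqrt (r\<^sup>2 + \<sigma>\<^sup>2) - sqrt (r\<^sup>2 + s\<^sup>2)\<bar> \<le> \<eta> / \<sigma> \<and>
      \<bar>1 / sqrt (r\<^sup>2 + s\<^sup>2) - 1 / sqrt (r\<^sup>2 + \<sigma>\<^sup>2)\<bar> \<le> 2 * \<rho> \<and>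
      (\<forall>a a0. a \<ge> 0 \<and> \<bar>a0 - r\<bar> \<le> \<epsilon>1 * r + K * \<delta> \<and> \<bar>a - r\<bar> > \<epsilon> * r + C * \<delta> \<longrightarrow>
        2 * \<rho> * r\<^sup>2 + K * ((a + r) * \<delta> + \<delta>\<^sup>2)
        < sqrt (a\<^sup>2 + s\<^sup>2) - sqrt (r\<^sup>2 + s\<^sup>2) - (a\<^sup>2 - r\<^sup>2) / (2 * sqrt (r\<^sup>2 + \<sigma>\<^sup>2)) + (a - a0)\<^sup>2 / (2 * sqrt (r\<^sup>2 + \<sigma>\<^sup>2)))"
        using bq inv unfolding \<beta>_def q_def by blast
    qed
    show "\<exists>C \<rho> \<eta> \<delta>0. 0 < C \<and> 0 < \<rho> \<and> \<rho> \<le> 1 \<and> 0 < \<eta> \<and> \<eta> \<le> \<eta>0 \<and> 0 < \<delta>0 \<and>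
    (\<forall>r s \<delta>. 0 \<le> r \<and> r \<le> rb \<and> s > 0 \<and> \<bar>s\<^sup>2 - \<sigma>\<^sup>2\<bar> \<le> \<eta> \<and> 0 < \<delta> \<and> \<delta> \<le> \<delta>0 \<longrightarrow>
      \<bar>sqrt (r\<^sup>2 + \<sigma>\<^sup>2) - sqrt (r\<^sup>2 + s\<^sup>2)\<bar> \<le> \<eta> / \<sigma> \<and>
      \<bar>1 / sqrt (r\<^sup>2 + s\<^sup>2) - 1 / sqrt (r\<^sup>2 + \<sigma>\<^sup>2)\<bar> \<le> 2 * \<rho> \<and>
      (\<forall>a a0. a \<ge> 0 \<and> \<bar>a0 - r\<bar> \<le> \<epsilon>1 * r + K * \<delta> \<and> \<bar>a - r\<bar> > \<epsilon> * r + C * \<delta> \<longrightarrow>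
        2 * \<rho> * r\<^sup>2 + K * ((a + r) * \<delta> + \<delta>\<^sup>2)
        < sqrt (a\<^sup>2 + s\<^sup>2) - sqrt (r\<^sup>2 + s\<^sup>2) - (a\<^sup>2 - r\<^sup>2) / (2 * sqrt (r\<^sup>2 + \<sigma>\<^sup>2)) + (a - a0)\<^sup>2 / (2 * sqrt (r\<^sup>2 + \<sigma>\<^sup>2))))"
    proof (rule exI[of _ C], rule exI[of _ \<rho>], rule exI[of _ \<eta>], rule exI[of _ \<delta>0], intro conjI)
      show "0 < C" using C by simp
      show "\<eta> \<le> \<eta>0" by (simp add: \<eta>_def)
    qed (rule \<rho> \<eta> \<delta>0 main)+
  qed
qed

section \<open>The primary and the auxiliary problem\<close>

text \<open>One point of \<open>S\<close> is picked from each basic open set that meets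
  \<open>S\<close>. Strict continuous inequalities over \<open>S\<close> are thereby reduced to
  countably many, as measurability and Gordon's comparison demand.\<close>

lemma dense_sequence:
  fixes S :: "'a::second_countable_topology set"
  assumes "S \<noteq> {}"
  shows "\<exists>s::nat \<Rightarrow> 'a. (\<forall>k. s k \<in> S) \<and> (\<forall>U x. open U \<and> x \<in> U \<and> x \<in> S \<longrightarrow> (\<exists>k. s k \<in> U))"
proof -
  obtain B :: "'a set set" where B: "countable B" "topological_basis B"
    using ex_countable_basis by blast
  define f where "f V = (SOME x. x \<in> V \<inter> S)" for V
  define T where "T = f ` {V \<in> B. V \<inter> S \<noteq> {}}"
  have f: "f V \<in> V \<inter> S" if "V \<inter> S \<noteq> {}" for V
    unfolding f_def by (rule someI_ex) (use that in auto)
  have cT: "countable T" unfolding T_def by (rule countable_image, rule countable_subset[OF _ B(1)]) auto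
  have dense: "\<exists>t\<in>T. t \<in> U" if U: "open U" "x \<in> U" "x \<in> S" for U x
  proof -
    obtain V where V: "V \<in> B" "x \<in> V" "V \<subseteq> U" by (rule topological_basisE[OF B(2) U(1,2)])
    then have ne: "V \<inter> S \<noteq> {}" using U by blast
    then have "f V \<in> T" using V(1) ne by (simp add: T_def)
    moreover have "f V \<in> U" using f[OF ne] V(3) by auto
    ultimately show ?thesis by (rule bexI[rotated])
  qed
  obtain x0 where "x0 \<in> S" using assms by auto
  then have ne: "T \<noteq> {}" using dense[OF open_UNIV UNIV_I] by auto
  have TS: "T \<subseteq> S" unfolding T_def using f by auto
  show ?thesis
  proof (intro exI[of _ "from_nat_into T"] conjI allI impI)
    show "from_nat_into T k \<in> S" for k by (rule subsetD[OF TS from_nat_into[OF ne]])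
    fix U x assume "open U \<and> x \<in> U \<and> x \<in> S"
    then obtain t where t: "t \<in> T" "t \<in> U" using dense[of U x] by auto
    obtain k where "from_nat_into T k = t" using from_nat_into_surj[OF cT t(1)] by auto
    then show "\<exists>k. from_nat_into T k \<in> U" using t(2) by auto
  qed
qed

text \<open>The members are arbitrary sequences from coordinate \<open>m\<close> on, so nearness is
  measured by \<open>enorm m\<close> and not by the topology.\<close>

definition sphere_seq :: "nat \<Rightarrow> (nat \<Rightarrow> nat \<Rightarrow> real) \<Rightarrow> bool" where
  "sphere_seq m u \<longleftrightarrow> (\<forall>j. enorm m (u j) = 1) \<and>
     (\<forall>w e. enorm m w = 1 \<and> e > 0 \<longrightarrow> (\<exists>j. enorm m (\<lambda>i. w i - u j i) < e))"

lemma sphere_seq_exists: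
  assumes "m > 0"
  shows "\<exists>u. sphere_seq m u"
proof -
  let ?S = "{x :: nat \<Rightarrow> real. enorm m x = 1}"
  have "enorm m (\<lambda>i. if i = 0 then 1 else 0) = 1"
  proof -
    have "ip m (\<lambda>i. if i = 0 then 1 else 0) (\<lambda>i. if i = 0 then 1 else 0) = (\<Sum>i<m. if i = 0 then 1 else 0)"
      unfolding ip_def by (rule sum.cong) auto
    also have "\<dots> = 1" using assms by simp
    finally show ?thesis by (simp add: enorm_eq_sqrt)
  qed
  then have "?S \<noteq> {}" by auto
  from dense_sequence[OF this] obtain u :: "nat \<Rightarrow> nat \<Rightarrow> real"
    where u: "(\<forall>k. u k \<in> ?S) \<and> (\<forall>U x. open U \<and> x \<in> U \<and> x \<in> ?S \<longrightarrow> (\<exists>k. u k \<in> U))"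
    by (rule exE)
  have u1: "enorm m (u k) = 1" for k using conjunct1[OF u] by simp
  have "\<exists>j. enorm m (\<lambda>i. w i - u j i) < e" if w: "enorm m w = 1" and e: "e > 0" for w e
  proof -
    have "open {x. enorm m (\<lambda>i. w i - x i) < e}"
      by (rule open_Collect_less[OF continuous_on_enorm_diff continuous_on_const])
    moreover have "w \<in> {x. enorm m (\<lambda>i. w i - x i) < e}" using e by (simp add: enorm_eq_sqrt)
    moreover have "w \<in> ?S" using w by simp
    ultimately have "\<exists>k. u k \<in> {x. enorm m (\<lambda>i. w i - x i) < e}"
      using conjunct2[OF u, rule_format, of "{x. enorm m (\<lambda>i. w i - x i) < e}" w] by (simp only: simp_thms)
    then show ?thesis by simp
  qed
  then have "sphere_seq m u" using u1 by (simp add: sphere_seq_def)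
  then show ?thesis by (rule exI[of _ u])
qed

lemma sphere_seq_near:
  assumes u: "sphere_seq m u" and w: "enorm m w = 1" and e: "e > 0"
  shows "\<exists>j. \<forall>y. \<bar>ip m (u j) y - ip m w y\<bar> \<le> e * enorm m y"
proof -
  obtain j where j: "enorm m (\<lambda>i. w i - u j i) < e" using u w e unfolding sphere_seq_def by blast
  have "\<bar>ip m (u j) y - ip m w y\<bar> \<le> e * enorm m y" for y
  proof -
    have "\<bar>ip m (u j) y - ip m w y\<bar> = \<bar>ip m (\<lambda>i. w i - u j i) y\<bar>" by (simp add: ip_simps abs_minus_commute)
    also have "\<dots> \<le> enorm m (\<lambda>i. w i - u j i) * enorm m y" by (rule abs_ip_le_enorm)
    also have "\<dots> \<le> e * enorm m y" using j by (intro mult_right_mono) auto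
    finally show ?thesis .
  qed
  then show ?thesis by blast
qed

lemma unit_vector:
  assumes "enorm m y > 0"
  shows "enorm m (\<lambda>i. (1 / enorm m y) * y i) = 1" and "ip m (\<lambda>i. (1 / enorm m y) * y i) z = ip m y z / enorm m y"
  using assms by (simp_all only: enorm_scale ip_scale_left) simp_all

lemma sphere_seq_sup:
  assumes u: "sphere_seq m u" and t: "t < enorm m y"
  shows "\<exists>j. t < ip m (u j) y"
proof (cases "enorm m y = 0")
  case True
  then have "ip m (u 0) y = 0" by (simp add: enorm_zero_iff ip_def)
  then show ?thesis using t True by (intro exI[of _ 0]) simp
next
  case False
  then have y: "enorm m y > 0" by (simp add: order_less_le)
  \<comment> \<open>Half of the slack, relative to the norm of \<open>y\<close>, so that the strict
    inequality survives the approximation.\<close>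
  define e where "e = (enorm m y - t) / (2 * enorm m y)"
  have e: "e > 0" using t y by (simp add: e_def)
  obtain j where j: "\<bar>ip m (u j) y - ip m (\<lambda>i. (1 / enorm m y) * y i) y\<bar> \<le> e * enorm m y"
    using sphere_seq_near[OF u unit_vector(1)[OF y] e] by blast
  have w: "ip m (\<lambda>i. (1 / enorm m y) * y i) y = enorm m y"
    unfolding unit_vector(2)[OF y] using y by (simp add: enorm_sq[symmetric] power2_eq_square)
  have ee: "e * enorm m y = (enorm m y - t) / 2" using y by (simp add: e_def)
  have "t < ip m (u j) y" 
  proof -
    have "- (ip m (u j) y - enorm m y) \<le> (enorm m y - t) / 2" using j[unfolded w ee] by (rule abs_le_D2)
    then have "2 * (enorm m y - ip m (u j) y) \<le> enorm m y - t" by simp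
    then have "t + enorm m y \<le> 2 * ip m (u j) y" by (simp add: algebra_simps)
    then show ?thesis using t by (simp add: algebra_simps)
  qed
  then show ?thesis ..
qed

text \<open>Here \<open>z\<close> has standard Gaussian entries and stands for \<open>sqrt n\<close>
  times the design, while \<open>x\<close> stands for the deviation from the true parameter divided
  by \<open>sqrt n\<close>.\<close>

definition res :: "(nat \<Rightarrow> real) \<Rightarrow> (nat \<times> nat \<Rightarrow> real) \<Rightarrow> nat \<Rightarrow> (nat \<Rightarrow> real) \<Rightarrow> nat \<Rightarrow> real" where
  "res \<xi> z n x a = \<xi> a - ip n (\<lambda>b. z (a, b)) x"

lemma ip_res: "ip m u (res \<xi> z n x) = ip m u \<xi> - ip m u (\<lambda>a. ip n (\<lambda>b. z (a, b)) x)"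
  unfolding res_def[abs_def] by (simp only: ip_diff_right)

lemma continuous_res: "continuous_on S (\<lambda>x. res \<xi> z n x)"
  unfolding res_def[abs_def]
  by (rule continuous_on_coordinatewise_then_product, rule continuous_on_diff[OF continuous_on_const],
      rule continuous_on_ip[OF continuous_on_const continuous_on_id])

lemma res_convex: "res \<xi> z n (\<lambda>i. (1 - t) * x i + t * y i) = (\<lambda>a. (1 - t) * res \<xi> z n x a + t * res \<xi> z n y a)"
  by (auto simp: res_def ip_simps algebra_simps)

text \<open>The direction of the smallest residual separates: all residuals have inner product at least its norm with it.\<close>

lemma min_residual_le:
  assumes D: "compact D" "cvx D" "D \<noteq> {}" and u: "sphere_seq m u" and c: "c \<ge> 0"
    and lt: "\<And>j. \<exists>v\<in>D. ip m (u j) (res \<xi> z n v) < c"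
  shows "\<exists>v\<in>D. enorm m (res \<xi> z n v) \<le> c"
proof (rule ccontr)
  assume "\<not> (\<exists>v\<in>D. enorm m (res \<xi> z n v) \<le> c)"
  then have gt: "enorm m (res \<xi> z n v) > c" if "v \<in> D" for v using that by force
  have cont: "continuous_on D (\<lambda>v. enorm m (res \<xi> z n v))" by (rule continuous_on_enorm[OF continuous_res])
  obtain v where v: "v \<in> D" and vmin: "\<forall>y\<in>D. enorm m (res \<xi> z n v) \<le> enorm m (res \<xi> z n y)"
    using continuous_attains_inf[OF D(1,3) cont] by blast
  obtain v1 where vmax: "\<forall>y\<in>D. enorm m (res \<xi> z n y) \<le> enorm m (res \<xi> z n v1)"
    using continuous_attains_sup[OF D(1,3) cont] by blast
  define Y where "Y = res \<xi> z n ` D"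
  define r0 where "r0 = res \<xi> z n v"
  have pos: "enorm m r0 > 0" using gt[OF v] c unfolding r0_def by linarith
  have cY: "cvx Y" unfolding cvx_def Y_def
  proof (intro ballI allI impI)
    fix x y and t :: real assume "x \<in> res \<xi> z n ` D" "y \<in> res \<xi> z n ` D" and t: "0 \<le> t \<and> t \<le> 1"
    then obtain a b where ab: "a \<in> D" "b \<in> D" "x = res \<xi> z n a" "y = res \<xi> z n b" by blast
    have "(\<lambda>i. (1 - t) * a i + t * b i) \<in> D" using D(2) ab t unfolding cvx_def by blast
    then show "(\<lambda>i. (1 - t) * x i + t * y i) \<in> res \<xi> z n ` D"
      unfolding ab res_convex[symmetric] by (rule imageI)
  qed
  have neg: "enorm m (\<lambda>i. 0 - x i) = enorm m x" for x by (simp add: enorm_def L2_set_def)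
  have sep: "ip m r0 r0 \<le> ip m r0 y" if y: "y \<in> Y" for y
  proof -
    have "ip m (\<lambda>i. 0 - r0 i) (\<lambda>i. y i - r0 i) \<le> 0"
    proof (rule projection_ip[OF cY _ y])
      show "r0 \<in> Y" unfolding Y_def r0_def using v by (rule imageI)
      show "enorm m (\<lambda>i. 0 - r0 i) \<le> enorm m (\<lambda>i. 0 - y i)" if "y \<in> Y" for y
        using that vmin unfolding neg Y_def r0_def by blast
    qed
    then show ?thesis unfolding ip_diff_left ip_diff_right by simp
  qed
  define R where "R = enorm m (res \<xi> z n v1) + 1"
  have R: "R > 0" by (simp add: R_def add_nonneg_pos)
  \<comment> \<open>Replacing the separating direction by a member of the sequence then changes its
    inner product with a residual by at most the excess \<open>enorm m r0 - c\<close>.\<close>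
  define e where "e = (enorm m r0 - c) / R"
  have e: "e > 0" using gt[OF v] R by (simp add: e_def r0_def)
  obtain j where j: "\<And>y. \<bar>ip m (u j) y - ip m (\<lambda>i. (1 / enorm m r0) * r0 i) y\<bar> \<le> e * enorm m y"
    using sphere_seq_near[OF u unit_vector(1)[OF pos] e] by blast
  obtain x where x: "x \<in> D" "ip m (u j) (res \<xi> z n x) < c" using lt by blast
  define y where "y = res \<xi> z n x"
  have yY: "y \<in> Y" unfolding Y_def y_def using x(1) by (rule imageI)
  have "enorm m r0 = ip m r0 r0 / enorm m r0" using pos by (simp add: enorm_sq[symmetric] power2_eq_square)
  also have "\<dots> \<le> ip m r0 y / enorm m r0" using sep[OF yY] pos by (intro divide_right_mono) auto
  finally have 1: "enorm m r0 \<le> ip m (\<lambda>i. (1 / enorm m r0) * r0 i) y" unfolding unit_vector(2)[OF pos] .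
  have "e * enorm m y \<le> e * R" using vmax x(1) e unfolding y_def R_def by (intro mult_left_mono) auto
  also have "\<dots> = enorm m r0 - c" using R by (simp add: e_def)
  finally have "c \<le> ip m (u j) y" using j[of y] 1 by linarith
  then show False using x(2) by (simp add: y_def)
qed

section \<open>Transfer from the auxiliary process to residuals\<close>

lemma measurable_entry: "k \<in> I \<Longrightarrow> (\<lambda>z. z k) \<in> borel_measurable (gauss I)"
  by (simp add: measurable_component_singleton)

lemma measurable_ip:
  assumes "\<And>i. i < n \<Longrightarrow> (\<lambda>z. f z i) \<in> borel_measurable N" "\<And>i. i < n \<Longrightarrow> (\<lambda>z. g z i) \<in> borel_measurable N"
  shows "(\<lambda>z. ip n (f z) (g z)) \<in> borel_measurable N"
  unfolding ip_def by (rule borel_measurable_sum, rule borel_measurable_times; rule assms; simp)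

lemma measurable_enorm:
  assumes "\<And>i. i < n \<Longrightarrow> (\<lambda>z. f z i) \<in> borel_measurable N"
  shows "(\<lambda>z. enorm n (f z)) \<in> borel_measurable N"
  unfolding enorm_eq_sqrt by (rule measurable_compose[OF _ borel_measurable_sqrt], rule measurable_ip; rule assms)

lemma measurable_res_gidx:
  assumes "a < m"
  shows "(\<lambda>z. res \<xi> z n x a) \<in> borel_measurable (gauss (gidx m n))"
  unfolding res_def using assms
  by (intro borel_measurable_diff borel_measurable_const measurable_ip measurable_entry) (auto simp: gidx_def)

lemma gamma_tail:
  assumes M: "M > 0"
  shows "measure (gauss (gidx m n)) {z \<in> space (gauss (gidx m n)). \<not> z (m, n) \<le> M} \<le> 1 / M\<^sup>2"
    and "{z \<in> space (gauss (gidx m n)). \<not> z (m, n) \<le> M} \<in> sets (gauss (gidx m n))"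
proof -
  interpret G: prob_space "gauss (gidx m n)" by (rule prob_space_gauss)
  have k: "(m, n) \<in> gidx m n" by (simp add: gidx_def)
  have [measurable]: "(\<lambda>z. z (m, n)) \<in> borel_measurable (gauss (gidx m n))" by (rule measurable_entry[OF k])
  show "{z \<in> space (gauss (gidx m n)). \<not> z (m, n) \<le> M} \<in> sets (gauss (gidx m n))" by measurable
  have "G.prob {z \<in> space (gauss (gidx m n)). \<not> z (m, n) \<le> M}
    \<le> G.prob {z \<in> space (gauss (gidx m n)). \<bar>\<Sum>k\<in>{(m, n)}. 1 * z k\<bar> > M * sqrt (\<Sum>k\<in>{(m, n)}. 1\<^sup>2)}"
  proof (rule G.finite_measure_mono)
    show "{z \<in> space (gauss (gidx m n)). \<bar>\<Sum>k\<in>{(m, n)}. 1 * z k\<bar> > M * sqrt (\<Sum>k\<in>{(m, n)}. 1\<^sup>2)} \<in> G.events"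
      by simp
  qed auto
  also have "\<dots> \<le> 1 / M\<^sup>2"
    by (rule gauss_linear_deviation[OF finite_gidx(1) _ M]) (use k in auto)
  finally show "G.prob {z \<in> space (gauss (gidx m n)). \<not> z (m, n) \<le> M} \<le> 1 / M\<^sup>2" .
qed

text \<open>Raising the threshold by \<open>enorm n (x i) * M\<close> absorbs the scalar term of
  \<open>po\<close> unless \<open>z (m, n)\<close> exceeds \<open>M\<close>, which costs probability
  at most \<open>1 / M\<^sup>2\<close>.\<close>

lemma residual_lower:
  assumes u: "sphere_seq m u" and M: "M > 0"
    and A: "A \<in> sets (gauss (gidx m n))"
    and imp: "\<And>z i. z \<in> A \<Longrightarrow> c + enorm n (x i) * M + ip n (\<lambda>b. z (m, b)) (x i) < enorm m (\<lambda>a. \<xi> a + enorm n (x i) * z (a, n))"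
  shows "measure (gauss (gidx m n)) A - 1 / M\<^sup>2
    \<le> measure (gauss (gidx m n)) {z \<in> space (gauss (gidx m n)). \<forall>i::nat. c < enorm m (res \<xi> z n (x i))}"
proof -
  let ?G = "gauss (gidx m n)"
  interpret G: prob_space ?G by (rule prob_space_gauss)
  define cc where "cc i j = c + enorm n (x i) * M - ip m (u j) \<xi>" for i j
  let ?AO = "{z \<in> space ?G. \<forall>i. \<exists>j. cc i j < ao m n z (x i) (u j)}"
  let ?PO = "{z \<in> space ?G. \<forall>i. \<exists>j. cc i j < po m n z (x i) (u j)}"
  let ?R = "{z \<in> space ?G. \<forall>i. c < enorm m (res \<xi> z n (x i))}"
  let ?g = "{z \<in> space ?G. \<not> z (m, n) \<le> M}"
  have u1: "enorm m (u j) = 1" for j using u by (simp add: sphere_seq_def)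
  have mao: "(\<lambda>z. ao m n z y w) \<in> borel_measurable ?G" for y w
    unfolding ao_def by (intro borel_measurable_diff borel_measurable_times borel_measurable_const measurable_ip measurable_entry) (auto simp: gidx_def)
  have mAO: "?AO \<in> G.events" using mao by measurable
  have mpo: "(\<lambda>z. po m n z y w) \<in> borel_measurable ?G" for y w
    unfolding po_def by (intro borel_measurable_diff borel_measurable_times borel_measurable_const measurable_ip measurable_entry) (auto simp: gidx_def)
  have mPO: "?PO \<in> G.events" using mpo by measurable
  have mR: "?R \<in> G.events" using measurable_enorm[OF measurable_res_gidx] by measurable
  have "A \<subseteq> ?AO"
  proof
    fix z assume z: "z \<in> A"
    have "\<exists>j. cc i j < ao m n z (x i) (u j)" for i
    proof -
      obtain j where j: "c + enorm n (x i) * M + ip n (\<lambda>b. z (m, b)) (x i) < ip m (u j) (\<lambda>a. \<xi> a + enorm n (x i) * z (a, n))"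
        using sphere_seq_sup[OF u imp[OF z, of i]] by blast
      then have "cc i j < ao m n z (x i) (u j)"
        unfolding cc_def ao_def ip_add_right ip_scale_right by linarith
      then show ?thesis ..
    qed
    then show "z \<in> ?AO" using z sets.sets_into_space[OF A] by blast
  qed
  then have "G.prob A \<le> G.prob ?AO" using mAO by (rule G.finite_measure_mono)
  also have "\<dots> \<le> G.prob ?PO" by (rule gordon_lower[OF u1])
  also have "\<dots> \<le> G.prob (?R \<union> ?g)"
  proof (rule G.finite_measure_mono)
    show "?R \<union> ?g \<in> G.events" using mR gamma_tail(2)[OF M] by blast
    show "?PO \<subseteq> ?R \<union> ?g"
    proof
      fix z assume z: "z \<in> ?PO"
      show "z \<in> ?R \<union> ?g"
      proof (cases "z (m, n) \<le> M")
        case True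
        have "c < enorm m (res \<xi> z n (x i))" for i
        proof -
          obtain j where j: "cc i j < po m n z (x i) (u j)" using z by blast
          have "enorm n (x i) * z (m, n) \<le> enorm n (x i) * M" using True by (intro mult_left_mono) auto
          then have "c < ip m (u j) (res \<xi> z n (x i))" using j unfolding cc_def po_def ip_res by linarith
          also have "\<dots> \<le> enorm m (res \<xi> z n (x i))" using ip_le_enorm[of m "u j" "res \<xi> z n (x i)"] u1 by simp
          finally show ?thesis .
        qed
        then show ?thesis using z by blast
      next
        case False
        then show ?thesis using z by blast
      qed
    qed
  qed
  also have "\<dots> \<le> G.prob ?R + G.prob ?g" using mR gamma_tail(2)[OF M] by (intro measure_Un_le)
  finally show ?thesis using gamma_tail(1)[OF M, of m n] by linarith
qed

lemma residual_upper:
  assumes u: "sphere_seq m u" and M: "M > 0"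
    and A: "A \<in> sets (gauss (gidx m n))"
    and imp: "\<And>z. z \<in> A \<Longrightarrow> \<exists>i. enorm m (\<lambda>a. \<xi> a - enorm n (x i) * z (a, n)) - ip n (\<lambda>b. z (m, b)) (x i) < c - enorm n (x i) * M"
  shows "measure (gauss (gidx m n)) A - 1 / M\<^sup>2
    \<le> measure (gauss (gidx m n)) {z \<in> space (gauss (gidx m n)). \<forall>j. \<exists>i::nat. ip m (u j) (res \<xi> z n (x i)) < c}"
proof -
  let ?G = "gauss (gidx m n)"
  interpret G: prob_space ?G by (rule prob_space_gauss)
  \<comment> \<open>Changing the sign of \<open>x\<close> flips the bilinear terms and keeps the
    norm. An upper bound on the residual becomes a lower bound on the process, while the scalar term
    remains one to be bounded from above.\<close>
  define x' where "x' i = (\<lambda>b. (-1) * x i b)" for i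
  have nx: "enorm n (x' i) = enorm n (x i)" for i unfolding x'_def enorm_scale by simp
  have ipx: "ip n y (x' i) = - ip n y (x i)" for i y unfolding x'_def ip_scale_right by simp
  define cc where "cc i j = ip m (u j) \<xi> - c + enorm n (x i) * M" for i j
  let ?AO = "{z \<in> space ?G. \<forall>j. \<exists>i. cc i j < ao m n z (x' i) (u j)}"
  let ?PO = "{z \<in> space ?G. \<forall>j. \<exists>i. cc i j < po m n z (x' i) (u j)}"
  let ?R = "{z \<in> space ?G. \<forall>j. \<exists>i. ip m (u j) (res \<xi> z n (x i)) < c}"
  let ?g = "{z \<in> space ?G. \<not> z (m, n) \<le> M}"
  have u1: "enorm m (u j) = 1" for j using u by (simp add: sphere_seq_def)
  have mao: "(\<lambda>z. ao m n z y w) \<in> borel_measurable ?G" for y w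
    unfolding ao_def by (intro borel_measurable_diff borel_measurable_times borel_measurable_const measurable_ip measurable_entry) (auto simp: gidx_def)
  have mAO: "?AO \<in> G.events" using mao by measurable
  have mR1: "(\<lambda>z. ip m (u j) (res \<xi> z n (x i))) \<in> borel_measurable ?G" for i j
    by (intro measurable_ip borel_measurable_const measurable_res_gidx)
  have mR: "?R \<in> G.events" using mR1 by measurable
  have "A \<subseteq> ?AO"
  proof
    fix z assume z: "z \<in> A"
    obtain i where i: "enorm m (\<lambda>a. \<xi> a - enorm n (x i) * z (a, n)) - ip n (\<lambda>b. z (m, b)) (x i) < c - enorm n (x i) * M"
      using imp[OF z] by blast
    have "cc i j < ao m n z (x' i) (u j)" for j
    proof -
      have "ip m (u j) (\<lambda>a. \<xi> a - enorm n (x i) * z (a, n)) \<le> enorm m (\<lambda>a. \<xi> a - enorm n (x i) * z (a, n))"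
        using ip_le_enorm[of m "u j"] u1 by simp
      then show ?thesis using i unfolding cc_def ao_def nx ipx ip_diff_right ip_scale_right by linarith
    qed
    then show "z \<in> ?AO" using z sets.sets_into_space[OF A] by blast
  qed
  then have "G.prob A \<le> G.prob ?AO" using mAO by (rule G.finite_measure_mono)
  also have "\<dots> \<le> G.prob ?PO" by (rule gordon_upper[OF u1])
  also have "\<dots> \<le> G.prob (?R \<union> ?g)"
  proof (rule G.finite_measure_mono)
    show "?R \<union> ?g \<in> G.events" using mR gamma_tail(2)[OF M] by blast
    show "?PO \<subseteq> ?R \<union> ?g"
    proof
      fix z assume z: "z \<in> ?PO"
      show "z \<in> ?R \<union> ?g"
      proof (cases "z (m, n) \<le> M")
        case True
        have "\<exists>i. ip m (u j) (res \<xi> z n (x i)) < c" for j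
        proof -
          obtain i where i: "cc i j < po m n z (x' i) (u j)" using z by blast
          have "enorm n (x i) * z (m, n) \<le> enorm n (x i) * M" using True by (intro mult_left_mono) auto
          moreover have "ip m (u j) (\<lambda>a. ip n (\<lambda>b. z (a, b)) (x' i)) = - ip m (u j) (\<lambda>a. ip n (\<lambda>b. z (a, b)) (x i))"
            unfolding ipx by (simp add: ip_def sum_negf)
          ultimately have "ip m (u j) (res \<xi> z n (x i)) < c" using i unfolding cc_def po_def ip_res nx by linarith
          then show ?thesis ..
        qed
        then show ?thesis using z by blast
      next
        case False
        then show ?thesis using z by blast
      qed
    qed
  qed
  also have "\<dots> \<le> G.prob ?R + G.prob ?g" using mR gamma_tail(2)[OF M] by (intro measure_Un_le)
  finally show ?thesis using gamma_tail(1)[OF M, of m n] by linarith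
qed

lemma gvec_deviation:
  fixes m n :: nat and \<xi> :: "nat \<Rightarrow> real"
  assumes M: "M > 0"
  defines "Bad \<equiv> {z \<in> space (gauss (gidx m n)). \<not> (\<bar>(enorm m (\<lambda>a. z (a, n)))\<^sup>2 - real m\<bar> \<le> M * sqrt (real m) \<and>
      \<bar>ip m \<xi> (\<lambda>a. z (a, n))\<bar> \<le> M * enorm m \<xi>)}"
  shows "Bad \<in> sets (gauss (gidx m n))" "measure (gauss (gidx m n)) Bad \<le> 3 / M\<^sup>2"
proof -
  let ?G = "gauss (gidx m n)"
  interpret G: prob_space ?G by (rule prob_space_gauss)
  let ?L = "(\<lambda>a. (a, n)) ` {..<m}"
  have L: "?L \<subseteq> gidx m n" by (auto simp: gidx_def)
  have inj: "inj_on (\<lambda>a. (a, n)) {..<m}" by (auto simp: inj_on_def)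
  have card: "card ?L = m" using inj by (simp add: card_image)
  have s1: "(\<Sum>k\<in>?L. (z k)\<^sup>2) = (enorm m (\<lambda>a. z (a, n)))\<^sup>2" for z :: "nat \<times> nat \<Rightarrow> real"
    unfolding enorm_sq ip_def by (subst sum.reindex[OF inj]) (simp add: power2_eq_square)
  have s2: "(\<Sum>k\<in>?L. \<xi> (fst k) * z k) = ip m \<xi> (\<lambda>a. z (a, n))" for z :: "nat \<times> nat \<Rightarrow> real"
    unfolding ip_def by (subst sum.reindex[OF inj]) simp
  have s3: "sqrt (\<Sum>k\<in>?L. (\<xi> (fst k))\<^sup>2) = enorm m \<xi>"
    unfolding enorm_eq_sqrt ip_def by (subst sum.reindex[OF inj]) (simp add: power2_eq_square)
  let ?B1 = "{z \<in> space ?G. \<bar>(enorm m (\<lambda>a. z (a, n)))\<^sup>2 - real m\<bar> > M * sqrt (real m)}"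
  let ?B2 = "{z \<in> space ?G. \<bar>ip m \<xi> (\<lambda>a. z (a, n))\<bar> > M * enorm m \<xi>}"
  have m1: "(\<lambda>z. enorm m (\<lambda>a. z (a, n))) \<in> borel_measurable ?G"
    by (intro measurable_enorm measurable_entry) (auto simp: gidx_def)
  have m2: "(\<lambda>z. ip m \<xi> (\<lambda>a. z (a, n))) \<in> borel_measurable ?G"
    by (intro measurable_ip borel_measurable_const measurable_entry) (auto simp: gidx_def)
  have mB: "?B1 \<in> G.events" "?B2 \<in> G.events" using m1 m2 by measurable
  have eq: "Bad = ?B1 \<union> ?B2" unfolding Bad_def by auto
  show "Bad \<in> G.events" unfolding eq using mB by (rule sets.Un)
  have "G.prob Bad \<le> G.prob ?B1 + G.prob ?B2" unfolding eq using mB by (rule measure_Un_le)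
  also have "\<dots> \<le> 2 / M\<^sup>2 + 1 / M\<^sup>2"
    using gauss_norm_deviation[OF finite_gidx(1) L M, unfolded s1 card]
      gauss_linear_deviation[OF finite_gidx(1) L M, of "\<lambda>k. \<xi> (fst k)", unfolded s2 s3]
    by (rule add_mono)
  finally show "G.prob Bad \<le> 3 / M\<^sup>2" by (simp add: add_divide_distrib[symmetric])
qed

text \<open>The square differs from \<open>m * (a\<^sup>2 + s\<^sup>2)\<close> by at most
  \<open>3 * a * M\<close> times the main root, so the root itself moves by at most
  \<open>3 * a * M\<close>. It is essential that this error is proportional to \<open>a\<close>,
  hence small for a small estimation error.\<close>

lemma norm_shift_bounds:
  assumes m: "m > 0" and a: "a \<ge> 0" and s: "s > 0" and M: "M \<ge> 0"
    and xs: "enorm m \<xi> = s * sqrt (real m)"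
    and g: "\<bar>(enorm m g)\<^sup>2 - real m\<bar> \<le> M * sqrt (real m)" "\<bar>ip m \<xi> g\<bar> \<le> M * enorm m \<xi>"
  shows "sqrt (real m) * sqrt (a\<^sup>2 + s\<^sup>2) - 3 * a * M \<le> enorm m (\<lambda>i. \<xi> i + a * g i)"
    and "enorm m (\<lambda>i. \<xi> i - a * g i) \<le> sqrt (real m) * sqrt (a\<^sup>2 + s\<^sup>2) + 3 * a * M"
proof -
  define w q where "w = sqrt (real m)" and "q = sqrt (a\<^sup>2 + s\<^sup>2)"
  have w: "w > 0" "w\<^sup>2 = real m" using m by (auto simp: w_def)
  have q2: "q\<^sup>2 = a\<^sup>2 + s\<^sup>2" by (simp add: q_def)
  have qa: "a \<le> q" unfolding q_def by (rule real_le_rsqrt) simp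
  have qs: "s \<le> q" unfolding q_def by (rule real_le_rsqrt) simp
  define G I where "G = (enorm m g)\<^sup>2 - w\<^sup>2" and "I = ip m \<xi> g"
  have G: "\<bar>G\<bar> \<le> M * w" and I: "\<bar>I\<bar> \<le> M * (s * w)" using g by (auto simp: G_def I_def w w_def xs)
  have sq: "(enorm m (\<lambda>i. \<xi> i + b * g i))\<^sup>2 = (w * q)\<^sup>2 + (b\<^sup>2 * G + 2 * b * I)" if b: "b\<^sup>2 = a\<^sup>2" for b
  proof -
    have e0: "ip m (\<lambda>i. \<xi> i + b * g i) (\<lambda>i. \<xi> i + b * g i) = ip m \<xi> \<xi> + b * I + b * (I + b * ip m g g)"
      unfolding ip_add_left ip_add_right ip_scale_left ip_scale_right I_def ip_commute[of m g \<xi>] by (simp only: distrib_left add.assoc)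
    have e1: "ip m \<xi> \<xi> = s\<^sup>2 * w\<^sup>2" unfolding enorm_sq[symmetric] xs w_def power_mult_distrib ..
    have e2: "ip m g g = G + w\<^sup>2" by (simp add: G_def enorm_sq)
    have e3: "(w * q)\<^sup>2 = w\<^sup>2 * (b\<^sup>2 + s\<^sup>2)" unfolding b q2[symmetric] by (simp add: power_mult_distrib)
    show ?thesis unfolding enorm_sq e0 e1 e2 e3 by algebra
  qed
  have dev: "\<bar>b\<^sup>2 * G + 2 * b * I\<bar> \<le> 3 * a * M * (w * q)" if b: "\<bar>b\<bar> = a" for b
  proof -
    have "\<bar>b\<^sup>2 * G + 2 * b * I\<bar> \<le> a\<^sup>2 * (M * w) + 2 * a * (M * (s * w))"
    proof (rule order_trans[OF abs_triangle_ineq], rule add_mono)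
      have "b\<^sup>2 = a\<^sup>2" using b by auto
      then show "\<bar>b\<^sup>2 * G\<bar> \<le> a\<^sup>2 * (M * w)" using G by (simp add: abs_mult mult_left_mono)
      show "\<bar>2 * b * I\<bar> \<le> 2 * a * (M * (s * w))" using I a b by (simp add: abs_mult mult_left_mono)
    qed
    also have "\<dots> = a * M * w * (a + 2 * s)" by (simp add: power2_eq_square algebra_simps)
    also have "\<dots> \<le> a * M * w * (3 * q)" using qa qs a M w by (intro mult_left_mono) auto
    finally show ?thesis by (simp add: algebra_simps)
  qed
  have wq: "w * q > 0" using w qs s by simp
  have aM: "0 \<le> 3 * a * M" using a M by simp
  show "sqrt (real m) * sqrt (a\<^sup>2 + s\<^sup>2) - 3 * a * M \<le> enorm m (\<lambda>i. \<xi> i + a * g i)"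
  proof (cases "w * q \<le> 3 * a * M")
    case True
    then show ?thesis using enorm_nonneg[of m "\<lambda>i. \<xi> i + a * g i"] unfolding w_def[symmetric] q_def[symmetric] by linarith
  next
    case False
    have "(w * q - 3 * a * M)\<^sup>2 = (w * q)\<^sup>2 - 3 * a * M * (w * q) - 3 * a * M * (w * q - 3 * a * M)"
      by algebra
    moreover have "0 \<le> 3 * a * M * (w * q - 3 * a * M)" by (rule mult_nonneg_nonneg[OF aM]) (use False in linarith)
    moreover have "- (3 * a * M * (w * q)) \<le> a\<^sup>2 * G + 2 * a * I" using abs_le_D2[OF dev[OF abs_of_nonneg[OF a]]] by linarith
    ultimately have "(w * q - 3 * a * M)\<^sup>2 \<le> (enorm m (\<lambda>i. \<xi> i + a * g i))\<^sup>2" unfolding sq[OF refl] by linarith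
    from power2_le_imp_le[OF this enorm_nonneg] show ?thesis unfolding w_def q_def .
  qed
  have n: "\<bar>- a\<bar> = a" "(- a)\<^sup>2 = a\<^sup>2" using a by simp_all
  have "(w * q + 3 * a * M)\<^sup>2 = (w * q)\<^sup>2 + 3 * a * M * (w * q) + 3 * a * M * (w * q + 3 * a * M)"
    by algebra
  moreover have "0 \<le> 3 * a * M * (w * q + 3 * a * M)" by (rule mult_nonneg_nonneg[OF aM]) (use aM wq in linarith)
  ultimately have "(enorm m (\<lambda>i. \<xi> i + (- a) * g i))\<^sup>2 \<le> (w * q + 3 * a * M)\<^sup>2"
    unfolding sq[OF n(2)] using abs_le_D1[OF dev[OF n(1)]] by linarith
  then have "enorm m (\<lambda>i. \<xi> i + (- a) * g i) \<le> w * q + 3 * a * M"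
    by (rule power2_le_imp_le) (use wq aM in auto)
  then show "enorm m (\<lambda>i. \<xi> i - a * g i) \<le> sqrt (real m) * sqrt (a\<^sup>2 + s\<^sup>2) + 3 * a * M"
    by (simp add: w_def q_def)
qed

section \<open>One problem instance\<close>

text \<open>Below, \<open>C\<close> is \<open>K - \<mu>\<^sub>0\<close> and \<open>T\<close> the tangent cone.\<close>

locale fixed_point_instance =
  fixes n m :: nat and C T :: "(nat \<Rightarrow> real) set" and \<sigma> r :: real
  assumes n: "n > 0" and m: "m > 0" and C: "cc_set0 n C"
    and T: "cc_set n T" "coneset T" "C \<subseteq> T"
    and \<sigma>: "\<sigma> > 0" and r: "r > 0"
    and fp: "Esq n C (omega \<sigma> (real m / real n) r) / real n = r\<^sup>2"
begin

definition "\<beta> = sqrt (r\<^sup>2 + \<sigma>\<^sup>2)"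
definition "w = \<beta> * sqrt (real n) / sqrt (real m)"
definition "jm = (\<integral>h. Jf n C w h \<partial>gauss {..<n}) / sqrt (real n)"
definition "dl = 1 / sqrt (real m)"
definition "dT = (\<integral>h. (enorm n (metric_proj n T h))\<^sup>2 \<partial>gauss {..<n})"
text \<open>The value at \<open>\<alpha> = r\<close> of the scalar problem with noise level
  \<open>s\<close>: \<open>jm\<close> is the normalized mean of the maximum, and
  \<open>r\<^sup>2 / (2 * \<beta>)\<close> undoes the quadratic regularization in \<open>Jf\<close>.
  The scale \<open>w\<close> is such that \<open>r\<close> is critical when
  \<open>s = \<sigma>\<close>.\<close>

definition "cstar s = sqrt (real m) * (sqrt (r\<^sup>2 + s\<^sup>2) - r\<^sup>2 / (2 * \<beta>)) - jm"

lemma beta: "\<beta> > 0" "\<beta> \<ge> \<sigma>" "\<beta>\<^sup>2 = r\<^sup>2 + \<sigma>\<^sup>2"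
proof -
  show b: "\<beta> \<ge> \<sigma>" unfolding \<beta>_def by (rule real_le_rsqrt) simp
  then show "\<beta> > 0" using \<sigma> by linarith
  show "\<beta>\<^sup>2 = r\<^sup>2 + \<sigma>\<^sup>2" by (simp add: \<beta>_def)
qed

lemma w: "w > 0" "w = omega \<sigma> (real m / real n) r" "w\<^sup>2 = \<beta>\<^sup>2 * (real n / real m)"
proof -
  show "w > 0" using beta n m by (simp add: w_def)
  show "w = omega \<sigma> (real m / real n) r"
    unfolding w_def \<beta>_def omega_def by (simp add: real_sqrt_divide real_sqrt_mult)
  show "w\<^sup>2 = \<beta>\<^sup>2 * (real n / real m)" by (simp add: w_def power_divide power_mult_distrib)
qed

lemma S: "Esq n C w = real n * r\<^sup>2"
  using fp n unfolding w(2)[symmetric] by (simp add: field_simps)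

lemma dl: "dl > 0" "dl * sqrt (real m) = 1"
  using m by (simp_all add: dl_def)

lemma r2_le: "r\<^sup>2 * real m \<le> \<beta>\<^sup>2 * dT"
proof -
  have "real n * r\<^sup>2 \<le> \<beta>\<^sup>2 * (real n / real m) * dT"
    using Esq_le_cone[OF C T w(1)] unfolding S w(3) dT_def .
  then have "real n * (r\<^sup>2 * real m) \<le> real n * (\<beta>\<^sup>2 * dT)" using m by (simp add: field_simps)
  then show ?thesis using n by (simp only: mult_le_cancel_left_pos of_nat_0_less_iff)
qed

lemma jm_le: "jm \<le> \<beta> * dT / (2 * sqrt (real m))"
proof -
  have "(\<integral>h. Jf n C w h \<partial>gauss {..<n}) \<le> w * dT / 2"
    using EJf_bounds[OF C T w(1)] unfolding dT_def .
  then have "jm \<le> w * dT / 2 / sqrt (real n)" unfolding jm_def using n by (intro divide_right_mono) auto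
  then show ?thesis using n by (simp add: w_def field_simps)
qed

text \<open>By the room between \<open>m\<close> and \<open>dT\<close>, both
  \<open>r\<^sup>2 / (2 * \<beta>)\<close> and \<open>jm / sqrt m\<close> are at most
  \<open>\<beta> / (2 * (1 + \<kappa>))\<close>. A positive level serves twice: in
  \<open>min_residual_le\<close>, and to convert a gap between norms into one between their
  squares.\<close>

lemma cstar_ge:
  assumes k: "\<kappa> > 0" "(1 + \<kappa>) * dT \<le> real m"
    and s: "\<bar>\<beta> - sqrt (r\<^sup>2 + s\<^sup>2)\<bar> \<le> \<sigma> * \<kappa> / (2 * (1 + \<kappa>))"
  shows "sqrt (real m) * (\<sigma> * \<kappa> / (2 * (1 + \<kappa>))) \<le> cstar s"
proof -
  define q where "q = sqrt (r\<^sup>2 + s\<^sup>2)"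
  have d: "dT / real m \<le> 1 / (1 + \<kappa>)" using k m by (simp add: field_simps)
  have "r\<^sup>2 \<le> \<beta>\<^sup>2 * (dT / real m)" using r2_le m by (simp add: field_simps)
  also have "\<dots> \<le> \<beta>\<^sup>2 * (1 / (1 + \<kappa>))" using d by (intro mult_left_mono) auto
  finally have r2: "r\<^sup>2 / (2 * \<beta>) \<le> \<beta>\<^sup>2 * (1 / (1 + \<kappa>)) / (2 * \<beta>)" using beta by (intro divide_right_mono) auto
  have r2': "\<beta>\<^sup>2 * (1 / (1 + \<kappa>)) / (2 * \<beta>) = \<beta> * (1 / (1 + \<kappa>)) / 2" using beta(1) by (simp add: power2_eq_square)
  have "jm \<le> sqrt (real m) * (\<beta> * (dT / real m) / 2)"
  proof -
    have "sqrt (real m) * (\<beta> * (dT / real m) / 2) = \<beta> * dT / (2 * sqrt (real m))"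
      using m by (simp add: field_simps)
    then show ?thesis using jm_le by simp
  qed
  also have "\<dots> \<le> sqrt (real m) * (\<beta> * (1 / (1 + \<kappa>)) / 2)"
    using d beta by (intro mult_left_mono divide_right_mono) auto
  finally have j: "jm \<le> sqrt (real m) * (\<beta> * (1 / (1 + \<kappa>)) / 2)" .
  have fr: "\<beta> - \<beta> * (1 / (1 + \<kappa>)) = \<beta> * (\<kappa> / (1 + \<kappa>))" using k by (simp add: field_simps)
  have "\<sigma> * (\<kappa> / (1 + \<kappa>)) \<le> \<beta> * (\<kappa> / (1 + \<kappa>))" using beta k by (intro mult_right_mono) auto
  moreover have "\<sigma> * \<kappa> / (2 * (1 + \<kappa>)) = \<sigma> * (\<kappa> / (1 + \<kappa>)) / 2" using k by (simp add: field_simps)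
  moreover define x y z where "x = \<sigma> * (\<kappa> / (1 + \<kappa>))" and "y = \<beta> * (1 / (1 + \<kappa>))" and "z = \<beta> * (\<kappa> / (1 + \<kappa>))"
  ultimately have g: "\<sigma> * \<kappa> / (2 * (1 + \<kappa>)) \<le> q - y"
    using s fr unfolding q_def[symmetric] x_def[symmetric] y_def[symmetric] z_def[symmetric] by linarith
  have "sqrt (real m) * (\<sigma> * \<kappa> / (2 * (1 + \<kappa>))) \<le> sqrt (real m) * (q - y)"
    using g by (intro mult_left_mono) auto
  also have "\<dots> = sqrt (real m) * (q - y / 2) - sqrt (real m) * (y / 2)"
    by (simp add: right_diff_distrib)
  also have "\<dots> = sqrt (real m) * (q - \<beta> * (1 / (1 + \<kappa>)) / 2) - sqrt (real m) * (\<beta> * (1 / (1 + \<kappa>)) / 2)"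
    unfolding y_def ..
  also have "\<dots> \<le> sqrt (real m) * (q - r\<^sup>2 / (2 * \<beta>)) - jm"
    using r2 j unfolding r2' by (intro diff_mono mult_left_mono) auto
  finally show ?thesis by (simp add: cstar_def q_def)
qed

text \<open>Strong concavity, weakened by the triangle inequality so that \<open>v\<close> enters
  through its norm alone. In the normalized variables the coefficient \<open>1 / (2 * w)\<close>
  becomes \<open>sqrt m / (2 * \<beta>)\<close>.\<close>

lemma ip_upper:
  assumes v: "v \<in> C"
  defines "a \<equiv> enorm n v / sqrt (real n)" and "a0 h \<equiv> enorm n (pj n C w h) / sqrt (real n)"
  shows "ip n h v / sqrt (real n) \<le> Jf n C w h / sqrt (real n) + sqrt (real m) / (2 * \<beta>) * (a\<^sup>2 - (a - a0 h)\<^sup>2)"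
    and "ip n h (pj n C w h) / sqrt (real n) = Jf n C w h / sqrt (real n) + sqrt (real m) / (2 * \<beta>) * (a0 h)\<^sup>2"
proof -
  let ?p = "pj n C w h"
  have sn: "sqrt (real n) > 0" "sqrt (real m) > 0" using n m by auto
  have nn: "real n = sqrt (real n) * sqrt (real n)" by simp
  have k: "x / (2 * w) / sqrt (real n) = sqrt (real m) / (2 * \<beta>) * (x / real n)" for x
    using sn beta by (subst nn) (simp add: w_def field_simps)
  have a2: "a\<^sup>2 = (enorm n v)\<^sup>2 / real n" "(a0 h)\<^sup>2 = (enorm n ?p)\<^sup>2 / real n" "(a - a0 h)\<^sup>2 = (enorm n v - enorm n ?p)\<^sup>2 / real n"
    by (simp_all add: a_def a0_def power_divide diff_divide_distrib[symmetric])
  have "(enorm n v - enorm n ?p)\<^sup>2 \<le> (enorm n (\<lambda>i. v i - ?p i))\<^sup>2"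
  proof -
    have tri: "enorm n x \<le> enorm n y + enorm n (\<lambda>i. x i - y i)" for x y
      using enorm_triangle[of n y "\<lambda>i. x i - y i"] by simp
    have "\<bar>enorm n v - enorm n ?p\<bar> \<le> enorm n (\<lambda>i. v i - ?p i)"
      using tri[of v ?p] tri[of ?p v] enorm_minus_commute[of n v ?p] by linarith
    from power_mono[OF this abs_ge_zero, of 2] show ?thesis by simp
  qed
  then have "ip n h v \<le> Jf n C w h + ((enorm n v)\<^sup>2 - (enorm n v - enorm n ?p)\<^sup>2) / (2 * w)"
  proof -
    assume le: "(enorm n v - enorm n ?p)\<^sup>2 \<le> (enorm n (\<lambda>i. v i - ?p i))\<^sup>2"
    have "(enorm n v - enorm n ?p)\<^sup>2 / (2 * w) \<le> (enorm n (\<lambda>i. v i - ?p i))\<^sup>2 / (2 * w)"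
      using le w(1) by (intro divide_right_mono) auto
    then show ?thesis using Jf_strong[OF cc_set0D(1)[OF C] v w(1), of h]
      unfolding enorm_sq[symmetric] diff_divide_distrib by linarith
  qed
  then have "ip n h v / sqrt (real n) \<le> (Jf n C w h + ((enorm n v)\<^sup>2 - (enorm n v - enorm n ?p)\<^sup>2) / (2 * w)) / sqrt (real n)"
    using sn by (intro divide_right_mono) auto
  also have "\<dots> = Jf n C w h / sqrt (real n) + sqrt (real m) / (2 * \<beta>) * (a\<^sup>2 - (a - a0 h)\<^sup>2)"
    unfolding add_divide_distrib k a2 by (simp add: diff_divide_distrib)
  finally show "ip n h v / sqrt (real n) \<le> Jf n C w h / sqrt (real n) + sqrt (real m) / (2 * \<beta>) * (a\<^sup>2 - (a - a0 h)\<^sup>2)" .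
  have "ip n h ?p = Jf n C w h + (enorm n ?p)\<^sup>2 / (2 * w)" by (simp add: Jf_def enorm_sq)
  then show "ip n h ?p / sqrt (real n) = Jf n C w h / sqrt (real n) + sqrt (real m) / (2 * \<beta>) * (a0 h)\<^sup>2"
    unfolding a2 k[symmetric] by (simp add: add_divide_distrib)
qed

text \<open>The typical behaviour of \<open>h\<close>. The additive deviations carry a factor
  \<open>r\<close> because the variance of the maximum is of order \<open>n * r\<^sup>2\<close>;
  \<open>e\<close> is the relative accuracy of the squared norm.\<close>

definition hgood :: "real \<Rightarrow> real \<Rightarrow> (nat \<Rightarrow> real) \<Rightarrow> bool" where
  "hgood e k h \<longleftrightarrow> \<bar>Jf n C w h / sqrt (real n) - jm\<bar> \<le> k * r \<and>
     \<bar>(enorm n (pj n C w h))\<^sup>2 / real n - r\<^sup>2\<bar> \<le> e * r\<^sup>2 + k * r * dl"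

lemma hgood_prob:
  assumes e: "0 < e" "e \<le> 1" and p: "0 < p" and k: "4 / sqrt p \<le> k" "96 * \<beta> / (e * sqrt p) \<le> k"
  shows "{h \<in> space (gauss {..<n}). \<not> hgood e k h} \<in> sets (gauss {..<n})"
    and "measure (gauss {..<n}) {h \<in> space (gauss {..<n}). \<not> hgood e k h} \<le> 2 * p"
proof -
  interpret G: prob_space "gauss {..<n}" by (rule prob_space_gauss)
  note [measurable] = measurable_Jf[OF cc_set0D(1)[OF C]] measurable_enorm_pj[OF cc_set0D(1)[OF C]]
  show "{h \<in> space (gauss {..<n}). \<not> hgood e k h} \<in> sets (gauss {..<n})"
    unfolding hgood_def by measurable
  define S where "S = real n * r\<^sup>2"
  have S0: "S > 0" using n r by (simp add: S_def)
  have sS: "sqrt S = sqrt (real n) * r" using r by (simp add: S_def real_sqrt_mult)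
  have SE: "S = (\<integral>h. (enorm n (pj n C w h))\<^sup>2 \<partial>gauss {..<n})" using S unfolding S_def Esq_def ..
  \<comment> \<open>The third compensates the factor 3 in \<open>proj_concentration\<close> and
    turns 32 into 96.\<close>
  have e3: "0 < e / 3" "e / 3 \<le> 1" using e by auto
  note pc = proj_concentration[OF C w(1) e3 p SE S0 refl]
  define Bad where "Bad = {h \<in> space (gauss {..<n}). \<not> (\<bar>Jf n C w h - (\<integral>h. Jf n C w h \<partial>gauss {..<n})\<bar> \<le> 4 * sqrt S / sqrt p \<and>
      \<bar>(enorm n (pj n C w h))\<^sup>2 - S\<bar> \<le> 3 * (e / 3) * S + 32 * w * sqrt S / (e / 3 * sqrt p))}"
  have sn: "sqrt (real n) > 0" "sqrt (real m) > 0" "sqrt p > 0" using n m p by auto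
  have sub: "{h \<in> space (gauss {..<n}). \<not> hgood e k h} \<subseteq> Bad"
  proof
    fix h assume h: "h \<in> {h \<in> space (gauss {..<n}). \<not> hgood e k h}"
    show "h \<in> Bad"
    proof (rule ccontr)
      assume "h \<notin> Bad"
      then have b: "\<bar>Jf n C w h - (\<integral>h. Jf n C w h \<partial>gauss {..<n})\<bar> \<le> 4 * sqrt S / sqrt p"
        "\<bar>(enorm n (pj n C w h))\<^sup>2 - S\<bar> \<le> 3 * (e / 3) * S + 32 * w * sqrt S / (e / 3 * sqrt p)"
        using h by (auto simp: Bad_def)
      have "\<bar>Jf n C w h / sqrt (real n) - jm\<bar> = \<bar>Jf n C w h - (\<integral>h. Jf n C w h \<partial>gauss {..<n})\<bar> / sqrt (real n)"
        using sn by (simp add: jm_def diff_divide_distrib[symmetric])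
      also have "\<dots> \<le> 4 * sqrt S / sqrt p / sqrt (real n)" using b(1) sn by (intro divide_right_mono) auto
      also have "\<dots> = 4 / sqrt p * r" using sn by (simp add: sS)
      also have "\<dots> \<le> k * r" using k(1) r by (intro mult_right_mono) auto
      finally have 1: "\<bar>Jf n C w h / sqrt (real n) - jm\<bar> \<le> k * r" .
      have "\<bar>(enorm n (pj n C w h))\<^sup>2 / real n - r\<^sup>2\<bar> = \<bar>(enorm n (pj n C w h))\<^sup>2 - S\<bar> / real n"
      proof -
        have "(enorm n (pj n C w h))\<^sup>2 / real n - r\<^sup>2 = ((enorm n (pj n C w h))\<^sup>2 - S) / real n"
          using n by (simp add: S_def field_simps)
        then show ?thesis by simp
      qed
      also have "\<dots> \<le> (3 * (e / 3) * S + 32 * w * sqrt S / (e / 3 * sqrt p)) / real n"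
        using b(2) n by (intro divide_right_mono) auto
      also have "\<dots> = e * r\<^sup>2 + 96 * \<beta> / (e * sqrt p) * r * dl"
      proof -
        have nn: "real n = sqrt (real n) * sqrt (real n)" by simp
        have "32 * w * sqrt S / (e / 3 * sqrt p) / real n = 96 * \<beta> / (e * sqrt p) * r * dl"
          using sn e by (subst nn) (simp add: sS w_def dl_def field_simps)
        moreover have "3 * (e / 3) * S / real n = e * r\<^sup>2" using n by (simp add: S_def)
        ultimately show ?thesis by (simp add: add_divide_distrib)
      qed
      also have "\<dots> \<le> e * r\<^sup>2 + k * r * dl" using k(2) r dl by (intro add_left_mono mult_right_mono) auto
      finally show False using h 1 by (simp add: hgood_def)
    qed
  qed
  have "G.prob {h \<in> space (gauss {..<n}). \<not> hgood e k h} \<le> G.prob Bad"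
    using sub pc(1) unfolding Bad_def by (intro G.finite_measure_mono)
  also have "\<dots> \<le> 2 * p" using pc(2) unfolding Bad_def .
  finally show "measure (gauss {..<n}) {h \<in> space (gauss {..<n}). \<not> hgood e k h} \<le> 2 * p" .
qed

definition sx :: "(nat \<Rightarrow> real) \<Rightarrow> nat \<Rightarrow> real" where
  "sx v = (\<lambda>i. (1 / sqrt (real n)) * v i)"

lemma sx: "enorm n (sx v) = enorm n v / sqrt (real n)" "ip n h (sx v) = ip n h v / sqrt (real n)"
  unfolding sx_def enorm_scale ip_scale_right by simp_all

text \<open>The difference of squares is at least \<open>r\<close> times the difference; division by
  \<open>r\<close> turns \<open>k * r * dl\<close> into \<open>k * dl\<close>.\<close>

lemma a0_close:
  assumes h: "hgood e k h"
  shows "\<bar>enorm n (pj n C w h) / sqrt (real n) - r\<bar> \<le> e * r + k * dl"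
proof -
  let ?a = "enorm n (pj n C w h) / sqrt (real n)"
  have a: "?a \<ge> 0" by simp
  have "?a\<^sup>2 - r\<^sup>2 = (?a - r) * (?a + r)" by (simp add: power2_eq_square algebra_simps)
  then have "\<bar>?a - r\<bar> * (?a + r) = \<bar>?a\<^sup>2 - r\<^sup>2\<bar>" using a r by (simp add: abs_mult)
  also have "?a\<^sup>2 = (enorm n (pj n C w h))\<^sup>2 / real n" by (simp add: power_divide)
  also have "\<bar>(enorm n (pj n C w h))\<^sup>2 / real n - r\<^sup>2\<bar> \<le> e * r\<^sup>2 + k * r * dl" using h by (simp add: hgood_def)
  also have "e * r\<^sup>2 + k * r * dl = (e * r + k * dl) * r" by (simp add: power2_eq_square algebra_simps)
  finally have 1: "\<bar>?a - r\<bar> * (?a + r) \<le> (e * r + k * dl) * r" .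
  have "\<bar>?a - r\<bar> * r \<le> \<bar>?a - r\<bar> * (?a + r)" using a by (intro mult_left_mono) auto
  then have "\<bar>?a - r\<bar> * r \<le> (e * r + k * dl) * r" using 1 by linarith
  then show ?thesis using r by simp
qed

text \<open>The errors add up to \<open>4 * a * M + k * r\<close>: three times \<open>a * M\<close>
  from the norm, once from the scalar variable, and \<open>k * r\<close> from the maximum. As
  \<open>dl * sqrt m = 1\<close>, they fit into the term with \<open>K\<close>. The part
  \<open>K1\<close> of \<open>K\<close> is set aside to match the error of the upper bound.\<close>

lemma ao_lower:
  assumes v: "v \<in> C" and s: "s > 0" "enorm m \<xi> = s * sqrt (real m)" and M: "M \<ge> 0"
    and g: "\<bar>(enorm m g)\<^sup>2 - real m\<bar> \<le> M * sqrt (real m)" "\<bar>ip m \<xi> g\<bar> \<le> M * enorm m \<xi>"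
    and h: "hgood e k h" and K: "k + 4 * M + K1 \<le> K" "0 \<le> K1" "0 \<le> k"
    and gap: "2 * \<rho> * r\<^sup>2 + K * ((enorm n v / sqrt (real n) + r) * dl + dl\<^sup>2)
        < sqrt ((enorm n v / sqrt (real n))\<^sup>2 + s\<^sup>2) - sqrt (r\<^sup>2 + s\<^sup>2) - ((enorm n v / sqrt (real n))\<^sup>2 - r\<^sup>2) / (2 * \<beta>)
          + (enorm n v / sqrt (real n) - enorm n (pj n C w h) / sqrt (real n))\<^sup>2 / (2 * \<beta>)"
  shows "cstar s + sqrt (real m) * (2 * \<rho> * r\<^sup>2 + K1 * (r * dl + dl\<^sup>2)) + enorm n (sx v) * M + ip n h (sx v)
    < enorm m (\<lambda>i. \<xi> i + enorm n (sx v) * g i)"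
proof -
  define W where "W = sqrt (real m)"
  define a a0 q p where "a = enorm n v / sqrt (real n)" and "a0 = enorm n (pj n C w h) / sqrt (real n)"
    and "q = sqrt (r\<^sup>2 + s\<^sup>2)" and "p = sqrt (a\<^sup>2 + s\<^sup>2)"
  have a: "a \<ge> 0" by (simp add: a_def)
  have W: "W > 0" "dl * W = 1" using m dl by (auto simp: W_def)
  have ip: "ip n h (sx v) \<le> jm + k * r + W / (2 * \<beta>) * (a\<^sup>2 - (a - a0)\<^sup>2)"
    using ip_upper(1)[OF v, of h] h unfolding sx a_def[symmetric] a0_def[symmetric] W_def[symmetric] hgood_def by linarith
  have nl: "W * p - 3 * a * M \<le> enorm m (\<lambda>i. \<xi> i + a * g i)"
    unfolding W_def p_def by (rule norm_shift_bounds(1)[OF m a s(1) M s(2) g])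
  define F where "F = p - q - (a\<^sup>2 - r\<^sup>2) / (2 * \<beta>) + (a - a0)\<^sup>2 / (2 * \<beta>)"
  have gap': "2 * \<rho> * r\<^sup>2 + K * ((a + r) * dl + dl\<^sup>2) < F"
    using gap unfolding a_def[symmetric] a0_def[symmetric] q_def[symmetric] p_def[symmetric] F_def .
  have "W * (2 * \<rho> * r\<^sup>2 + K1 * (r * dl + dl\<^sup>2)) + 4 * a * M + k * r
    \<le> W * (2 * \<rho> * r\<^sup>2 + K * ((a + r) * dl + dl\<^sup>2))"
  proof -
    have "4 * M * a + k * r = W * ((4 * M * a + k * r) * dl)" using W by (simp add: mult.commute[of W] mult.assoc)
    moreover have "(4 * M * a + k * r) * dl + K1 * (r * dl + dl\<^sup>2) \<le> K * ((a + r) * dl + dl\<^sup>2)"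
    proof -
      have "(4 * M * a + k * r) * dl + K1 * (r * dl + dl\<^sup>2) \<le> (k + 4 * M + K1) * ((a + r) * dl + dl\<^sup>2)"
      proof -
        have "0 \<le> 4 * M * (r * dl + dl\<^sup>2) + k * (a * dl + dl\<^sup>2) + K1 * (a * dl)"
          using M K a r dl by (intro add_nonneg_nonneg mult_nonneg_nonneg) auto
        then show ?thesis by (simp add: algebra_simps)
      qed
      also have "\<dots> \<le> K * ((a + r) * dl + dl\<^sup>2)" using K a r dl by (intro mult_right_mono) auto
      finally show ?thesis .
    qed
    ultimately have "W * (2 * \<rho> * r\<^sup>2) + (W * ((4 * M * a + k * r) * dl) + W * (K1 * (r * dl + dl\<^sup>2))) \<le> W * (2 * \<rho> * r\<^sup>2) + W * (K * ((a + r) * dl + dl\<^sup>2))"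
      using W by (simp add: distrib_left[symmetric])
    then show ?thesis using \<open>4 * M * a + k * r = W * ((4 * M * a + k * r) * dl)\<close> by (simp add: distrib_left algebra_simps)
  qed
  also have "\<dots> < W * F" using gap' W by (intro mult_strict_left_mono)
  also have "W * F = W * p - W * q - W / (2 * \<beta>) * (a\<^sup>2 - r\<^sup>2) + W / (2 * \<beta>) * (a - a0)\<^sup>2"
    by (simp add: F_def right_diff_distrib distrib_left diff_divide_distrib)
  finally have main: "W * (2 * \<rho> * r\<^sup>2 + K1 * (r * dl + dl\<^sup>2)) + 4 * a * M + k * r
    < W * p - W * q - W / (2 * \<beta>) * (a\<^sup>2 - r\<^sup>2) + W / (2 * \<beta>) * (a - a0)\<^sup>2" .
  have cs: "cstar s = W * q - W / (2 * \<beta>) * r\<^sup>2 - jm"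
    by (simp add: cstar_def W_def q_def right_diff_distrib)
  have "cstar s + W * (2 * \<rho> * r\<^sup>2 + K1 * (r * dl + dl\<^sup>2)) + a * M + ip n h (sx v) < enorm m (\<lambda>i. \<xi> i + a * g i)"
    using main ip nl unfolding cs right_diff_distrib[of "W / (2 * \<beta>)"] by linarith
  then show ?thesis unfolding sx a_def W_def .
qed

text \<open>The competitor is the maximizer itself. By concavity of the square root its tangent at
  \<open>r\<^sup>2 + s\<^sup>2\<close> is an upper bound, with slope \<open>1 / (2 * q)\<close>
  instead of \<open>1 / (2 * \<beta>)\<close>. Since \<open>a\<^sup>2 - r\<^sup>2\<close> is already
  of order \<open>r\<^sup>2 + r * dl\<close>, this mismatch costs only
  \<open>\<rho> * r\<^sup>2\<close> and a multiple of \<open>r * dl\<close>.\<close>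

lemma ao_upper:
  assumes s: "s > 0" "enorm m \<xi> = s * sqrt (real m)" and M: "M \<ge> 0"
    and g: "\<bar>(enorm m g)\<^sup>2 - real m\<bar> \<le> M * sqrt (real m)" "\<bar>ip m \<xi> g\<bar> \<le> M * enorm m \<xi>"
    and h: "hgood e k h" and e: "0 < e" "e \<le> 1" and k: "0 \<le> k" and \<rho>: "0 \<le> \<rho>" "\<rho> \<le> 1"
    and inv: "\<bar>1 / sqrt (r\<^sup>2 + s\<^sup>2) - 1 / \<beta>\<bar> \<le> 2 * \<rho>"
    and K1: "2 * k + 8 * M + 4 * M * k + 1 \<le> K1"
  shows "enorm m (\<lambda>i. \<xi> i - enorm n (sx (pj n C w h)) * g i) - ip n h (sx (pj n C w h))
    < cstar s + sqrt (real m) * (\<rho> * r\<^sup>2 + K1 * (r * dl + dl\<^sup>2)) - enorm n (sx (pj n C w h)) * M"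
proof -
  define W where "W = sqrt (real m)"
  define a q p where "a = enorm n (pj n C w h) / sqrt (real n)" and "q = sqrt (r\<^sup>2 + s\<^sup>2)" and "p = sqrt (a\<^sup>2 + s\<^sup>2)"
  have a: "a \<ge> 0" by (simp add: a_def)
  have W: "W > 0" "dl * W = 1" using m dl by (auto simp: W_def)
  have q: "q > 0" using s by (simp add: q_def add_nonneg_pos)
  have ip: "jm - k * r + W / (2 * \<beta>) * a\<^sup>2 \<le> ip n h (sx (pj n C w h))"
    using ip_upper(2)[OF pj_mem[OF cc_set0D(1)[OF C]], of h] h unfolding sx a_def[symmetric] W_def[symmetric] hgood_def by linarith
  have nu: "enorm m (\<lambda>i. \<xi> i - a * g i) \<le> W * p + 3 * a * M"
    unfolding W_def p_def by (rule norm_shift_bounds(2)[OF m a s(1) M s(2) g])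
  have pq: "p \<le> q + (a\<^sup>2 - r\<^sup>2) / (2 * q)"
  proof -
    have "0 \<le> (p - q)\<^sup>2" by simp
    then have "2 * p * q \<le> p\<^sup>2 + q\<^sup>2" by (simp add: power2_diff)
    also have "p\<^sup>2 = a\<^sup>2 - r\<^sup>2 + q\<^sup>2" by (simp add: p_def q_def)
    finally show ?thesis using q by (simp add: field_simps power2_eq_square)
  qed
  have a2: "\<bar>a\<^sup>2 - r\<^sup>2\<bar> \<le> e * r\<^sup>2 + k * r * dl"
    using h by (simp add: hgood_def a_def power_divide)
  have x: "(a\<^sup>2 - r\<^sup>2) / (2 * q) - (a\<^sup>2 - r\<^sup>2) / (2 * \<beta>) \<le> \<rho> * r\<^sup>2 + k * (r * dl)"
  proof -
    have "(a\<^sup>2 - r\<^sup>2) / (2 * q) - (a\<^sup>2 - r\<^sup>2) / (2 * \<beta>) = (a\<^sup>2 - r\<^sup>2) * (1 / q - 1 / \<beta>) / 2"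
      by (simp add: right_diff_distrib diff_divide_distrib)
    also have "\<dots> \<le> \<bar>a\<^sup>2 - r\<^sup>2\<bar> * \<bar>1 / q - 1 / \<beta>\<bar> / 2" by (simp add: abs_mult[symmetric])
    also have "\<dots> \<le> (e * r\<^sup>2 + k * r * dl) * (2 * \<rho>) / 2"
      using a2 inv r k e dl unfolding q_def by (intro divide_right_mono mult_mono) auto
    also have "\<dots> = \<rho> * (e * r\<^sup>2) + \<rho> * (k * (r * dl))" by (simp add: algebra_simps)
    also have "\<dots> \<le> \<rho> * r\<^sup>2 + k * (r * dl)"
      using \<rho> e k r dl by (intro add_mono mult_left_mono) (auto intro: mult_left_le_one_le)
    finally show ?thesis .
  qed
  have al: "a \<le> 2 * r + k * dl"
  proof -
    have "\<bar>a - r\<bar> \<le> e * r + k * dl" unfolding a_def by (rule a0_close[OF h])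
    moreover have "e * r \<le> r" using e r by simp
    ultimately show ?thesis by linarith
  qed
  have "4 * a * M + k * r < W * (K1 * (r * dl + dl\<^sup>2) - k * (r * dl))"
  proof -
    have "4 * a * M \<le> 4 * (2 * r + k * dl) * M" using al M by (intro mult_right_mono) auto
    then have "4 * a * M + k * r \<le> (8 * M + k) * r + 4 * M * k * dl" by (simp add: algebra_simps)
    also have "\<dots> = W * (((8 * M + k) * r + 4 * M * k * dl) * dl)" using W by (simp add: mult.commute[of W] mult.assoc)
    also have "\<dots> < W * (K1 * (r * dl + dl\<^sup>2) - k * (r * dl))"
    proof (rule mult_strict_left_mono[OF _ W(1)])
      have "0 < r * dl" "0 < dl\<^sup>2" using r dl by auto
      then have pos: "0 < (4 * M * k + 1) * (r * dl) + (2 * k + 8 * M + 1) * dl\<^sup>2"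
      proof -
        have "0 \<le> M * k" using M k by simp
        then have "0 < 4 * M * k + 1" "0 < 2 * k + 8 * M + 1" using M k by linarith+
        then show ?thesis using \<open>0 < r * dl\<close> \<open>0 < dl\<^sup>2\<close> by (metis add_pos_pos mult_pos_pos)
      qed
      have "((8 * M + k) * r + 4 * M * k * dl) * dl + k * (r * dl) + ((4 * M * k + 1) * (r * dl) + (2 * k + 8 * M + 1) * dl\<^sup>2)
        = (2 * k + 8 * M + 4 * M * k + 1) * (r * dl + dl\<^sup>2)" by (simp add: power2_eq_square algebra_simps)
      also have "\<dots> \<le> K1 * (r * dl + dl\<^sup>2)" using K1 r dl by (intro mult_right_mono) auto
      finally show "((8 * M + k) * r + 4 * M * k * dl) * dl < K1 * (r * dl + dl\<^sup>2) - k * (r * dl)" using pos by linarith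
    qed
    finally show ?thesis .
  qed
  moreover have "W * p - W / (2 * \<beta>) * a\<^sup>2 \<le> W * (q - r\<^sup>2 / (2 * \<beta>)) + W * (\<rho> * r\<^sup>2 + k * (r * dl))"
  proof -
    have "p - a\<^sup>2 / (2 * \<beta>) \<le> q - r\<^sup>2 / (2 * \<beta>) + (\<rho> * r\<^sup>2 + k * (r * dl))"
      using pq x by (simp add: diff_divide_distrib)
    then have "W * (p - a\<^sup>2 / (2 * \<beta>)) \<le> W * (q - r\<^sup>2 / (2 * \<beta>) + (\<rho> * r\<^sup>2 + k * (r * dl)))"
      using W by (intro mult_left_mono) auto
    then show ?thesis by (simp add: algebra_simps)
  qed
  moreover have "W * (K1 * (r * dl + dl\<^sup>2) - k * (r * dl)) + W * (\<rho> * r\<^sup>2 + k * (r * dl)) = W * (\<rho> * r\<^sup>2 + K1 * (r * dl + dl\<^sup>2))"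
    by (simp add: algebra_simps)
  moreover have "cstar s = W * (q - r\<^sup>2 / (2 * \<beta>)) - jm" by (simp add: cstar_def W_def q_def)
  ultimately have "enorm m (\<lambda>i. \<xi> i - a * g i) - ip n h (sx (pj n C w h)) < cstar s + W * (\<rho> * r\<^sup>2 + K1 * (r * dl + dl\<^sup>2)) - a * M"
    using ip nu by linarith
  then show ?thesis unfolding sx a_def W_def .
qed

end

text \<open>The flag \<open>b\<close> tells whether there are points out of range at all. If not, no
  sequence \<open>x\<close> of such points exists, and the first clause is switched off.\<close>

definition gap_event :: "nat \<Rightarrow> nat \<Rightarrow> (nat \<Rightarrow> nat \<Rightarrow> real) \<Rightarrow> (nat \<Rightarrow> nat \<Rightarrow> real) \<Rightarrow> (nat \<Rightarrow> nat \<Rightarrow> real) \<Rightarrow> bool \<Rightarrow>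
    real \<Rightarrow> real \<Rightarrow> (nat \<times> nat \<Rightarrow> real) \<Rightarrow> (nat \<Rightarrow> real) \<Rightarrow> bool" where
  "gap_event m n u x y b c1 c2 G \<xi> \<longleftrightarrow> (b \<longrightarrow> (\<forall>i. c1 < enorm m (res \<xi> G n (x i)))) \<and>
     (\<forall>j. \<exists>i. ip m (u j) (res \<xi> G n (y i)) < c2)"

lemma measurable_res:
  assumes "\<And>b. b < n \<Longrightarrow> (\<lambda>\<omega>. G \<omega> (a, b)) \<in> borel_measurable N"
    and "(\<lambda>\<omega>. \<xi> \<omega> a) \<in> borel_measurable N"
  shows "(\<lambda>\<omega>. res (\<xi> \<omega>) (G \<omega>) n x a) \<in> borel_measurable N"
  unfolding res_def by (rule borel_measurable_diff[OF assms(2) measurable_ip]) (auto intro: assms(1))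

lemma measurable_gap_event:
  assumes G: "\<And>a b. a < m \<Longrightarrow> b < n \<Longrightarrow> (\<lambda>\<omega>. G \<omega> (a, b)) \<in> borel_measurable N"
    and \<xi>: "\<And>a. a < m \<Longrightarrow> (\<lambda>\<omega>. \<xi> \<omega> a) \<in> borel_measurable N"
    and c: "c1 \<in> borel_measurable N" "c2 \<in> borel_measurable N"
  shows "{\<omega> \<in> space N. gap_event m n u x y b (c1 \<omega>) (c2 \<omega>) (G \<omega>) (\<xi> \<omega>)} \<in> sets N"
proof -
  have r: "(\<lambda>\<omega>. res (\<xi> \<omega>) (G \<omega>) n v a) \<in> borel_measurable N" if "a < m" for a v
    using G[OF that] \<xi>[OF that] by (intro measurable_res)
  have e: "(\<lambda>\<omega>. enorm m (res (\<xi> \<omega>) (G \<omega>) n v)) \<in> borel_measurable N" for v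
    by (rule measurable_enorm[OF r])
  have i: "(\<lambda>\<omega>. ip m (u j) (res (\<xi> \<omega>) (G \<omega>) n v)) \<in> borel_measurable N" for v j
    by (rule measurable_ip[OF borel_measurable_const r])
  have 1: "Measurable.pred N (\<lambda>\<omega>. c1 \<omega> < enorm m (res (\<xi> \<omega>) (G \<omega>) n v))" for v
    using borel_measurable_less[OF c(1) e[of v]] unfolding pred_def .
  have 2: "Measurable.pred N (\<lambda>\<omega>. ip m (u j) (res (\<xi> \<omega>) (G \<omega>) n v) < c2 \<omega>)" for v j
    using borel_measurable_less[OF i[of j v] c(2)] unfolding pred_def .
  have "Measurable.pred N (\<lambda>\<omega>. (b \<longrightarrow> (\<forall>i. c1 \<omega> < enorm m (res (\<xi> \<omega>) (G \<omega>) n (x i)))) \<and>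
     (\<forall>j. \<exists>i. ip m (u j) (res (\<xi> \<omega>) (G \<omega>) n (y i)) < c2 \<omega>))"
    by (intro pred_intros_logic pred_intros_countable measurable_const UNIV_I 1 2) simp_all
  then show ?thesis unfolding gap_event_def pred_def .
qed

lemma gap_event_cong:
  assumes "\<And>a b. a < m \<Longrightarrow> b < n \<Longrightarrow> G (a, b) = G' (a, b)" "\<And>a. a < m \<Longrightarrow> \<xi> a = \<xi>' a"
  shows "gap_event m n u x y b c1 c2 G \<xi> = gap_event m n u x y b c1 c2 G' \<xi>'"
proof -
  have r: "res \<xi> G n v a = res \<xi>' G' n v a" if "a < m" for a v
    unfolding res_def using that assms by (auto intro!: arg_cong2[where f="(-)"] ip_cong)
  have e: "enorm m (res \<xi> G n v) = enorm m (res \<xi>' G' n v)" for v by (rule enorm_cong) (rule r)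
  have i: "ip m (u j) (res \<xi> G n v) = ip m (u j) (res \<xi>' G' n v)" for j v by (rule ip_cong) (auto intro: r)
  show ?thesis unfolding gap_event_def e i ..
qed

context fixed_point_instance
begin

text \<open>The good event \<open>A\<close> for the column \<open>g\<close> and the row
  \<open>h\<close> fails with probability at most \<open>3 / M\<^sup>2 + 2 * p\<close>, and each
  direction of Gordon's comparison loses another \<open>1 / M\<^sup>2\<close>. Intersecting the two
  resulting events doubles the total.\<close>

lemma gap_event_prob:
  assumes s: "s > 0" "enorm m \<xi> = s * sqrt (real m)" and M: "M > 0"
    and e: "0 < e" "e \<le> 1" and p: "0 < p" and k: "4 / sqrt p \<le> k" "96 * \<beta> / (e * sqrt p) \<le> k"
    and K: "k + 4 * M + K1 \<le> K" and K1: "2 * k + 8 * M + 4 * M * k + 1 \<le> K1"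
    and \<rho>: "0 \<le> \<rho>" "\<rho> \<le> 1"
    and inv: "\<bar>1 / sqrt (r\<^sup>2 + s\<^sup>2) - 1 / \<beta>\<bar> \<le> 2 * \<rho>"
    and u: "sphere_seq m u"
    and xs: "\<And>i. b \<Longrightarrow> xs i \<in> C"
      "\<And>i a0. b \<Longrightarrow> \<bar>a0 - r\<bar> \<le> e * r + k * dl \<Longrightarrow> 2 * \<rho> * r\<^sup>2 + K * ((enorm n (xs i) / sqrt (real n) + r) * dl + dl\<^sup>2)
        < sqrt ((enorm n (xs i) / sqrt (real n))\<^sup>2 + s\<^sup>2) - sqrt (r\<^sup>2 + s\<^sup>2) - ((enorm n (xs i) / sqrt (real n))\<^sup>2 - r\<^sup>2) / (2 * \<beta>)
          + (enorm n (xs i) / sqrt (real n) - a0)\<^sup>2 / (2 * \<beta>)"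
    and ys: "\<And>v U. v \<in> C \<Longrightarrow> enorm n v \<le> sqrt (real n) * (2 * r + k * dl) \<Longrightarrow> open U \<Longrightarrow> v \<in> U \<Longrightarrow> \<exists>i. ys i \<in> U"
  shows "1 - 2 * (4 / M\<^sup>2 + 2 * p) \<le> measure (gauss ({..<m} \<times> {..<n})) {G \<in> space (gauss ({..<m} \<times> {..<n})).
    gap_event m n u (\<lambda>i. sx (xs i)) (\<lambda>i. sx (ys i)) b
      (cstar s + sqrt (real m) * (2 * \<rho> * r\<^sup>2 + K1 * (r * dl + dl\<^sup>2)))
      (cstar s + sqrt (real m) * (\<rho> * r\<^sup>2 + K1 * (r * dl + dl\<^sup>2))) G \<xi>}"
proof -
  let ?G = "gauss (gidx m n)"
  interpret G: prob_space ?G by (rule prob_space_gauss)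
  have k0: "0 \<le> k"
  proof -
    have "0 \<le> 4 / sqrt p" using p by simp
    then show ?thesis using k(1) by linarith
  qed
  have K10: "0 \<le> K1"
  proof -
    have "0 \<le> M * k" using M k0 by simp
    then show ?thesis using K1 M k0 by linarith
  qed
  define hh where "hh z = (\<lambda>b\<in>{..<n}. z (m, b))" for z :: "nat \<times> nat \<Rightarrow> real"
  have iph: "ip n (\<lambda>b. z (m, b)) v = ip n (hh z) v" for z v by (rule ip_cong) (auto simp: hh_def)
  define B1 where "B1 = {z \<in> space ?G. \<not> (\<bar>(enorm m (\<lambda>a. z (a, n)))\<^sup>2 - real m\<bar> \<le> M * sqrt (real m) \<and>
      \<bar>ip m \<xi> (\<lambda>a. z (a, n))\<bar> \<le> M * enorm m \<xi>)}"
  note B1 = gvec_deviation[OF M, of m n \<xi>, folded B1_def]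
  define B2 where "B2 = {z \<in> space ?G. (\<lambda>b\<in>{..<n}. z (m, b)) \<in> {h \<in> space (gauss {..<n}). \<not> hgood e k h}}"
  note hp = hgood_prob[OF e p k]
  have inj: "inj_on (Pair m) {..<n}" "Pair m ` {..<n} \<subseteq> gidx m n" by (auto simp: inj_on_def gidx_def)
  note rp = gauss_reindex_prob[OF inj hp(1), folded B2_def]
  define A where "A = space ?G - (B1 \<union> B2)"
  have Asets: "A \<in> sets ?G" unfolding A_def using B1(1) rp(2) by blast
  have PA: "1 - (3 / M\<^sup>2 + 2 * p) \<le> measure ?G A"
  proof -
    have "measure ?G (B1 \<union> B2) \<le> measure ?G B1 + measure ?G B2" by (rule measure_Un_le[OF B1(1) rp(2)])
    also have "\<dots> \<le> 3 / M\<^sup>2 + 2 * p" using B1(2) rp(1) hp(2) by linarith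
    finally show ?thesis unfolding A_def using G.prob_compl[of "B1 \<union> B2"] B1(1) rp(2) by auto
  qed
  have good: "\<bar>(enorm m (\<lambda>a. z (a, n)))\<^sup>2 - real m\<bar> \<le> M * sqrt (real m)"
      "\<bar>ip m \<xi> (\<lambda>a. z (a, n))\<bar> \<le> M * enorm m \<xi>" "hgood e k (hh z)" if z: "z \<in> A" for z
  proof -
    have sp: "z \<in> space ?G" "z \<notin> B1" "z \<notin> B2" using z by (auto simp: A_def)
    have "hh z \<in> space (gauss {..<n})" by (simp add: hh_def space_gauss)
    then show "hgood e k (hh z)" using sp(1,3) by (auto simp: B2_def hh_def)
    show "\<bar>(enorm m (\<lambda>a. z (a, n)))\<^sup>2 - real m\<bar> \<le> M * sqrt (real m)"
      "\<bar>ip m \<xi> (\<lambda>a. z (a, n))\<bar> \<le> M * enorm m \<xi>" using sp(1,2) by (auto simp: B1_def)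
  qed
  define c1 c2 where "c1 = cstar s + sqrt (real m) * (2 * \<rho> * r\<^sup>2 + K1 * (r * dl + dl\<^sup>2))"
    and "c2 = cstar s + sqrt (real m) * (\<rho> * r\<^sup>2 + K1 * (r * dl + dl\<^sup>2))"
  define L where "L = {z \<in> space ?G. b \<longrightarrow> (\<forall>i::nat. c1 < enorm m (res \<xi> z n (sx (xs i))))}"
  define R where "R = {z \<in> space ?G. \<forall>j. \<exists>i::nat. ip m (u j) (res \<xi> z n (sx (ys i))) < c2}"
  have PL: "measure ?G A - 1 / M\<^sup>2 \<le> measure ?G L"
  proof (cases b)
    case True
    have "c1 + enorm n (sx (xs i)) * M + ip n (\<lambda>b. z (m, b)) (sx (xs i)) < enorm m (\<lambda>a. \<xi> a + enorm n (sx (xs i)) * z (a, n))"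
      if z: "z \<in> A" for z i
      using ao_lower[OF xs(1)[OF True] s less_imp_le[OF M] good[OF z] K K10 k0 xs(2)[OF True a0_close[OF good(3)[OF z]]]]
      unfolding c1_def iph .
    from residual_lower[OF u M Asets this] show ?thesis using True unfolding L_def by simp
  next
    case False
    then have "L = space ?G" by (auto simp: L_def)
    then have "measure ?G L = 1" by (simp add: G.prob_space)
    moreover have "measure ?G A \<le> 1" by simp
    moreover have "0 \<le> 1 / M\<^sup>2" by simp
    ultimately show ?thesis by linarith
  qed
  have PR: "measure ?G A - 1 / M\<^sup>2 \<le> measure ?G R"
  proof -
    have "\<exists>i. enorm m (\<lambda>a. \<xi> a - enorm n (sx (ys i)) * z (a, n)) - ip n (\<lambda>b. z (m, b)) (sx (ys i)) < c2 - enorm n (sx (ys i)) * M"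
      if z: "z \<in> A" for z
    proof -
      define v0 where "v0 = pj n C w (hh z)"
      have lt: "enorm m (\<lambda>a. \<xi> a - enorm n (sx v0) * z (a, n)) - ip n (hh z) (sx v0) < c2 - enorm n (sx v0) * M"
        unfolding c2_def v0_def by (rule ao_upper[OF s less_imp_le[OF M] good[OF z] e k0 \<rho> inv K1])
      \<comment> \<open>The maximizer depends on \<open>h\<close>, but Gordon's comparison requires
        a fixed countable family; continuity of \<open>F\<close> passes from the one to a member of
        the other.\<close>
      define F where "F v = enorm m (\<lambda>a. \<xi> a - (enorm n v / sqrt (real n)) * z (a, n)) - ip n (hh z) v / sqrt (real n) + (enorm n v / sqrt (real n)) * M" for v
      have F0: "F v0 < c2" using lt unfolding F_def sx by linarith
      have cF: "continuous_on UNIV F"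
        unfolding F_def by (intro continuous_on_add continuous_on_diff continuous_on_mult continuous_on_divide continuous_on_enorm
          continuous_on_ip continuous_on_coordinatewise_then_product continuous_on_const continuous_on_id) (use n in auto)
      have op: "open {v. F v < c2}" by (rule open_Collect_less[OF cF continuous_on_const])
      have v0C: "v0 \<in> C" unfolding v0_def by (rule pj_mem[OF cc_set0D(1)[OF C]])
      have "enorm n v0 / sqrt (real n) \<le> 2 * r + k * dl"
      proof -
        have "\<bar>enorm n v0 / sqrt (real n) - r\<bar> \<le> e * r + k * dl" unfolding v0_def by (rule a0_close[OF good(3)[OF z]])
        moreover have "e * r \<le> r" using e r by simp
        ultimately show ?thesis by linarith
      qed
      then have "enorm n v0 \<le> sqrt (real n) * (2 * r + k * dl)" using n by (simp add: pos_divide_le_eq mult.commute)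
      from ys[OF v0C this op] F0 obtain i where "F (ys i) < c2" by auto
      then show ?thesis unfolding F_def iph sx by (intro exI[of _ i]) linarith
    qed
    from residual_upper[OF u M Asets this] show ?thesis unfolding R_def .
  qed
  have mr: "(\<lambda>z. res \<xi> z n v a) \<in> borel_measurable ?G" if "a < m" for v a by (rule measurable_res_gidx[OF that])
  have me: "(\<lambda>\<omega>. enorm m (res \<xi> \<omega> n v)) \<in> borel_measurable ?G" for v by (rule measurable_enorm[OF mr])
  have mi: "(\<lambda>\<omega>. ip m (u j) (res \<xi> \<omega> n v)) \<in> borel_measurable ?G" for v j
    by (rule measurable_ip[OF borel_measurable_const mr])
  have 1: "Measurable.pred ?G (\<lambda>\<omega>. c1 < enorm m (res \<xi> \<omega> n v))" for v
    using borel_measurable_less[OF borel_measurable_const me[of v]] unfolding pred_def .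
  have 2: "Measurable.pred ?G (\<lambda>\<omega>. ip m (u j) (res \<xi> \<omega> n v) < c2)" for v j
    using borel_measurable_less[OF mi[of j v] borel_measurable_const] unfolding pred_def .
  have Ls: "L \<in> sets ?G"
  proof -
    have "Measurable.pred ?G (\<lambda>\<omega>. b \<longrightarrow> (\<forall>i::nat. c1 < enorm m (res \<xi> \<omega> n (sx (xs i)))))"
      by (intro pred_intros_logic pred_intros_countable measurable_const UNIV_I 1) simp_all
    then show ?thesis unfolding L_def pred_def .
  qed
  have Rs: "R \<in> sets ?G"
  proof -
    have "Measurable.pred ?G (\<lambda>\<omega>. \<forall>j. \<exists>i::nat. ip m (u j) (res \<xi> \<omega> n (sx (ys i))) < c2)"
      by (intro pred_intros_logic pred_intros_countable 2)
    then show ?thesis unfolding R_def pred_def .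
  qed
  have LR: "1 - 2 * (4 / M\<^sup>2 + 2 * p) \<le> measure ?G (L \<inter> R)"
  proof -
    have un: "measure ?G (L \<union> R) + measure ?G (L \<inter> R) = measure ?G L + measure ?G R"
      using G.finite_measure_Union'[OF Ls Rs] G.finite_measure_Diff'[OF Rs Ls] by (simp add: Int_commute)
    have le1: "measure ?G (L \<union> R) \<le> 1" by simp
    have arith: "1 - 2 * (4 * t + 2 * p) \<le> i" if "q + i = a + b" "q \<le> 1" "c - t \<le> a" "c - t \<le> b" "1 - (3 * t + 2 * p) \<le> c"
      for a b c i q t p :: real using that by argo
    show ?thesis
      using arith[OF un le1, of "measure ?G A" "1 / M\<^sup>2" p] PL PR PA by simp
  qed
  let ?H = "gauss ({..<m} \<times> {..<n})"
  let ?g = "gap_event m n u (\<lambda>i. sx (xs i)) (\<lambda>i. sx (ys i)) b c1 c2"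
  \<comment> \<open>Residuals involve the design block of the array only, so the event is
    transported to the law of this block.\<close>
  have S: "{G \<in> space ?H. ?g G \<xi>} \<in> sets ?H"
    by (rule measurable_gap_event) (auto intro: measurable_entry)
  have inj2: "inj_on (\<lambda>q. q) ({..<m} \<times> {..<n})" "(\<lambda>q. q) ` ({..<m} \<times> {..<n}) \<subseteq> gidx m n" by (auto simp: gidx_def)
  have "{z \<in> space ?G. (\<lambda>i\<in>{..<m} \<times> {..<n}. z i) \<in> {G \<in> space ?H. ?g G \<xi>}} = L \<inter> R"
  proof -
    have gg: "?g (\<lambda>i\<in>{..<m} \<times> {..<n}. z i) \<xi> = ?g z \<xi>" for z by (rule gap_event_cong) auto
    have sp: "(\<lambda>i\<in>{..<m} \<times> {..<n}. z i) \<in> space ?H" for z by (simp add: space_gauss)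
    have "L \<inter> R = {z \<in> space ?G. ?g z \<xi>}" unfolding L_def R_def gap_event_def by auto
    then show ?thesis by (simp only: mem_Collect_eq gg sp simp_thms)
  qed
  then have "measure ?H {G \<in> space ?H. ?g G \<xi>} = measure ?G (L \<inter> R)"
    using gauss_reindex_prob(1)[OF inj2 S] by simp
  then show ?thesis using LR unfolding c1_def c2_def by simp
qed

end

context fixed_point_instance
begin

text \<open>A bound on \<open>r\<close> that is uniform over the instances, as
  \<open>curvature_gap\<close> asks for.\<close>

lemma r_le:
  assumes \<kappa>: "\<kappa> > 0" "(1 + \<kappa>) * dT \<le> real m"
  shows "r \<le> \<sigma> / sqrt \<kappa>"
proof -
  have "(1 + \<kappa>) * (r\<^sup>2 * real m) \<le> (1 + \<kappa>) * (\<beta>\<^sup>2 * dT)" using r2_le \<kappa> by (intro mult_left_mono) auto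
  also have "\<dots> = \<beta>\<^sup>2 * ((1 + \<kappa>) * dT)" by simp
  also have "\<dots> \<le> \<beta>\<^sup>2 * real m" using \<kappa> by (intro mult_left_mono) auto
  finally have "((1 + \<kappa>) * r\<^sup>2) * real m \<le> \<beta>\<^sup>2 * real m" by (simp add: mult.assoc)
  then have "(1 + \<kappa>) * r\<^sup>2 \<le> r\<^sup>2 + \<sigma>\<^sup>2" using m unfolding beta(3) by simp
  then have "(r * sqrt \<kappa>)\<^sup>2 \<le> \<sigma>\<^sup>2" using \<kappa> by (simp add: power_mult_distrib algebra_simps)
  then have "r * sqrt \<kappa> \<le> \<sigma>" using \<sigma> by (auto intro: power2_le_imp_le)
  then show ?thesis using \<kappa> by (simp add: pos_le_divide_eq)
qed

lemma sx_cont: "continuous_on S sx"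
  unfolding sx_def by (intro continuous_on_coordinatewise_then_product continuous_on_mult continuous_on_const continuous_on_coord)

text \<open>The lower bound extends from the sequence to all of \<open>S\<close> by density and
  continuity. In the upper bound the competitor still depends on \<open>u j\<close>; on the compact
  convex image of the bounded part, \<open>min_residual_le\<close> provides one competitor for all
  directions.\<close>

lemma gap_event_gap:
  assumes c: "0 \<le> c2" and u: "sphere_seq m u"
    and xs: "\<And>v U. v \<in> S \<Longrightarrow> open U \<Longrightarrow> v \<in> U \<Longrightarrow> \<exists>i. xs i \<in> U" and b: "S \<noteq> {} \<Longrightarrow> b"
    and ys: "\<And>i. ys i \<in> bounded_part n C B"
    and gap_event: "gap_event m n u (\<lambda>i. sx (xs i)) (\<lambda>i. sx (ys i)) b c1 c2 G \<xi>"
    and v: "v \<in> S"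
  shows "c1 \<le> enorm m (res \<xi> G n (sx v))" "\<exists>v'\<in>C. enorm m (res \<xi> G n (sx v')) \<le> c2"
proof -
  have cF: "continuous_on UNIV (\<lambda>v. enorm m (res \<xi> G n (sx v)))"
    by (rule continuous_on_enorm) (rule continuous_on_compose2[OF continuous_res[of UNIV] sx_cont subset_UNIV])
  show "c1 \<le> enorm m (res \<xi> G n (sx v))"
  proof (rule ccontr)
    assume "\<not> ?thesis"
    then have "v \<in> {v. enorm m (res \<xi> G n (sx v)) < c1}" by simp
    from xs[OF v open_Collect_less[OF cF continuous_on_const] this] obtain i where "enorm m (res \<xi> G n (sx (xs i))) < c1" by auto
    moreover have "c1 < enorm m (res \<xi> G n (sx (xs i)))" using gap_event b v unfolding gap_event_def by auto
    ultimately show False by simp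
  qed
  have Cc: "cc_set n C" by (rule cc_set0D(1)[OF C])
  then have Cp: "closed C" "C \<subseteq> Rn n" "cvx C" by (auto simp: cc_set_def)
  let ?B = "bounded_part n C B"
  have 1: "compact (sx ` ?B)" by (rule compact_continuous_image[OF sx_cont compact_bounded_part[OF Cp(1,2)]])
  have cB: "cvx ?B" unfolding cvx_def
  proof (intro ballI allI impI)
    fix x y t assume xy: "x \<in> ?B" "y \<in> ?B" and t: "0 \<le> t \<and> t \<le> (1::real)"
    have "(\<lambda>i. (1 - t) * x i + t * y i) \<in> C" using Cp(3) xy t unfolding cvx_def bounded_part_def by simp
    moreover have "enorm n (\<lambda>i. (1 - t) * x i + t * y i) \<le> B"
    proof -
      have "enorm n (\<lambda>i. (1 - t) * x i + t * y i) \<le> enorm n (\<lambda>i. (1 - t) * x i) + enorm n (\<lambda>i. t * y i)" by (rule enorm_triangle)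
      also have "\<dots> = (1 - t) * enorm n x + t * enorm n y" using t by (simp add: enorm_scale)
      also have "\<dots> \<le> (1 - t) * B + t * B" using xy t by (intro add_mono mult_left_mono) (auto simp: bounded_part_def)
      finally show ?thesis by (simp add: algebra_simps)
    qed
    ultimately show "(\<lambda>i. (1 - t) * x i + t * y i) \<in> ?B" by (simp add: bounded_part_def)
  qed
  have 2: "cvx (sx ` ?B)" unfolding cvx_def
  proof (intro ballI allI impI)
    fix x y t assume xy: "x \<in> sx ` ?B" "y \<in> sx ` ?B" and t: "0 \<le> t \<and> t \<le> (1::real)"
    from xy obtain x' y' where x': "x = sx x'" "x' \<in> ?B" and y': "y = sx y'" "y' \<in> ?B" by blast
    have "(\<lambda>i. (1 - t) * x i + t * y i) = sx (\<lambda>i. (1 - t) * x' i + t * y' i)"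
      unfolding x' y' sx_def by (simp add: fun_eq_iff add_divide_distrib mult.left_commute)
    moreover have "(\<lambda>i. (1 - t) * x' i + t * y' i) \<in> ?B" using cB x'(2) y'(2) t unfolding cvx_def by simp
    ultimately show "(\<lambda>i. (1 - t) * x i + t * y i) \<in> sx ` ?B" by (rule image_eqI)
  qed
  have 3: "sx ` ?B \<noteq> {}" using ys by auto
  have "\<exists>v\<in>sx ` ?B. ip m (u j) (res \<xi> G n v) < c2" for j
  proof -
    have "\<exists>i. ip m (u j) (res \<xi> G n (sx (ys i))) < c2" using gap_event unfolding gap_event_def by simp
    then obtain i where "ip m (u j) (res \<xi> G n (sx (ys i))) < c2" ..
    moreover have "sx (ys i) \<in> sx ` ?B" by (rule imageI[OF ys])
    ultimately show ?thesis by (rule bexI)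
  qed
  from min_residual_le[OF 1 2 3 u c this] show "\<exists>v'\<in>C. enorm m (res \<xi> G n (sx v')) \<le> c2"
    unfolding bounded_part_def by auto
qed

end

text \<open>The event \<open>gap_event\<close> involves countably many points \<open>x\<close>, \<open>y\<close> only, so that, unlike the gap it entails,
  it is measurable.\<close>

definition gap_certificate ::
  "nat \<Rightarrow> nat \<Rightarrow> (nat \<Rightarrow> real) set \<Rightarrow> real \<Rightarrow> real \<Rightarrow> real \<Rightarrow> real \<Rightarrow> real \<Rightarrow> real \<Rightarrow> bool" where
  "gap_certificate n m C \<sigma> \<eta> p r t g \<longleftrightarrow> (\<exists>u x y b c1 c2. c1 \<in> borel_measurable borel \<and> c2 \<in> borel_measurable borel \<and>
      (\<forall>\<xi>. \<bar>(enorm m \<xi>)\<^sup>2 / real m - \<sigma>\<^sup>2\<bar> \<le> \<eta> \<longrightarrow>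
        1 - p \<le> measure (gauss ({..<m} \<times> {..<n})) {G \<in> space (gauss ({..<m} \<times> {..<n})).
            gap_event m n u x y b (c1 (enorm m \<xi>)) (c2 (enorm m \<xi>)) G \<xi>} \<and>
        (\<forall>G. gap_event m n u x y b (c1 (enorm m \<xi>)) (c2 (enorm m \<xi>)) G \<xi> \<longrightarrow>
          (\<forall>v\<in>C. t < \<bar>enorm n v / sqrt (real n) - r\<bar> \<longrightarrow>
            (\<exists>v'\<in>C. (enorm m (res \<xi> G n (\<lambda>i. 1 / sqrt (real n) * v' i)))\<^sup>2 / real m + g
               \<le> (enorm m (res \<xi> G n (\<lambda>i. 1 / sqrt (real n) * v i)))\<^sup>2 / real m)))))"

text \<open>Uniformity is the point: the constants precede \<open>n\<close>, \<open>m\<close>,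
  \<open>C\<close>, \<open>T\<close> and \<open>r\<close>. The curvature yields \<open>e\<close>,
  which with the failure probability determines \<open>k\<close> and \<open>M\<close>, these
  determine \<open>K1\<close> and \<open>K\<close>, and the rest is what the curvature returns for
  this \<open>K\<close>.\<close>

theorem primary_gap:
  fixes \<sigma> \<kappa> \<epsilon> p :: real
  assumes \<sigma>: "\<sigma> > 0" and \<kappa>: "\<kappa> > 0" and \<epsilon>: "0 < \<epsilon>" "\<epsilon> \<le> 1" and p: "0 < p"
  shows "\<exists>Cc>0. \<exists>\<tau>>0. \<exists>\<eta>>0. \<exists>m0. \<forall>n m C T r. fixed_point_instance n m C T \<sigma> r \<longrightarrow> m0 \<le> real m \<longrightarrow>
    (1 + \<kappa>) * (\<integral>h. (enorm n (metric_proj n T h))\<^sup>2 \<partial>gauss {..<n}) \<le> real m \<longrightarrow>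
    gap_certificate n m C \<sigma> \<eta> p r (\<epsilon> * r + Cc / sqrt (real m)) (\<tau> * r\<^sup>2)"
proof -
  define rb where "rb = \<sigma> / sqrt \<kappa>"
  have rb: "rb \<ge> 0" using \<sigma> \<kappa> by (simp add: rb_def)
  obtain e where e: "0 < e" "e \<le> 1" and cg: "\<forall>K\<ge>1. \<forall>\<eta>0>0. \<exists>C \<rho> \<eta> \<delta>0. 0 < C \<and> 0 < \<rho> \<and> \<rho> \<le> 1 \<and> 0 < \<eta> \<and> \<eta> \<le> \<eta>0 \<and> 0 < \<delta>0 \<and>
    (\<forall>r s \<delta>. 0 \<le> r \<and> r \<le> rb \<and> s > 0 \<and> \<bar>s\<^sup>2 - \<sigma>\<^sup>2\<bar> \<le> \<eta> \<and> 0 < \<delta> \<and> \<delta> \<le> \<delta>0 \<longrightarrow>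
      \<bar>sqrt (r\<^sup>2 + \<sigma>\<^sup>2) - sqrt (r\<^sup>2 + s\<^sup>2)\<bar> \<le> \<eta> / \<sigma> \<and>
      \<bar>1 / sqrt (r\<^sup>2 + s\<^sup>2) - 1 / sqrt (r\<^sup>2 + \<sigma>\<^sup>2)\<bar> \<le> 2 * \<rho> \<and>
      (\<forall>a a0. a \<ge> 0 \<and> \<bar>a0 - r\<bar> \<le> e * r + K * \<delta> \<and> \<bar>a - r\<bar> > \<epsilon> * r + C * \<delta> \<longrightarrow>
        2 * \<rho> * r\<^sup>2 + K * ((a + r) * \<delta> + \<delta>\<^sup>2)
        < sqrt (a\<^sup>2 + s\<^sup>2) - sqrt (r\<^sup>2 + s\<^sup>2) - (a\<^sup>2 - r\<^sup>2) / (2 * sqrt (r\<^sup>2 + \<sigma>\<^sup>2)) + (a - a0)\<^sup>2 / (2 * sqrt (r\<^sup>2 + \<sigma>\<^sup>2))))"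
    by (rule exE[OF curvature_gap[OF \<sigma> rb \<epsilon>]], elim conjE, rule that)
  \<comment> \<open>With \<open>4 / M\<^sup>2 = p / 4\<close> the total loss
    \<open>2 * (4 / M\<^sup>2 + 2 * p')\<close> is exactly \<open>p\<close>.\<close>
  define p' where "p' = p / 8"
  have p': "p' > 0" using p by (simp add: p'_def)
  define M where "M = 4 / sqrt p"
  have M: "M > 0" "4 / M\<^sup>2 = p / 4" using p by (auto simp: M_def power_divide)
  define k where "k = max (4 / sqrt p') (96 * (rb + \<sigma>) / (e * sqrt p'))"
  have k: "4 / sqrt p' \<le> k" "96 * (rb + \<sigma>) / (e * sqrt p') \<le> k" by (simp_all add: k_def)
  have k0: "0 < k"
  proof -
    have "0 < 4 / sqrt p'" using p' by simp
    then show ?thesis using k(1) by linarith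
  qed
  define K1 where "K1 = 2 * k + 8 * M + 4 * M * k + 1"
  define K where "K = k + 4 * M + K1"
  have Mk: "0 \<le> M * k" using M k0 by simp
  have K1: "0 \<le> K1" "1 \<le> K" "k \<le> K" using M k0 Mk unfolding K_def K1_def by linarith+
  \<comment> \<open>A lower bound for \<open>cstar\<close> in units of \<open>sqrt m\<close>.
    Requiring \<open>\<eta> \<le> \<sigma> * x\<close> makes the perturbation of \<beta> admissible
    in \<open>cstar_ge\<close> and keeps \<open>s\<close> positive.\<close>
  define x where "x = \<sigma> * \<kappa> / (2 * (1 + \<kappa>))"
  have x: "x > 0" using \<sigma> \<kappa> by (simp add: x_def)
  have x1: "\<sigma> * x < \<sigma>\<^sup>2"
  proof -
    have "x < \<sigma>" unfolding x_def using \<sigma> \<kappa> by (simp add: pos_divide_less_eq algebra_simps add_pos_pos)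
    then show ?thesis using \<sigma> by (simp add: power2_eq_square)
  qed
  from cg[rule_format, OF K1(2) mult_pos_pos[OF \<sigma> x]] obtain Cc \<rho> \<eta> \<delta>0 where Cc: "0 < Cc" and \<rho>: "0 < \<rho>" "\<rho> \<le> 1" and \<eta>: "0 < \<eta>" "\<eta> \<le> \<sigma> * x" and \<delta>0: "0 < \<delta>0"
    and cg0: "\<forall>r s \<delta>. 0 \<le> r \<and> r \<le> rb \<and> s > 0 \<and> \<bar>s\<^sup>2 - \<sigma>\<^sup>2\<bar> \<le> \<eta> \<and> 0 < \<delta> \<and> \<delta> \<le> \<delta>0 \<longrightarrow>
      \<bar>sqrt (r\<^sup>2 + \<sigma>\<^sup>2) - sqrt (r\<^sup>2 + s\<^sup>2)\<bar> \<le> \<eta> / \<sigma> \<and>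
      \<bar>1 / sqrt (r\<^sup>2 + s\<^sup>2) - 1 / sqrt (r\<^sup>2 + \<sigma>\<^sup>2)\<bar> \<le> 2 * \<rho> \<and>
      (\<forall>a a0. a \<ge> 0 \<and> \<bar>a0 - r\<bar> \<le> e * r + K * \<delta> \<and> \<bar>a - r\<bar> > \<epsilon> * r + Cc * \<delta> \<longrightarrow>
        2 * \<rho> * r\<^sup>2 + K * ((a + r) * \<delta> + \<delta>\<^sup>2)
        < sqrt (a\<^sup>2 + s\<^sup>2) - sqrt (r\<^sup>2 + s\<^sup>2) - (a\<^sup>2 - r\<^sup>2) / (2 * sqrt (r\<^sup>2 + \<sigma>\<^sup>2)) + (a - a0)\<^sup>2 / (2 * sqrt (r\<^sup>2 + \<sigma>\<^sup>2)))"
    by (elim exE conjE) (rule that; assumption)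
  note cg1 = cg0[rule_format, OF conjI, OF _ conjI, OF _ _ conjI, OF _ _ _ conjI, OF _ _ _ _ conjI]
  define m0 where "m0 = 1 / \<delta>0\<^sup>2"
  \<comment> \<open>The squares of the thresholds differ by at least
    \<open>2 * c2 * (c1 - c2)\<close>, where \<open>c2\<close> is at least \<open>sqrt m * x\<close>
    and \<open>c1 - c2\<close> equals \<open>sqrt m * (\<rho> * r\<^sup>2)\<close>; division by
    \<open>m\<close> leaves \<open>\<tau> * r\<^sup>2\<close>.\<close>
  define \<tau> where "\<tau> = 2 * x * \<rho>"
  have \<tau>: "\<tau> > 0" using x \<rho> by (simp add: \<tau>_def)
  show ?thesis
  proof (rule exI[of _ Cc], rule conjI[OF Cc], rule exI[of _ \<tau>], rule conjI[OF \<tau>], rule exI[of _ \<eta>], rule conjI[OF \<eta>(1)],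
      rule exI[of _ m0], intro allI impI)
    fix n m C T r assume inst: "fixed_point_instance n m C T \<sigma> r" and m0: "m0 \<le> real m"
      and dT: "(1 + \<kappa>) * (\<integral>h. (enorm n (metric_proj n T h))\<^sup>2 \<partial>gauss {..<n}) \<le> real m"
    interpret fixed_point_instance n m C T \<sigma> r by (rule inst)
    have dT': "(1 + \<kappa>) * dT \<le> real m" using dT unfolding dT_def .
    have rle: "r \<le> rb" unfolding rb_def by (rule r_le[OF \<kappa> dT'])
    have bb: "\<beta> \<le> rb + \<sigma>"
    proof -
      have "\<beta> \<le> \<bar>r\<bar> + \<bar>\<sigma>\<bar>" unfolding \<beta>_def by (rule sqrt_sum_squares_le_sum_abs)
      then show ?thesis using rle r \<sigma> by simp
    qed
    have kb: "96 * \<beta> / (e * sqrt p') \<le> k"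
    proof -
      have "96 * \<beta> / (e * sqrt p') \<le> 96 * (rb + \<sigma>) / (e * sqrt p')" using bb e p' by (intro divide_right_mono) auto
      then show ?thesis using k(2) by linarith
    qed
    have dl0: "dl \<le> \<delta>0"
    proof -
      have "1 \<le> \<delta>0\<^sup>2 * real m" using m0 \<delta>0 unfolding m0_def by (simp add: pos_divide_le_eq mult.commute)
      then have "sqrt 1 \<le> sqrt (\<delta>0\<^sup>2 * real m)" by (rule real_sqrt_le_mono)
      then have "1 \<le> \<delta>0 * sqrt (real m)" using \<delta>0 by (simp add: real_sqrt_mult)
      then show ?thesis using m by (simp add: dl_def pos_divide_le_eq)
    qed
    obtain u where u: "sphere_seq m u" using sphere_seq_exists[OF m] by blast
    define S where "S = {v \<in> C. \<epsilon> * r + Cc / sqrt (real m) < \<bar>enorm n v / sqrt (real n) - r\<bar>}"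
    have "\<exists>xs::nat \<Rightarrow> nat \<Rightarrow> real. S \<noteq> {} \<longrightarrow> (\<forall>i. xs i \<in> S) \<and> (\<forall>U x. open U \<and> x \<in> U \<and> x \<in> S \<longrightarrow> (\<exists>i. xs i \<in> U))"
      using dense_sequence[of S] by auto
    then obtain xs :: "nat \<Rightarrow> nat \<Rightarrow> real" where xsd: "S \<noteq> {} \<longrightarrow> (\<forall>i. xs i \<in> S) \<and> (\<forall>U x. open U \<and> x \<in> U \<and> x \<in> S \<longrightarrow> (\<exists>i. xs i \<in> U))" ..
    have xs: "xs i \<in> S" if "S \<noteq> {}" for i using xsd that by simp
    have xd: "\<exists>i. xs i \<in> U" if "x \<in> S" "open U" "x \<in> U" for x U
    proof -
      have "S \<noteq> {}" using that by auto
      then show ?thesis using xsd that by blast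
    qed
    define B where "B = sqrt (real n) * (2 * r + k * dl)"
    have B0: "(\<lambda>i. 0) \<in> bounded_part n C B"
      using cc_set0D(2)[OF C] k0 dl r by (simp add: bounded_part_def B_def enorm_eq_sqrt)
    then have "bounded_part n C B \<noteq> {}" by auto
    from dense_sequence[OF this] obtain ys :: "nat \<Rightarrow> nat \<Rightarrow> real"
      where ysd: "(\<forall>i. ys i \<in> bounded_part n C B) \<and> (\<forall>U x. open U \<and> x \<in> U \<and> x \<in> bounded_part n C B \<longrightarrow> (\<exists>i. ys i \<in> U))" ..
    have ys: "ys i \<in> bounded_part n C B" for i using ysd by simp
    have yd: "\<exists>i. ys i \<in> U" if "x \<in> bounded_part n C B" "open U" "x \<in> U" for x U using ysd that by blast
    define c1 c2 where "c1 t = cstar (t / sqrt (real m)) + sqrt (real m) * (2 * \<rho> * r\<^sup>2 + K1 * (r * dl + dl\<^sup>2))"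
      and "c2 t = cstar (t / sqrt (real m)) + sqrt (real m) * (\<rho> * r\<^sup>2 + K1 * (r * dl + dl\<^sup>2))" for t
    have mc: "c1 \<in> borel_measurable borel" "c2 \<in> borel_measurable borel"
      unfolding c1_def[abs_def] c2_def[abs_def] cstar_def by measurable
    have sm: "sqrt (real m) > 0" using m by simp
    have main: "1 - p \<le> measure (gauss ({..<m} \<times> {..<n})) {G \<in> space (gauss ({..<m} \<times> {..<n})).
            gap_event m n u (\<lambda>i. sx (xs i)) (\<lambda>i. sx (ys i)) (S \<noteq> {}) (c1 (enorm m \<xi>)) (c2 (enorm m \<xi>)) G \<xi>} \<and>
        (\<forall>G. gap_event m n u (\<lambda>i. sx (xs i)) (\<lambda>i. sx (ys i)) (S \<noteq> {}) (c1 (enorm m \<xi>)) (c2 (enorm m \<xi>)) G \<xi> \<longrightarrow>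
          (\<forall>v\<in>C. \<epsilon> * r + Cc / sqrt (real m) < \<bar>enorm n v / sqrt (real n) - r\<bar> \<longrightarrow>
            (\<exists>v'\<in>C. (enorm m (res \<xi> G n (sx v')))\<^sup>2 / real m + \<tau> * r\<^sup>2 \<le> (enorm m (res \<xi> G n (sx v)))\<^sup>2 / real m)))"
      if xi: "\<bar>(enorm m \<xi>)\<^sup>2 / real m - \<sigma>\<^sup>2\<bar> \<le> \<eta>" for \<xi>
    proof -
      define s where "s = enorm m \<xi> / sqrt (real m)"
      have s2: "\<bar>s\<^sup>2 - \<sigma>\<^sup>2\<bar> \<le> \<eta>" using xi by (simp add: s_def power_divide)
      have s: "s > 0" "enorm m \<xi> = s * sqrt (real m)"
      proof -
        show "enorm m \<xi> = s * sqrt (real m)" using sm by (simp add: s_def)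
        have "s\<^sup>2 > 0" using s2 \<eta>(2) x1 by linarith
        moreover have "s \<ge> 0" using sm by (simp add: s_def)
        ultimately show "s > 0" by (simp add: le_less)
      qed
      note cg2 = cg1[OF less_imp_le[OF r] rle s(1) s2 dl(1) dl0]
      have sb: "\<bar>\<beta> - sqrt (r\<^sup>2 + s\<^sup>2)\<bar> \<le> \<sigma> * \<kappa> / (2 * (1 + \<kappa>))"
      proof -
        have "\<eta> / \<sigma> \<le> x" using \<eta>(2) \<sigma> by (simp add: pos_divide_le_eq mult.commute)
        then show ?thesis using cg2 unfolding \<beta>_def x_def by linarith
      qed
      have inv: "\<bar>1 / sqrt (r\<^sup>2 + s\<^sup>2) - 1 / \<beta>\<bar> \<le> 2 * \<rho>" using cg2 unfolding \<beta>_def by blast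
      have xg: "2 * \<rho> * r\<^sup>2 + K * ((enorm n (xs i) / sqrt (real n) + r) * dl + dl\<^sup>2)
        < sqrt ((enorm n (xs i) / sqrt (real n))\<^sup>2 + s\<^sup>2) - sqrt (r\<^sup>2 + s\<^sup>2) - ((enorm n (xs i) / sqrt (real n))\<^sup>2 - r\<^sup>2) / (2 * \<beta>)
          + (enorm n (xs i) / sqrt (real n) - a0)\<^sup>2 / (2 * \<beta>)"
        if ne: "S \<noteq> {}" and a0: "\<bar>a0 - r\<bar> \<le> e * r + k * dl" for i a0
      proof -
        have "k * dl \<le> K * dl" using K1(3) dl by (intro mult_right_mono) auto
        then have 1: "\<bar>a0 - r\<bar> \<le> e * r + K * dl" using a0 by linarith
        have 2: "\<epsilon> * r + Cc * dl < \<bar>enorm n (xs i) / sqrt (real n) - r\<bar>" using xs[OF ne, of i] by (simp add: S_def dl_def)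
        have 3: "0 \<le> enorm n (xs i) / sqrt (real n)" by simp
        show ?thesis using cg2 1 2 3 unfolding \<beta>_def by blast
      qed
      have yd': "\<exists>i. ys i \<in> U" if "v \<in> C" "enorm n v \<le> sqrt (real n) * (2 * r + k * dl)" "open U" "v \<in> U" for v U
        by (rule yd[OF _ that(3,4)]) (use that in \<open>auto simp: bounded_part_def B_def\<close>)
      have xC: "xs i \<in> C" if "S \<noteq> {}" for i using xs[OF that, of i] by (simp add: S_def)
      have c12: "c1 (enorm m \<xi>) = cstar s + sqrt (real m) * (2 * \<rho> * r\<^sup>2 + K1 * (r * dl + dl\<^sup>2))"
        "c2 (enorm m \<xi>) = cstar s + sqrt (real m) * (\<rho> * r\<^sup>2 + K1 * (r * dl + dl\<^sup>2))"
        unfolding c1_def c2_def s_def by simp_all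
      have pr: "1 - 2 * (4 / M\<^sup>2 + 2 * p') = 1 - p" unfolding M(2) p'_def by simp
      have Kl: "k + 4 * M + K1 \<le> K" "2 * k + 8 * M + 4 * M * k + 1 \<le> K1" by (simp_all add: K_def K1_def)
      have A: "1 - p \<le> measure (gauss ({..<m} \<times> {..<n})) {G \<in> space (gauss ({..<m} \<times> {..<n})).
            gap_event m n u (\<lambda>i. sx (xs i)) (\<lambda>i. sx (ys i)) (S \<noteq> {}) (c1 (enorm m \<xi>)) (c2 (enorm m \<xi>)) G \<xi>}"
        using gap_event_prob[OF s M(1) e p' k(1) kb Kl less_imp_le[OF \<rho>(1)] \<rho>(2) inv u xC xg yd'] unfolding pr c12 .
      have cs: "sqrt (real m) * x \<le> cstar s" unfolding x_def by (rule cstar_ge[OF \<kappa> dT' sb])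
      have ex: "0 \<le> sqrt (real m) * (\<rho> * r\<^sup>2)" "0 \<le> sqrt (real m) * (K1 * (r * dl + dl\<^sup>2))" "0 \<le> sqrt (real m) * x"
        using \<rho> K1 r dl x by auto
      have c2g: "sqrt (real m) * x \<le> c2 (enorm m \<xi>)" using cs ex unfolding c12 distrib_left by linarith
      have c1e: "c1 (enorm m \<xi>) = c2 (enorm m \<xi>) + sqrt (real m) * (\<rho> * r\<^sup>2)" unfolding c12 by (simp add: algebra_simps)
      have c20: "0 \<le> c2 (enorm m \<xi>)" using c2g ex by linarith
      have B: "\<exists>v'\<in>C. (enorm m (res \<xi> G n (sx v')))\<^sup>2 / real m + \<tau> * r\<^sup>2 \<le> (enorm m (res \<xi> G n (sx v)))\<^sup>2 / real m"
        if gdG: "gap_event m n u (\<lambda>i. sx (xs i)) (\<lambda>i. sx (ys i)) (S \<noteq> {}) (c1 (enorm m \<xi>)) (c2 (enorm m \<xi>)) G \<xi>"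
          and v: "v \<in> C" "\<epsilon> * r + Cc / sqrt (real m) < \<bar>enorm n v / sqrt (real n) - r\<bar>" for G v
      proof -
        have vS: "v \<in> S" using v by (simp add: S_def)
        have gg: "c1 (enorm m \<xi>) \<le> enorm m (res \<xi> G n (sx v))" "\<exists>v'\<in>C. enorm m (res \<xi> G n (sx v')) \<le> c2 (enorm m \<xi>)"
          using gap_event_gap[where S = S and xs = xs, OF c20 u _ _ ys gdG vS] xd by simp_all
        from gg(2) obtain v' where v': "v' \<in> C" "enorm m (res \<xi> G n (sx v')) \<le> c2 (enorm m \<xi>)" by blast
        have "(enorm m (res \<xi> G n (sx v')))\<^sup>2 + real m * (\<tau> * r\<^sup>2) \<le> (c2 (enorm m \<xi>))\<^sup>2 + 2 * c2 (enorm m \<xi>) * (sqrt (real m) * (\<rho> * r\<^sup>2))"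
        proof (rule add_mono)
          show "(enorm m (res \<xi> G n (sx v')))\<^sup>2 \<le> (c2 (enorm m \<xi>))\<^sup>2" using v'(2) by (intro power_mono) auto
          have "real m * (\<tau> * r\<^sup>2) = 2 * (sqrt (real m) * x) * (sqrt (real m) * (\<rho> * r\<^sup>2))" by (simp add: \<tau>_def)
          also have "\<dots> \<le> 2 * c2 (enorm m \<xi>) * (sqrt (real m) * (\<rho> * r\<^sup>2))"
            using c2g ex by (intro mult_right_mono mult_left_mono) auto
          finally show "real m * (\<tau> * r\<^sup>2) \<le> 2 * c2 (enorm m \<xi>) * (sqrt (real m) * (\<rho> * r\<^sup>2))" .
        qed
        also have "\<dots> \<le> (c1 (enorm m \<xi>))\<^sup>2" unfolding c1e power2_sum by simp
        also have "\<dots> \<le> (enorm m (res \<xi> G n (sx v)))\<^sup>2"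
          using gg(1) c20 ex c1e by (intro power_mono) auto
        finally have "((enorm m (res \<xi> G n (sx v')))\<^sup>2 + real m * (\<tau> * r\<^sup>2)) / real m \<le> (enorm m (res \<xi> G n (sx v)))\<^sup>2 / real m"
          by (rule divide_right_mono) simp
        then have "(enorm m (res \<xi> G n (sx v')))\<^sup>2 / real m + \<tau> * r\<^sup>2 \<le> (enorm m (res \<xi> G n (sx v)))\<^sup>2 / real m"
          using m by (simp add: add_divide_distrib)
        then show ?thesis using v'(1) by (rule bexI)
      qed
      show ?thesis using A B by simp
    qed
    show "gap_certificate n m C \<sigma> \<eta> p r (\<epsilon> * r + Cc / sqrt (real m)) (\<tau> * r\<^sup>2)"
      unfolding gap_certificate_def sx_def[symmetric]
      by (rule exI[of _ u], rule exI[of _ "\<lambda>i. sx (xs i)"], rule exI[of _ "\<lambda>i. sx (ys i)"], rule exI[of _ "S \<noteq> {}"],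
          rule exI[of _ c1], rule exI[of _ c2], rule conjI[OF mc(1) conjI[OF mc(2)]], intro allI impI, rule main)
  qed
qed

section \<open>The linear model\<close>

lemma truncated_second_moment:
  assumes P: "noise_law P \<sigma>" and t: "t > 0"
  shows "\<exists>B>0. \<sigma>\<^sup>2 - t \<le> (\<integral>x. min (x\<^sup>2) B \<partial>P)"
proof -
  interpret real_distribution P using P by (simp add: noise_law_def)
  have int: "integrable P (\<lambda>x. x\<^sup>2)" "(\<integral>x. x\<^sup>2 \<partial>P) = \<sigma>\<^sup>2" using P by (auto simp: noise_law_def)
  have "(\<lambda>k. \<integral>x. min (x\<^sup>2) (real (Suc k)) \<partial>P) \<longlonglongrightarrow> (\<integral>x. x\<^sup>2 \<partial>P)"
  proof (rule integral_dominated_convergence[where w = "\<lambda>x. x\<^sup>2"])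
    show "AE x in P. (\<lambda>k. min (x\<^sup>2) (real (Suc k))) \<longlonglongrightarrow> x\<^sup>2"
    proof (rule AE_I2, rule tendsto_eventually)
      fix x :: real
      have "\<forall>\<^sub>F k in sequentially. x\<^sup>2 \<le> real k"
        using eventually_ge_at_top[of "nat \<lceil>x\<^sup>2\<rceil>"] by eventually_elim (simp add: nat_ceiling_le_eq)
      then show "\<forall>\<^sub>F k in sequentially. min (x\<^sup>2) (real (Suc k)) = x\<^sup>2" by eventually_elim simp
    qed
  qed (use int in auto)
  then have "\<forall>\<^sub>F k in sequentially. \<sigma>\<^sup>2 - t < (\<integral>x. min (x\<^sup>2) (real (Suc k)) \<partial>P)"
    unfolding int(2) by (rule order_tendstoD) (use t in simp)
  then obtain k where "\<sigma>\<^sup>2 - t < (\<integral>x. min (x\<^sup>2) (real (Suc k)) \<partial>P)" by (auto simp: eventually_sequentially)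
  then show ?thesis by (intro exI[of _ "real (Suc k)"]) auto
qed

text \<open>Truncation at \<open>B\<close> reduces the claim to Hoeffding's inequality and Markov's inequality for the tail.\<close>

lemma noise_weak_law:
  assumes P: "noise_law P \<sigma>" and \<eta>: "\<eta> > 0" and p: "p > 0"
  shows "\<exists>m0. \<forall>M m n X \<xi>. linear_model (M :: 'w measure) m n X \<xi> P \<longrightarrow> m0 \<le> real m \<longrightarrow>
    measure M {\<omega> \<in> space M. \<eta> < \<bar>(enorm m (\<xi> \<omega>))\<^sup>2 / real m - \<sigma>\<^sup>2\<bar>} \<le> p"
proof -
  interpret P: real_distribution P using P by (simp add: noise_law_def)
  have int: "integrable P (\<lambda>x. x\<^sup>2)" "(\<integral>x. x\<^sup>2 \<partial>P) = \<sigma>\<^sup>2" using P by (auto simp: noise_law_def)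
  \<comment> \<open>The first bound limits the bias of the truncation to \<open>\<eta> / 4\<close>;
    the second makes Markov's inequality for the tail at level \<open>\<eta> / 4\<close> yield
    \<open>p / 2\<close>.\<close>
  define t where "t = min (\<eta> / 4) (p * \<eta> / 8)"
  have t: "t > 0" "t \<le> \<eta> / 4" "t \<le> p * \<eta> / 8" using \<eta> p by (auto simp: t_def)
  obtain B where B: "B > 0" "\<sigma>\<^sup>2 - t \<le> (\<integral>x. min (x\<^sup>2) B \<partial>P)" using truncated_second_moment[OF P t(1)] by blast
  have intB: "integrable P (\<lambda>x. min (x\<^sup>2) B)" by (intro integrable_min int) simp
  have tail: "integrable P (\<lambda>x. x\<^sup>2 - min (x\<^sup>2) B)" "(\<integral>x. x\<^sup>2 - min (x\<^sup>2) B \<partial>P) \<le> t"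
    using B(2) int intB by auto
  have le\<sigma>: "(\<integral>x. min (x\<^sup>2) B \<partial>P) \<le> \<sigma>\<^sup>2" unfolding int(2)[symmetric] by (rule integral_mono[OF intB int(1)]) simp
  have "((\<lambda>m. 2 * exp (- 2 * real m * (\<eta> / 4)\<^sup>2 / B\<^sup>2)) \<longlongrightarrow> 0) sequentially"
    using \<eta> B by real_asymp
  then have "\<forall>\<^sub>F m in sequentially. 2 * exp (- 2 * real m * (\<eta> / 4)\<^sup>2 / B\<^sup>2) < p / 2"
    by (rule order_tendstoD) (use p in simp)
  then obtain m1 where m1: "2 * exp (- 2 * real m * (\<eta> / 4)\<^sup>2 / B\<^sup>2) < p / 2" if "m \<ge> m1" for m
    by (auto simp: eventually_sequentially)
  show ?thesis
  proof (intro exI[of _ "real (m1 + 1)"] allI impI)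
    fix M :: "'w measure" and m n X \<xi> assume lm: "linear_model M m n X \<xi> P" and m0: "real (m1 + 1) \<le> real m"
    interpret prob_space M using lm by (simp add: linear_model_def)
    have m: "m \<ge> m1" "m > 0" using m0 by auto
    have rv: "(\<lambda>\<omega>. \<xi> \<omega> i) \<in> borel_measurable M" and law: "distr M borel (\<lambda>\<omega>. \<xi> \<omega> i) = P" if "i < m" for i
      using lm that by (auto simp: linear_model_def)
    have ind: "indep_vars (\<lambda>_. borel) (\<lambda>i \<omega>. \<xi> \<omega> i) {..<m}" using lm by (simp add: linear_model_def)
    have ind2: "indep_vars (\<lambda>_. borel) (\<lambda>i \<omega>. min ((\<xi> \<omega> i)\<^sup>2) B) {..<m}"
      by (rule indep_vars_compose2[OF ind]) measurable
    have tr: "integrable M (\<lambda>\<omega>. g (\<xi> \<omega> i))" "expectation (\<lambda>\<omega>. g (\<xi> \<omega> i)) = (\<integral>x. g x \<partial>P)"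
      if i: "i < m" and g: "integrable P g" for i and g :: "real \<Rightarrow> real"
      using integrable_distr_eq[OF rv[OF i], of g] integral_distr[OF rv[OF i], of g] g unfolding law[OF i]
      by (auto dest: borel_measurable_integrable simp: P.M_is_borel)
    define U where "U \<omega> = (\<Sum>i<m. (\<xi> \<omega> i)\<^sup>2 - min ((\<xi> \<omega> i)\<^sup>2) B) / real m" for \<omega>
    define V where "V \<omega> = (\<Sum>i<m. min ((\<xi> \<omega> i)\<^sup>2) B) / real m" for \<omega>
    have rvU: "U \<in> borel_measurable M" "V \<in> borel_measurable M"
      unfolding U_def[abs_def] V_def[abs_def]
      by (intro borel_measurable_divide borel_measurable_sum borel_measurable_diff borel_measurable_min borel_measurable_power
        borel_measurable_const rv; simp)+
    have ev: "{\<omega> \<in> space M. \<eta> / 4 \<le> U \<omega>} \<in> events" "{\<omega> \<in> space M. \<eta> / 4 \<le> \<bar>V \<omega> - c\<bar>} \<in> events" for c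
      using rvU by measurable
    have EU: "expectation U \<le> t" "integrable M U"
    proof -
      have "expectation U = (\<Sum>i<m. (\<integral>x. x\<^sup>2 - min (x\<^sup>2) B \<partial>P)) / real m"
        unfolding U_def using tr[OF _ tail(1)] by (simp add: Bochner_Integration.integral_sum)
      then show "expectation U \<le> t" using tail(2) m by simp
      show "integrable M U" unfolding U_def[abs_def] using tr(1)[OF _ tail(1)]
        by (intro integrable_divide Bochner_Integration.integrable_sum) auto
    qed
    have U0: "U \<omega> \<ge> 0" for \<omega> unfolding U_def by (intro divide_nonneg_nonneg sum_nonneg) auto
    have PU: "prob {\<omega> \<in> space M. \<eta> / 4 \<le> U \<omega>} \<le> p / 2"
    proof -
      have "prob {\<omega> \<in> space M. \<eta> / 4 \<le> U \<omega>} \<le> expectation U / (\<eta> / 4)"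
        by (rule integral_Markov_inequality_measure[OF EU(2), of "{}"]) (use U0 \<eta> in auto)
      also have "\<dots> \<le> (p * \<eta> / 8) / (\<eta> / 4)" using EU(1) t(3) \<eta> by (intro divide_right_mono) auto
      also have "\<dots> = p / 2" using \<eta> by simp
      finally show ?thesis .
    qed
    have PV: "prob {\<omega> \<in> space M. \<eta> / 4 \<le> \<bar>V \<omega> - (\<integral>x. min (x\<^sup>2) B \<partial>P)\<bar>} \<le> p / 2"
    proof -
      have H: "Hoeffding_ineq_iid M {..<m} (\<lambda>i \<omega>. min ((\<xi> \<omega> i)\<^sup>2) B) (\<lambda>\<omega>. min ((\<xi> \<omega> 0)\<^sup>2) B) 0 B"
      proof (unfold_locales)
        show "indep_vars (\<lambda>_. borel) (\<lambda>i \<omega>. min ((\<xi> \<omega> i)\<^sup>2) B) {..<m}" by (rule ind2)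
        fix i assume i: "i \<in> {..<m}"
        have e: "distr M borel (\<lambda>\<omega>. min ((\<xi> \<omega> j)\<^sup>2) B) = distr P borel (\<lambda>x. min (x\<^sup>2) B)" if "j < m" for j
          unfolding law[OF that, symmetric] using rv[OF that] by (subst distr_distr) (auto simp: comp_def)
        show "distr M borel (\<lambda>\<omega>. min ((\<xi> \<omega> i)\<^sup>2) B) = distr M borel (\<lambda>\<omega>. min ((\<xi> \<omega> 0)\<^sup>2) B)"
          using e[of i] e[of 0] i m by simp
      next
        show "random_variable borel (\<lambda>\<omega>. min ((\<xi> \<omega> 0)\<^sup>2) B)" using rv[of 0] m by simp
      next
        show "AE \<omega> in M. min ((\<xi> \<omega> 0)\<^sup>2) B \<in> {0..B}" using B by simp
      qed simp_all
      have "prob {\<omega> \<in> space M. \<eta> / 4 \<le> \<bar>V \<omega> - expectation (\<lambda>\<omega>. min ((\<xi> \<omega> 0)\<^sup>2) B)\<bar>} \<le> 2 * exp (- 2 * real m * (\<eta> / 4)\<^sup>2 / B\<^sup>2)"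
      proof -
        have ne: "{..<m} \<noteq> {}" using m by auto
        show ?thesis using Hoeffding_ineq_iid.Hoeffding_ineq_abs_ge'[OF H _ B(1) ne, of "\<eta> / 4"] \<eta> unfolding V_def by simp
      qed
      then show ?thesis using m1[OF m(1)] tr(2)[OF m(2) intB] by simp
    qed
    have dec: "(enorm m (\<xi> \<omega>))\<^sup>2 / real m = U \<omega> + V \<omega>" for \<omega>
      unfolding U_def V_def enorm_sq ip_def
      by (simp add: add_divide_distrib[symmetric] sum.distrib[symmetric] power2_eq_square)
    have "prob {\<omega> \<in> space M. \<eta> < \<bar>(enorm m (\<xi> \<omega>))\<^sup>2 / real m - \<sigma>\<^sup>2\<bar>}
      \<le> prob ({\<omega> \<in> space M. \<eta> / 4 \<le> U \<omega>} \<union> {\<omega> \<in> space M. \<eta> / 4 \<le> \<bar>V \<omega> - (\<integral>x. min (x\<^sup>2) B \<partial>P)\<bar>})"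
    proof (rule finite_measure_mono)
      show "{\<omega> \<in> space M. \<eta> < \<bar>(enorm m (\<xi> \<omega>))\<^sup>2 / real m - \<sigma>\<^sup>2\<bar>}
        \<subseteq> {\<omega> \<in> space M. \<eta> / 4 \<le> U \<omega>} \<union> {\<omega> \<in> space M. \<eta> / 4 \<le> \<bar>V \<omega> - (\<integral>x. min (x\<^sup>2) B \<partial>P)\<bar>}"
      proof
        fix \<omega> assume "\<omega> \<in> {\<omega> \<in> space M. \<eta> < \<bar>(enorm m (\<xi> \<omega>))\<^sup>2 / real m - \<sigma>\<^sup>2\<bar>}"
        then have "\<omega> \<in> space M" "\<eta> < \<bar>U \<omega> + V \<omega> - \<sigma>\<^sup>2\<bar>" by (auto simp: dec)
        then show "\<omega> \<in> {\<omega> \<in> space M. \<eta> / 4 \<le> U \<omega>} \<union> {\<omega> \<in> space M. \<eta> / 4 \<le> \<bar>V \<omega> - (\<integral>x. min (x\<^sup>2) B \<partial>P)\<bar>}"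
        proof (cases "\<eta> / 4 \<le> U \<omega>")
          case False
          define c where "c = (\<integral>x. min (x\<^sup>2) B \<partial>P)"
          have "\<eta> / 4 \<le> \<bar>V \<omega> - c\<bar>" using False \<open>\<eta> < \<bar>U \<omega> + V \<omega> - \<sigma>\<^sup>2\<bar>\<close> U0[of \<omega>] B(2) le\<sigma> t(2) \<eta>
            unfolding c_def[symmetric] by linarith
          then show ?thesis using \<open>\<omega> \<in> space M\<close> unfolding c_def by simp
        qed simp
      qed
      show "{\<omega> \<in> space M. \<eta> / 4 \<le> U \<omega>} \<union> {\<omega> \<in> space M. \<eta> / 4 \<le> \<bar>V \<omega> - (\<integral>x. min (x\<^sup>2) B \<partial>P)\<bar>} \<in> events"
        by (intro sets.Un ev)
    qed
    also have "\<dots> \<le> prob {\<omega> \<in> space M. \<eta> / 4 \<le> U \<omega>} + prob {\<omega> \<in> space M. \<eta> / 4 \<le> \<bar>V \<omega> - (\<integral>x. min (x\<^sup>2) B \<partial>P)\<bar>}"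
      by (intro measure_Un_le ev)
    finally show "prob {\<omega> \<in> space M. \<eta> < \<bar>(enorm m (\<xi> \<omega>))\<^sup>2 / real m - \<sigma>\<^sup>2\<bar>} \<le> p" using PU PV by linarith
  qed
qed

section \<open>Joint law of design and noise\<close>

lemma design_law:
  assumes lm: "linear_model M m n X \<xi> P" and m: "m > 0" and n: "n > 0"
  defines "G \<equiv> \<lambda>\<omega>. \<lambda>k\<in>{..<m} \<times> {..<n}. sqrt (real n) * X \<omega> (fst k) (snd k)"
    and "\<Xi> \<equiv> \<lambda>\<omega>. \<lambda>i\<in>{..<m}. \<xi> \<omega> i"
  shows "distr M (\<Pi>\<^sub>M _\<in>{..<m} \<times> {..<n}. borel) G = gauss ({..<m} \<times> {..<n})"
    and "distr M (\<Pi>\<^sub>M _\<in>{..<m} \<times> {..<n}. borel) G \<Otimes>\<^sub>M distr M (\<Pi>\<^sub>M _\<in>{..<m}. borel) \<Xi>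
      = distr M ((\<Pi>\<^sub>M _\<in>{..<m} \<times> {..<n}. borel) \<Otimes>\<^sub>M (\<Pi>\<^sub>M _\<in>{..<m}. borel)) (\<lambda>\<omega>. (G \<omega>, \<Xi> \<omega>))"
    and "G \<in> M \<rightarrow>\<^sub>M (\<Pi>\<^sub>M _\<in>{..<m} \<times> {..<n}. borel)" "\<Xi> \<in> M \<rightarrow>\<^sub>M (\<Pi>\<^sub>M _\<in>{..<m}. borel)"
proof -
  interpret prob_space M using lm by (simp add: linear_model_def)
  let ?I = "{..<m} \<times> {..<n}"
  have sn: "sqrt (real n) > 0" using n by simp
  have d: "distributed M lborel (\<lambda>\<omega>. X \<omega> i j) (normal_density 0 (1 / sqrt (real n)))" if "i < m" "j < n" for i j
    using lm that by (simp add: linear_model_def)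
  have iv: "indep_vars (\<lambda>_. borel) (\<lambda>k \<omega>. X \<omega> (fst k) (snd k)) ?I"
    using lm by (simp add: linear_model_def case_prod_unfold)
  have iv2: "indep_vars (\<lambda>_. borel) (\<lambda>k \<omega>. sqrt (real n) * X \<omega> (fst k) (snd k)) ?I"
    by (rule indep_vars_compose2[OF iv]) measurable
  have ne: "?I \<noteq> {}" using m n by auto
  have rvX: "(\<lambda>\<omega>. X \<omega> (fst k) (snd k)) \<in> borel_measurable M" if "k \<in> ?I" for k
    using iv that by (auto simp: indep_vars_def)
  have dk: "distr M borel (\<lambda>\<omega>. sqrt (real n) * X \<omega> (fst k) (snd k)) = stdn" if k: "k \<in> ?I" for k
  proof -
    have "distributed M lborel (\<lambda>\<omega>. 0 + sqrt (real n) * X \<omega> (fst k) (snd k))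
      (normal_density (0 + sqrt (real n) * 0) (\<bar>sqrt (real n)\<bar> * (1 / sqrt (real n))))"
      by (rule normal_density_affine) (use d k sn in auto)
    then have "distributed M lborel (\<lambda>\<omega>. sqrt (real n) * X \<omega> (fst k) (snd k)) std_normal_density"
      using sn by simp
    then have "distr M lborel (\<lambda>\<omega>. sqrt (real n) * X \<omega> (fst k) (snd k)) = stdn"
      by (simp add: distributed_def)
    moreover have "distr M borel (\<lambda>\<omega>. sqrt (real n) * X \<omega> (fst k) (snd k)) = distr M lborel (\<lambda>\<omega>. sqrt (real n) * X \<omega> (fst k) (snd k))"
      by (rule distr_cong) simp_all
    ultimately show ?thesis by simp
  qed
  have "distr M (\<Pi>\<^sub>M _\<in>?I. borel) G = (\<Pi>\<^sub>M k\<in>?I. distr M borel (\<lambda>\<omega>. sqrt (real n) * X \<omega> (fst k) (snd k)))"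
    unfolding G_def using iv2 rvX by (subst indep_vars_iff_distr_eq_PiM'[OF ne, symmetric]) auto
  also have "\<dots> = gauss ?I" unfolding gauss_def by (rule PiM_cong) (use dk in auto)
  finally show "distr M (\<Pi>\<^sub>M _\<in>?I. borel) G = gauss ?I" .
  let ?X = "\<lambda>\<omega>. \<lambda>k\<in>?I. X \<omega> (fst k) (snd k)"
  have mX: "?X \<in> M \<rightarrow>\<^sub>M (\<Pi>\<^sub>M _\<in>?I. borel)" using rvX by (intro measurable_restrict) auto
  have m\<Xi>: "\<Xi> \<in> M \<rightarrow>\<^sub>M (\<Pi>\<^sub>M _\<in>{..<m}. borel)"
    unfolding \<Xi>_def using lm by (intro measurable_restrict) (auto simp: linear_model_def)
  have iset: "indep_set (sets (vimage_algebra (space M) ?X (\<Pi>\<^sub>M _\<in>?I. borel)))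
     (sets (vimage_algebra (space M) \<Xi> (\<Pi>\<^sub>M _\<in>{..<m}. borel)))"
    using lm unfolding linear_model_def \<Xi>_def case_prod_unfold by simp
  let ?s = "\<lambda>z. \<lambda>k\<in>?I. sqrt (real n) * z k"
  have ms: "?s \<in> (\<Pi>\<^sub>M _\<in>?I. borel) \<rightarrow>\<^sub>M (\<Pi>\<^sub>M _\<in>?I. borel)" by (intro measurable_restrict) measurable
  \<comment> \<open>Independence is assumed for \<open>X\<close>; since \<open>G\<close> is a
    measurable function of it, preimages under \<open>G\<close> are preimages under
    \<open>X\<close>.\<close>
  have G: "G \<omega> = ?s (?X \<omega>)" for \<omega> unfolding G_def by (auto simp: fun_eq_iff restrict_def)
  have mG: "G \<in> M \<rightarrow>\<^sub>M (\<Pi>\<^sub>M _\<in>?I. borel)" unfolding G by (rule measurable_compose[OF mX ms])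
  show "G \<in> M \<rightarrow>\<^sub>M (\<Pi>\<^sub>M _\<in>?I. borel)" "\<Xi> \<in> M \<rightarrow>\<^sub>M (\<Pi>\<^sub>M _\<in>{..<m}. borel)" by (rule mG, rule m\<Xi>)
  let ?BI = "\<Pi>\<^sub>M _\<in>{..<m} \<times> {..<n}. (borel :: real measure)" and ?Bm = "\<Pi>\<^sub>M _\<in>{..<m}. (borel :: real measure)"
  interpret D1: prob_space "distr M ?BI G" by (rule prob_space_distr[OF mG])
  interpret D2: prob_space "distr M ?Bm \<Xi>" by (rule prob_space_distr[OF m\<Xi>])
  have mp: "(\<lambda>x. (G x, \<Xi> x)) \<in> M \<rightarrow>\<^sub>M ?BI \<Otimes>\<^sub>M ?Bm" using mG m\<Xi> by (rule measurable_Pair)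
  show "distr M ?BI G \<Otimes>\<^sub>M distr M ?Bm \<Xi> = distr M (?BI \<Otimes>\<^sub>M ?Bm) (\<lambda>\<omega>. (G \<omega>, \<Xi> \<omega>))"
  proof (rule pair_measure_eqI)
    fix A B assume "A \<in> sets (distr M ?BI G)" "B \<in> sets (distr M ?Bm \<Xi>)"
    then have A: "A \<in> sets ?BI" and B: "B \<in> sets ?Bm" by simp_all
    have "G -` A \<inter> space M = ?X -` (?s -` A \<inter> space ?BI) \<inter> space M"
      using measurable_space[OF mX] by (auto simp: G)
    moreover have "?s -` A \<inter> space ?BI \<in> sets ?BI" by (rule measurable_sets[OF ms A])
    ultimately have "G -` A \<inter> space M \<in> sets (vimage_algebra (space M) ?X ?BI)"
      by (simp only: in_vimage_algebra)
    moreover have "\<Xi> -` B \<inter> space M \<in> sets (vimage_algebra (space M) \<Xi> ?Bm)" by (rule in_vimage_algebra[OF B])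
    ultimately have "prob ((G -` A \<inter> space M) \<inter> (\<Xi> -` B \<inter> space M)) = prob (G -` A \<inter> space M) * prob (\<Xi> -` B \<inter> space M)"
      using iset unfolding indep_sets2_eq by blast
    moreover have "(\<lambda>\<omega>. (G \<omega>, \<Xi> \<omega>)) -` (A \<times> B) \<inter> space M = (G -` A \<inter> space M) \<inter> (\<Xi> -` B \<inter> space M)" by auto
    ultimately show "emeasure (distr M ?BI G) A * emeasure (distr M ?Bm \<Xi>) B = emeasure (distr M (?BI \<Otimes>\<^sub>M ?Bm) (\<lambda>\<omega>. (G \<omega>, \<Xi> \<omega>))) (A \<times> B)"
      using A B mG m\<Xi> mp by (simp add: emeasure_distr emeasure_eq_measure ennreal_mult)
  qed (simp_all add: D1.sigma_finite_measure_axioms D2.sigma_finite_measure_axioms)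
qed

text \<open>Fubini's theorem for the product law of design and noise: a bound valid for each frozen
  noise vector in \<open>A\<close> is integrated over the noise. The sections of \<open>S\<close>
  may vary with the noise, and so may the thresholds of the comparison.\<close>

lemma conditional_event_bound:
  assumes lm: "linear_model M m n X \<xi> P" and m: "m > 0" and n: "n > 0" and p: "p \<le> 1"
  defines "G \<equiv> \<lambda>\<omega>. \<lambda>k\<in>{..<m} \<times> {..<n}. sqrt (real n) * X \<omega> (fst k) (snd k)"
    and "\<Xi> \<equiv> \<lambda>\<omega>. \<lambda>i\<in>{..<m}. \<xi> \<omega> i"
  assumes S: "S \<in> sets ((\<Pi>\<^sub>M _\<in>{..<m} \<times> {..<n}. borel) \<Otimes>\<^sub>M (\<Pi>\<^sub>M _\<in>{..<m}. borel))"
    and A: "A \<in> sets (\<Pi>\<^sub>M _\<in>{..<m}. borel)"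
    and ge: "\<And>y. y \<in> A \<Longrightarrow> 1 - p \<le> measure (gauss ({..<m} \<times> {..<n})) {z \<in> space (gauss ({..<m} \<times> {..<n})). (z, y) \<in> S}"
  shows "(1 - p) * measure M {\<omega> \<in> space M. \<Xi> \<omega> \<in> A} \<le> measure M {\<omega> \<in> space M. (G \<omega>, \<Xi> \<omega>) \<in> S}"
proof -
  interpret prob_space M using lm by (simp add: linear_model_def)
  let ?I = "{..<m} \<times> {..<n}" and ?BI = "\<Pi>\<^sub>M _\<in>{..<m} \<times> {..<n}. (borel :: real measure)" and ?Bm = "\<Pi>\<^sub>M _\<in>{..<m}. (borel :: real measure)"
  note dl = design_law[OF lm m n, folded G_def \<Xi>_def]
  note iv = dl(3,4)
  have prod: "distr M ?BI G \<Otimes>\<^sub>M distr M ?Bm \<Xi> = distr M (?BI \<Otimes>\<^sub>M ?Bm) (\<lambda>\<omega>. (G \<omega>, \<Xi> \<omega>))"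
    using dl(2) unfolding G_def \<Xi>_def .
  interpret D1: prob_space "distr M ?BI G" by (rule prob_space_distr[OF iv(1)])
  interpret D2: prob_space "distr M ?Bm \<Xi>" by (rule prob_space_distr[OF iv(2)])
  interpret D: pair_prob_space "distr M ?BI G" "distr M ?Bm \<Xi>" ..
  interpret gp: prob_space "gauss ?I" by (rule prob_space_gauss)
  have mp: "(\<lambda>x. (G x, \<Xi> x)) \<in> M \<rightarrow>\<^sub>M ?BI \<Otimes>\<^sub>M ?Bm" using iv by (rule measurable_Pair)
  have "ennreal ((1 - p) * prob {\<omega> \<in> space M. \<Xi> \<omega> \<in> A}) = ennreal (1 - p) * emeasure (distr M ?Bm \<Xi>) A"
  proof -
    have "{\<omega> \<in> space M. \<Xi> \<omega> \<in> A} = \<Xi> -` A \<inter> space M" by auto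
    then have "emeasure (distr M ?Bm \<Xi>) A = ennreal (prob {\<omega> \<in> space M. \<Xi> \<omega> \<in> A})"
      by (simp only: emeasure_distr[OF iv(2) A] emeasure_eq_measure)
    then show ?thesis using p by (simp only: ennreal_mult' measure_nonneg diff_ge_0_iff_ge)
  qed
  also have "\<dots> = (\<integral>\<^sup>+y. ennreal (1 - p) * indicator A y \<partial>distr M ?Bm \<Xi>)"
    using A by (simp add: nn_integral_cmult_indicator)
  also have "\<dots> \<le> (\<integral>\<^sup>+y. emeasure (distr M ?BI G) ((\<lambda>x. (x, y)) -` S) \<partial>distr M ?Bm \<Xi>)"
  proof (rule nn_integral_mono)
    fix y
    show "ennreal (1 - p) * indicator A y \<le> emeasure (distr M ?BI G) ((\<lambda>x. (x, y)) -` S)"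
    proof (cases "y \<in> A")
      case True
      have "(\<lambda>x. (x, y)) -` S = {z \<in> space (gauss ?I). (z, y) \<in> S}"
        using sets.sets_into_space[OF S] by (auto simp: space_pair_measure space_gauss space_PiM)
      then show ?thesis using ge[OF True] True unfolding dl(1) by (simp add: gp.emeasure_eq_measure ennreal_leI)
    qed simp
  qed
  also have "\<dots> = emeasure (distr M ?BI G \<Otimes>\<^sub>M distr M ?Bm \<Xi>) S"
    by (rule D.emeasure_pair_measure_alt2[symmetric]) (use S in simp)
  also have "\<dots> = emeasure M {\<omega> \<in> space M. (G \<omega>, \<Xi> \<omega>) \<in> S}"
  proof -
    have "(\<lambda>x. (G x, \<Xi> x)) -` S \<inter> space M = {\<omega> \<in> space M. (G \<omega>, \<Xi> \<omega>) \<in> S}" by auto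
    then show ?thesis unfolding prod emeasure_distr[OF mp S] by (rule arg_cong)
  qed
  also have "\<dots> = ennreal (prob {\<omega> \<in> space M. (G \<omega>, \<Xi> \<omega>) \<in> S})" by (rule emeasure_eq_measure)
  finally show ?thesis by simp
qed

section \<open>Deviation of near minimizers in one instance\<close>

lemma fixed_point_radius_props:
  assumes f: "closed_convex_fun n f" and \<mu>: "\<mu> \<in> Rn n" and n: "n > 0" and \<sigma>: "\<sigma> > 0"
    and m: "stat_dim n (tangent_cone n (level_set n f \<mu>) \<mu>) < real m"
  defines "K \<equiv> level_set n f \<mu>"
  defines "\<delta> \<equiv> stat_dim n (tangent_cone n K \<mu>)" and "r \<equiv> fixed_point_radius n m \<sigma> K \<mu>" and "C \<equiv> shift_set K \<mu>"
  shows "0 \<le> r" "Esq n C (omega \<sigma> (real m / real n) r) / real n = r\<^sup>2"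
    "r\<^sup>2 \<le> \<sigma>\<^sup>2 * (\<delta> / (real m - \<delta>))" "closed_convex_cone n C \<Longrightarrow> r\<^sup>2 = \<sigma>\<^sup>2 * (\<delta> / (real m - \<delta>))"
proof -
  have K: "cc_set n K" "\<mu> \<in> K" unfolding K_def by (rule level_set_cc[OF f \<mu>])+
  note tc = tangent_cone_props[OF K, folded C_def]
  have \<delta>: "\<delta> = (\<integral>h. (enorm n (metric_proj n (tangent_cone n K \<mu>) h))\<^sup>2 \<partial>gauss {..<n})"
    unfolding \<delta>_def stat_dim_def std_gaussian_eq ..
  have \<delta>m: "\<delta> < real m" using m unfolding \<delta>_def K_def .
  have e: "err n K \<mu> \<tau> h = (enorm n (pj n C \<tau> h))\<^sup>2" for \<tau> h
    unfolding err_def pj_def C_def using metric_proj_shift[OF _ \<mu> K(1)] cc_set0D(1)[OF tc(1)] unfolding C_def by simp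
  have r: "r = (THE r. 0 \<le> r \<and> Esq n C (omega \<sigma> (real m / real n) r) / real n = r\<^sup>2)"
    unfolding r_def fixed_point_radius_def e std_gaussian_eq Esq_def ..
  note fu = fixed_point_exists_unique[OF tc(1-4) \<delta> \<delta>m n \<sigma>]
  have rr: "0 \<le> r \<and> Esq n C (omega \<sigma> (real m / real n) r) / real n = r\<^sup>2" unfolding r by (rule theI'[OF fu(1)])
  then show "0 \<le> r" "Esq n C (omega \<sigma> (real m / real n) r) / real n = r\<^sup>2" by auto
  show "r\<^sup>2 \<le> \<sigma>\<^sup>2 * (\<delta> / (real m - \<delta>))" by (rule fu(2)[OF rr])
  show "r\<^sup>2 = \<sigma>\<^sup>2 * (\<delta> / (real m - \<delta>))" if "closed_convex_cone n C" by (rule fu(3)[OF tc(5)[OF that] rr])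
qed

lemma loss_eq_res:
  assumes n: "n > 0" and Y: "\<And>i. Y i = mat_vec n X \<mu> i + \<xi> i"
  shows "loss m n X Y \<nu> = (enorm m (res (\<lambda>i\<in>{..<m}. \<xi> i) (\<lambda>k\<in>{..<m} \<times> {..<n}. sqrt (real n) * X (fst k) (snd k)) n
    (\<lambda>i. 1 / sqrt (real n) * (\<nu> i - \<mu> i))))\<^sup>2 / real m"
proof -
  have "Y a - mat_vec n X \<nu> a = res (\<lambda>i\<in>{..<m}. \<xi> i) (\<lambda>k\<in>{..<m} \<times> {..<n}. sqrt (real n) * X (fst k) (snd k)) n
    (\<lambda>i. 1 / sqrt (real n) * (\<nu> i - \<mu> i)) a" if a: "a < m" for a
  proof -
    have "ip n (\<lambda>b. (\<lambda>k\<in>{..<m} \<times> {..<n}. sqrt (real n) * X (fst k) (snd k)) (a, b)) (\<lambda>i. 1 / sqrt (real n) * (\<nu> i - \<mu> i))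
      = (\<Sum>j<n. X a j * \<nu> j - X a j * \<mu> j)"
      unfolding ip_def using a n by (intro sum.cong) (auto simp: right_diff_distrib)
    then show ?thesis using a by (simp add: res_def Y mat_vec_def sum_subtractf)
  qed
  then have "enorm m (\<lambda>i. Y i - mat_vec n X \<nu> i) = enorm m (res (\<lambda>i\<in>{..<m}. \<xi> i) (\<lambda>k\<in>{..<m} \<times> {..<n}. sqrt (real n) * X (fst k) (snd k)) n
    (\<lambda>i. 1 / sqrt (real n) * (\<nu> i - \<mu> i)))" by (rule enorm_cong)
  then show ?thesis by (simp only: loss_def)
qed

text \<open>A near minimizer out of range would exceed the infimum by
  \<open>\<tau> * r\<^sup>2\<close>, whereas the optimization error is at most half of that outside
  an event of probability \<open>p3\<close>. Failure of the certificate and atypical noise account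
  for \<open>p1\<close> and \<open>p2\<close>.\<close>

lemma instance_deviation:
  assumes lm: "linear_model M m n X \<xi> P" and m: "m > 0" and n: "n > 0" and r: "r > 0" and \<tau>: "\<tau> > 0"
    and p: "0 \<le> p1" "p1 \<le> 1" "0 \<le> p2"
    and cert: "gap_certificate n m (shift_set K \<mu>) \<sigma> \<eta> p1 r t (\<tau> * r\<^sup>2)"
    and noise: "measure M {\<omega> \<in> space M. \<eta> < \<bar>(enorm m (\<xi> \<omega>))\<^sup>2 / real m - \<sigma>\<^sup>2\<bar>} \<le> p2"
    and Y: "\<And>\<omega> i. Y \<omega> i = mat_vec n (X \<omega>) \<mu> i + \<xi> \<omega> i"
    and \<mu>h: "\<And>j. j < n \<Longrightarrow> (\<lambda>\<omega>. \<mu>h \<omega> j) \<in> borel_measurable M" "AE \<omega> in M. \<mu>h \<omega> \<in> K"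
    and near: "AE \<omega> in M. loss m n (X \<omega>) (Y \<omega>) (\<mu>h \<omega>) \<le> (INF \<nu>\<in>K. loss m n (X \<omega>) (Y \<omega>) \<nu>) + R \<omega>"
    and R: "R \<in> borel_measurable M" "measure M {\<omega> \<in> space M. \<bar>R \<omega>\<bar> > \<tau> / 2 * \<bar>r\<^sup>2\<bar>} \<le> p3"
  shows "measure M {\<omega> \<in> space M. t < \<bar>enorm n (\<lambda>i. \<mu>h \<omega> i - \<mu> i) / sqrt (real n) - r\<bar>} \<le> p1 + p2 + p3"
proof -
  obtain u x y b c1 c2 where c: "c1 \<in> borel_measurable borel" "c2 \<in> borel_measurable borel"
    and gap: "\<forall>\<xi>. \<bar>(enorm m \<xi>)\<^sup>2 / real m - \<sigma>\<^sup>2\<bar> \<le> \<eta> \<longrightarrow>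
        1 - p1 \<le> measure (gauss ({..<m} \<times> {..<n})) {G \<in> space (gauss ({..<m} \<times> {..<n})).
            gap_event m n u x y b (c1 (enorm m \<xi>)) (c2 (enorm m \<xi>)) G \<xi>} \<and>
        (\<forall>G. gap_event m n u x y b (c1 (enorm m \<xi>)) (c2 (enorm m \<xi>)) G \<xi> \<longrightarrow>
          (\<forall>v\<in>shift_set K \<mu>. t < \<bar>enorm n v / sqrt (real n) - r\<bar> \<longrightarrow>
            (\<exists>v'\<in>shift_set K \<mu>. (enorm m (res \<xi> G n (\<lambda>i. 1 / sqrt (real n) * v' i)))\<^sup>2 / real m + \<tau> * r\<^sup>2
               \<le> (enorm m (res \<xi> G n (\<lambda>i. 1 / sqrt (real n) * v i)))\<^sup>2 / real m)))"
    using cert unfolding gap_certificate_def by (elim exE conjE) (rule that)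
  interpret prob_space M using lm by (simp add: linear_model_def)
  let ?BI = "\<Pi>\<^sub>M _\<in>{..<m} \<times> {..<n}. (borel :: real measure)" and ?Bm = "\<Pi>\<^sub>M _\<in>{..<m}. (borel :: real measure)"
  define G where "G \<omega> = (\<lambda>k\<in>{..<m} \<times> {..<n}. sqrt (real n) * X \<omega> (fst k) (snd k))" for \<omega>
  define \<Xi> where "\<Xi> \<omega> = (\<lambda>i\<in>{..<m}. \<xi> \<omega> i)" for \<omega>
  have en: "enorm m (\<Xi> \<omega>) = enorm m (\<xi> \<omega>)" for \<omega> by (rule enorm_cong) (simp add: \<Xi>_def)
  define A where "A = {y \<in> space ?Bm. \<bar>(enorm m y)\<^sup>2 / real m - \<sigma>\<^sup>2\<bar> \<le> \<eta>}"
  have mem: "(\<lambda>y. enorm m y) \<in> borel_measurable ?Bm" by (rule measurable_enorm) (simp add: measurable_component_singleton)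
  have A: "A \<in> sets ?Bm" unfolding A_def using mem by measurable
  define g where "g z \<zeta> \<longleftrightarrow> gap_event m n u x y b (c1 (enorm m \<zeta>)) (c2 (enorm m \<zeta>)) z \<zeta>" for z \<zeta>
  define S where "S = {q \<in> space (?BI \<Otimes>\<^sub>M ?Bm). g (fst q) (snd q)} \<inter> (space ?BI \<times> A)"
  have mc: "(\<lambda>q. fst q k) \<in> borel_measurable (?BI \<Otimes>\<^sub>M ?Bm)" if "k \<in> {..<m} \<times> {..<n}" for k
    by (rule measurable_compose[OF measurable_fst measurable_component_singleton[OF that]])
  have md: "(\<lambda>q. snd q k) \<in> borel_measurable (?BI \<Otimes>\<^sub>M ?Bm)" if "k \<in> {..<m}" for k
    by (rule measurable_compose[OF measurable_snd measurable_component_singleton[OF that]])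
  have me: "(\<lambda>q. enorm m (snd q)) \<in> borel_measurable (?BI \<Otimes>\<^sub>M ?Bm)" by (rule measurable_enorm[OF md]) simp
  have S: "S \<in> sets (?BI \<Otimes>\<^sub>M ?Bm)" unfolding S_def g_def
  proof (rule sets.Int)
    show "{q \<in> space (?BI \<Otimes>\<^sub>M ?Bm). gap_event m n u x y b (c1 (enorm m (snd q))) (c2 (enorm m (snd q))) (fst q) (snd q)} \<in> sets (?BI \<Otimes>\<^sub>M ?Bm)"
    proof (rule measurable_gap_event)
      show "(\<lambda>q. fst q (a, b)) \<in> borel_measurable (?BI \<Otimes>\<^sub>M ?Bm)" if "a < m" "b < n" for a b using that by (intro mc) auto
      show "(\<lambda>q. snd q a) \<in> borel_measurable (?BI \<Otimes>\<^sub>M ?Bm)" if "a < m" for a using that by (intro md) auto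
      show "(\<lambda>q. c1 (enorm m (snd q))) \<in> borel_measurable (?BI \<Otimes>\<^sub>M ?Bm)" by (rule measurable_compose[OF me c(1)])
      show "(\<lambda>q. c2 (enorm m (snd q))) \<in> borel_measurable (?BI \<Otimes>\<^sub>M ?Bm)" by (rule measurable_compose[OF me c(2)])
    qed
    show "space ?BI \<times> A \<in> sets (?BI \<Otimes>\<^sub>M ?Bm)" using A by (intro pair_measureI) auto
  qed
  have ge: "1 - p1 \<le> measure (gauss ({..<m} \<times> {..<n})) {z \<in> space (gauss ({..<m} \<times> {..<n})). (z, \<zeta>) \<in> S}" if \<zeta>: "\<zeta> \<in> A" for \<zeta>
  proof -
    have "\<bar>(enorm m \<zeta>)\<^sup>2 / real m - \<sigma>\<^sup>2\<bar> \<le> \<eta>" using \<zeta> by (simp add: A_def)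
    then have "1 - p1 \<le> measure (gauss ({..<m} \<times> {..<n})) {z \<in> space (gauss ({..<m} \<times> {..<n})). g z \<zeta>}"
      using gap unfolding g_def by blast
    moreover have "{z \<in> space (gauss ({..<m} \<times> {..<n})). (z, \<zeta>) \<in> S} = {z \<in> space (gauss ({..<m} \<times> {..<n})). g z \<zeta>}"
      using \<zeta> by (auto simp: S_def space_pair_measure space_gauss space_PiM A_def)
    ultimately show ?thesis by simp
  qed
  have m\<xi>: "(\<lambda>\<omega>. enorm m (\<xi> \<omega>)) \<in> borel_measurable M"
    by (rule measurable_enorm) (use lm in \<open>simp add: linear_model_def\<close>)
  have evN: "{\<omega> \<in> space M. \<eta> < \<bar>(enorm m (\<xi> \<omega>))\<^sup>2 / real m - \<sigma>\<^sup>2\<bar>} \<in> events" using m\<xi> by measurable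
  have "1 - p2 \<le> prob {\<omega> \<in> space M. \<Xi> \<omega> \<in> A}"
  proof -
    have "{\<omega> \<in> space M. \<Xi> \<omega> \<in> A} = space M - {\<omega> \<in> space M. \<eta> < \<bar>(enorm m (\<xi> \<omega>))\<^sup>2 / real m - \<sigma>\<^sup>2\<bar>}"
      by (auto simp: A_def en) (simp add: \<Xi>_def space_PiM)
    then show ?thesis using prob_compl[OF evN] noise by simp
  qed
  then have "(1 - p1) * (1 - p2) \<le> (1 - p1) * prob {\<omega> \<in> space M. \<Xi> \<omega> \<in> A}" using p by (intro mult_left_mono) auto
  also have "\<dots> \<le> prob {\<omega> \<in> space M. (G \<omega>, \<Xi> \<omega>) \<in> S}"
    using conditional_event_bound[OF lm m n p(2) S A ge] unfolding G_def \<Xi>_def .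
  finally have PS: "1 - p1 - p2 \<le> prob {\<omega> \<in> space M. (G \<omega>, \<Xi> \<omega>) \<in> S}"
  proof -
    have "0 \<le> p1 * p2" using p by simp
    then show "(1 - p1) * (1 - p2) \<le> q \<Longrightarrow> 1 - p1 - p2 \<le> q" for q by (simp add: algebra_simps)
  qed
  have evS: "{\<omega> \<in> space M. (G \<omega>, \<Xi> \<omega>) \<in> S} \<in> events"
  proof -
    have "(\<lambda>\<omega>. (G \<omega>, \<Xi> \<omega>)) \<in> M \<rightarrow>\<^sub>M ?BI \<Otimes>\<^sub>M ?Bm"
      using design_law(3,4)[OF lm m n] unfolding G_def \<Xi>_def by (rule measurable_Pair)
    from measurable_sets[OF this S] show ?thesis by (simp add: vimage_def Int_def conj_commute)
  qed
  have evR: "{\<omega> \<in> space M. \<bar>R \<omega>\<bar> > \<tau> / 2 * \<bar>r\<^sup>2\<bar>} \<in> events" using R(1) by measurable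
  let ?B = "{\<omega> \<in> space M. t < \<bar>enorm n (\<lambda>i. \<mu>h \<omega> i - \<mu> i) / sqrt (real n) - r\<bar>}"
  let ?U = "(space M - {\<omega> \<in> space M. (G \<omega>, \<Xi> \<omega>) \<in> S}) \<union> {\<omega> \<in> space M. \<bar>R \<omega>\<bar> > \<tau> / 2 * \<bar>r\<^sup>2\<bar>}"
  have "prob ?B \<le> prob ?U"
  \<comment> \<open>Membership in \<open>K\<close> and near minimality hold only almost
    surely.\<close>
  proof (rule finite_measure_mono_AE)
    show "?U \<in> events" using evS evR by auto
    show "AE \<omega> in M. \<omega> \<in> ?B \<longrightarrow> \<omega> \<in> ?U"
      using \<mu>h(2) near
    proof eventually_elim
      case (elim \<omega>)
      show ?case
      proof (rule impI, rule ccontr)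
        assume B: "\<omega> \<in> ?B" and "\<omega> \<notin> ?U"
        then have SR: "(G \<omega>, \<Xi> \<omega>) \<in> S" "\<bar>R \<omega>\<bar> \<le> \<tau> / 2 * r\<^sup>2" by auto
        then have g: "g (G \<omega>) (\<Xi> \<omega>)" and a: "\<bar>(enorm m (\<Xi> \<omega>))\<^sup>2 / real m - \<sigma>\<^sup>2\<bar> \<le> \<eta>" by (auto simp: S_def A_def)
        have vC: "(\<lambda>i. \<mu>h \<omega> i - \<mu> i) \<in> shift_set K \<mu>" using elim(1) by (auto simp: shift_set_def)
        have tb: "t < \<bar>enorm n (\<lambda>i. \<mu>h \<omega> i - \<mu> i) / sqrt (real n) - r\<bar>" using B by simp
        have "\<exists>v'\<in>shift_set K \<mu>. (enorm m (res (\<Xi> \<omega>) (G \<omega>) n (\<lambda>i. 1 / sqrt (real n) * v' i)))\<^sup>2 / real m + \<tau> * r\<^sup>2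
               \<le> (enorm m (res (\<Xi> \<omega>) (G \<omega>) n (\<lambda>i. 1 / sqrt (real n) * (\<mu>h \<omega> i - \<mu> i))))\<^sup>2 / real m"
          using gap[rule_format, OF a] g vC tb unfolding g_def by blast
        then obtain \<nu> where \<nu>: "\<nu> \<in> K" and le: "loss m n (X \<omega>) (Y \<omega>) \<nu> + \<tau> * r\<^sup>2 \<le> loss m n (X \<omega>) (Y \<omega>) (\<mu>h \<omega>)"
          unfolding loss_eq_res[OF n Y] G_def \<Xi>_def shift_set_def by auto
        have "(INF \<nu>\<in>K. loss m n (X \<omega>) (Y \<omega>) \<nu>) \<le> loss m n (X \<omega>) (Y \<omega>) \<nu>"
          by (rule cINF_lower[OF _ \<nu>]) (auto intro!: bdd_belowI[of _ 0] simp: loss_def)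
        then have "\<tau> * r\<^sup>2 \<le> \<tau> / 2 * r\<^sup>2" using le elim(2) SR(2) by linarith
        moreover have "0 < \<tau> * r\<^sup>2" using \<tau> r by simp
        ultimately show False by simp
      qed
    qed
  qed
  also have "\<dots> \<le> prob (space M - {\<omega> \<in> space M. (G \<omega>, \<Xi> \<omega>) \<in> S}) + prob {\<omega> \<in> space M. \<bar>R \<omega>\<bar> > \<tau> / 2 * \<bar>r\<^sup>2\<bar>}"
    by (rule measure_Un_le) (use evS evR in auto)
  also have "\<dots> \<le> p1 + p2 + p3" using prob_compl[OF evS] PS R(2) by linarith
  finally show ?thesis .
qed

text \<open>Expanding \<open>\<bar>a - r\<bar> * (a + r)\<close> leaves terms in
  \<open>r\<^sup>2\<close> and \<open>d\<^sup>2\<close>, once the mixed term is split by the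
  arithmetic-geometric inequality with weight \<epsilon>. The terms in \<open>d\<^sup>2\<close> are
  at most half of \<open>L * d\<^sup>2\<close>, hence of the quantity to be bounded, and are
  absorbed; this doubles \<open>4 * \<epsilon>\<close> to \<open>8 * \<epsilon>\<close>.\<close>

lemma square_ratio_bound:
  fixes a r d L C \<epsilon> :: real
  assumes r: "0 \<le> r" and a: "0 \<le> a" and d: "0 < d" and C: "0 \<le> C" and \<epsilon>: "0 < \<epsilon>" "\<epsilon> \<le> 1"
    and dev: "\<bar>a - r\<bar> \<le> \<epsilon> * r + C * d" and L: "0 < L" "2 * (4 * C\<^sup>2 / \<epsilon> + C\<^sup>2) \<le> L"
    and large: "L * d\<^sup>2 < \<bar>a\<^sup>2 - r\<^sup>2\<bar>"
  shows "\<bar>a\<^sup>2 - r\<^sup>2\<bar> \<le> 8 * \<epsilon> * r\<^sup>2" "r > 0"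
proof -
  have "\<bar>a\<^sup>2 - r\<^sup>2\<bar> = \<bar>a - r\<bar> * (a + r)"
  proof -
    have "a\<^sup>2 - r\<^sup>2 = (a - r) * (a + r)" by (simp add: power2_eq_square algebra_simps)
    then show ?thesis using a r by (simp add: abs_mult)
  qed
  also have "\<dots> \<le> (\<epsilon> * r + C * d) * (3 * r + C * d)"
  proof (rule mult_mono[OF dev])
    have "\<epsilon> * r \<le> r" using \<epsilon> r by (simp add: mult_left_le_one_le)
    then show "a + r \<le> 3 * r + C * d" using dev by linarith
  qed (use a r \<epsilon> C d in auto)
  also have "\<dots> = 3 * \<epsilon> * r\<^sup>2 + (\<epsilon> + 3) * (r * (C * d)) + C\<^sup>2 * d\<^sup>2" by (simp add: power2_eq_square algebra_simps)
  also have "\<dots> \<le> 3 * \<epsilon> * r\<^sup>2 + 4 * (r * (C * d)) + C\<^sup>2 * d\<^sup>2"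
    using \<epsilon> r C d by (intro add_mono mult_right_mono) auto
  also have "4 * (r * (C * d)) \<le> \<epsilon> * r\<^sup>2 + 4 * C\<^sup>2 / \<epsilon> * d\<^sup>2"
  proof -
    have "0 \<le> (\<epsilon> * r - 2 * (C * d))\<^sup>2 / \<epsilon>" using \<epsilon> by simp
    also have "\<dots> = \<epsilon> * r\<^sup>2 + 4 * C\<^sup>2 / \<epsilon> * d\<^sup>2 - 4 * (r * (C * d))"
      using \<epsilon> by (simp add: power2_eq_square field_simps)
    finally show ?thesis by simp
  qed
  finally have 1: "\<bar>a\<^sup>2 - r\<^sup>2\<bar> \<le> 4 * (\<epsilon> * r\<^sup>2) + (4 * C\<^sup>2 / \<epsilon> + C\<^sup>2) * d\<^sup>2" by (simp add: algebra_simps)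
  have "2 * ((4 * C\<^sup>2 / \<epsilon> + C\<^sup>2) * d\<^sup>2) \<le> L * d\<^sup>2" using mult_right_mono[OF L(2), of "d\<^sup>2"] by (simp only: mult.assoc) simp
  then have 2: "\<bar>a\<^sup>2 - r\<^sup>2\<bar> \<le> 8 * (\<epsilon> * r\<^sup>2)" using 1 large by linarith
  then show "\<bar>a\<^sup>2 - r\<^sup>2\<bar> \<le> 8 * \<epsilon> * r\<^sup>2" by simp
  have "0 < L * d\<^sup>2" using L d by simp
  then have "r \<noteq> 0" using 2 large by auto
  then show "r > 0" using r by simp
qed

section \<open>The normalized estimation error\<close>

text \<open>Any real number between 1 and the lower limit serves as \<open>1 + \<kappa>\<close>.
  Where \<open>d n\<close> vanishes the extended quotient carries no information, and positivity of
  \<open>a n\<close> gives the claim directly.\<close>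

lemma ereal_ratio_eventually:
  fixes a d :: "nat \<Rightarrow> real"
  assumes lim: "1 < liminf (\<lambda>n. ereal (a n) / ereal (d n))" and d: "\<And>n. 0 \<le> d n" and a: "\<forall>\<^sub>F n in sequentially. 0 < a n"
  shows "\<exists>\<kappa>>0. \<forall>\<^sub>F n in sequentially. (1 + \<kappa>) * d n \<le> a n \<and> d n < a n"
proof -
  obtain z where z: "1 < ereal z" "ereal z < liminf (\<lambda>n. ereal (a n) / ereal (d n))" using ereal_dense2[OF lim] by blast
  have z1: "z > 1" using z(1) by simp
  have "\<forall>\<^sub>F n in sequentially. ereal z < ereal (a n) / ereal (d n)" by (rule less_LiminfD[OF z(2)])
  with a have "\<forall>\<^sub>F n in sequentially. (1 + (z - 1)) * d n \<le> a n \<and> d n < a n"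
  proof eventually_elim
    case (elim n)
    show ?case
    proof (cases "d n = 0")
      case False
      then have dp: "d n > 0" using d[of n] by simp
      then have "z < a n / d n" using elim(2) by simp
      then have 1: "z * d n < a n" using dp by (simp add: pos_less_divide_eq)
      have "1 * d n < z * d n" using z1 dp by (intro mult_strict_right_mono) auto
      then show ?thesis using 1 by simp
    qed (use elim(1) in simp)
  qed
  then show ?thesis using z1 by (intro exI[of _ "z - 1"]) simp
qed

theorem theorem3p5:
  fixes M :: "nat \<Rightarrow> 'w measure"
    and m :: "nat \<Rightarrow> nat"
    and \<sigma> :: real
    and P :: "real measure"
    and X :: "nat \<Rightarrow> 'w \<Rightarrow> nat \<Rightarrow> nat \<Rightarrow> real"
    and \<xi> Y :: "nat \<Rightarrow> 'w \<Rightarrow> nat \<Rightarrow> real"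
    and f :: "nat \<Rightarrow> (nat \<Rightarrow> real) \<Rightarrow> ereal"
    and \<mu>\<^sub>0 :: "nat \<Rightarrow> nat \<Rightarrow> real"
    and \<mu>h :: "nat \<Rightarrow> 'w \<Rightarrow> nat \<Rightarrow> real"
    and K :: "nat \<Rightarrow> (nat \<Rightarrow> real) set"
    and \<delta>\<^sub>0 r :: "nat \<Rightarrow> real"
  assumes "\<sigma> > 0"
    and "noise_law P \<sigma>"
    and "\<And>n. linear_model (M n) (m n) n (X n) (\<xi> n) P"
    and "\<And>n. closed_convex_fun n (f n)"
    and "\<And>n. \<mu>\<^sub>0 n \<in> Rn n"
    and K_def: "\<And>n. K n = level_set n (f n) (\<mu>\<^sub>0 n)"
    and Y_def: "\<And>n \<omega> i. Y n \<omega> i = mat_vec n (X n \<omega>) (\<mu>\<^sub>0 n) i + \<xi> n \<omega> i"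
    and \<delta>\<^sub>0_def: "\<And>n. \<delta>\<^sub>0 n = stat_dim n (tangent_cone n (K n) (\<mu>\<^sub>0 n))"
    and r_def: "\<And>n. r n = fixed_point_radius n (m n) \<sigma> (K n) (\<mu>\<^sub>0 n)"
    and "liminf (\<lambda>n. ereal (real (m n)) / ereal (\<delta>\<^sub>0 n)) > 1"
    and "filterlim (\<lambda>n. real (m n) / ln (ln (real n))) at_top sequentially"
    and "near_minimizers M m X Y K r \<mu>h"
  shows "\<exists>E E'.
    big_O_prob M E (\<lambda>n. frakL n (\<delta>\<^sub>0 n) / real (m n)) \<and>
    big_O_prob M E' (\<lambda>n. ln (ln (real n)) / real (m n)) \<and>
    equiv_in_prob M
      (\<lambda>n \<omega>. (enorm n (\<lambda>i. \<mu>h n \<omega> i - \<mu>\<^sub>0 n i))\<^sup>2 / real n)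
      (\<lambda>n \<omega>. (r n)\<^sup>2 + E n \<omega>) \<and>
    (\<forall>\<^sub>F n in sequentially. \<forall>\<omega>\<in>space (M n).
      (r n)\<^sup>2 + E n \<omega> \<le> \<sigma>\<^sup>2 * (\<delta>\<^sub>0 n / (real (m n) - \<delta>\<^sub>0 n)) + E' n \<omega>) \<and>
    (\<forall>\<^sub>F n in sequentially. closed_convex_cone n (shift_set (K n) (\<mu>\<^sub>0 n)) \<longrightarrow>
      (\<forall>\<omega>\<in>space (M n).
        (r n)\<^sup>2 + E n \<omega> = \<sigma>\<^sup>2 * (\<delta>\<^sub>0 n / (real (m n) - \<delta>\<^sub>0 n)) + E' n \<omega>))"
proof -
  note \<sigma> = assms(1) and P = assms(2) and lm = assms(3) and f = assms(4) and \<mu>R = assms(5)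
  note liminf = assms(10) and growth = assms(11) and near = assms(12)
  define L where "L n = ln (ln (real n))" for n
  have Llim: "filterlim L at_top sequentially" unfolding L_def by real_asymp
  have mlim: "filterlim (\<lambda>n. real (m n)) at_top sequentially"
  proof -
    have "filterlim (\<lambda>n. real (m n) / L n * L n) at_top sequentially"
      using growth unfolding L_def[symmetric] by (rule filterlim_at_top_mult_at_top) (rule Llim)
    moreover have "\<forall>\<^sub>F n in sequentially. real (m n) / L n * L n = real (m n)"
      using filterlim_at_top_dense[THEN iffD1, OF Llim, rule_format, of 0] by eventually_elim simp
    ultimately show ?thesis by (rule filterlim_mono_eventually[OF _ order_refl order_refl])
  qed
  have mge: "\<forall>\<^sub>F n in sequentially. c \<le> real (m n)" for c
    using mlim unfolding filterlim_at_top by blast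
  have Lge: "\<forall>\<^sub>F n in sequentially. c \<le> L n" for c
    using Llim unfolding filterlim_at_top by blast
  have m0: "\<forall>\<^sub>F n in sequentially. 0 < real (m n)" using mge[of 1] by eventually_elim simp
  have \<delta>0: "0 \<le> \<delta>\<^sub>0 n" for n unfolding \<delta>\<^sub>0_def stat_dim_def by simp
  obtain \<kappa> where \<kappa>: "\<kappa> > 0" and ratio: "\<forall>\<^sub>F n in sequentially. (1 + \<kappa>) * \<delta>\<^sub>0 n \<le> real (m n) \<and> \<delta>\<^sub>0 n < real (m n)"
    using ereal_ratio_eventually[OF liminf \<delta>0 m0] by blast
  define C where "C n = shift_set (K n) (\<mu>\<^sub>0 n)" for n
  define T where "T n = tangent_cone n (K n) (\<mu>\<^sub>0 n)" for n
  have Kcc: "cc_set n (K n)" "\<mu>\<^sub>0 n \<in> K n" for n unfolding K_def by (rule level_set_cc[OF f \<mu>R])+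
  note tc = tangent_cone_props[OF Kcc, folded C_def T_def]
  have radius: "0 \<le> r n" "Esq n (C n) (omega \<sigma> (real (m n) / real n) (r n)) / real n = (r n)\<^sup>2"
      "(r n)\<^sup>2 \<le> \<sigma>\<^sup>2 * (\<delta>\<^sub>0 n / (real (m n) - \<delta>\<^sub>0 n))"
      "closed_convex_cone n (shift_set (K n) (\<mu>\<^sub>0 n)) \<Longrightarrow> (r n)\<^sup>2 = \<sigma>\<^sup>2 * (\<delta>\<^sub>0 n / (real (m n) - \<delta>\<^sub>0 n))"
    if "n > 0" "\<delta>\<^sub>0 n < real (m n)" for n
    using fixed_point_radius_props[OF f \<mu>R that(1) \<sigma>, of "m n"] that(2)
    unfolding C_def r_def \<delta>\<^sub>0_def K_def by simp_all
  have ps: "prob_space (M n)" for n using lm[of n] by (simp add: linear_model_def)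
  define a where "a n \<omega> = enorm n (\<lambda>i. \<mu>h n \<omega> i - \<mu>\<^sub>0 n i) / sqrt (real n)" for n \<omega>
  have \<mu>h: "\<And>n j. j < n \<Longrightarrow> (\<lambda>\<omega>. \<mu>h n \<omega> j) \<in> borel_measurable (M n)" "\<And>n. AE \<omega> in M n. \<mu>h n \<omega> \<in> K n"
    using near by (auto simp: near_minimizers_def)
  have ma: "a n \<in> borel_measurable (M n)" for n
    unfolding a_def[abs_def] by (intro borel_measurable_divide borel_measurable_const measurable_enorm borel_measurable_diff \<mu>h(1))
  obtain R where R: "small_o_prob M R (\<lambda>n. (r n)\<^sup>2)"
    and nm: "\<And>n. AE \<omega> in M n. loss (m n) n (X n \<omega>) (Y n \<omega>) (\<mu>h n \<omega>)
            \<le> (INF \<mu>\<in>K n. loss (m n) n (X n \<omega>) (Y n \<omega>) \<mu>) + R n \<omega>"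
    using near unfolding near_minimizers_def by blast
  have deviation: "\<exists>Cc>0. \<forall>\<^sub>F n in sequentially. measure (M n) {\<omega> \<in> space (M n).
      \<epsilon> * r n + Cc / sqrt (real (m n)) < \<bar>a n \<omega> - r n\<bar>} \<le> p"
    if \<epsilon>: "0 < \<epsilon>" "\<epsilon> \<le> 1" and p: "0 < p" "p \<le> 1" for \<epsilon> p
  proof -
    \<comment> \<open>One third each for the design, the noise and the optimization error.\<close>
    have p3: "0 < p / 3" "p / 3 \<le> 1" using p by auto
    obtain Cc \<tau> \<eta> mm where Cc: "Cc > 0" and \<tau>: "\<tau> > 0" and \<eta>: "\<eta> > 0" and
      gap: "\<forall>n m C T r. fixed_point_instance n m C T \<sigma> r \<longrightarrow> mm \<le> real m \<longrightarrow>
        (1 + \<kappa>) * (\<integral>h. (enorm n (metric_proj n T h))\<^sup>2 \<partial>gauss {..<n}) \<le> real m \<longrightarrow>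
        gap_certificate n m C \<sigma> \<eta> (p / 3) r (\<epsilon> * r + Cc / sqrt (real m)) (\<tau> * r\<^sup>2)"
      by (rule exE[OF primary_gap[OF \<sigma> \<kappa> \<epsilon> p3(1)]], elim conjE exE, rule that)
    obtain mn where mn: "\<forall>M m n X \<xi>. linear_model (M :: 'w measure) m n X \<xi> P \<longrightarrow> mn \<le> real m \<longrightarrow>
        measure M {\<omega> \<in> space M. \<eta> < \<bar>(enorm m (\<xi> \<omega>))\<^sup>2 / real m - \<sigma>\<^sup>2\<bar>} \<le> p / 3"
      using noise_weak_law[OF P \<eta> p3(1)] by (rule exE)
    have Rm: "R n \<in> borel_measurable (M n)" for n using R by (simp add: small_o_prob_def)
    have "(\<lambda>n. measure (M n) {\<omega> \<in> space (M n). \<bar>R n \<omega>\<bar> > \<tau> / 2 * \<bar>(r n)\<^sup>2\<bar>}) \<longlonglongrightarrow> 0"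
      using R \<tau> unfolding small_o_prob_def by (meson half_gt_zero)
    then have Rp: "\<forall>\<^sub>F n in sequentially. measure (M n) {\<omega> \<in> space (M n). \<bar>R n \<omega>\<bar> > \<tau> / 2 * \<bar>(r n)\<^sup>2\<bar>} < p / 3"
      by (rule order_tendstoD(2)) (rule p3(1))
    have "\<forall>\<^sub>F n in sequentially. measure (M n) {\<omega> \<in> space (M n). \<epsilon> * r n + Cc / sqrt (real (m n)) < \<bar>a n \<omega> - r n\<bar>} \<le> p"
      using Rp ratio m0 mge[of mm] mge[of mn] eventually_gt_at_top[of 0]
    proof eventually_elim
      case (elim n)
      have n: "n > 0" and \<delta>: "\<delta>\<^sub>0 n < real (m n)" and m: "m n > 0" using elim by auto
      note rad = radius[OF n \<delta>]
      show ?case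
      \<comment> \<open>A vanishing radius forces \<open>K n\<close> to consist of
        \<open>\<mu>\<^sub>0 n\<close> alone, so the estimate is exact almost surely. The
        certificate covers positive radii.\<close>
      proof (cases "r n = 0")
        case True
        have w: "omega \<sigma> (real (m n) / real n) (r n) > 0" using \<sigma> n m by (simp add: omega_def True)
        have z: "Esq n (C n) (omega \<sigma> (real (m n) / real n) (r n)) = 0" using rad(2) n True by simp
        have "AE \<omega> in M n. \<not> \<epsilon> * r n + Cc / sqrt (real (m n)) < \<bar>a n \<omega> - r n\<bar>"
          using \<mu>h(2)[of n]
        proof eventually_elim
          case (elim \<omega>)
          then have "(\<lambda>i. \<mu>h n \<omega> i - \<mu>\<^sub>0 n i) \<in> C n" by (auto simp: C_def shift_set_def)
          then have v0: "(\<lambda>i. \<mu>h n \<omega> i - \<mu>\<^sub>0 n i) = (\<lambda>i. 0)" by (rule Esq_zero_imp_trivial[OF tc(1) w z])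
          have "a n \<omega> = 0" unfolding a_def v0 by (simp add: enorm_eq_sqrt)
          then show ?case using True Cc by (simp add: not_less)
        qed
        then have "measure (M n) {\<omega> \<in> space (M n). \<epsilon> * r n + Cc / sqrt (real (m n)) < \<bar>a n \<omega> - r n\<bar>} = 0"
        proof -
          have "{\<omega> \<in> space (M n). \<epsilon> * r n + Cc / sqrt (real (m n)) < \<bar>a n \<omega> - r n\<bar>} \<in> sets (M n)"
            using ma[of n] by measurable
          moreover assume "AE \<omega> in M n. \<not> \<epsilon> * r n + Cc / sqrt (real (m n)) < \<bar>a n \<omega> - r n\<bar>"
          ultimately show ?thesis by (intro measure_eq_0_null_sets) (auto simp: AE_iff_null_sets)
        qed
        then show ?thesis using p by simp
      next
        case False
        then have r0: "r n > 0" using rad(1) by simp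
        have inst: "fixed_point_instance n (m n) (C n) (T n) \<sigma> (r n)"
          by unfold_locales (rule n m tc(1) tc(2) tc(3) tc(4) \<sigma> r0 rad(2))+
        have \<delta>e: "\<delta>\<^sub>0 n = (\<integral>h. (enorm n (metric_proj n (T n) h))\<^sup>2 \<partial>gauss {..<n})"
          unfolding \<delta>\<^sub>0_def stat_dim_def std_gaussian_eq T_def ..
        have \<kappa>m: "(1 + \<kappa>) * (\<integral>h. (enorm n (metric_proj n (T n) h))\<^sup>2 \<partial>gauss {..<n}) \<le> real (m n)"
          using elim unfolding \<delta>e by blast
        have mm: "mm \<le> real (m n)" and mn': "mn \<le> real (m n)" by fact+
        have noise: "measure (M n) {\<omega> \<in> space (M n). \<eta> < \<bar>(enorm (m n) (\<xi> n \<omega>))\<^sup>2 / real (m n) - \<sigma>\<^sup>2\<bar>} \<le> p / 3"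
          by (rule mn[rule_format, OF lm mn'])
        have Rn: "measure (M n) {\<omega> \<in> space (M n). \<bar>R n \<omega>\<bar> > \<tau> / 2 * \<bar>(r n)\<^sup>2\<bar>} \<le> p / 3" using elim(1) by simp
        note cert = gap[rule_format, OF inst mm \<kappa>m]
        have "measure (M n) {\<omega> \<in> space (M n). \<epsilon> * r n + Cc / sqrt (real (m n)) < \<bar>a n \<omega> - r n\<bar>} \<le> p / 3 + p / 3 + p / 3"
          unfolding a_def
          by (rule instance_deviation[OF lm m n r0 \<tau> less_imp_le[OF p3(1)] p3(2) less_imp_le[OF p3(1)] cert[unfolded C_def]
                noise Y_def \<mu>h(1) \<mu>h(2) nm Rm Rn])
        then show ?thesis by simp
      qed
    qed
    then show ?thesis using Cc by blast
  qed
  define D where "D n \<omega> = (a n \<omega>)\<^sup>2 - (r n)\<^sup>2" for n \<omega>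
  define E where "E n \<omega> = (if \<bar>D n \<omega>\<bar> \<le> L n / real (m n) then D n \<omega> else 0)" for n \<omega>
  have mE: "E n \<in> borel_measurable (M n)" for n
  proof -
    have [measurable]: "D n \<in> borel_measurable (M n)" unfolding D_def[abs_def] using ma[of n] by measurable
    show ?thesis unfolding E_def[abs_def] by measurable
  qed
  have Eb: "\<bar>E n \<omega>\<bar> \<le> \<bar>L n / real (m n)\<bar>" for n \<omega>
    using order_trans[OF _ abs_ge_self, of "\<bar>D n \<omega>\<bar>" "L n / real (m n)"] unfolding E_def by (auto simp del: abs_divide)
  \<comment> \<open>The cutoff bounds \<open>E n\<close> pointwise by \<open>L n / m n\<close>, so
    stochastic boundedness holds with constant one at every scale that is eventually at least as
    large. Both required scales are of this kind.\<close>
  have bigO: "big_O_prob M E s" if s: "\<forall>\<^sub>F n in sequentially. \<bar>L n / real (m n)\<bar> \<le> \<bar>s n\<bar>" for s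
    unfolding big_O_prob_def
  proof (intro conjI allI impI)
    show "E n \<in> borel_measurable (M n)" for n by (rule mE)
    fix e :: real assume e: "0 < e"
    have "\<forall>\<^sub>F n in sequentially. measure (M n) {\<omega> \<in> space (M n). 1 * \<bar>s n\<bar> < \<bar>E n \<omega>\<bar>} < e"
      using s
    proof eventually_elim
      case (elim n)
      have "{\<omega> \<in> space (M n). 1 * \<bar>s n\<bar> < \<bar>E n \<omega>\<bar>} = {}"
      proof -
        have "\<not> 1 * \<bar>s n\<bar> < \<bar>E n \<omega>\<bar>" for \<omega> using Eb[of n \<omega>] elim by linarith
        then show ?thesis by blast
      qed
      then show ?case using e by (simp only: measure_empty)
    qed
    then show "\<exists>Ca>0. \<forall>\<^sub>F n in sequentially. measure (M n) {\<omega> \<in> space (M n). Ca * \<bar>s n\<bar> < \<bar>E n \<omega>\<bar>} < e"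
      by (intro exI[of _ 1] conjI) simp
  qed
  have 1: "big_O_prob M E (\<lambda>n. frakL n (\<delta>\<^sub>0 n) / real (m n))"
  proof (rule bigO)
    show "\<forall>\<^sub>F n in sequentially. \<bar>L n / real (m n)\<bar> \<le> \<bar>frakL n (\<delta>\<^sub>0 n) / real (m n)\<bar>"
      using Lge[of 0] eventually_ge_at_top[of 3]
    proof eventually_elim
      case (elim n)
      \<comment> \<open>From \<open>n = 3\<close> on, \<open>ln n\<close> is at least one, so the
        iterated logarithm is monotone there.\<close>
      have e: "exp 1 \<le> real n" using exp_le elim(2) by linarith
      then have "1 \<le> ln (real n)" using elim(2) by (simp add: ln_ge_iff)
      moreover have "ln (real n) \<le> ln (16 * real n)" using elim(2) by simp
      ultimately have "L n \<le> ln (ln (16 * real n))" unfolding L_def by simp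
      moreover have "0 \<le> ln (1 + \<delta>\<^sub>0 n)" using \<delta>0[of n] by simp
      ultimately have "L n \<le> frakL n (\<delta>\<^sub>0 n)" unfolding frakL_def by linarith
      then have "L n / real (m n) \<le> frakL n (\<delta>\<^sub>0 n) / real (m n)" by (intro divide_right_mono) auto
      moreover have "0 \<le> L n / real (m n)" using elim(1) by simp
      ultimately show ?case by linarith
    qed
  qed
  have 2: "big_O_prob M E (\<lambda>n. ln (ln (real n)) / real (m n))"
    by (rule bigO) (simp add: L_def)
  have 4: "\<forall>\<^sub>F n in sequentially. \<forall>\<omega>\<in>space (M n). (r n)\<^sup>2 + E n \<omega> \<le> \<sigma>\<^sup>2 * (\<delta>\<^sub>0 n / (real (m n) - \<delta>\<^sub>0 n)) + E n \<omega>"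
    using ratio eventually_gt_at_top[of 0]
  proof eventually_elim
    case (elim n)
    then have "(r n)\<^sup>2 \<le> \<sigma>\<^sup>2 * (\<delta>\<^sub>0 n / (real (m n) - \<delta>\<^sub>0 n))" by (intro radius(3)) auto
    then show ?case by (intro ballI add_right_mono)
  qed
  have 5: "\<forall>\<^sub>F n in sequentially. closed_convex_cone n (shift_set (K n) (\<mu>\<^sub>0 n)) \<longrightarrow>
      (\<forall>\<omega>\<in>space (M n). (r n)\<^sup>2 + E n \<omega> = \<sigma>\<^sup>2 * (\<delta>\<^sub>0 n / (real (m n) - \<delta>\<^sub>0 n)) + E n \<omega>)"
    using ratio eventually_gt_at_top[of 0]
  proof eventually_elim
    case (elim n)
    show ?case
    proof (intro impI ballI)
      fix \<omega> assume "closed_convex_cone n (shift_set (K n) (\<mu>\<^sub>0 n))"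
      then have "(r n)\<^sup>2 = \<sigma>\<^sup>2 * (\<delta>\<^sub>0 n / (real (m n) - \<delta>\<^sub>0 n))" using elim by (intro radius(4)) auto
      then show "(r n)\<^sup>2 + E n \<omega> = \<sigma>\<^sup>2 * (\<delta>\<^sub>0 n / (real (m n) - \<delta>\<^sub>0 n)) + E n \<omega>" by simp
    qed
  qed
  define A where "A n \<omega> = (enorm n (\<lambda>i. \<mu>h n \<omega> i - \<mu>\<^sub>0 n i))\<^sup>2 / real n" for n \<omega>
  have Aa: "A n \<omega> = (a n \<omega>)\<^sup>2" for n \<omega> by (simp add: A_def a_def power_divide)
  define Z where "Z n \<omega> = (if A n \<omega> = 0 \<and> (r n)\<^sup>2 + E n \<omega> = 0 then 1 else A n \<omega> / ((r n)\<^sup>2 + E n \<omega>))" for n \<omega>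
  have 3: "tendsto_in_prob M Z 1" unfolding tendsto_in_prob_def
  proof (intro allI impI)
    fix e :: real assume e: "0 < e"
    \<comment> \<open>The factor 8 is the one lost in \<open>square_ratio_bound\<close>.\<close>
    define \<epsilon> where "\<epsilon> = min 1 (e / 8)"
    have \<epsilon>: "0 < \<epsilon>" "\<epsilon> \<le> 1" "8 * \<epsilon> \<le> e" using e by (auto simp: \<epsilon>_def)
    have ev: "\<forall>\<^sub>F n in sequentially. measure (M n) {\<omega> \<in> space (M n). e < \<bar>Z n \<omega> - 1\<bar>} \<le> p" if p: "0 < p" "p \<le> 1" for p
    proof -
      obtain Cc where Cc: "Cc > 0" and dev: "\<forall>\<^sub>F n in sequentially. measure (M n) {\<omega> \<in> space (M n).
          \<epsilon> * r n + Cc / sqrt (real (m n)) < \<bar>a n \<omega> - r n\<bar>} \<le> p"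
        using deviation[OF \<epsilon>(1,2) p] by blast
      show ?thesis using dev ratio m0 eventually_gt_at_top[of 0] Lge[of 1] Lge[of "2 * (4 * Cc\<^sup>2 / \<epsilon> + Cc\<^sup>2)"]
      proof eventually_elim
        case (elim n)
        have r0: "0 \<le> r n" by (rule radius(1)) (use elim in auto)
        have d: "0 < 1 / sqrt (real (m n))" using elim by simp
        have "measure (M n) {\<omega> \<in> space (M n). e < \<bar>Z n \<omega> - 1\<bar>}
          \<le> measure (M n) {\<omega> \<in> space (M n). \<epsilon> * r n + Cc / sqrt (real (m n)) < \<bar>a n \<omega> - r n\<bar>}"
        proof (rule finite_measure.finite_measure_mono)
          show "finite_measure (M n)" using ps[of n] by (simp add: prob_space_def)
          show "{\<omega> \<in> space (M n). \<epsilon> * r n + Cc / sqrt (real (m n)) < \<bar>a n \<omega> - r n\<bar>} \<in> sets (M n)"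
            using ma[of n] by measurable
          show "{\<omega> \<in> space (M n). e < \<bar>Z n \<omega> - 1\<bar>} \<subseteq> {\<omega> \<in> space (M n). \<epsilon> * r n + Cc / sqrt (real (m n)) < \<bar>a n \<omega> - r n\<bar>}"
          proof
            fix \<omega> assume "\<omega> \<in> {\<omega> \<in> space (M n). e < \<bar>Z n \<omega> - 1\<bar>}"
            then have \<omega>: "\<omega> \<in> space (M n)" "e < \<bar>Z n \<omega> - 1\<bar>" by auto
            have "\<not> \<bar>a n \<omega> - r n\<bar> \<le> \<epsilon> * r n + Cc * (1 / sqrt (real (m n)))"
            proof
              assume dv: "\<bar>a n \<omega> - r n\<bar> \<le> \<epsilon> * r n + Cc * (1 / sqrt (real (m n)))"
              show False
              \<comment> \<open>Below the cutoff both sides are equal by construction, and the ratio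
                is one, including the convention for \<open>0 / 0\<close>.\<close>
              proof (cases "\<bar>D n \<omega>\<bar> \<le> L n / real (m n)")
                case True
                then have "A n \<omega> = (r n)\<^sup>2 + E n \<omega>" unfolding Aa E_def D_def by simp
                then have "Z n \<omega> = 1" unfolding Z_def by auto
                then show False using \<omega>(2) e by simp
              next
                case False
                have a0: "0 \<le> a n \<omega>" by (simp add: a_def)
                have lg: "L n * (1 / sqrt (real (m n)))\<^sup>2 < \<bar>(a n \<omega>)\<^sup>2 - (r n)\<^sup>2\<bar>"
                  using False unfolding D_def by (simp add: power_divide not_le)
                have Lp: "0 < L n" using elim by linarith
                note sb = square_ratio_bound[OF r0 a0 d less_imp_le[OF Cc] \<epsilon>(1,2) dv Lp _ lg]
                have sb': "\<bar>(a n \<omega>)\<^sup>2 - (r n)\<^sup>2\<bar> \<le> 8 * \<epsilon> * (r n)\<^sup>2" "r n > 0" using sb elim by auto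
                have "E n \<omega> = 0" using False by (simp add: E_def)
                then have "Z n \<omega> - 1 = ((a n \<omega>)\<^sup>2 - (r n)\<^sup>2) / (r n)\<^sup>2" using sb'(2) by (simp add: Z_def Aa diff_divide_distrib)
                then have "\<bar>Z n \<omega> - 1\<bar> = \<bar>(a n \<omega>)\<^sup>2 - (r n)\<^sup>2\<bar> / (r n)\<^sup>2" by simp
                also have "\<dots> \<le> 8 * \<epsilon>" using sb' by (simp add: pos_divide_le_eq)
                finally show False using \<omega>(2) \<epsilon>(3) by linarith
              qed
            qed
            then show "\<omega> \<in> {\<omega> \<in> space (M n). \<epsilon> * r n + Cc / sqrt (real (m n)) < \<bar>a n \<omega> - r n\<bar>}" using \<omega>(1) by simp
          qed
        qed
        then show ?case using elim(1) by linarith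
      qed
    qed
    show "(\<lambda>n. measure (M n) {\<omega> \<in> space (M n). e < \<bar>Z n \<omega> - 1\<bar>}) \<longlonglongrightarrow> 0"
    proof (rule tendstoI)
      fix q :: real assume q: "0 < q"
      have "0 < min 1 (q / 2)" "min 1 (q / 2) \<le> 1" using q by auto
      from ev[OF this] show "\<forall>\<^sub>F n in sequentially. dist (measure (M n) {\<omega> \<in> space (M n). e < \<bar>Z n \<omega> - 1\<bar>}) 0 < q"
        by eventually_elim (use q in auto)
    qed
  qed
  show ?thesis
    by (intro exI[of _ E] conjI 1 2 4 5) (use 3 in \<open>simp only: equiv_in_prob_def Z_def[abs_def] A_def\<close>)
qed

end
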